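(* Let $g=1+\sum_{|\alpha|\ge1}b_\alpha Z_\alpha$ be an admissible free holomorphic function with the property that $\sup_{\alpha\in\mathbb F_n^+}\frac{b_\alpha}{b_{\alpha g_i}}<\infty$ for any $i\in\{1,\ldots,n\}$, and let ${\bf W}=(W_1,\ldots,W_n)$ be the universal model of the noncommutative domain $\mathcal D_{g^{-1}}$. Suppose that $T=(T_1,\ldots,T_n)\in\mathcal D_{g^{-1}}(\mathcal H)$ is completely non-coisometric with respect to $\mathcal D_{g^{-1}}(\mathcal H)$. (i) If $T\in\overline{\mathcal D^{pure}_{g^{-1}}(\mathcal H)}$ (operator norm closure), then the completely contractive linear map $\Phi:\mathcal A(g)\to B(\mathcal H)$, $\Phi(p({\bf W})):=p(T)$, where $p$ is any polynomial in $n$ noncommutative indeterminates, has a unique extension to a $w^*$-continuous homomorphism $\Psi_T:F^\infty(g)\to B(\mathcal H)$ which is completely contractive and sequentially WOT-continuous (resp. SOT-continuous). Moreover, if $\varphi({\bf W})\in F^\infty(g)$ has the Fourier representation $\sum_{\alpha\in\mathbb F_n^+}c_\alpha W_\alpha$, then $$\Psi_T(\varphi({\bf W}))=\text{SOT-}\lim_{N\to\infty}\sum_{0\le s\le N}\Big(1-\frac{s}{N+1}\Big)\sum_{|\alpha|=s}c_\alpha T_\alpha.$$ (ii) In particular, if $T$ and ${\bf W}$ are radially pure with respect to $\mathcal D_{g^{-1}}$ (that is, with respect to $\mathcal D_{g^{-1}}(\mathcal H)$ and $\mathcal D_{g^{-1}}(F^2(H_n))$, respectively) and $\varphi({\bf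 W})\in F^\infty(g)$ has the Fourier representation $\sum_{\alpha\in\mathbb F_n^+}c_\alpha W_\alpha$, then, for $r\in[0,1)$, $\varphi_r(T):=\sum_{k=0}^\infty\sum_{|\alpha|=k}r^{|\alpha|}c_\alpha T_\alpha$ converges in the operator norm and $$\Psi_T(\varphi({\bf W}))=\text{SOT-}\lim_{r\to1}\varphi_r(T)=\text{SOT-}\lim_{r\to1}K_{g,rT}^*[\varphi({\bf W})\otimes I_{\mathcal H}]K_{g,rT}.$$
   Context: $\mathbb F_n^+$ is the unital free semigroup on generators $g_1,\ldots,g_n$ with identity $g_0$, and $|\alpha|$ is the length of $\alpha$. For $\alpha=g_{i_1}\cdots g_{i_k}$, $X_\alpha:=X_{i_1}\cdots X_{i_k}$, $X_{g_0}:=I$. $F^2(H_n)$ is the full Fock space with orthonormal basis $\{e_\alpha\}_{\alpha\in\mathbb F_n^+}$, $e_\alpha=e_{i_1}\otimes\cdots\otimes e_{i_k}$, $e_{g_0}=1$. A formal power series $\sum_\alpha c_\alpha Z_\alpha$ in noncommuting indeterminates is a free holomorphic function in a neighborhood of the origin if there is $\rho>0$ such that $\sum_{k}\sum_{|\alpha|=k}c_\alpha X_\alpha$ converges in norm for every Hilbert space $\mathcal H$ and every $X\in B(\mathcal H)^n$ with $\|\sum_iX_iX_i^*\|^{1/2}\le\rho$; equivalently $\limsup_k(\sum_{|\alpha|=k}|c_\alpha|^2)^{1/2k}<\infty$. $g$ is admissible if: (a) $b_{g_0}=1$, all $b_\alpha>0$, and $\sup_\alpha b_\alpha/b_{g_i\alpha}<\infty$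 for each $i$; (b) $g$ is free holomorphic in a neighborhood of the origin; (c) $\sup_{k}\big\|\sum_{p=0}^k\sum_{|\alpha|=p}a_\alpha W_\alpha W_\alpha^*\big\|<\infty$, where $g^{-1}=1+\sum_{|\alpha|\ge1}a_\alpha Z_\alpha$ is the inverse power series ($a_{g_0}=1$) and $W_ie_\alpha=\sqrt{b_\alpha/b_{g_i\alpha}}\,e_{g_i\alpha}$ are the weighted left creation operators on $F^2(H_n)$. ${\bf W}=(W_1,\ldots,W_n)$ is the universal model. $\mathcal A(g)$ is the norm-closed algebra generated by $W_1,\ldots,W_n$ and the identity. $\mathcal D_{g^{-1}}(\mathcal H)$ is the set of all $X\in B(\mathcal H)^n$ such that (i) $\Delta_{g^{-1}}(X,X^* ):=\sum_{p=0}^\infty\sum_{|\alpha|=p}a_\alpha X_\alpha X_\alpha^*$ converges in the weak operator topology and is $\ge0$; (ii) $\sum_{\alpha}b_\alpha X_\alpha\Delta_{g^{-1}}(X,X^* )X_\alpha^*\le I$ (WOT convergence). $X\in\mathcal D_{g^{-1}}(\mathcal H)$ is pure if equality holds in (ii); $\mathcal D^{pure}_{g^{-1}}(\mathcal H)$ is the set of pure elements. $X\in B(\mathcal H)^n$ is radially pure with respect to $\mathcal D_{g^{-1}}(\mathcal H)$ if there is $\delta\in(0,1)$ such that $rX\in\mathcal D_{g^{-1}}(\mathcal H)$ is pure for every $r\in(\delta,1)$. $T\in\mathcal D_{g^{-1}}(\mathcal H)$ is completely non-coisometric if there is no nonzero subspace $\mathcal H_0\subset\mathcal H$ jointly invariant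 under $T_1^*,\ldots,T_n^*$ with $\Delta_{g^{-1}}(T,T^* )|_{\mathcal H_0}=0$. The noncommutative Berezin kernel of $T\in\mathcal D_{g^{-1}}(\mathcal H)$ is $K_{g,T}:\mathcal H\to F^2(H_n)\otimes\overline{\Delta_{g^{-1}}(T,T^* )\mathcal H}\subset F^2(H_n)\otimes\mathcal H$, $K_{g,T}h:=\sum_{\alpha}\sqrt{b_\alpha}\,e_\alpha\otimes\Delta_{g^{-1}}(T,T^* )^{1/2}T_\alpha^*h$. $F^\infty(g)$: let $\mathcal P=\mathrm{span}\{e_\alpha\}$. Consider formal series $\sum_{\beta}c_\beta W_\beta$ with $\sum_{\beta}|c_\beta|^2\frac{b_\gamma}{b_{\beta\gamma}}<\infty$ for each $\gamma$ and $\sup_{p\in\mathcal P,\|p\|\le1}\|\sum_\beta c_\beta W_\beta(p)\|<\infty$. Each determines a unique bounded operator $\varphi({\bf W})$ with $\varphi({\bf W})p=\sum_\beta c_\beta W_\beta(p)$, $p\in\mathcal P$; $F^\infty(g)$ is the algebra of all such operators, and $\sum_\beta c_\beta W_\beta$ is the (unique) Fourier representation of $\varphi({\bf W})$. *)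

theory Defs
  imports "HOL-Analysis.Analysis"
begin

section \<open>Complex Hilbert spaces\<close>

class scaleC =
  fixes scaleC :: "complex \<Rightarrow> 'a \<Rightarrow> 'a"  (infixr "*\<^sub>C" 75)

class complex_vector = scaleC + real_vector +
  assumes scaleC_add_right: "a *\<^sub>C (x + y) = a *\<^sub>C x + a *\<^sub>C y"
    and scaleC_add_left: "(a + b) *\<^sub>C x = a *\<^sub>C x + b *\<^sub>C x"
    and scaleC_scaleC: "a *\<^sub>C (b *\<^sub>C x) = (a * b) *\<^sub>C x"
    and scaleC_one: "1 *\<^sub>C x = x"
    and scaleR_scaleC: "r *\<^sub>R x = complex_of_real r *\<^sub>C x"

text \<open>The complex inner product is linear in the first argument. Positivity, definiteness and
  \<open>norm x = sqrt (Re (cinner x x))\<close> are inherited from \<^class>\<open>real_inner\<close> through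
  \<open>inner_eq_Re_cinner\<close>.\<close>

class complex_inner = complex_vector + real_inner +
  fixes cinner :: "'a \<Rightarrow> 'a \<Rightarrow> complex"
  assumes cinner_commute: "cinner x y = cnj (cinner y x)"
    and cinner_add_left: "cinner (x + y) z = cinner x z + cinner y z"
    and cinner_scaleC_left: "cinner (a *\<^sub>C x) y = a * cinner x y"
    and inner_eq_Re_cinner: "inner x y = Re (cinner x y)"

class chilbert_space = complex_inner + complete_space

instantiation complex :: chilbert_space
begin
definition scaleC_complex :: "complex \<Rightarrow> complex \<Rightarrow> complex"
  where "scaleC_complex a x = a * x"
definition cinner_complex :: "complex \<Rightarrow> complex \<Rightarrow> complex"
  where "cinner_complex x y = x * cnj y"
instance
  by standard (auto simp: scaleC_complex_def cinner_complex_def algebra_simps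
      scaleR_conv_of_real inner_complex_def)
end

lemma cinner_add_right: "cinner x (y + z) = cinner x y + cinner x (z :: 'a :: complex_inner)"
  by (metis cinner_add_left cinner_commute complex_cnj_add)

lemma cinner_scaleC_right: "cinner x (a *\<^sub>C y) = cnj a * cinner x (y :: 'a :: complex_inner)"
  by (metis cinner_commute cinner_scaleC_left complex_cnj_mult)

lemma norm_sq_eq_cinner: "complex_of_real ((norm x)\<^sup>2) = cinner x (x :: 'a :: complex_inner)"
proof -
  have "Im (cinner x x) = 0"
    using arg_cong[OF cinner_commute[of x x], of Im] by simp
  then show ?thesis
    by (simp add: complex_eq_iff power2_norm_eq_inner inner_eq_Re_cinner)
qed

lemma norm_scaleC: "norm (a *\<^sub>C x) = cmod a * norm (x :: 'a :: complex_inner)"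
proof -
  have "complex_of_real ((norm (a *\<^sub>C x))\<^sup>2) = (a * cnj a) * cinner x x"
    unfolding norm_sq_eq_cinner by (simp add: cinner_scaleC_left cinner_scaleC_right)
  also have "\<dots> = complex_of_real ((cmod a * norm x)\<^sup>2)"
    by (metis complex_norm_square norm_sq_eq_cinner of_real_mult power_mult_distrib)
  finally have "(norm (a *\<^sub>C x))\<^sup>2 = (cmod a * norm x)\<^sup>2"
    using of_real_eq_iff by blast
  then show ?thesis
    by simp
qed

lemma Im_cinner: "Im (cinner x y) = inner (x :: 'a :: complex_inner) (\<i> *\<^sub>C y)"
  by (simp add: inner_eq_Re_cinner cinner_scaleC_right)


section \<open>Bounded complex-linear operators\<close>

typedef (overloaded) ('a :: complex_inner, 'b :: complex_inner) cblinfun =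
  "{f :: 'a \<Rightarrow> 'b. bounded_linear f \<and> (\<forall>c x. f (c *\<^sub>C x) = c *\<^sub>C f x)}"
  morphisms cblinfun_apply Abs_cblinfun
proof (rule exI[of _ "\<lambda>_. 0"])
  have "c *\<^sub>C (0 :: 'b) = 0" for c
    by (metis add_cancel_right_left scaleC_add_right)
  then show "(\<lambda>_. 0) \<in> {f :: 'a \<Rightarrow> 'b. bounded_linear f \<and> (\<forall>c x. f (c *\<^sub>C x) = c *\<^sub>C f x)}"
    by simp
qed

setup_lifting type_definition_cblinfun

notation cblinfun_apply  (infixr "*\<^sub>V" 74)

type_synonym 'a cop = "('a, 'a) cblinfun"

lemma cblinfun_eqI: "(\<And>x. A *\<^sub>V x = B *\<^sub>V x) \<Longrightarrow> A = B"
  by transfer auto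

lemma scaleC_zero_right [simp]: "c *\<^sub>C (0 :: 'a :: complex_vector) = 0"
  by (metis add_cancel_right_left scaleC_add_right)

lemma scaleC_minus_right: "c *\<^sub>C (- x) = - (c *\<^sub>C (x :: 'a :: complex_vector))"
  by (metis add.right_inverse add_eq_0_iff scaleC_add_right scaleC_zero_right)

lemma scaleC_diff_right: "c *\<^sub>C (x - y) = c *\<^sub>C x - c *\<^sub>C (y :: 'a :: complex_vector)"
  by (metis diff_conv_add_uminus scaleC_add_right scaleC_minus_right)

lemma scaleC_scaleR_commute: "c *\<^sub>C (r *\<^sub>R x) = r *\<^sub>R (c *\<^sub>C (x :: 'a :: complex_vector))"
  by (simp add: scaleR_scaleC scaleC_scaleC mult.commute)

lemma bounded_linear_scaleC: "bounded_linear (\<lambda>x :: 'a :: complex_inner. c *\<^sub>C x)"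
  by (rule bounded_linear_intro[where K = "cmod c"])
    (simp_all add: scaleC_add_right scaleC_scaleR_commute norm_scaleC mult.commute)

instantiation cblinfun :: (complex_inner, complex_inner) real_normed_vector
begin

lift_definition zero_cblinfun :: "('a, 'b) cblinfun" is "\<lambda>_. 0"
  by simp
lift_definition plus_cblinfun :: "('a, 'b) cblinfun \<Rightarrow> ('a, 'b) cblinfun \<Rightarrow> ('a, 'b) cblinfun"
  is "\<lambda>f g x. f x + g x"
  by (simp add: bounded_linear_add scaleC_add_right)
lift_definition minus_cblinfun :: "('a, 'b) cblinfun \<Rightarrow> ('a, 'b) cblinfun \<Rightarrow> ('a, 'b) cblinfun"
  is "\<lambda>f g x. f x - g x"
  by (simp add: bounded_linear_sub scaleC_diff_right)
lift_definition uminus_cblinfun :: "('a, 'b) cblinfun \<Rightarrow> ('a, 'b) cblinfun"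
  is "\<lambda>f x. - f x"
  by (simp add: bounded_linear_minus scaleC_minus_right)
lift_definition scaleR_cblinfun :: "real \<Rightarrow> ('a, 'b) cblinfun \<Rightarrow> ('a, 'b) cblinfun"
  is "\<lambda>r f x. r *\<^sub>R f x"
  by (auto simp: scaleC_scaleR_commute intro: bounded_linear_compose[OF bounded_linear_scaleR_right])
lift_definition norm_cblinfun :: "('a, 'b) cblinfun \<Rightarrow> real" is onorm .

definition dist_cblinfun :: "('a, 'b) cblinfun \<Rightarrow> ('a, 'b) cblinfun \<Rightarrow> real"
  where "dist_cblinfun A B = norm (A - B)"
definition sgn_cblinfun :: "('a, 'b) cblinfun \<Rightarrow> ('a, 'b) cblinfun"
  where "sgn_cblinfun A = inverse (norm A) *\<^sub>R A"
definition uniformity_cblinfun :: "(('a, 'b) cblinfun \<times> ('a, 'b) cblinfun) filter"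
  where "uniformity_cblinfun = (INF e\<in>{0<..}. principal {(A, B). dist A B < e})"
definition open_cblinfun :: "('a, 'b) cblinfun set \<Rightarrow> bool"
  where "open_cblinfun S = (\<forall>A\<in>S. \<forall>\<^sub>F (A', B) in uniformity. A' = A \<longrightarrow> B \<in> S)"

instance
proof
  fix A B C :: "('a, 'b) cblinfun" and r s :: real
  show "A + B + C = A + (B + C)" "A + B = B + A" "0 + A = A" "- A + A = 0" "A - B = A + - B"
    by (transfer, force)+
  show "r *\<^sub>R (A + B) = r *\<^sub>R A + r *\<^sub>R B" "(r + s) *\<^sub>R A = r *\<^sub>R A + s *\<^sub>R A"
    "r *\<^sub>R s *\<^sub>R A = (r * s) *\<^sub>R A" "1 *\<^sub>R A = A"
    by (transfer, force simp: algebra_simps)+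
  show "norm A = 0 \<longleftrightarrow> A = 0"
    by transfer (auto simp: onorm_eq_0)
  show "norm (A + B) \<le> norm A + norm B"
    by transfer (auto intro: onorm_triangle)
  show "norm (r *\<^sub>R A) = \<bar>r\<bar> * norm A"
    by transfer (auto intro: onorm_scaleR)
qed (simp_all add: dist_cblinfun_def sgn_cblinfun_def uniformity_cblinfun_def open_cblinfun_def)

end

instantiation cblinfun :: (complex_inner, complex_inner) complex_vector
begin

lift_definition scaleC_cblinfun :: "complex \<Rightarrow> ('a, 'b) cblinfun \<Rightarrow> ('a, 'b) cblinfun"
  is "\<lambda>c f x. c *\<^sub>C f x"
  by (auto simp: scaleC_scaleC mult.commute intro: bounded_linear_compose[OF bounded_linear_scaleC])

instance
  by standard (transfer, force simp: scaleC_add_right scaleC_add_left scaleC_scaleC scaleC_one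
      scaleR_scaleC)+

end

lift_definition id_cop :: "'a :: complex_inner cop" is "\<lambda>x. x"
  by simp

lift_definition cop_comp :: "('b :: complex_inner, 'c :: complex_inner) cblinfun \<Rightarrow>
    ('a :: complex_inner, 'b) cblinfun \<Rightarrow> ('a, 'c) cblinfun"  (infixl "o\<^sub>C" 67)
  is "\<lambda>f g x. f (g x)"
  by (auto intro: bounded_linear_compose)

definition adj :: "('a :: chilbert_space, 'b :: chilbert_space) cblinfun \<Rightarrow> ('b, 'a) cblinfun"
  where "adj A = (THE B. \<forall>x y. cinner (A *\<^sub>V x) y = cinner x (B *\<^sub>V y))"

definition cop_pos :: "'a :: complex_inner cop \<Rightarrow> bool"
  where "cop_pos A \<longleftrightarrow> (\<forall>x. Im (cinner (A *\<^sub>V x) x) = 0 \<and> 0 \<le> Re (cinner (A *\<^sub>V x) x))"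

definition cop_sqrt :: "'a :: chilbert_space cop \<Rightarrow> 'a cop"
  where "cop_sqrt A = (THE B. cop_pos B \<and> B o\<^sub>C B = A)"

definition wot_tendsto :: "('i \<Rightarrow> ('a :: complex_inner, 'b :: complex_inner) cblinfun) \<Rightarrow>
    ('a, 'b) cblinfun \<Rightarrow> 'i filter \<Rightarrow> bool"
  where "wot_tendsto A L F \<longleftrightarrow>
    (\<forall>x y. ((\<lambda>i. cinner (A i *\<^sub>V x) y) \<longlongrightarrow> cinner (L *\<^sub>V x) y) F)"

definition sot_tendsto :: "('i \<Rightarrow> ('a :: complex_inner, 'b :: complex_inner) cblinfun) \<Rightarrow>
    ('a, 'b) cblinfun \<Rightarrow> 'i filter \<Rightarrow> bool"
  where "sot_tendsto A L F \<longleftrightarrow> (\<forall>x. ((\<lambda>i. A i *\<^sub>V x) \<longlongrightarrow> L *\<^sub>V x) F)"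

text \<open>The \<open>w\<^sup>*\<close>-topology of \<open>B(H)\<close> as the dual of the trace class operators. The trace class
  operators are exactly the sums \<open>\<Sum>k. x\<^sub>k \<otimes> y\<^sub>k\<^sup>*\<close> with square-summable \<open>x\<close>, \<open>y\<close>, and
  the trace pairing of \<open>A\<close> with such a sum is \<open>\<Sum>k. \<langle>A x\<^sub>k, y\<^sub>k\<rangle>\<close>.\<close>

definition wstar_topology :: "'a :: chilbert_space cop topology"
  where "wstar_topology = topology_generated_by
    {{A. (\<Sum>k. cinner (A *\<^sub>V x k) (y k)) \<in> U} | x y U.
       summable (\<lambda>k. (norm (x k))\<^sup>2) \<and> summable (\<lambda>k. (norm (y k))\<^sup>2) \<and> open U}"

text \<open>The norm of the operator matrix \<open>[A i j]\<close>, \<open>i, j < m\<close>, acting on the direct sum of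
  \<open>m\<close> copies of the Hilbert space.\<close>

definition opmat_norm :: "nat \<Rightarrow> (nat \<Rightarrow> nat \<Rightarrow> 'a :: complex_inner cop) \<Rightarrow> real"
  where "opmat_norm m A =
    Sup {sqrt (\<Sum>i<m. (norm (\<Sum>j<m. A i j *\<^sub>V x j))\<^sup>2) | x. (\<Sum>j<m. (norm (x j))\<^sup>2) \<le> 1}"

definition completely_contractive_on ::
    "'a :: complex_inner cop set \<Rightarrow> ('a cop \<Rightarrow> 'b :: complex_inner cop) \<Rightarrow> bool"
  where "completely_contractive_on S \<Phi> \<longleftrightarrow>
    (\<forall>m A. (\<forall>i<m. \<forall>j<m. A i j \<in> S) \<longrightarrow> opmat_norm m (\<lambda>i j. \<Phi> (A i j)) \<le> opmat_norm m A)"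

definition clinear_on ::
    "'a :: complex_inner cop set \<Rightarrow> ('a cop \<Rightarrow> 'b :: complex_inner cop) \<Rightarrow> bool"
  where "clinear_on S \<Phi> \<longleftrightarrow>
    (\<forall>A\<in>S. \<forall>B\<in>S. \<Phi> (A + B) = \<Phi> A + \<Phi> B) \<and> (\<forall>c. \<forall>A\<in>S. \<Phi> (c *\<^sub>C A) = c *\<^sub>C \<Phi> A)"

definition algebra_hom_on ::
    "'a :: complex_inner cop set \<Rightarrow> ('a cop \<Rightarrow> 'b :: complex_inner cop) \<Rightarrow> bool"
  where "algebra_hom_on S \<Phi> \<longleftrightarrow>
    clinear_on S \<Phi> \<and> (\<forall>A\<in>S. \<forall>B\<in>S. \<Phi> (A o\<^sub>C B) = \<Phi> A o\<^sub>C \<Phi> B)"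

definition seq_wot_continuous_on ::
    "'a :: complex_inner cop set \<Rightarrow> ('a cop \<Rightarrow> 'b :: complex_inner cop) \<Rightarrow> bool"
  where "seq_wot_continuous_on S \<Phi> \<longleftrightarrow>
    (\<forall>A L. range A \<subseteq> S \<and> L \<in> S \<and> wot_tendsto A L sequentially \<longrightarrow>
       wot_tendsto (\<lambda>k :: nat. \<Phi> (A k)) (\<Phi> L) sequentially)"

definition seq_sot_continuous_on ::
    "'a :: complex_inner cop set \<Rightarrow> ('a cop \<Rightarrow> 'b :: complex_inner cop) \<Rightarrow> bool"
  where "seq_sot_continuous_on S \<Phi> \<longleftrightarrow>
    (\<forall>A L. range A \<subseteq> S \<and> L \<in> S \<and> sot_tendsto A L sequentially \<longrightarrow>
       sot_tendsto (\<lambda>k :: nat. \<Phi> (A k)) (\<Phi> L) sequentially)"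


section \<open>Square-summable families\<close>

text \<open>\<open>('i, 'h) l2\<close> is the Hilbert space of square-summable families in \<open>'h\<close> indexed by
  \<open>'i\<close>, that is, the Hilbert tensor product of \<open>\<ell>\<^sup>2('i)\<close> with \<open>'h\<close>.\<close>

typedef (overloaded) ('i, 'h :: complex_inner) l2 =
  "{f :: 'i \<Rightarrow> 'h. (\<lambda>i. (norm (f i))\<^sup>2) summable_on UNIV}"
  morphisms l2_nth Abs_l2
  by (rule exI[of _ "\<lambda>_. 0"]) simp

setup_lifting type_definition_l2

lemma l2_mult_summable:
  fixes f g :: "'i \<Rightarrow> real"
  assumes "(\<lambda>i. (f i)\<^sup>2) summable_on UNIV" "(\<lambda>i. (g i)\<^sup>2) summable_on UNIV"
  shows "(\<lambda>i. norm (f i * g i)) summable_on UNIV"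
proof (rule Infinite_Sum.abs_summable_on_comparison_test')
  show "(\<lambda>i. (f i)\<^sup>2 + (g i)\<^sup>2) summable_on UNIV"
    using assms by (rule summable_on_add)
  fix i
  have "0 \<le> (\<bar>f i\<bar> - \<bar>g i\<bar>)\<^sup>2"
    by simp
  moreover have "0 \<le> \<bar>f i\<bar> * \<bar>g i\<bar>"
    by simp
  ultimately show "norm (f i * g i) \<le> (f i)\<^sup>2 + (g i)\<^sup>2"
    unfolding power2_diff abs_mult real_norm_def power2_abs by linarith
qed

lemma l2_add_summable:
  fixes f g :: "'i \<Rightarrow> 'h :: complex_inner"
  assumes "(\<lambda>i. (norm (f i))\<^sup>2) summable_on UNIV" "(\<lambda>i. (norm (g i))\<^sup>2) summable_on UNIV"
  shows "(\<lambda>i. (norm (f i + g i))\<^sup>2) summable_on UNIV"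
proof (rule summable_on_comparison_test)
  show "(\<lambda>i. 2 * (norm (f i))\<^sup>2 + 2 * (norm (g i))\<^sup>2) summable_on UNIV"
    using assms by (intro summable_on_add summable_on_cmult_right)
  fix i
  have "(norm (f i + g i))\<^sup>2 \<le> (norm (f i) + norm (g i))\<^sup>2"
    by (simp add: norm_triangle_ineq)
  also have "\<dots> \<le> 2 * (norm (f i))\<^sup>2 + 2 * (norm (g i))\<^sup>2"
    using zero_le_power2[of "norm (f i) - norm (g i)"]
    unfolding power2_sum power2_diff by linarith
  finally show "(norm (f i + g i))\<^sup>2 \<le> 2 * (norm (f i))\<^sup>2 + 2 * (norm (g i))\<^sup>2" .
qed auto

lemma l2_scaleC_summable:
  fixes f :: "'i \<Rightarrow> 'h :: complex_inner"
  assumes "(\<lambda>i. (norm (f i))\<^sup>2) summable_on UNIV"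
  shows "(\<lambda>i. (norm (c *\<^sub>C f i))\<^sup>2) summable_on UNIV"
  using summable_on_cmult_right[OF assms, of "(cmod c)\<^sup>2"]
  by (simp add: norm_scaleC power_mult_distrib)

lemma l2_inner_summable:
  fixes f g :: "'i \<Rightarrow> 'h :: complex_inner"
  assumes "(\<lambda>i. (norm (f i))\<^sup>2) summable_on UNIV" "(\<lambda>i. (norm (g i))\<^sup>2) summable_on UNIV"
  shows "(\<lambda>i. inner (f i) (g i)) summable_on UNIV"
proof (rule Infinite_Sum.abs_summable_summable)
  show "(\<lambda>i. norm (inner (f i) (g i))) summable_on UNIV"
    by (rule Infinite_Sum.abs_summable_on_comparison_test[OF l2_mult_summable[OF assms]])
      (simp add: Cauchy_Schwarz_ineq2)
qed

lemma l2_cinner_summable: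
  fixes f g :: "'i \<Rightarrow> 'h :: complex_inner"
  assumes f: "(\<lambda>i. (norm (f i))\<^sup>2) summable_on UNIV"
    and g: "(\<lambda>i. (norm (g i))\<^sup>2) summable_on UNIV"
  shows "(\<lambda>i. cinner (f i) (g i)) summable_on UNIV"
proof -
  have "(\<lambda>i. complex_of_real (inner (f i) (g i)) + \<i> * complex_of_real (inner (f i) (\<i> *\<^sub>C g i)))
      summable_on UNIV"
    by (intro summable_on_add summable_on_cmult_right
        summable_on_bounded_linear[OF bounded_linear_of_real] l2_inner_summable f g
        l2_scaleC_summable)
  moreover have "complex_of_real (inner (f i) (g i)) + \<i> * complex_of_real (inner (f i) (\<i> *\<^sub>C g i))
      = cinner (f i) (g i)" for i
    by (simp add: complex_eq_iff inner_eq_Re_cinner cinner_scaleC_right)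
  ultimately show ?thesis
    by simp
qed

instantiation l2 :: (type, complex_inner) complex_inner
begin

lift_definition zero_l2 :: "('a, 'b) l2" is "\<lambda>_. 0"
  by simp
lift_definition plus_l2 :: "('a, 'b) l2 \<Rightarrow> ('a, 'b) l2 \<Rightarrow> ('a, 'b) l2" is "\<lambda>f g i. f i + g i"
  by (rule l2_add_summable)
lift_definition uminus_l2 :: "('a, 'b) l2 \<Rightarrow> ('a, 'b) l2" is "\<lambda>f i. - f i"
  by simp
lift_definition minus_l2 :: "('a, 'b) l2 \<Rightarrow> ('a, 'b) l2 \<Rightarrow> ('a, 'b) l2" is "\<lambda>f g i. f i - g i"
  using l2_add_summable[of _ "\<lambda>i. - _ i"] by simp
lift_definition scaleC_l2 :: "complex \<Rightarrow> ('a, 'b) l2 \<Rightarrow> ('a, 'b) l2" is "\<lambda>c f i. c *\<^sub>C f i"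
  by (rule l2_scaleC_summable)
lift_definition scaleR_l2 :: "real \<Rightarrow> ('a, 'b) l2 \<Rightarrow> ('a, 'b) l2" is "\<lambda>r f i. r *\<^sub>R f i"
  unfolding scaleR_scaleC by (rule l2_scaleC_summable)
lift_definition inner_l2 :: "('a, 'b) l2 \<Rightarrow> ('a, 'b) l2 \<Rightarrow> real"
  is "\<lambda>f g. \<Sum>\<^sub>\<infinity>i. inner (f i) (g i)" .
lift_definition cinner_l2 :: "('a, 'b) l2 \<Rightarrow> ('a, 'b) l2 \<Rightarrow> complex"
  is "\<lambda>f g. \<Sum>\<^sub>\<infinity>i. cinner (f i) (g i)" .

definition norm_l2 :: "('a, 'b) l2 \<Rightarrow> real"
  where "norm_l2 f = sqrt (inner f f)"
definition dist_l2 :: "('a, 'b) l2 \<Rightarrow> ('a, 'b) l2 \<Rightarrow> real"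
  where "dist_l2 f g = norm (f - g)"
definition sgn_l2 :: "('a, 'b) l2 \<Rightarrow> ('a, 'b) l2"
  where "sgn_l2 f = inverse (norm f) *\<^sub>R f"
definition uniformity_l2 :: "(('a, 'b) l2 \<times> ('a, 'b) l2) filter"
  where "uniformity_l2 = (INF e\<in>{0<..}. principal {(f, g). dist f g < e})"
definition open_l2 :: "('a, 'b) l2 set \<Rightarrow> bool"
  where "open_l2 S = (\<forall>f\<in>S. \<forall>\<^sub>F (f', g) in uniformity. f' = f \<longrightarrow> g \<in> S)"

instance
proof
  fix f g h :: "('a, 'b) l2" and r s :: real and c d :: complex
  show "f + g + h = f + (g + h)" "f + g = g + f" "0 + f = f" "- f + f = 0" "f - g = f + - g"
    by (transfer, force)+
  show "r *\<^sub>R (f + g) = r *\<^sub>R f + r *\<^sub>R g" "(r + s) *\<^sub>R f = r *\<^sub>R f + s *\<^sub>R f"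
    "r *\<^sub>R s *\<^sub>R f = (r * s) *\<^sub>R f" "1 *\<^sub>R f = f"
    by (transfer, force simp: algebra_simps)+
  show "c *\<^sub>C (f + g) = c *\<^sub>C f + c *\<^sub>C g" "(c + d) *\<^sub>C f = c *\<^sub>C f + d *\<^sub>C f"
    "c *\<^sub>C d *\<^sub>C f = (c * d) *\<^sub>C f" "1 *\<^sub>C f = f" "r *\<^sub>R f = complex_of_real r *\<^sub>C f"
    by (transfer, force simp: scaleC_add_right scaleC_add_left scaleC_scaleC scaleC_one
        scaleR_scaleC)+
  show "inner f g = inner g f"
    by transfer (simp add: inner_commute)
  show "inner (f + g) h = inner f h + inner g h"
    by transfer (simp add: inner_add_left infsum_add l2_inner_summable)
  show "inner (r *\<^sub>R f) g = r * inner f g"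
    by transfer (simp add: infsum_cmult_right')
  show "0 \<le> inner f f"
    by transfer (simp add: infsum_nonneg)
  show "inner f f = 0 \<longleftrightarrow> f = 0"
  proof (transfer, safe)
    fix f :: "'a \<Rightarrow> 'b"
    assume sm: "(\<lambda>i. (norm (f i))\<^sup>2) summable_on UNIV"
      and z: "(\<Sum>\<^sub>\<infinity>i. inner (f i) (f i)) = 0"
    have "inner (f i) (f i) = 0" for i
      by (rule nonneg_infsum_le_0D[of "\<lambda>i. inner (f i) (f i)" UNIV])
        (use z l2_inner_summable[OF sm sm] in auto)
    then show "f = (\<lambda>_. 0)"
      by auto
  qed simp
  show "norm f = sqrt (inner f f)"
    by (simp add: norm_l2_def)
  show "cinner f g = cnj (cinner g f)"
    by transfer (subst cinner_commute, simp flip: infsum_cnj)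
  show "cinner (f + g) h = cinner f h + cinner g h"
    by transfer (simp add: cinner_add_left infsum_add l2_cinner_summable)
  show "cinner (c *\<^sub>C f) g = c * cinner f g"
    by transfer (simp add: cinner_scaleC_left infsum_cmult_right')
  show "inner f g = Re (cinner f g)"
  proof transfer
    fix f g :: "'a \<Rightarrow> 'b"
    assume "(\<lambda>i. (norm (f i))\<^sup>2) summable_on UNIV" "(\<lambda>i. (norm (g i))\<^sup>2) summable_on UNIV"
    then show "(\<Sum>\<^sub>\<infinity>i. inner (f i) (g i)) = Re (\<Sum>\<^sub>\<infinity>i. cinner (f i) (g i))"
      by (simp add: inner_eq_Re_cinner infsum_Re l2_cinner_summable)
  qed
qed (simp_all add: dist_l2_def sgn_l2_def uniformity_l2_def open_l2_def)

end

lemma l2_nth_summable: "(\<lambda>i. (norm (l2_nth f i))\<^sup>2) summable_on UNIV"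
  using l2_nth by blast

lemma norm_l2_sq: "(norm f)\<^sup>2 = (\<Sum>\<^sub>\<infinity>i. (norm (l2_nth f i))\<^sup>2)"
  by (simp add: power2_norm_eq_inner inner_l2.rep_eq)

lemma sum_le_norm_l2_sq:
  assumes "finite F"
  shows "(\<Sum>i\<in>F. (norm (l2_nth f i))\<^sup>2) \<le> (norm f)\<^sup>2"
  unfolding norm_l2_sq by (rule finite_sum_le_infsum[OF l2_nth_summable assms]) auto

lemma norm_l2_nth_le: "norm (l2_nth f i) \<le> norm f"
  by (rule power2_le_imp_le) (use sum_le_norm_l2_sq[of "{i}" f] in auto)

instance l2 :: (type, chilbert_space) chilbert_space
proof
  fix X :: "nat \<Rightarrow> ('a, 'b) l2"
  assume X: "Cauchy X"
  have "Cauchy (\<lambda>n. l2_nth (X n) i)" for i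
  proof (rule CauchyI)
    fix e :: real
    assume "0 < e"
    then obtain M where M: "\<And>m n. m \<ge> M \<Longrightarrow> n \<ge> M \<Longrightarrow> norm (X m - X n) < e"
      using CauchyD[OF X] by blast
    show "\<exists>M. \<forall>m\<ge>M. \<forall>n\<ge>M. norm (l2_nth (X m) i - l2_nth (X n) i) < e"
      using M norm_l2_nth_le[of "X _ - X _" i]
      by (metis le_less_trans minus_l2.rep_eq)
  qed
  then have "\<forall>i. \<exists>l. (\<lambda>n. l2_nth (X n) i) \<longlonglongrightarrow> l"
    using Cauchy_convergent convergent_def by blast
  then obtain f where f: "\<And>i. (\<lambda>n. l2_nth (X n) i) \<longlonglongrightarrow> f i"
    by metis
  have bound: "\<exists>M. \<forall>m\<ge>M. \<forall>F. finite F \<longrightarrow> (\<Sum>i\<in>F. (norm (l2_nth (X m) i - f i))\<^sup>2) \<le> e\<^sup>2"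
    if "0 < e" for e
  proof -
    obtain M where M: "\<And>m n. m \<ge> M \<Longrightarrow> n \<ge> M \<Longrightarrow> norm (X m - X n) < e"
      using CauchyD[OF X \<open>0 < e\<close>] by blast
    have "(\<Sum>i\<in>F. (norm (l2_nth (X m) i - f i))\<^sup>2) \<le> e\<^sup>2" if "m \<ge> M" "finite F" for m F
    proof (rule LIMSEQ_le_const2)
      show "(\<lambda>n. \<Sum>i\<in>F. (norm (l2_nth (X m) i - l2_nth (X n) i))\<^sup>2)
          \<longlonglongrightarrow> (\<Sum>i\<in>F. (norm (l2_nth (X m) i - f i))\<^sup>2)"
        by (intro tendsto_intros f)
      have "(\<Sum>i\<in>F. (norm (l2_nth (X m) i - l2_nth (X n) i))\<^sup>2) \<le> e\<^sup>2" if "n \<ge> M" for n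
      proof -
        have "(\<Sum>i\<in>F. (norm (l2_nth (X m) i - l2_nth (X n) i))\<^sup>2) \<le> (norm (X m - X n))\<^sup>2"
          using sum_le_norm_l2_sq[OF \<open>finite F\<close>, of "X m - X n"] by (simp add: minus_l2.rep_eq)
        also have "\<dots> \<le> e\<^sup>2"
          using M[OF \<open>m \<ge> M\<close> that] by (intro power_mono) auto
        finally show ?thesis .
      qed
      then show "\<exists>N. \<forall>n\<ge>N. (\<Sum>i\<in>F. (norm (l2_nth (X m) i - l2_nth (X n) i))\<^sup>2) \<le> e\<^sup>2"
        by blast
    qed
    then show ?thesis
      by blast
  qed
  have diff_sm: "(\<lambda>i. (norm (l2_nth (X m) i - f i))\<^sup>2) summable_on UNIV"
    if "\<forall>F. finite F \<longrightarrow> (\<Sum>i\<in>F. (norm (l2_nth (X m) i - f i))\<^sup>2) \<le> e\<^sup>2" for m e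
    by (rule nonneg_bdd_above_summable_on) (use that in \<open>auto intro!: bdd_aboveI[of _ "e\<^sup>2"]\<close>)
  have f_sm: "(\<lambda>i. (norm (f i))\<^sup>2) summable_on UNIV"
  proof -
    obtain M where "\<forall>m\<ge>M. \<forall>F. finite F \<longrightarrow>
        (\<Sum>i\<in>F. (norm (l2_nth (X m) i - f i))\<^sup>2) \<le> 1\<^sup>2"
      using bound[of 1] by auto
    then have "(\<lambda>i. (norm (l2_nth (X M) i - f i))\<^sup>2) summable_on UNIV"
      using diff_sm[of M 1] by blast
    then have "(\<lambda>i. (norm (f i - l2_nth (X M) i))\<^sup>2) summable_on UNIV"
      by (simp add: norm_minus_commute)
    from l2_add_summable[OF this l2_nth_summable[of "X M"]] show ?thesis
      by simp
  qed
  define L where "L = Abs_l2 f"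
  have L: "l2_nth L = f"
    unfolding L_def using f_sm by (simp add: Abs_l2_inverse)
  have "X \<longlonglongrightarrow> L"
  proof (rule metric_LIMSEQ_I)
    fix e :: real
    assume "0 < e"
    then obtain M where M: "\<forall>m\<ge>M. \<forall>F. finite F \<longrightarrow>
        (\<Sum>i\<in>F. (norm (l2_nth (X m) i - f i))\<^sup>2) \<le> (e/2)\<^sup>2"
      using bound[of "e/2"] by auto
    have "dist (X m) L < e" if "m \<ge> M" for m
    proof -
      have *: "\<forall>F. finite F \<longrightarrow> (\<Sum>i\<in>F. (norm (l2_nth (X m) i - f i))\<^sup>2) \<le> (e/2)\<^sup>2"
        using M that by blast
      have "(norm (X m - L))\<^sup>2 \<le> (e/2)\<^sup>2"
        unfolding norm_l2_sq minus_l2.rep_eq L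
        by (rule infsum_le_finite_sums[OF diff_sm[OF *]]) (simp add: *)
      then have "norm (X m - L) \<le> e/2"
        by (rule power2_le_imp_le) (use \<open>0 < e\<close> in simp)
      then show ?thesis
        using \<open>0 < e\<close> by (simp add: dist_norm)
    qed
    then show "\<exists>M. \<forall>m\<ge>M. dist (X m) L < e"
      by blast
  qed
  then show "convergent X"
    by (auto simp: convergent_def)
qed

lift_definition l2_tensor :: "('i, complex) l2 \<Rightarrow> 'h :: complex_inner \<Rightarrow> ('i, 'h) l2"  (infixr "\<otimes>\<^sub>l" 76)
  is "\<lambda>f h i. f i *\<^sub>C h"
proof -
  fix f :: "'i \<Rightarrow> complex" and h :: 'h
  assume "(\<lambda>i. (norm (f i))\<^sup>2) summable_on UNIV"
  from summable_on_cmult_left[OF this, of "(norm h)\<^sup>2"]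
  show "(\<lambda>i. (norm (f i *\<^sub>C h))\<^sup>2) summable_on UNIV"
    by (simp add: norm_scaleC power_mult_distrib)
qed

definition cop_amplify :: "('i, complex) l2 cop \<Rightarrow> ('i, 'h :: chilbert_space) l2 cop"
  where "cop_amplify A = (THE B. \<forall>f h. B *\<^sub>V (f \<otimes>\<^sub>l h) = (A *\<^sub>V f) \<otimes>\<^sub>l h)"


section \<open>The full Fock space and noncommutative power series\<close>

text \<open>The free semigroup on \<open>n = CARD('n)\<close> generators is \<open>'n list\<close> with concatenation; a formal
  power series is its family of coefficients. The full Fock space with its orthonormal basis
  \<open>e\<^sub>\<alpha>\<close> is identified with \<open>\<ell>\<^sup>2\<close> of the free semigroup.\<close>

type_synonym 'n fock = "('n list, complex) l2"

lift_definition fock_basis :: "'n list \<Rightarrow> 'n fock" is "\<lambda>\<alpha> \<beta>. if \<beta> = \<alpha> then 1 else 0"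
proof -
  fix \<alpha> :: "'n list"
  show "(\<lambda>\<beta>. (norm (if \<beta> = \<alpha> then 1 else 0 :: complex))\<^sup>2) summable_on UNIV"
    by (rule finite_nonzero_values_imp_summable_on) (auto intro: finite_subset[of _ "{\<alpha>}"])
qed

definition fock_polys :: "'n fock set"
  where "fock_polys = {\<Sum>\<alpha>\<in>F. c \<alpha> *\<^sub>C fock_basis \<alpha> | F c. finite F}"

definition words :: "nat \<Rightarrow> 'n list set"
  where "words k = {\<alpha>. length \<alpha> = k}"

definition word_op :: "('h :: complex_inner cop) ^ 'n \<Rightarrow> 'n list \<Rightarrow> 'h cop"
  where "word_op X \<alpha> = foldr (\<lambda>i A. X $ i o\<^sub>C A) \<alpha> id_cop"

text \<open>Noncommutative polynomials are the coefficient families \<open>p\<close> with finite support.\<close>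

definition poly_op :: "('n list \<Rightarrow> complex) \<Rightarrow> ('h :: complex_inner cop) ^ 'n \<Rightarrow> 'h cop"
  where "poly_op p X = (\<Sum>\<alpha> | p \<alpha> \<noteq> 0. p \<alpha> *\<^sub>C word_op X \<alpha>)"

definition nc_mult :: "('n list \<Rightarrow> real) \<Rightarrow> ('n list \<Rightarrow> real) \<Rightarrow> 'n list \<Rightarrow> real"
  where "nc_mult a b \<gamma> = (\<Sum>(\<alpha>, \<beta>) | \<alpha> @ \<beta> = \<gamma>. a \<alpha> * b \<beta>)"

definition nc_one :: "'n list \<Rightarrow> real"
  where "nc_one \<gamma> = (if \<gamma> = [] then 1 else 0)"

definition nc_inverse :: "('n list \<Rightarrow> real) \<Rightarrow> 'n list \<Rightarrow> real"
  where "nc_inverse b = (THE a. nc_mult a b = nc_one \<and> nc_mult b a = nc_one)"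

text \<open>Free holomorphic in a neighbourhood of the origin: the radius of convergence, given by the
  noncommutative Cauchy--Hadamard formula, is positive.\<close>

definition free_holomorphic_near_0 :: "('n :: finite list \<Rightarrow> real) \<Rightarrow> bool"
  where "free_holomorphic_near_0 c \<longleftrightarrow>
    limsup (\<lambda>k. ereal ((\<Sum>\<alpha>\<in>words k. \<bar>c \<alpha>\<bar>\<^sup>2) powr (1 / (2 * real k)))) < \<infinity>"


section \<open>Admissible series, the universal model and noncommutative domains\<close>

definition universal_model :: "('n :: finite list \<Rightarrow> real) \<Rightarrow> ('n fock cop) ^ 'n"
  where "universal_model b = (\<chi> i. THE A. \<forall>\<alpha>.
    A *\<^sub>V fock_basis \<alpha> = sqrt (b \<alpha> / b (i # \<alpha>)) *\<^sub>R fock_basis (i # \<alpha>))"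

definition admissible :: "('n :: finite list \<Rightarrow> real) \<Rightarrow> bool"
  where "admissible b \<longleftrightarrow>
    b [] = 1 \<and> (\<forall>\<alpha>. 0 < b \<alpha>) \<and> (\<forall>i. bdd_above (range (\<lambda>\<alpha>. b \<alpha> / b (i # \<alpha>)))) \<and>
    free_holomorphic_near_0 b \<and>
    bdd_above (range (\<lambda>k. norm (\<Sum>p\<le>k. \<Sum>\<alpha>\<in>words p.
      nc_inverse b \<alpha> *\<^sub>R (word_op (universal_model b) \<alpha> o\<^sub>C adj (word_op (universal_model b) \<alpha>)))))"

text \<open>Series over words are WOT limits of the partial sums over the words of length at most \<open>k\<close>.\<close>

definition wot_word_sums :: "('n list \<Rightarrow> 'h :: complex_inner cop) \<Rightarrow> 'h cop \<Rightarrow> bool"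
  where "wot_word_sums A S \<longleftrightarrow> wot_tendsto (\<lambda>k. \<Sum>p\<le>k. \<Sum>\<alpha>\<in>words p. A \<alpha>) S sequentially"

definition Delta :: "('n :: finite list \<Rightarrow> real) \<Rightarrow> ('h :: chilbert_space cop) ^ 'n \<Rightarrow> 'h cop"
  where "Delta b X =
    (THE D. wot_word_sums (\<lambda>\<alpha>. nc_inverse b \<alpha> *\<^sub>R (word_op X \<alpha> o\<^sub>C adj (word_op X \<alpha>))) D)"

text \<open>A tuple in \<open>B(H)\<^sup>n\<close> is a vector indexed by \<open>'n\<close>; its norm is the \<open>\<ell>\<^sup>2\<close> norm of the
  operator norms of the components, which is equivalent to the row norm, so that
  \<^const>\<open>closure\<close> is the operator norm closure.\<close>

definition nc_domain :: "('n :: finite list \<Rightarrow> real) \<Rightarrow> (('h :: chilbert_space cop) ^ 'n) set"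
  where "nc_domain b = {X.
    wot_word_sums (\<lambda>\<alpha>. nc_inverse b \<alpha> *\<^sub>R (word_op X \<alpha> o\<^sub>C adj (word_op X \<alpha>))) (Delta b X) \<and>
    cop_pos (Delta b X) \<and>
    (\<exists>S. wot_word_sums (\<lambda>\<alpha>. b \<alpha> *\<^sub>R (word_op X \<alpha> o\<^sub>C Delta b X o\<^sub>C adj (word_op X \<alpha>))) S \<and>
         cop_pos (id_cop - S))}"

definition nc_domain_pure :: "('n :: finite list \<Rightarrow> real) \<Rightarrow> (('h :: chilbert_space cop) ^ 'n) set"
  where "nc_domain_pure b = {X \<in> nc_domain b.
    wot_word_sums (\<lambda>\<alpha>. b \<alpha> *\<^sub>R (word_op X \<alpha> o\<^sub>C Delta b X o\<^sub>C adj (word_op X \<alpha>))) id_cop}"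

definition radially_pure :: "('n :: finite list \<Rightarrow> real) \<Rightarrow> ('h :: chilbert_space cop) ^ 'n \<Rightarrow> bool"
  where "radially_pure b X \<longleftrightarrow>
    (\<exists>\<delta>. 0 < \<delta> \<and> \<delta> < 1 \<and> (\<forall>r. \<delta> < r \<and> r < 1 \<longrightarrow> r *\<^sub>R X \<in> nc_domain_pure b))"

definition closed_csubspace :: "'h :: complex_inner set \<Rightarrow> bool"
  where "closed_csubspace M \<longleftrightarrow> closed M \<and> 0 \<in> M \<and>
    (\<forall>x\<in>M. \<forall>y\<in>M. x + y \<in> M) \<and> (\<forall>c. \<forall>x\<in>M. c *\<^sub>C x \<in> M)"

definition completely_non_coisometric ::
    "('n :: finite list \<Rightarrow> real) \<Rightarrow> ('h :: chilbert_space cop) ^ 'n \<Rightarrow> bool"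
  where "completely_non_coisometric b T \<longleftrightarrow>
    \<not> (\<exists>M. closed_csubspace M \<and> M \<noteq> {0} \<and> (\<forall>i. \<forall>x\<in>M. adj (T $ i) *\<^sub>V x \<in> M) \<and>
         (\<forall>x\<in>M. Delta b T *\<^sub>V x = 0))"

definition berezin_kernel :: "('n :: finite list \<Rightarrow> real) \<Rightarrow> ('h :: chilbert_space cop) ^ 'n \<Rightarrow>
    ('h, ('n list, 'h) l2) cblinfun"
  where "berezin_kernel b T = (THE K. \<forall>h.
    ((\<lambda>\<alpha>. sqrt (b \<alpha>) *\<^sub>R
        (fock_basis \<alpha> \<otimes>\<^sub>l (cop_sqrt (Delta b T) *\<^sub>V adj (word_op T \<alpha>) *\<^sub>V h)))
      has_sum K *\<^sub>V h) UNIV)"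


section \<open>The algebras \<open>\<A>(g)\<close> and \<open>F\<^sup>\<infinity>(g)\<close> and their representations\<close>

definition A_alg :: "('n :: finite list \<Rightarrow> real) \<Rightarrow> 'n fock cop set"
  where "A_alg b = \<Inter>{S. closed S \<and> id_cop \<in> S \<and> (\<forall>i. universal_model b $ i \<in> S) \<and>
    (\<forall>A\<in>S. \<forall>B\<in>S. A + B \<in> S \<and> A o\<^sub>C B \<in> S) \<and> (\<forall>c. \<forall>A\<in>S. c *\<^sub>C A \<in> S)}"

definition fourier_rep ::
    "('n :: finite list \<Rightarrow> real) \<Rightarrow> 'n fock cop \<Rightarrow> ('n list \<Rightarrow> complex) \<Rightarrow> bool"
  where "fourier_rep b \<phi> c \<longleftrightarrow>
    (\<forall>\<gamma>. (\<lambda>\<beta>. (cmod (c \<beta>))\<^sup>2 * (b \<gamma> / b (\<beta> @ \<gamma>))) summable_on UNIV) \<and>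
    bdd_above {norm (\<Sum>\<^sub>\<infinity>\<beta>. c \<beta> *\<^sub>C (word_op (universal_model b) \<beta> *\<^sub>V p)) | p.
      p \<in> fock_polys \<and> norm p \<le> 1} \<and>
    (\<forall>p\<in>fock_polys. \<phi> *\<^sub>V p = (\<Sum>\<^sub>\<infinity>\<beta>. c \<beta> *\<^sub>C (word_op (universal_model b) \<beta> *\<^sub>V p)))"

definition F_inf :: "('n :: finite list \<Rightarrow> real) \<Rightarrow> 'n fock cop set"
  where "F_inf b = {\<phi>. \<exists>c. fourier_rep b \<phi> c}"

text \<open>Maps defined on a set of operators are taken to be \<^const>\<open>extensional\<close> so that uniqueness
  can be expressed as equality of functions.\<close>

definition is_poly_calculus :: "('n :: finite list \<Rightarrow> real) \<Rightarrow> ('h :: chilbert_space cop) ^ 'n \<Rightarrow>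
    ('n fock cop \<Rightarrow> 'h cop) \<Rightarrow> bool"
  where "is_poly_calculus b T \<Phi> \<longleftrightarrow>
    \<Phi> \<in> extensional (A_alg b) \<and> clinear_on (A_alg b) \<Phi> \<and>
    completely_contractive_on (A_alg b) \<Phi> \<and>
    (\<forall>p. finite {\<alpha>. p \<alpha> \<noteq> 0} \<longrightarrow> \<Phi> (poly_op p (universal_model b)) = poly_op p T)"

definition poly_calculus :: "('n :: finite list \<Rightarrow> real) \<Rightarrow> ('h :: chilbert_space cop) ^ 'n \<Rightarrow>
    'n fock cop \<Rightarrow> 'h cop"
  where "poly_calculus b T = (THE \<Phi>. is_poly_calculus b T \<Phi>)"

definition is_wstar_extension :: "('n :: finite list \<Rightarrow> real) \<Rightarrow> ('h :: chilbert_space cop) ^ 'n \<Rightarrow>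
    ('n fock cop \<Rightarrow> 'h cop) \<Rightarrow> bool"
  where "is_wstar_extension b T \<Psi> \<longleftrightarrow>
    \<Psi> \<in> extensional (F_inf b) \<and> (\<forall>A\<in>A_alg b. \<Psi> A = poly_calculus b T A) \<and>
    algebra_hom_on (F_inf b) \<Psi> \<and>
    continuous_map (subtopology wstar_topology (F_inf b)) wstar_topology \<Psi>"

definition Hinf_calculus :: "('n :: finite list \<Rightarrow> real) \<Rightarrow> ('h :: chilbert_space cop) ^ 'n \<Rightarrow>
    'n fock cop \<Rightarrow> 'h cop"
  where "Hinf_calculus b T = (THE \<Psi>. is_wstar_extension b T \<Psi>)"

end

(* Write K for the Berezin kernel of T. It intertwines, T_i K* = K*(W_i \<otimes> I), and it is injective
   because T is completely non-coisometric, so K* has dense range. For a pure tuple X the kernel is an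
   isometry, whence p(X) = K*(p(W) \<otimes> I)K and the von Neumann inequality for p; the inequality passes to
   the norm closure of the pure tuples, hence holds for T.

   The Cesaro means of an element phi of the Hardy algebra are averages of compressions of phi to windows of
   degrees, so they are bounded by norm phi and converge strongly to phi. The Cesaro means at T are
   therefore bounded, converge on the range of K*, and so converge everywhere. The limit Psi(phi) satisfies
   Psi(phi) K* = K*(phi \<otimes> I), which makes Psi a completely contractive homomorphism. The Hardy algebra is
   the commutant of the weighted right shifts, which are bounded because of the hypothesis on
   b_alpha / b_(alpha g_i); this is what makes it a weakly closed algebra.

   For weak-star continuity no Krein-Smulian theorem is needed. The functional A |-> sum_k <Psi(A) x_k, y_k>
   is the norm limit of its Cesaro means, each of which depends on finitely many Fourier coefficients. Such
   a functional is a trace class pairing: it is approximated by trace class pairings of controlled norm, by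
   separation in the Fock space, and the error is halved at each step of an iteration.

   The second part follows because Cesaro summability implies Abel summability, and because
   phi_r(T) = K_(rT)* (phi \<otimes> I) K_(rT) when rT is pure. *)
theory Submission
  imports Defs
begin

section \<open>Operators on complex Hilbert spaces\<close>

text \<open>Fejer weights depend only on word length, and their norm bound uses only the grading of
  the Fock space, at all matrix levels at once. Two facts make the dual argument elementary. A
  Cesaro mean sees finitely many coefficients, all readable from the vacuum column, so a truncated
  functional is the inner product with one vector of the Fock space, and separating that vector from
  a convex set is a nearest point argument. The windows behind the norm bound also write <(ces N A)
  x, y>, for finitely supported x and y, as a finite trace pairing of size controlled by x and y; so
  the convex set is large enough. A pairing carries separate square sums for its left and right
  vectors, because these must stay summable when the pairings of infinitely many steps are joined.
  That the Cesaro means of A -> <Psi(A) x, y> converge uniformly on the unit ball is computed for x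
  in the range of K*, and the norm bound on Psi carries it to all x.\<close>

lemma scaleC_zero_left [simp]: "0 *\<^sub>C x = (0 :: 'a :: complex_vector)"
  using scaleC_add_left[of 0 0 x] by simp

lemma scaleC_minus_left: "(- c) *\<^sub>C x = - (c *\<^sub>C (x :: 'a :: complex_vector))"
  using scaleC_add_left[of c "- c" x] by (simp add: eq_neg_iff_add_eq_0 add.commute)

lemma cinner_zero_left [simp]: "cinner 0 (y :: 'a :: complex_inner) = 0"
  using cinner_add_left[of 0 0 y] by simp

lemma cinner_zero_right [simp]: "cinner (x :: 'a :: complex_inner) 0 = 0"
  using cinner_add_right[of x 0 0] by simp

lemma cinner_minus_left: "cinner (- x) y = - cinner x (y :: 'a :: complex_inner)"
  using cinner_add_left[of x "- x" y] by (simp add: eq_neg_iff_add_eq_0 add.commute)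

lemma cinner_minus_right: "cinner x (- y) = - cinner x (y :: 'a :: complex_inner)"
  using cinner_add_right[of x y "- y"] by (simp add: eq_neg_iff_add_eq_0 add.commute)

lemma cinner_diff_left: "cinner (x - x') y = cinner x y - cinner x' (y :: 'a :: complex_inner)"
  using cinner_add_left[of x "- x'" y] by (simp add: cinner_minus_left)

lemma cinner_diff_right: "cinner x (y - y') = cinner x y - cinner x (y' :: 'a :: complex_inner)"
  using cinner_add_right[of x y "- y'"] by (simp add: cinner_minus_right)

lemma cinner_scaleR_left: "cinner (r *\<^sub>R x) y = complex_of_real r * cinner x (y :: 'a :: complex_inner)"
  by (simp add: scaleR_scaleC cinner_scaleC_left)

lemma cinner_scaleR_right: "cinner x (r *\<^sub>R y) = complex_of_real r * cinner x (y :: 'a :: complex_inner)"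
  by (simp add: scaleR_scaleC cinner_scaleC_right)

lemma cinner_norm_sq: "cinner x x = complex_of_real ((norm (x :: 'a :: complex_inner))\<^sup>2)"
  by (simp only: norm_sq_eq_cinner)

lemma Re_cinner_self: "Re (cinner x x) = (norm (x :: 'a :: complex_inner))\<^sup>2"
  by (simp only: cinner_norm_sq Re_complex_of_real)

text \<open>The factor \<open>a\<close>, of modulus at most one, rotates the complex inner product
  to its modulus, and the real Cauchy-Schwarz inequality applies to the rotated vector.\<close>

lemma norm_cinner_le: "norm (cinner x y) \<le> norm x * norm (y :: 'a :: complex_inner)"
proof -
  define a where "a = cnj (sgn (cinner x y))"
  have "norm a \<le> 1"
    by (simp add: a_def norm_sgn)
  have "a * cinner x y = complex_of_real (norm (cinner x y))"
  proof (cases "cinner x y = 0")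
    case False
    then show ?thesis
      using complex_norm_square[of "cinner x y"]
      by (simp add: a_def sgn_eq field_simps power2_eq_square)
  qed (simp add: a_def)
  then have "inner (a *\<^sub>C x) y = norm (cinner x y)"
    by (simp add: inner_eq_Re_cinner cinner_scaleC_left)
  moreover have "inner (a *\<^sub>C x) y \<le> norm (a *\<^sub>C x) * norm y"
    by (rule norm_cauchy_schwarz)
  moreover have "norm (a *\<^sub>C x) * norm y \<le> norm x * norm y"
    using \<open>norm a \<le> 1\<close> by (intro mult_right_mono) (auto simp: norm_scaleC mult_left_le_one_le)
  ultimately show ?thesis
    by linarith
qed

lemma bounded_bilinear_cinner: "bounded_bilinear (cinner :: 'a :: complex_inner \<Rightarrow> 'a \<Rightarrow> complex)"
proof
  show "\<exists>K. \<forall>a b. norm (cinner a (b :: 'a)) \<le> norm a * norm b * K"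
    by (rule exI[of _ 1]) (simp add: norm_cinner_le)
qed (auto simp: cinner_add_left cinner_add_right cinner_scaleR_left cinner_scaleR_right scaleR_conv_of_real)

interpretation cinner: bounded_bilinear "cinner :: 'a :: complex_inner \<Rightarrow> 'a \<Rightarrow> complex"
  by (rule bounded_bilinear_cinner)

lemma cinner_eq_zeroI: "(\<And>y. cinner (x :: 'a :: complex_inner) y = 0) \<Longrightarrow> x = 0"
  using Re_cinner_self[of x] by simp

lemma cinner_eqI: "(\<And>y. cinner (x :: 'a :: complex_inner) y = cinner x' y) \<Longrightarrow> x = x'"
  using cinner_eq_zeroI[of "x - x'"] by (simp add: cinner_diff_left)

section \<open>Elementary calculus of bounded complex-linear operators\<close>

lemma cop_bounded_linear: "bounded_linear (cblinfun_apply A)"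
  using cblinfun_apply by blast

lemma cop_add_right: "A *\<^sub>V (x + y) = A *\<^sub>V x + A *\<^sub>V y"
  by (rule bounded_linear.linear[OF cop_bounded_linear, THEN linear_add])

lemma cop_diff_right: "A *\<^sub>V (x - y) = A *\<^sub>V x - A *\<^sub>V y"
  by (rule bounded_linear.linear[OF cop_bounded_linear, THEN linear_diff])

lemma cop_zero_right [simp]: "A *\<^sub>V 0 = 0"
  by (rule bounded_linear.linear[OF cop_bounded_linear, THEN linear_0])

lemma cop_sum_right: "A *\<^sub>V (\<Sum>i\<in>F. f i) = (\<Sum>i\<in>F. A *\<^sub>V f i)"
  by (rule bounded_linear.linear[OF cop_bounded_linear, THEN linear_sum])

lemma cop_scaleR_right: "A *\<^sub>V (r *\<^sub>R x) = r *\<^sub>R (A *\<^sub>V x)"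
  by (rule bounded_linear.linear[OF cop_bounded_linear, THEN linear_scale])

lemma cop_scaleC_right: "A *\<^sub>V (c *\<^sub>C x) = c *\<^sub>C (A *\<^sub>V x)"
  using cblinfun_apply[of A] by blast

lemma cop_tendsto: "(f \<longlongrightarrow> l) F \<Longrightarrow> ((\<lambda>i. A *\<^sub>V f i) \<longlongrightarrow> A *\<^sub>V l) F"
  by (rule bounded_linear.tendsto[OF cop_bounded_linear])

lemma cop_norm_bound: "norm (A *\<^sub>V x) \<le> norm A * norm x"
  unfolding norm_cblinfun.rep_eq by (rule onorm[OF cop_bounded_linear])

lemma cop_norm_leI: "(\<And>x. norm (A *\<^sub>V x) \<le> c * norm x) \<Longrightarrow> 0 \<le> c \<Longrightarrow> norm A \<le> c"
  unfolding norm_cblinfun.rep_eq by (rule onorm_bound)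

lemma cop_apply_simps [simp]:
  "(A + B) *\<^sub>V x = A *\<^sub>V x + B *\<^sub>V x" "(A - B) *\<^sub>V x = A *\<^sub>V x - B *\<^sub>V x" "(- A) *\<^sub>V x = - (A *\<^sub>V x)"
  "0 *\<^sub>V x = 0" "(r *\<^sub>R A) *\<^sub>V x = r *\<^sub>R (A *\<^sub>V x)" "(c *\<^sub>C A) *\<^sub>V x = c *\<^sub>C (A *\<^sub>V x)"
  "id_cop *\<^sub>V y = y" "(C o\<^sub>C A) *\<^sub>V x = C *\<^sub>V (A *\<^sub>V x)"
  by (transfer; simp)+

lemma cop_sum_apply: "(\<Sum>i\<in>F. A i) *\<^sub>V x = (\<Sum>i\<in>F. A i *\<^sub>V x)"
  by (induction F rule: infinite_finite_induct) auto

lemma bounded_linear_cop_apply: "bounded_linear (\<lambda>A. A *\<^sub>V x)"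
  by (rule bounded_linear_intro[where K = "norm x"]) (auto simp: cop_norm_bound)

lemma cop_comp_norm: "norm (A o\<^sub>C B) \<le> norm A * norm B"
proof (rule cop_norm_leI)
  fix x
  have "norm (A *\<^sub>V B *\<^sub>V x) \<le> norm A * norm (B *\<^sub>V x)"
    by (rule cop_norm_bound)
  also have "\<dots> \<le> norm A * (norm B * norm x)"
    by (intro mult_left_mono cop_norm_bound) auto
  finally show "norm ((A o\<^sub>C B) *\<^sub>V x) \<le> norm A * norm B * norm x"
    by (simp add: mult.assoc)
qed auto

lemma bounded_bilinear_cop_comp:
  "bounded_bilinear (cop_comp :: ('b :: complex_inner, 'c :: complex_inner) cblinfun \<Rightarrow>
    ('a :: complex_inner, 'b) cblinfun \<Rightarrow> ('a, 'c) cblinfun)"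
proof
  show "\<exists>K. \<forall>(A :: ('b, 'c) cblinfun) (B :: ('a, 'b) cblinfun). norm (A o\<^sub>C B) \<le> norm A * norm B * K"
    by (rule exI[of _ 1]) (simp add: cop_comp_norm)
qed (auto intro!: cblinfun_eqI simp: cop_add_right cop_scaleR_right)

interpretation cop_comp: bounded_bilinear "cop_comp :: ('b :: complex_inner, 'c :: complex_inner) cblinfun \<Rightarrow>
    ('a :: complex_inner, 'b) cblinfun \<Rightarrow> ('a, 'c) cblinfun"
  by (rule bounded_bilinear_cop_comp)

lemma cop_comp_assoc: "(A o\<^sub>C B) o\<^sub>C C = A o\<^sub>C (B o\<^sub>C C)"
  by (rule cblinfun_eqI) simp

lemma cop_comp_id [simp]: "A o\<^sub>C id_cop = A" "id_cop o\<^sub>C A = A"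
  by (rule cblinfun_eqI; simp)+

lemma cop_norm_scaleC: "norm (c *\<^sub>C A) = cmod c * norm (A :: ('a :: complex_inner, 'b :: complex_inner) cblinfun)"
proof (cases "c = 0")
  case False
  have le: "norm (c *\<^sub>C A) \<le> cmod c * norm A" for c and A :: "('a, 'b) cblinfun"
    using mult_left_mono[OF cop_norm_bound, of "cmod c"]
    by (intro cop_norm_leI) (auto simp: norm_scaleC mult.assoc)
  have "norm A \<le> cmod (inverse c) * norm (c *\<^sub>C A)"
    using le[of "inverse c" "c *\<^sub>C A"] False by (simp add: scaleC_scaleC scaleC_one)
  then have "cmod c * norm A \<le> norm (c *\<^sub>C A)"
    using False mult_left_mono[of "norm A" "cmod (inverse c) * norm (c *\<^sub>C A)" "cmod c"]
    by (simp add: norm_mult[symmetric] mult.assoc[symmetric])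
  then show ?thesis
    using le[of c A] by simp
qed simp

text \<open>Common source of the operators constructed below: complex homogeneity contains real
  homogeneity, so additivity, complex scaling and a norm bound are enough to enter the operator
  type.\<close>

lemma cop_exists:
  fixes f :: "'a :: complex_inner \<Rightarrow> 'b :: complex_inner"
  assumes "\<And>x y. f (x + y) = f x + f y" "\<And>c x. f (c *\<^sub>C x) = c *\<^sub>C f x" "\<And>x. norm (f x) \<le> K * norm x"
  obtains A where "\<And>x. A *\<^sub>V x = f x"
proof -
  have "bounded_linear f"
    using assms by (intro bounded_linear_intro[where K = K]) (auto simp: scaleR_scaleC mult.commute)
  then have "cblinfun_apply (Abs_cblinfun f) = f"
    using assms by (intro Abs_cblinfun_inverse) auto
  then show ?thesis
    using that by metis
qed

lemma closed_ccombI: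
  assumes "closed_csubspace M" "x \<in> M" "y \<in> M" shows "x - y \<in> M"
proof -
  have "x + (-1) *\<^sub>C y \<in> M"
    using assms unfolding closed_csubspace_def by blast
  then show ?thesis
    by (simp add: scaleC_minus_left scaleC_one)
qed

subsection \<open>Projections, the Riesz representation and adjoints\<close>

text \<open>A minimizing sequence is Cauchy by the parallelogram law, convexity keeping midpoints in
  \<open>S\<close>. The obtuse angle inequality comes from moving slightly from \<open>p\<close>
  towards \<open>s\<close>. The convex form serves both orthogonal projection and the later
  separation argument.\<close>

lemma closest_point_exists_hilbert:
  fixes S :: "'a :: {real_inner, complete_space} set"
  assumes "closed S" "convex S" "S \<noteq> {}"
  obtains p where "p \<in> S" "\<And>s. s \<in> S \<Longrightarrow> inner (a - p) (s - p) \<le> 0"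
proof -
  define d where "d = Inf ((\<lambda>s. (norm (a - s))\<^sup>2) ` S)"
  have bdd: "bdd_below ((\<lambda>s. (norm (a - s))\<^sup>2) ` S)"
    by (intro bdd_belowI2[of _ 0]) auto
  have d_le: "d \<le> (norm (a - s))\<^sup>2" if "s \<in> S" for s
    unfolding d_def using bdd that by (intro cINF_lower) auto
  have "\<exists>s\<in>S. (norm (a - s))\<^sup>2 < d + 1 / real (Suc n)" for n
    using cINF_less_iff[OF assms(3) bdd, of "d + 1 / real (Suc n)"] unfolding d_def by auto
  then obtain s where s: "\<And>n. s n \<in> S" "\<And>n. (norm (a - s n))\<^sup>2 < d + 1 / real (Suc n)"
    by metis
  have dist_sq: "(norm (s m - s n))\<^sup>2 \<le> 2 / real (Suc m) + 2 / real (Suc n)" for m n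
  proof -
    have "(1/2) *\<^sub>R s m + (1/2) *\<^sub>R s n \<in> S"
      using assms(2) s(1) by (intro convexD) auto
    then have "d \<le> (norm (a - ((1/2) *\<^sub>R s m + (1/2) *\<^sub>R s n)))\<^sup>2"
      by (rule d_le)
    moreover have "4 * (norm (a - ((1/2) *\<^sub>R s m + (1/2) *\<^sub>R s n)))\<^sup>2 + (norm (s m - s n))\<^sup>2
        = 2 * (norm (a - s m))\<^sup>2 + 2 * (norm (a - s n))\<^sup>2"
      unfolding power2_norm_eq_inner
      by (simp add: algebra_simps inner_commute)
    ultimately show ?thesis
      using s(2)[of m] s(2)[of n] by simp
  qed
  have "Cauchy s"
  proof (rule metric_CauchyI)
    fix e :: real
    assume "e > 0"
    then obtain M where "inverse (real (Suc M)) < e\<^sup>2 / 4"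
      using reals_Archimedean[of "e\<^sup>2 / 4"] by auto
    then have M: "4 * inverse (real (Suc M)) < e\<^sup>2"
      by simp
    have "dist (s m) (s n) < e" if "m \<ge> M" "n \<ge> M" for m n
    proof -
      have "inverse (real (Suc m)) \<le> inverse (real (Suc M))" "inverse (real (Suc n)) \<le> inverse (real (Suc M))"
        using that by (auto intro!: le_imp_inverse_le)
      then have "(norm (s m - s n))\<^sup>2 < e\<^sup>2"
        using dist_sq[of m n] M unfolding divide_inverse by linarith
      then show ?thesis
        unfolding dist_norm using \<open>e > 0\<close> by (meson power2_less_imp_less less_imp_le)
    qed
    then show "\<exists>M. \<forall>m\<ge>M. \<forall>n\<ge>M. dist (s m) (s n) < e"
      by blast
  qed
  then obtain p where p: "s \<longlonglongrightarrow> p"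
    using Cauchy_convergent convergent_def by blast
  then have "p \<in> S"
    using assms(1) s(1) closed_sequentially by blast
  have "(\<lambda>n. d + 1 / real (Suc n)) \<longlonglongrightarrow> d + 0"
    using LIMSEQ_inverse_real_of_nat by (intro tendsto_intros) (simp add: divide_inverse)
  moreover have "(\<lambda>n. (norm (a - s n))\<^sup>2) \<longlonglongrightarrow> (norm (a - p))\<^sup>2"
    by (intro tendsto_intros p)
  ultimately have p_le: "(norm (a - p))\<^sup>2 \<le> d"
    using LIMSEQ_le[of "\<lambda>n. (norm (a - s n))\<^sup>2" _ "\<lambda>n. d + 1 / real (Suc n)"] less_imp_le[OF s(2)] by simp
  have "inner (a - p) (u - p) \<le> 0" if "u \<in> S" for u
  proof (rule ccontr)
    assume neg: "\<not> ?thesis"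
    define i where "i = inner (a - p) (u - p)"
    define q where "q = (norm (u - p))\<^sup>2"
    have "i > 0" "q \<ge> 0"
      using neg by (auto simp: i_def q_def)
    have key: "2 * i \<le> t * q" if "0 < t" "t \<le> 1" for t
    proof -
      have "(1 - t) *\<^sub>R p + t *\<^sub>R u \<in> S"
        using assms(2) \<open>p \<in> S\<close> \<open>u \<in> S\<close> that by (intro convexD) auto
      then have "(norm (a - p))\<^sup>2 \<le> (norm (a - ((1 - t) *\<^sub>R p + t *\<^sub>R u)))\<^sup>2"
        using d_le order_trans[OF p_le] by blast
      also have "\<dots> = (norm ((a - p) - t *\<^sub>R (u - p)))\<^sup>2"
        by (simp add: algebra_simps)
      also have "\<dots> = (norm (a - p))\<^sup>2 - 2 * t * i + t * t * q"
        unfolding i_def q_def power2_norm_eq_inner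
        by (simp add: inner_diff_left inner_diff_right inner_commute)
      finally have "t * (2 * i) \<le> t * (t * q)"
        by (simp add: mult_ac)
      then show ?thesis
        using that by simp
    qed
    \<comment> \<open>With t = 1 the estimate gives 2i <= q <= i; otherwise t = i / q lies in (0, 1)
      and gives 2i <= i.\<close>
    show False
    proof (cases "q \<le> i")
      case True
      then show False using key[of 1] \<open>i > 0\<close> by simp
    next
      case False
      then show False using key[of "i / q"] \<open>i > 0\<close> by simp
    qed
  qed
  then show ?thesis
    using that \<open>p \<in> S\<close> by blast
qed

lemma closed_csubspace_convex: "closed_csubspace M \<Longrightarrow> convex M"
  unfolding closed_csubspace_def convex_def by (auto simp: scaleR_scaleC)

text \<open>Applied to s and to -s, the obtuse angle inequality becomes an equation for the real
  part of the inner product; the vector i s supplies the imaginary part.\<close>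

lemma orthogonal_projection_exists:
  fixes M :: "'a :: chilbert_space set"
  assumes M: "closed_csubspace M"
  obtains p where "p \<in> M" "\<And>s. s \<in> M \<Longrightarrow> cinner (a - p) s = 0"
proof -
  obtain p where p: "p \<in> M" "\<And>s. s \<in> M \<Longrightarrow> inner (a - p) (s - p) \<le> 0"
    using closest_point_exists_hilbert[of M a] closed_csubspace_convex[OF M] M
    unfolding closed_csubspace_def by blast
  have inn: "inner (a - p) s \<le> 0" if "s \<in> M" for s
    using p(2)[of "p + s"] p(1) that M unfolding closed_csubspace_def by simp
  have inn0: "inner (a - p) s = 0" if "s \<in> M" for s
    using inn[OF that] inn[OF closed_ccombI[OF M _ that, of 0]] M unfolding closed_csubspace_def by simp
  have "cinner (a - p) s = 0" if "s \<in> M" for s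
  proof -
    have "\<i> *\<^sub>C s \<in> M"
      using M that unfolding closed_csubspace_def by blast
    then show ?thesis
      using inn0[OF that] inn0[of "\<i> *\<^sub>C s"]
      by (simp add: complex_eq_iff Im_cinner inner_eq_Re_cinner)
  qed
  then show ?thesis
    using that p(1) by blast
qed

lemma closed_csubspace_eq_UNIV:
  fixes M :: "'a :: chilbert_space set"
  assumes M: "closed_csubspace M" and orth: "\<And>v. (\<And>s. s \<in> M \<Longrightarrow> cinner v s = 0) \<Longrightarrow> v = 0"
  shows "M = UNIV"
proof -
  have "a \<in> M" for a
  proof -
    obtain p where p: "p \<in> M" "\<And>s. s \<in> M \<Longrightarrow> cinner (a - p) s = 0"
      using orthogonal_projection_exists[OF M] by blast
    then have "a - p = 0"
      by (intro orth)
    then show ?thesis using p by simp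
  qed
  then show ?thesis by blast
qed

text \<open>A nonzero \<open>v\<close> orthogonal to the kernel of \<open>f\<close> determines
  \<open>f\<close>: subtracting a suitable multiple of \<open>v\<close> moves any vector into the
  kernel. The norm bound comes from evaluating \<open>f\<close> at the representing vector.\<close>

lemma riesz_representation:
  fixes f :: "'a :: chilbert_space \<Rightarrow> complex"
  assumes add: "\<And>x y. f (x + y) = f x + f y" and scale: "\<And>c x. f (c *\<^sub>C x) = c * f x"
    and bound: "\<And>x. norm (f x) \<le> K * norm x" and "0 \<le> K"
  obtains v where "\<And>x. f x = cinner x v" "norm v \<le> K"
proof -
  have bl: "bounded_linear f"
  proof (rule bounded_linear_intro[where K = K])
    show "f (r *\<^sub>R x) = r *\<^sub>R f x" for r x
      unfolding scaleR_scaleC[of r x] scale by (simp add: scaleR_conv_of_real)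
    show "norm (f x) \<le> norm x * K" for x
      using bound[of x] by (simp only: mult.commute)
  qed (rule add)
  have f0: "f 0 = 0"
    using bl by (simp add: bounded_linear.linear linear_0)
  define M where "M = {x. f x = 0}"
  have M: "closed_csubspace M"
    unfolding closed_csubspace_def M_def
    using add scale f0 bounded_linear.continuous_on[OF bl continuous_on_id]
    by (auto intro!: closed_Collect_eq continuous_on_const)
  have "\<exists>v. \<forall>x. f x = cinner x v"
  proof (cases "M = UNIV")
    case True
    then show ?thesis by (intro exI[of _ 0]) (auto simp: M_def)
  next
    case False
    then obtain v where v: "\<And>s. s \<in> M \<Longrightarrow> cinner v s = 0" "v \<noteq> 0"
      using closed_csubspace_eq_UNIV[OF M] by blast
    have vv: "cinner v v \<noteq> 0"
      using v(2) by (simp add: cinner_norm_sq)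
    have "f v \<noteq> 0"
      using v(1)[of v] vv by (auto simp: M_def)
    have "f x = cinner x (cnj (f v / cinner v v) *\<^sub>C v)" for x
    proof -
      have "x - (f x / f v) *\<^sub>C v \<in> M"
        using add[of "x - (f x / f v) *\<^sub>C v" "(f x / f v) *\<^sub>C v"] \<open>f v \<noteq> 0\<close>
        by (simp add: M_def scale)
      then have "cinner (x - (f x / f v) *\<^sub>C v) v = 0"
        using v(1) cinner_commute[of _ v] by (metis complex_cnj_zero)
      then have "cinner x v = f x / f v * cinner v v"
        by (simp add: cinner_diff_left cinner_scaleC_left)
      then show ?thesis
        using vv \<open>f v \<noteq> 0\<close> by (simp add: cinner_scaleC_right)
    qed
    then show ?thesis by blast
  qed
  then obtain v where v: "\<And>x. f x = cinner x v" by blast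
  have "norm v * norm v \<le> K * norm v"
    using bound[of v] by (simp add: v cinner_norm_sq power2_eq_square norm_mult)
  moreover note \<open>0 \<le> K\<close>
  ultimately have "norm v \<le> K" 
    by (cases "norm v = 0") auto
  then show ?thesis using v that by blast
qed

lemma adj_eqI:
  assumes "\<And>x y. cinner (A *\<^sub>V x) y = cinner x (B *\<^sub>V y)"
  shows "adj A = B"
  unfolding adj_def
proof (rule the_equality)
  fix B' assume B': "\<forall>x y. cinner (A *\<^sub>V x) y = cinner x (B' *\<^sub>V y)"
  show "B' = B"
  proof (rule cblinfun_eqI, rule cinner_eqI)
    fix x y
    show "cinner (B' *\<^sub>V x) y = cinner (B *\<^sub>V x) y"
      using B' assms by (metis cinner_commute)
  qed
qed (use assms in auto)

text \<open>Riesz gives a vector for each y, and definiteness of the inner product makes it linear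
  in y. This existence is what gives the definite description in \<open>adj\<close> a value.\<close>

lemma cinner_adj_right: "cinner x (adj A *\<^sub>V y) = cinner (A *\<^sub>V x) y"
proof -
  have "\<exists>v. \<forall>x. cinner (A *\<^sub>V x) y = cinner x v \<and> norm v \<le> norm A * norm y" for y
  proof (rule riesz_representation[of "\<lambda>x. cinner (A *\<^sub>V x) y" "norm A * norm y"])
    fix x
    have "norm (cinner (A *\<^sub>V x) y) \<le> norm (A *\<^sub>V x) * norm y"
      by (rule norm_cinner_le)
    also have "\<dots> \<le> (norm A * norm x) * norm y"
      by (intro mult_right_mono cop_norm_bound) auto
    finally show "norm (cinner (A *\<^sub>V x) y) \<le> norm A * norm y * norm x"
      by (simp add: mult_ac)
  qed (auto simp: cop_add_right cop_scaleC_right cinner_add_left cinner_scaleC_left)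
  then obtain g where g: "\<And>x y. cinner (A *\<^sub>V x) y = cinner x (g y)" "\<And>y. norm (g y) \<le> norm A * norm y"
    by metis
  have gl: "cinner (g u) z = cinner u (A *\<^sub>V z)" for u z
    using g(1)[of z u] cinner_commute[of u "A *\<^sub>V z"] cinner_commute[of "g u" z] by simp
  obtain B where "\<And>y. B *\<^sub>V y = g y"
  proof (rule cop_exists[of g "norm A"])
    show "g (x + y) = g x + g y" for x y
      by (rule cinner_eqI) (simp add: gl cinner_add_left)
    show "g (c *\<^sub>C x) = c *\<^sub>C g x" for c x
      by (rule cinner_eqI) (simp add: gl cinner_scaleC_left)
  qed (use g(2) in auto)
  then have "adj A = B"
    using g(1) by (intro adj_eqI) simp
  then show ?thesis
    using g(1) \<open>\<And>y. B *\<^sub>V y = g y\<close> by simp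
qed

lemma cinner_adj_left: "cinner (adj A *\<^sub>V x) y = cinner x (A *\<^sub>V y)"
  using cinner_adj_right[of y A x] by (metis cinner_commute)

lemma adj_comp: "adj (A o\<^sub>C B) = adj B o\<^sub>C adj A"
  by (rule adj_eqI) (simp add: cinner_adj_right)

lemma adj_id [simp]: "adj id_cop = id_cop"
  by (rule adj_eqI) simp

lemma closed_csubspace_closure:
  fixes R :: "'a :: complex_inner set"
  assumes "0 \<in> R" "\<And>x y. x \<in> R \<Longrightarrow> y \<in> R \<Longrightarrow> x + y \<in> R" "\<And>c x. x \<in> R \<Longrightarrow> c *\<^sub>C x \<in> R"
  shows "closed_csubspace (closure R)"
proof -
  have "c *\<^sub>C x \<in> closure R" if x: "x \<in> closure R" for c x
  proof -
    obtain f where f: "\<And>n. f n \<in> R" "f \<longlonglongrightarrow> x"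
      using x closure_sequential by metis
    have "(\<lambda>n. c *\<^sub>C f n) \<longlonglongrightarrow> c *\<^sub>C x"
      by (rule bounded_linear.tendsto[OF bounded_linear_scaleC f(2)])
    moreover have "\<forall>n. c *\<^sub>C f n \<in> R"
      using f(1) assms(3) by simp
    ultimately show ?thesis
      unfolding closure_sequential by (intro exI[of _ "\<lambda>n. c *\<^sub>C f n"]) simp
  qed
  moreover have "x + y \<in> closure R" if x: "x \<in> closure R" and y: "y \<in> closure R" for x y
  proof -
    obtain f where f: "\<And>n. f n \<in> R" "f \<longlonglongrightarrow> x"
      using x closure_sequential by metis
    obtain g where g: "\<And>n. g n \<in> R" "g \<longlonglongrightarrow> y"
      using y closure_sequential by metis
    have "(\<lambda>n. f n + g n) \<longlonglongrightarrow> x + y"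
      by (rule tendsto_add[OF f(2) g(2)])
    moreover have "\<forall>n. f n + g n \<in> R"
      using f(1) g(1) assms(2) by simp
    ultimately show ?thesis
      unfolding closure_sequential by (intro exI[of _ "\<lambda>n. f n + g n"]) simp
  qed
  moreover have "0 \<in> closure R"
    using assms(1) closure_subset by blast
  ultimately show ?thesis
    by (simp add: closed_csubspace_def)
qed

text \<open>The orthogonal complement of the range of the adjoint is the kernel of
  \<open>A\<close>.\<close>

lemma adj_dense_range:
  assumes "\<And>x. A *\<^sub>V x = 0 \<Longrightarrow> x = 0"
  shows "closure (range (cblinfun_apply (adj A))) = UNIV"
proof (rule closed_csubspace_eq_UNIV)
  show "closed_csubspace (closure (range (cblinfun_apply (adj A))))"
  proof (rule closed_csubspace_closure)
    show "0 \<in> range (cblinfun_apply (adj A))"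
      using cop_zero_right[of "adj A"] by (metis rangeI)
  qed (auto simp: cop_add_right[symmetric] cop_scaleC_right[symmetric])
next
  fix v
  assume v: "\<And>s. s \<in> closure (range (cblinfun_apply (adj A))) \<Longrightarrow> cinner v s = 0"
  have "cinner (A *\<^sub>V v) y = 0" for y
    using v[of "adj A *\<^sub>V y"] closure_subset[of "range (cblinfun_apply (adj A))"]
    by (simp only: cinner_adj_right subset_iff rangeI)
  then have "A *\<^sub>V v = 0"
    by (rule cinner_eq_zeroI)
  then show "v = 0"
    by (rule assms)
qed

subsection \<open>Completeness and uniform boundedness\<close>

text \<open>Pointwise convergence identifies the limit; the Cauchy estimate, uniform on the unit
  ball, survives the passage to the pointwise limit.\<close>

lemma tendsto_cop_normI:
  assumes "\<And>x. (\<lambda>n. X n *\<^sub>V x) \<longlonglongrightarrow> L *\<^sub>V x" "Cauchy X"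
  shows "X \<longlonglongrightarrow> L"
proof (rule metric_LIMSEQ_I)
  fix e :: real
  assume "e > 0"
  then obtain M where M: "\<And>m n. m \<ge> M \<Longrightarrow> n \<ge> M \<Longrightarrow> norm (X m - X n) < e / 2"
    using CauchyD[OF assms(2), of "e / 2"] by auto
  have "dist (X m) L < e" if "m \<ge> M" for m
  proof -
    have "norm (X m - L) \<le> e / 2"
    proof (rule cop_norm_leI)
      fix x
      have "(\<lambda>n. norm (X m *\<^sub>V x - X n *\<^sub>V x)) \<longlonglongrightarrow> norm (X m *\<^sub>V x - L *\<^sub>V x)"
        by (intro tendsto_intros assms)
      moreover have "norm (X m *\<^sub>V x - X n *\<^sub>V x) \<le> e / 2 * norm x" if "n \<ge> M" for n
      proof -
        have "norm ((X m - X n) *\<^sub>V x) \<le> norm (X m - X n) * norm x"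
          by (rule cop_norm_bound)
        also have "\<dots> \<le> e / 2 * norm x"
          using M[OF \<open>m \<ge> M\<close> that] by (intro mult_right_mono) auto
        finally show ?thesis by simp
      qed
      ultimately show "norm ((X m - L) *\<^sub>V x) \<le> e / 2 * norm x"
        using LIMSEQ_le_const2[of _ "norm (X m *\<^sub>V x - L *\<^sub>V x)" "e / 2 * norm x"] by auto
    qed (use \<open>e > 0\<close> in auto)
    then show ?thesis
      using \<open>e > 0\<close> by (simp add: dist_norm)
  qed
  then show "\<exists>M. \<forall>m\<ge>M. dist (X m) L < e"
    by blast
qed

lemma cop_pointwise_limit:
  fixes X :: "nat \<Rightarrow> ('a :: complex_inner, 'b :: complex_inner) cblinfun"
  assumes "\<And>x. (\<lambda>n. X n *\<^sub>V x) \<longlonglongrightarrow> f x" "\<And>n. norm (X n) \<le> K"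
  obtains L where "\<And>x. L *\<^sub>V x = f x"
proof (rule cop_exists[of f K])
  show "f (x + y) = f x + f y" for x y
    using LIMSEQ_unique[OF assms(1)[of "x + y"]] tendsto_add[OF assms(1)[of x] assms(1)[of y]]
    by (simp add: cop_add_right)
  show "f (c *\<^sub>C x) = c *\<^sub>C f x" for c x
    using LIMSEQ_unique[OF assms(1)[of "c *\<^sub>C x"]]
      bounded_linear.tendsto[OF bounded_linear_scaleC assms(1)[of x], of c]
    by (simp add: cop_scaleC_right)
  show "norm (f x) \<le> K * norm x" for x
  proof (rule LIMSEQ_le_const2[OF tendsto_norm[OF assms(1)]])
    have "norm (X n *\<^sub>V x) \<le> K * norm x" for n
      using cop_norm_bound[of "X n" x] mult_right_mono[OF assms(2)[of n], of "norm x"] by simp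
    then show "\<exists>N. \<forall>n\<ge>N. norm (X n *\<^sub>V x) \<le> K * norm x"
      by blast
  qed
qed (rule that)

text \<open>Completeness in operator norm is what lets the square root series and the Abel sums be
  formed as series of operators.\<close>

instance cblinfun :: (complex_inner, chilbert_space) banach
proof
  fix X :: "nat \<Rightarrow> ('a, 'b) cblinfun"
  assume X: "Cauchy X"
  have "Cauchy (\<lambda>n. X n *\<^sub>V x)" for x
    using X by (rule bounded_linear.Cauchy[OF bounded_linear_cop_apply])
  then have "\<forall>x. \<exists>l. (\<lambda>n. X n *\<^sub>V x) \<longlonglongrightarrow> l"
    using Cauchy_convergent convergent_def by blast
  then obtain f where f: "\<And>x. (\<lambda>n. X n *\<^sub>V x) \<longlonglongrightarrow> f x"
    by metis
  obtain K where K: "\<And>n. norm (X n) \<le> K"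
    using Cauchy_Bseq[OF X] by (auto simp: Bseq_def)
  obtain L where "\<And>x. L *\<^sub>V x = f x"
    using cop_pointwise_limit[OF f K] by blast
  then have "X \<longlonglongrightarrow> L"
    using f X by (intro tendsto_cop_normI) simp_all
  then show "convergent X"
    by (auto simp: convergent_def)
qed

text \<open>The difference of the values at x + su and x - su is 2 A(su). If \<open>A\<close> were
  at most K on the whole ball about \<open>x\<close>, it would be at most K on the ball of the same
  radius about 0.\<close>

lemma cop_large_value_near:
  fixes A :: "('a :: complex_inner, 'b :: complex_inner) cblinfun"
  assumes "0 < r" "K < r * norm A"
  obtains z where "norm (z - x) \<le> r" "K < norm (A *\<^sub>V z)"
proof (rule ccontr)
  note hump = that
  assume neg: "\<not> thesis"
  have le: "norm (A *\<^sub>V z) \<le> K" if "norm (z - x) \<le> r" for z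
  proof (rule ccontr)
    assume "\<not> ?thesis"
    then show False
      using neg hump that by simp
  qed
  have "K \<ge> 0"
    using le[of x] \<open>0 < r\<close> norm_ge_zero order_trans by (metis diff_self less_imp_le norm_zero)
  have "norm A \<le> K / r"
  proof (rule cop_norm_leI)
    fix u
    show "norm (A *\<^sub>V u) \<le> K / r * norm u"
    proof (cases "u = 0")
      case False
      define s where "s = r / norm u"
      have s: "s > 0" "norm (s *\<^sub>R u) = r"
        using False \<open>0 < r\<close> by (auto simp: s_def)
      have "2 *\<^sub>R (A *\<^sub>V (s *\<^sub>R u)) = A *\<^sub>V (x + s *\<^sub>R u) - A *\<^sub>V (x - s *\<^sub>R u)"
        by (simp add: cop_add_right cop_diff_right scaleR_2)
      then have "2 * norm (A *\<^sub>V (s *\<^sub>R u)) = norm (A *\<^sub>V (x + s *\<^sub>R u) - A *\<^sub>V (x - s *\<^sub>R u))"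
        by (metis norm_scaleR abs_numeral)
      also have "\<dots> \<le> norm (A *\<^sub>V (x + s *\<^sub>R u)) + norm (A *\<^sub>V (x - s *\<^sub>R u))"
        by (rule norm_triangle_ineq4)
      also have "\<dots> \<le> K + K"
        using s by (intro add_mono le) auto
      finally have "s * norm (A *\<^sub>V u) \<le> K"
        using s by (simp add: cop_scaleR_right)
      then show ?thesis
        using False \<open>0 < r\<close> by (simp add: s_def field_simps)
    qed simp
  qed (use \<open>K \<ge> 0\<close> \<open>0 < r\<close> in auto)
  then show False
    using assms by (simp add: field_simps)
qed

(* Sokal's gliding hump argument. *)
lemma uniform_boundedness_cop:
  fixes A :: "'i \<Rightarrow> ('a :: chilbert_space, 'b :: complex_inner) cblinfun"
  assumes pw: "\<And>x. \<exists>C. \<forall>i. norm (A i *\<^sub>V x) \<le> C"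
  obtains C where "\<And>i. norm (A i) \<le> C"
proof (rule ccontr)
  assume "\<not> thesis"
  then have unb: "\<exists>i. C < norm (A i)" for C
    using that by (meson not_le)
  define d where "d = (\<lambda>n. (1/3 :: real) ^ n)"
  have d_pos: "d n > 0" for n
    by (simp add: d_def)
  obtain i where i: "\<And>n. 3 * real n / d n < norm (A (i n))"
    using choice[of "\<lambda>n i. 3 * real n / d n < norm (A i)"] unb by blast
  have "\<exists>x. \<forall>n. norm (x (Suc n) - x n) \<le> d (Suc n) \<and>
      2 / 3 * d (Suc n) * norm (A (i (Suc n))) \<le> norm (A (i (Suc n)) *\<^sub>V x (Suc n))"
  proof -
    have step: "\<exists>z. norm (z - x) \<le> d (Suc n) \<and>
      2 / 3 * d (Suc n) * norm (A (i (Suc n))) \<le> norm (A (i (Suc n)) *\<^sub>V z)" for x n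
    proof -
      have "0 < norm (A (i (Suc n)))"
        using i[of "Suc n"] d_pos[of "Suc n"]
        by (meson divide_nonneg_pos le_less_trans mult_nonneg_nonneg of_nat_0_le_iff zero_le_numeral)
      then have "2 / 3 * d (Suc n) * norm (A (i (Suc n))) < d (Suc n) * norm (A (i (Suc n)))"
        using d_pos[of "Suc n"] by simp
      from cop_large_value_near[OF d_pos this] show ?thesis
        by (metis less_imp_le)
    qed
    define x where "x = rec_nat 0 (\<lambda>n x. SOME z. norm (z - x) \<le> d (Suc n) \<and>
      2 / 3 * d (Suc n) * norm (A (i (Suc n))) \<le> norm (A (i (Suc n)) *\<^sub>V z))"
    show ?thesis
      by (rule exI[of _ x]) (use someI_ex[OF step] in \<open>simp add: x_def\<close>)
  qed
  then obtain x where x: "\<And>n. norm (x (Suc n) - x n) \<le> d (Suc n)"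
      "\<And>n. 2 / 3 * d (Suc n) * norm (A (i (Suc n))) \<le> norm (A (i (Suc n)) *\<^sub>V x (Suc n))"
    by blast
  \<comment> \<open>The steps d(n+1), ..., d(n+k) form a geometric series of ratio 1/3 with sum d n
    / 2 * (1 - d k), so the tail is at most d n / 2.\<close>
  have close: "norm (x (n + k) - x n) \<le> d n / 2 * (1 - d k)" for n k
  proof (induction k)
    case (Suc k)
    have "norm (x (n + Suc k) - x n) \<le> norm (x (Suc (n + k)) - x (n + k)) + norm (x (n + k) - x n)"
      using norm_triangle_ineq[of "x (Suc (n + k)) - x (n + k)" "x (n + k) - x n"] by simp
    also have "\<dots> \<le> d (Suc (n + k)) + d n / 2 * (1 - d k)"
      by (intro add_mono x Suc)
    also have "\<dots> = d n / 2 * (1 - d (Suc k))"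
      by (simp add: d_def power_add field_simps)
    finally show ?case .
  qed (simp add: d_def)
  have close': "norm (x m - x n) \<le> d n / 2" if "m \<ge> n" for m n
  proof -
    have "norm (x (n + (m - n)) - x n) \<le> d n / 2 * (1 - d (m - n))"
      by (rule close)
    also have "\<dots> \<le> d n / 2 * 1"
      using d_pos[of n] d_pos[of "m - n"] by (intro mult_left_mono) auto
    finally show ?thesis using that by simp
  qed
  have d_lim: "d \<longlonglongrightarrow> 0"
    unfolding d_def by (rule LIMSEQ_power_zero) simp
  have "Cauchy x"
  proof (rule metric_CauchyI)
    fix e :: real
    assume "e > 0"
    then obtain M where M: "d M < e"
      using LIMSEQ_D[OF d_lim, of e] d_pos by (auto simp: abs_of_pos)
    have "dist (x m) (x n) < e" if "m \<ge> M" "n \<ge> M" for m n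
    proof -
      have "dist (x m) (x n) \<le> norm (x m - x M) + norm (x n - x M)"
        by (metis dist_norm dist_triangle2)
      then show ?thesis
        using close'[OF that(1)] close'[OF that(2)] M by linarith
    qed
    then show "\<exists>M. \<forall>m\<ge>M. \<forall>n\<ge>M. dist (x m) (x n) < e"
      by blast
  qed
  then obtain y where y: "x \<longlonglongrightarrow> y"
    using Cauchy_convergent convergent_def by blast
  have y_close: "norm (y - x n) \<le> d n / 2" for n
    by (rule LIMSEQ_le_const2[of "\<lambda>m. norm (x m - x n)"]) (use close' in \<open>auto intro!: tendsto_intros y\<close>)
  obtain C where C: "\<And>i. norm (A i *\<^sub>V y) \<le> C"
    using pw by blast
  obtain n :: nat where n: "2 * C < real n"
    using reals_Archimedean2 by blast
  let ?k = "Suc n"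
  let ?a = "norm (A (i ?k))"
  have "norm (A (i ?k) *\<^sub>V x ?k) \<le> norm (A (i ?k) *\<^sub>V y) + norm (A (i ?k) *\<^sub>V (x ?k - y))"
    using norm_triangle_ineq[of "A (i ?k) *\<^sub>V y" "A (i ?k) *\<^sub>V (x ?k - y)"] by (simp add: cop_diff_right)
  also have "\<dots> \<le> C + ?a * (d ?k / 2)"
    using y_close[of ?k] by (intro add_mono C order_trans[OF cop_norm_bound] mult_left_mono)
      (auto simp: norm_minus_commute)
  finally have "2 / 3 * d ?k * ?a \<le> C + ?a * (d ?k / 2)"
    using x(2)[of n] by linarith
  \<comment> \<open>The share 2/3 gained at the point of index \<open>?k\<close> beats the loss 1/2
    from moving on to \<open>y\<close>; their difference 1/6 accounts for the 6. Then 3(n+1) < 6C <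
    3n is absurd.\<close>
  then have "d ?k * ?a \<le> 6 * C"
    by (simp add: field_simps)
  moreover have "3 * real ?k < d ?k * ?a"
    using i[of ?k] d_pos[of ?k] by (simp add: pos_divide_less_eq mult.commute)
  ultimately show False
    using n by simp
qed

text \<open>Uniform boundedness is used twice: on the functionals y -> <y, A_n x>, whose norms
  dominate those of the vectors A_n x, and then on the operators themselves.\<close>

lemma wot_convergent_bounded:
  fixes A :: "nat \<Rightarrow> ('a :: chilbert_space, 'b :: chilbert_space) cblinfun"
  assumes "wot_tendsto A L sequentially"
  obtains C where "\<And>n. norm (A n) \<le> C"
proof -
  have "\<exists>C. \<forall>n. norm (A n *\<^sub>V x) \<le> C" for x
  proof -
    have "\<exists>f. \<forall>y. f *\<^sub>V y = cinner y (A n *\<^sub>V x)" for n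
      by (rule cop_exists[of "\<lambda>y. cinner y (A n *\<^sub>V x)" "norm (A n *\<^sub>V x)"])
        (auto simp: cinner_add_left cinner_scaleC_left scaleC_complex_def norm_cinner_le mult.commute
          intro: order_trans[OF norm_cinner_le])
    then obtain f where f: "\<And>n y. f n *\<^sub>V y = cinner y (A n *\<^sub>V x)"
      by metis
    obtain C where C: "\<And>n. norm (f n) \<le> C"
    proof (rule uniform_boundedness_cop[of f])
      fix y
      have "(\<lambda>n. cinner (A n *\<^sub>V x) y) \<longlonglongrightarrow> cinner (L *\<^sub>V x) y"
        using assms unfolding wot_tendsto_def by blast
      then obtain C where "\<And>n. norm (cinner (A n *\<^sub>V x) y) \<le> C"
        using convergent_imp_Bseq convergentI by (metis Bseq_def)
      then show "\<exists>C. \<forall>n. norm (f n *\<^sub>V y) \<le> C"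
        using cinner_commute[of y] by (metis complex_mod_cnj f)
    qed blast
    have "norm (A n *\<^sub>V x) \<le> C" for n
    proof (cases "A n *\<^sub>V x = 0")
      case False
      have "(norm (A n *\<^sub>V x))\<^sup>2 = norm (f n *\<^sub>V (A n *\<^sub>V x))"
        unfolding f by (simp add: cinner_norm_sq norm_power)
      also have "\<dots> \<le> C * norm (A n *\<^sub>V x)"
        using cop_norm_bound order_trans mult_right_mono[OF C norm_ge_zero] by blast
      finally show ?thesis
        using False by (simp add: power2_eq_square)
    next
      case True
      then show ?thesis
        using C[of n] norm_ge_zero[of "f n"] by (simp del: norm_ge_zero)
    qed
    then show ?thesis by blast
  qed
  then show ?thesis
    using uniform_boundedness_cop[of A] that by blast
qed

subsection \<open>Positive operators and square roots\<close>

lemma cop_pos_Im: "cop_pos A \<Longrightarrow> Im (cinner (A *\<^sub>V x) x) = 0"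
  and cop_pos_Re: "cop_pos A \<Longrightarrow> 0 \<le> Re (cinner (A *\<^sub>V x) x)"
  by (auto simp: cop_pos_def)

text \<open>Polarization: the quadratic form is real at x + y and at x + i y.\<close>

lemma cop_pos_selfadjoint:
  assumes "cop_pos A"
  shows "cinner (A *\<^sub>V x) y = cinner x (A *\<^sub>V y)"
proof -
  have "Im (cinner (A *\<^sub>V (x + c *\<^sub>C y)) (x + c *\<^sub>C y)) = 0" for c
    by (rule cop_pos_Im[OF assms])
  from this[of 1] this[of \<i>] show ?thesis
    using cop_pos_Im[OF assms, of x] cop_pos_Im[OF assms, of y] cinner_commute[of x "A *\<^sub>V y"]
    by (simp add: cop_add_right cop_scaleC_right cinner_add_left cinner_add_right cinner_scaleC_left
        cinner_scaleC_right complex_eq_iff)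
qed

lemma cop_zeroI_quadratic:
  fixes A :: "'a :: complex_inner cop"
  assumes "\<And>x. cinner (A *\<^sub>V x) x = 0"
  shows "A = 0"
proof (rule cblinfun_eqI, rule cinner_eqI)
  fix x y
  have "cinner (A *\<^sub>V (x + c *\<^sub>C y)) (x + c *\<^sub>C y) = 0" for c
    by (rule assms)
  from this[of 1] this[of \<i>] show "cinner (A *\<^sub>V x) y = cinner (0 *\<^sub>V x) y"
    using assms[of x] assms[of y]
    by (simp add: cop_add_right cop_scaleC_right cinner_add_left cinner_add_right cinner_scaleC_left
        cinner_scaleC_right complex_eq_iff)
qed

text \<open>This is A^2 <= norm A * A, obtained before any square root exists: evaluate the form at
  x - t A x with t = 1 / norm A, the value for which the quadratic term takes back only half of the
  linear one.\<close>

lemma cop_pos_norm_sq_le: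
  fixes A :: "'a :: complex_inner cop"
  assumes "cop_pos A"
  shows "(norm (A *\<^sub>V x))\<^sup>2 \<le> norm A * Re (cinner (A *\<^sub>V x) x)"
proof (cases "norm A = 0")
  case False
  then have nA: "norm A > 0" by simp
  define t where "t = 1 / norm A"
  define n where "n = (norm (A *\<^sub>V x))\<^sup>2"
  have "0 \<le> Re (cinner (A *\<^sub>V (x - t *\<^sub>R (A *\<^sub>V x))) (x - t *\<^sub>R (A *\<^sub>V x)))"
    by (rule cop_pos_Re[OF assms])
  also have "\<dots> = Re (cinner (A *\<^sub>V x) x) - 2 * t * n + t * t * Re (cinner (A *\<^sub>V A *\<^sub>V x) (A *\<^sub>V x))"
    using cop_pos_selfadjoint[OF assms, of "A *\<^sub>V x" x]
    by (simp add: cop_diff_right cop_scaleR_right cinner_diff_left cinner_diff_right cinner_scaleR_left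
        cinner_scaleR_right Re_cinner_self n_def algebra_simps)
  finally have q: "0 \<le> Re (cinner (A *\<^sub>V x) x) - 2 * t * n + t * t * Re (cinner (A *\<^sub>V A *\<^sub>V x) (A *\<^sub>V x))" .
  have "Re (cinner (A *\<^sub>V A *\<^sub>V x) (A *\<^sub>V x)) \<le> norm A * n"
  proof -
    have "Re (cinner (A *\<^sub>V A *\<^sub>V x) (A *\<^sub>V x)) \<le> norm (A *\<^sub>V A *\<^sub>V x) * norm (A *\<^sub>V x)"
      using complex_Re_le_cmod norm_cinner_le order_trans by blast
    also have "\<dots> \<le> (norm A * norm (A *\<^sub>V x)) * norm (A *\<^sub>V x)"
      by (intro mult_right_mono cop_norm_bound) auto
    finally show ?thesis
      by (simp add: n_def power2_eq_square mult.assoc)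
  qed
  then have "t * t * Re (cinner (A *\<^sub>V A *\<^sub>V x) (A *\<^sub>V x)) \<le> t * t * (norm A * n)"
    by (intro mult_left_mono) auto
  also have "t * t * (norm A * n) = t * n"
    using nA by (simp add: t_def)
  finally have "t * n \<le> Re (cinner (A *\<^sub>V x) x)"
    using q by linarith
  then show ?thesis
    using nA by (simp add: t_def n_def field_simps)
qed simp

primrec cop_power :: "'a :: complex_inner cop \<Rightarrow> nat \<Rightarrow> 'a cop" where
  "cop_power A 0 = id_cop"
| "cop_power A (Suc n) = A o\<^sub>C cop_power A n"

lemma cop_power_add: "cop_power A m o\<^sub>C cop_power A n = cop_power A (m + n)"
  by (induction m) (auto simp: cop_comp_assoc)

lemma id_cop_norm_le: "norm (id_cop :: 'a :: complex_inner cop) \<le> 1"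
  by (rule cop_norm_leI) auto

lemma cop_power_norm_le: "norm A \<le> 1 \<Longrightarrow> norm (cop_power A n) \<le> 1"
proof (induction n)
  case (Suc n)
  have "norm (cop_power A (Suc n)) \<le> norm A * norm (cop_power A n)"
    by (simp add: cop_comp_norm)
  also have "\<dots> \<le> 1"
    using Suc by (intro mult_le_one) auto
  finally show ?case .
qed (simp add: id_cop_norm_le)

lemma cop_power_commute:
  assumes "A o\<^sub>C B = B o\<^sub>C A"
  shows "cop_power A n o\<^sub>C B = B o\<^sub>C cop_power A n"
proof (induction n)
  case (Suc n)
  then show ?case
    using assms by (simp add: cop_comp_assoc) (simp add: cop_comp_assoc[symmetric])
qed simp

section \<open>The binomial series of (1 - z)^(1/2) and positive square roots\<close>

definition sqrt_coeff :: "nat \<Rightarrow> real"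
  where "sqrt_coeff k = (-1) ^ k * ((1/2) gchoose k)"

lemma sqrt_coeff_0: "sqrt_coeff 0 = 1"
  by (simp add: sqrt_coeff_def)

lemma sqrt_coeff_Suc: "real (Suc k) * sqrt_coeff (Suc k) = (real k - 1/2) * sqrt_coeff k"
proof -
  have "real (Suc k) * ((1/2) gchoose Suc k) = (1/2 - real k) * ((1/2 :: real) gchoose k)"
    using gbinomial_mult_1[of "1/2 :: real" k] by (simp add: algebra_simps)
  then have "(-1) ^ Suc k * (real (Suc k) * ((1/2) gchoose Suc k))
      = (-1) ^ Suc k * ((1/2 - real k) * ((1/2 :: real) gchoose k))"
    by (rule arg_cong)
  then show ?thesis
    unfolding sqrt_coeff_def power_Suc by (simp only: mult_ac minus_mult_minus mult_minus_left mult_minus_right minus_diff_eq mult_1 mult_1_right algebra_simps)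
qed

lemma sqrt_coeff_nonpos: "k > 0 \<Longrightarrow> sqrt_coeff k \<le> 0"
proof (induction k)
  case (Suc k)
  have "real (Suc k) * sqrt_coeff (Suc k) \<le> 0"
  proof (cases "k = 0")
    case False
    then show ?thesis
      using Suc by (subst sqrt_coeff_Suc) (auto intro: mult_nonneg_nonpos)
  qed (simp add: sqrt_coeff_Suc[of 0, simplified] sqrt_coeff_0)
  then show ?case
    by (simp add: mult_le_0_iff)
qed simp

text \<open>For 0 < x < 1 the full series is the nonnegative number (1 - x)^(1/2) and its tail is
  nonpositive, so the partial sum is nonnegative; then x tends to 1.\<close>

lemma sqrt_coeff_partial_sum: "0 \<le> (\<Sum>n\<le>N. sqrt_coeff n)"
proof -
  have "0 \<le> (\<Sum>n\<le>N. sqrt_coeff n * x ^ n)" if "0 < x" "x < 1" for x :: real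
  proof -
    have sums: "(\<lambda>n. sqrt_coeff n * x ^ n) sums ((1 - x) powr (1/2))"
      using gen_binomial_real[of "- x" "1/2"] that
      by (simp add: sqrt_coeff_def power_minus[of x] mult_ac)
    then have "(1 - x) powr (1/2) = (\<Sum>n. sqrt_coeff n * x ^ n)"
      by (simp add: sums_iff)
    also have "\<dots> = (\<Sum>n. sqrt_coeff (n + Suc N) * x ^ (n + Suc N)) + (\<Sum>n<Suc N. sqrt_coeff n * x ^ n)"
      using sums by (intro suminf_split_initial_segment) (simp add: sums_iff)
    also have "(\<Sum>n. sqrt_coeff (n + Suc N) * x ^ (n + Suc N)) \<le> 0"
    proof -
      have "summable (\<lambda>n. sqrt_coeff (n + Suc N) * x ^ (n + Suc N))"
        using sums by (intro summable_ignore_initial_segment) (simp add: sums_iff)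
      then have "(\<Sum>n. sqrt_coeff (n + Suc N) * x ^ (n + Suc N)) \<le> (\<Sum>n. 0)"
        using that by (intro suminf_le) (auto intro!: mult_nonpos_nonneg sqrt_coeff_nonpos)
      then show ?thesis by simp
    qed
    finally show ?thesis
      using powr_ge_zero[of "1 - x" "1/2"] unfolding lessThan_Suc_atMost by linarith
  qed
  then have "eventually (\<lambda>x. 0 \<le> (\<Sum>n\<le>N. sqrt_coeff n * x ^ n)) (at_left (1 :: real))"
    using eventually_at_left_real[of 0 1] by (auto elim: eventually_mono)
  moreover have "((\<lambda>x. \<Sum>n\<le>N. sqrt_coeff n * x ^ n) \<longlongrightarrow> (\<Sum>n\<le>N. sqrt_coeff n * 1 ^ n)) (at_left (1 :: real))"
    by (intro tendsto_intros)
  ultimately show ?thesis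
    using tendsto_lowerbound[of _ _ "at_left (1 :: real)" 0] by auto
qed

text \<open>Only the coefficient 1 at index 0 is positive, so a partial sum of absolute values is 2
  minus the partial sum of the coefficients.\<close>

lemma summable_abs_sqrt_coeff: "summable (\<lambda>n. \<bar>sqrt_coeff n\<bar>)"
proof (rule bounded_imp_summable[of _ 2])
  fix N
  have "(\<Sum>n\<le>N. \<bar>sqrt_coeff n\<bar>) = \<bar>sqrt_coeff 0\<bar> + (\<Sum>n=1..N. \<bar>sqrt_coeff n\<bar>)"
    by (simp add: sum.atLeast_Suc_atMost atMost_atLeast0)
  also have "(\<Sum>n=1..N. \<bar>sqrt_coeff n\<bar>) = - (\<Sum>n=1..N. sqrt_coeff n)"
    unfolding sum_negf[symmetric] by (intro sum.cong) (auto simp: sqrt_coeff_nonpos)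
  also have "(\<Sum>n=1..N. sqrt_coeff n) = (\<Sum>n\<le>N. sqrt_coeff n) - sqrt_coeff 0"
    by (simp add: sum.atLeast_Suc_atMost atMost_atLeast0)
  finally show "(\<Sum>n\<le>N. \<bar>sqrt_coeff n\<bar>) \<le> 2"
    using sqrt_coeff_partial_sum[of N] by (simp add: sqrt_coeff_0)
qed simp

text \<open>Vandermonde convolution for 1/2 + 1/2 = 1: the square of the series is 1 - z.\<close>

lemma sqrt_coeff_convolution:
  "(\<Sum>i\<le>k. sqrt_coeff i * sqrt_coeff (k - i)) = (if k = 0 then 1 else if k = 1 then -1 else 0)"
proof -
  have "(\<Sum>i\<le>k. sqrt_coeff i * sqrt_coeff (k - i))
      = (-1) ^ k * (\<Sum>i\<le>k. ((1/2) gchoose i) * ((1/2) gchoose (k - i)))"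
    unfolding sum_distrib_left
  proof (rule sum.cong)
    fix i assume "i \<in> {..k}"
    then have "(-1 :: real) ^ k = (-1) ^ i * (-1) ^ (k - i)"
      by (simp add: power_add[symmetric])
    then show "sqrt_coeff i * sqrt_coeff (k - i) = (-1) ^ k * (((1/2) gchoose i) * ((1/2) gchoose (k - i)))"
      by (simp only: sqrt_coeff_def mult_ac)
  qed simp
  also have "(\<Sum>i\<le>k. ((1/2 :: real) gchoose i) * ((1/2) gchoose (k - i))) = (1/2 + 1/2) gchoose k"
    by (simp only: gbinomial_Vandermonde atMost_atLeast0)
  also have "(1/2 + 1/2 :: real) gchoose k = of_nat (1 choose k)"
    by (simp add: binomial_gbinomial)
  also have "1 choose k = (if k \<le> 1 then 1 else 0)"
    by (cases k rule: nat.exhaust) auto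
  finally show ?thesis
    by auto
qed

lemma sum_square_eq_triangle:
  fixes f :: "nat \<Rightarrow> nat \<Rightarrow> 'a :: comm_monoid_add"
  shows "(\<Sum>k\<le>N. \<Sum>i\<le>k. f i (k - i)) = (\<Sum>(i, j) | i \<le> N \<and> j \<le> N \<and> i + j \<le> N. f i j)"
proof -
  have "(\<Sum>k\<le>N. \<Sum>i\<le>k. f i (k - i)) = (\<Sum>(k, i)\<in>(SIGMA k:{..N}. {..k}). f i (k - i))"
    by (simp add: sum.Sigma)
  also have "\<dots> = (\<Sum>(i, j) | i \<le> N \<and> j \<le> N \<and> i + j \<le> N. f i j)"
    by (rule sum.reindex_bij_witness[of _ "\<lambda>(i, j). (i + j, i)" "\<lambda>(k, i). (i, k - i)"]) auto
  finally show ?thesis .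
qed

text \<open>The binomial series in \<open>Z\<close> converges absolutely, and everything is read off
  its partial sums. The commutation clause is kept because uniqueness of the root rests on
  it.\<close>

lemma sqrt_one_minus_exists:
  fixes Z :: "'a :: chilbert_space cop"
  assumes Z: "norm Z \<le> 1" and sa: "\<And>x y. cinner (Z *\<^sub>V x) y = cinner x (Z *\<^sub>V y)"
  obtains B where "cop_pos B" "B o\<^sub>C B = id_cop - Z" "\<And>C. C o\<^sub>C Z = Z o\<^sub>C C \<Longrightarrow> C o\<^sub>C B = B o\<^sub>C C"
proof -
  define S where "S = (\<lambda>N. \<Sum>n\<le>N. sqrt_coeff n *\<^sub>R cop_power Z n)"
  have norm_term: "norm (c *\<^sub>R cop_power Z n) \<le> \<bar>c\<bar>" for c n
    using cop_power_norm_le[OF Z, of n] by (simp add: mult_left_le)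
  have "summable (\<lambda>n. sqrt_coeff n *\<^sub>R cop_power Z n)"
    using summable_abs_sqrt_coeff norm_term by (rule summable_comparison_test'[where N = 0])
  then obtain B where B: "S \<longlonglongrightarrow> B"
    unfolding S_def using summable_LIMSEQ' by blast
  have SS: "(\<lambda>N. S N o\<^sub>C S N) \<longlonglongrightarrow> B o\<^sub>C B"
    using B by (intro cop_comp.tendsto)
  define a where "a = (\<lambda>n. \<bar>sqrt_coeff n\<bar>)"
  let ?Q = "\<lambda>N :: nat. {..N} \<times> {..N}"
  let ?T = "\<lambda>N :: nat. {(i, j). i \<le> N \<and> j \<le> N \<and> i + j \<le> N}"
  have T_sub: "?T N \<subseteq> ?Q N" for N by auto
  have fin: "finite (?Q N)" for N by simp
  have tri: "(\<Sum>k\<le>N. \<Sum>i\<le>k. (sqrt_coeff i * sqrt_coeff (k - i)) *\<^sub>R cop_power Z k) = id_cop - Z"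
    if "N \<ge> 1" for N
  proof -
    have "(\<Sum>k\<le>N. \<Sum>i\<le>k. (sqrt_coeff i * sqrt_coeff (k - i)) *\<^sub>R cop_power Z k)
        = (\<Sum>k\<le>N. (if k = 0 then 1 else if k = 1 then -1 else 0) *\<^sub>R cop_power Z k)"
      by (simp only: scaleR_left.sum[symmetric] sqrt_coeff_convolution)
    also have "\<dots> = (\<Sum>k\<in>{0, 1}. (if k = 0 then 1 else if k = 1 then -1 else 0) *\<^sub>R cop_power Z k)"
      using that by (intro sum.mono_neutral_right) auto
    also have "\<dots> = id_cop - Z"
      by simp
    finally show ?thesis .
  qed
  \<comment> \<open>The product of partial sums runs over a square of indices, the Cauchy product
    over a triangle. The terms in between are majorized by the same difference for the absolute
    coefficients, which tends to 0 by the product theorem for absolutely convergent series.\<close>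
  have diff: "norm (S N o\<^sub>C S N - (id_cop - Z)) \<le> (\<Sum>i\<le>N. a i) * (\<Sum>i\<le>N. a i) - (\<Sum>k\<le>N. \<Sum>i\<le>k. a i * a (k - i))"
    if "N \<ge> 1" for N
  proof -
    define g where "g = (\<lambda>p. a (fst p) * a (snd p))"
    let ?f = "\<lambda>(i, j). (sqrt_coeff i * sqrt_coeff j) *\<^sub>R cop_power Z (i + j)"
    have "S N o\<^sub>C S N = (\<Sum>p\<in>?Q N. ?f p)"
      unfolding S_def cop_comp.sum_left cop_comp.sum_right sum.cartesian_product
      by (intro sum.cong) (auto simp: cop_comp.scaleR_left cop_comp.scaleR_right cop_power_add mult.commute add.commute)
    moreover have "id_cop - Z = (\<Sum>p\<in>?T N. ?f p)"
      unfolding tri[OF that, symmetric]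
      using sum_square_eq_triangle[of "\<lambda>i j. (sqrt_coeff i * sqrt_coeff j) *\<^sub>R cop_power Z (i + j)" N]
      by simp
    ultimately have 1: "S N o\<^sub>C S N - (id_cop - Z) = (\<Sum>p\<in>?Q N - ?T N. ?f p)"
      using sum_diff[OF fin T_sub, of ?f] by simp
    have 2: "norm (\<Sum>p\<in>?Q N - ?T N. ?f p) \<le> sum g (?Q N - ?T N)"
    proof (rule sum_norm_le)
      fix p
      show "norm (?f p) \<le> g p"
        using norm_term[of "sqrt_coeff (fst p) * sqrt_coeff (snd p)" "fst p + snd p"]
        unfolding case_prod_beta a_def g_def abs_mult by simp
    qed
    have 3: "sum g (?Q N - ?T N) = sum g (?Q N) - sum g (?T N)"
      by (rule sum_diff[OF fin T_sub])
    have 4: "sum g (?Q N) = (\<Sum>i\<le>N. a i) * (\<Sum>i\<le>N. a i)"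
      unfolding sum_product sum.cartesian_product by (simp add: g_def case_prod_beta)
    have 5: "sum g (?T N) = (\<Sum>k\<le>N. \<Sum>i\<le>k. a i * a (k - i))"
      unfolding sum_square_eq_triangle[of "\<lambda>i j. a i * a j"] by (simp add: g_def case_prod_beta)
    show ?thesis
      unfolding 1 using 2 unfolding 3 4 5 .
  qed
  have a_sum: "summable (\<lambda>n. norm (a n))"
    using summable_abs_sqrt_coeff by (simp add: a_def)
  have lim1: "(\<lambda>N. \<Sum>i\<le>N. a i) \<longlonglongrightarrow> suminf a"
    using a_sum by (intro summable_LIMSEQ') (simp add: a_def)
  have lim2: "(\<lambda>N. \<Sum>k\<le>N. \<Sum>i\<le>k. a i * a (k - i)) \<longlonglongrightarrow> suminf a * suminf a"
    using Cauchy_product_sums[OF a_sum a_sum] by (simp add: sums_def_le)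
  define e where "e = (\<lambda>N. (\<Sum>i\<le>N. a i) * (\<Sum>i\<le>N. a i) - (\<Sum>k\<le>N. \<Sum>i\<le>k. a i * a (k - i)))"
  have "e \<longlonglongrightarrow> suminf a * suminf a - suminf a * suminf a"
    unfolding e_def by (intro tendsto_diff tendsto_mult lim1 lim2)
  then have e0: "e \<longlonglongrightarrow> 0"
    by simp
  have "\<forall>\<^sub>F N in sequentially. norm (S N o\<^sub>C S N - (id_cop - Z)) \<le> e N"
    unfolding e_def by (rule eventually_sequentiallyI[of 1]) (rule diff)
  then have "(\<lambda>N. S N o\<^sub>C S N - (id_cop - Z)) \<longlonglongrightarrow> 0"
    by (rule Lim_null_comparison) (rule e0)
  then have "(\<lambda>N. S N o\<^sub>C S N) \<longlonglongrightarrow> id_cop - Z"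
    by (simp add: LIM_zero_iff)
  then have sq: "B o\<^sub>C B = id_cop - Z"
    by (rule LIMSEQ_unique[OF SS])
  have comm: "C o\<^sub>C B = B o\<^sub>C C" if "C o\<^sub>C Z = Z o\<^sub>C C" for C
  proof -
    have "C o\<^sub>C S N = S N o\<^sub>C C" for N
      using cop_power_commute[of Z C] that
      by (simp add: S_def cop_comp.sum_left cop_comp.sum_right cop_comp.scaleR_left cop_comp.scaleR_right)
    moreover have "(\<lambda>N. C o\<^sub>C S N) \<longlonglongrightarrow> C o\<^sub>C B" "(\<lambda>N. S N o\<^sub>C C) \<longlonglongrightarrow> B o\<^sub>C C"
      by (intro cop_comp.tendsto tendsto_const B)+
    ultimately show ?thesis
      using LIMSEQ_unique[of "\<lambda>N. C o\<^sub>C S N" "C o\<^sub>C B" "B o\<^sub>C C"] by simp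
  qed
  have sa_pow: "cinner (cop_power Z n *\<^sub>V x) y = cinner x (cop_power Z n *\<^sub>V y)" for n x y
  proof (induction n arbitrary: x y)
    case (Suc n)
    have "cinner (cop_power Z (Suc n) *\<^sub>V x) y = cinner x (cop_power Z n *\<^sub>V Z *\<^sub>V y)"
      by (simp add: sa Suc)
    also have "cop_power Z n *\<^sub>V Z *\<^sub>V y = cop_power Z (Suc n) *\<^sub>V y"
      using arg_cong[OF cop_power_commute[of Z Z n], of "\<lambda>A. A *\<^sub>V y"] by simp
    finally show ?case .
  qed simp
  have Im0: "Im (cinner (cop_power Z n *\<^sub>V x) x) = 0" for n x
    using sa_pow[of n x x] cinner_commute[of x "cop_power Z n *\<^sub>V x"] by (simp add: complex_eq_iff)
  have quad: "(\<lambda>N. cinner (S N *\<^sub>V x) x) \<longlonglongrightarrow> cinner (B *\<^sub>V x) x" for x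
    by (intro cinner.tendsto bounded_linear.tendsto[OF bounded_linear_cop_apply] B tendsto_const)
  have S_quad: "cinner (S N *\<^sub>V x) x = (\<Sum>n\<le>N. complex_of_real (sqrt_coeff n) * cinner (cop_power Z n *\<^sub>V x) x)" for N x
    by (simp add: S_def cop_sum_apply cinner.sum_left cinner_scaleR_left)
  have "Im (cinner (B *\<^sub>V x) x) = 0" for x
    using LIMSEQ_unique[OF tendsto_Im[OF quad[of x]], of 0] by (simp add: S_quad Im0)
  moreover have "0 \<le> Re (cinner (B *\<^sub>V x) x)" for x
  proof -
    have le: "Re (cinner (cop_power Z n *\<^sub>V x) x) \<le> (norm x)\<^sup>2" for n
    proof -
      have "Re (cinner (cop_power Z n *\<^sub>V x) x) \<le> norm (cop_power Z n *\<^sub>V x) * norm x"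
        using complex_Re_le_cmod norm_cinner_le order_trans by blast
      also have "\<dots> \<le> (1 * norm x) * norm x"
        using cop_power_norm_le[OF Z, of n]
        by (intro mult_right_mono order_trans[OF cop_norm_bound]) auto
      finally show ?thesis by (simp add: power2_eq_square)
    qed
    \<comment> \<open>The coefficients after the first are nonpositive, so replacing each form by
      its upper bound (norm x)^2 only lowers the sum, which then is a partial coefficient sum times
      (norm x)^2.\<close>
    have "0 \<le> Re (cinner (S N *\<^sub>V x) x)" for N
    proof -
      have "0 \<le> (\<Sum>n\<le>N. sqrt_coeff n) * (norm x)\<^sup>2"
        by (intro mult_nonneg_nonneg sqrt_coeff_partial_sum) auto
      also have "\<dots> \<le> (\<Sum>n\<le>N. sqrt_coeff n * Re (cinner (cop_power Z n *\<^sub>V x) x))"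
        unfolding sum_distrib_right
      proof (rule sum_mono)
        fix n
        show "sqrt_coeff n * (norm x)\<^sup>2 \<le> sqrt_coeff n * Re (cinner (cop_power Z n *\<^sub>V x) x)"
        proof (cases "n = 0")
          case True
          then show ?thesis by (simp add: Re_cinner_self)
        next
          case False
          then show ?thesis using le[of n] sqrt_coeff_nonpos[of n] by (intro mult_left_mono_neg) auto
        qed
      qed
      finally show ?thesis by (simp add: S_quad)
    qed
    then show ?thesis
      using tendsto_Re[OF quad[of x]] by (auto intro: LIMSEQ_le_const)
  qed
  ultimately have "cop_pos B"
    by (simp add: cop_pos_def)
  then show ?thesis
    using sq comm that by blast
qed

text \<open>Z = 1 - A / norm A is a contraction because A^2 <= norm A * A, and a root of 1 - Z
  rescales to a root of \<open>A\<close>.\<close>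

lemma cop_pos_sqrt_exists:
  fixes A :: "'a :: chilbert_space cop"
  assumes A: "cop_pos A"
  obtains B where "cop_pos B" "B o\<^sub>C B = A" "\<And>C. C o\<^sub>C A = A o\<^sub>C C \<Longrightarrow> C o\<^sub>C B = B o\<^sub>C C"
proof (cases "A = 0")
  case True
  then show ?thesis
    by (intro that[of 0]) (auto simp: cop_pos_def cop_comp.zero_left cop_comp.zero_right)
next
  case False
  define a where "a = norm A"
  have a: "a > 0" using False by (simp add: a_def)
  define Z where "Z = id_cop - (1 / a) *\<^sub>R A"
  have sa: "cinner (Z *\<^sub>V x) y = cinner x (Z *\<^sub>V y)" for x y
    by (simp add: Z_def cinner_diff_left cinner_diff_right cinner_scaleR_left cinner_scaleR_right
        cop_pos_selfadjoint[OF A])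
  have Z: "norm Z \<le> 1"
  proof (rule cop_norm_leI)
    fix x
    define u where "u = (1 / a) *\<^sub>R (A *\<^sub>V x)"
    have "(norm u)\<^sup>2 \<le> Re (cinner u x)"
      using cop_pos_norm_sq_le[OF A, of x] a
      by (simp add: u_def power_mult_distrib cinner_scaleR_left a_def[symmetric] divide_simps power2_eq_square mult.commute)
    moreover have "0 \<le> Re (cinner u x)"
      using cop_pos_Re[OF A, of x] a by (simp add: u_def cinner_scaleR_left)
    moreover have "(norm (x - u))\<^sup>2 = (norm x)\<^sup>2 - 2 * Re (cinner u x) + (norm u)\<^sup>2"
      by (simp add: power2_norm_eq_inner inner_diff_left inner_diff_right inner_eq_Re_cinner[symmetric] inner_commute)
    ultimately have "(norm (x - u))\<^sup>2 \<le> (norm x)\<^sup>2"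
      by linarith
    then have "norm (x - u) \<le> norm x"
      by (rule power2_le_imp_le) simp
    then show "norm (Z *\<^sub>V x) \<le> 1 * norm x"
      by (simp add: Z_def u_def)
  qed simp
  obtain B where B: "cop_pos B" "B o\<^sub>C B = id_cop - Z" "\<And>C. C o\<^sub>C Z = Z o\<^sub>C C \<Longrightarrow> C o\<^sub>C B = B o\<^sub>C C"
    using sqrt_one_minus_exists[OF Z sa] by blast
  show ?thesis
  proof (rule that[of "sqrt a *\<^sub>R B"])
    show "cop_pos (sqrt a *\<^sub>R B)"
      using B(1) a by (simp add: cop_pos_def cinner_scaleR_left)
    show "sqrt a *\<^sub>R B o\<^sub>C sqrt a *\<^sub>R B = A"
      using B(2) a by (simp add: cop_comp.scaleR_left cop_comp.scaleR_right Z_def)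
    fix C assume "C o\<^sub>C A = A o\<^sub>C C"
    then have "C o\<^sub>C Z = Z o\<^sub>C C"
      by (simp add: Z_def cop_comp.diff_left cop_comp.diff_right cop_comp.scaleR_left cop_comp.scaleR_right)
    then show "C o\<^sub>C sqrt a *\<^sub>R B = sqrt a *\<^sub>R B o\<^sub>C C"
      using B(3) by (simp add: cop_comp.scaleR_left cop_comp.scaleR_right)
  qed
qed

text \<open>With D = B - C one has (B + C) D = 0. The two nonnegative forms at D x add up to 0, so B
  D x = C D x = 0, hence D D = 0, and D is self-adjoint.\<close>

lemma cop_pos_sqrt_unique:
  fixes B C :: "'a :: chilbert_space cop"
  assumes B: "cop_pos B" and C: "cop_pos C" and eq: "B o\<^sub>C B = C o\<^sub>C C" and comm: "B o\<^sub>C C = C o\<^sub>C B"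
  shows "B = C"
proof -
  define D where "D = B - C"
  have D_sa: "cinner (D *\<^sub>V x) y = cinner x (D *\<^sub>V y)" for x y
    by (simp add: D_def cinner_diff_left cinner_diff_right cop_pos_selfadjoint[OF B] cop_pos_selfadjoint[OF C])
  have BD: "(B + C) o\<^sub>C D = 0"
    by (simp add: D_def cop_comp.diff_right cop_comp.add_left eq comm)
  have "Re (cinner (B *\<^sub>V D *\<^sub>V x) (D *\<^sub>V x)) = 0 \<and> Re (cinner (C *\<^sub>V D *\<^sub>V x) (D *\<^sub>V x)) = 0" for x
  proof -
    have "B *\<^sub>V D *\<^sub>V x + C *\<^sub>V D *\<^sub>V x = 0"
      using arg_cong[OF BD, of "\<lambda>A. A *\<^sub>V x"] by simp
    then have "Re (cinner (B *\<^sub>V D *\<^sub>V x) (D *\<^sub>V x)) + Re (cinner (C *\<^sub>V D *\<^sub>V x) (D *\<^sub>V x)) = 0"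
      by (metis cinner_add_left cinner_zero_left plus_complex.sel(1) zero_complex.sel(1))
    then show ?thesis
      using cop_pos_Re[OF B, of "D *\<^sub>V x"] cop_pos_Re[OF C, of "D *\<^sub>V x"] by linarith
  qed
  then have "(norm (B *\<^sub>V D *\<^sub>V x))\<^sup>2 \<le> 0" "(norm (C *\<^sub>V D *\<^sub>V x))\<^sup>2 \<le> 0" for x
    using cop_pos_norm_sq_le[OF B, of "D *\<^sub>V x"] cop_pos_norm_sq_le[OF C, of "D *\<^sub>V x"] by simp_all
  then have "D *\<^sub>V D *\<^sub>V x = 0" for x
    by (simp add: D_def)
  then have "cinner (D *\<^sub>V x) (D *\<^sub>V x) = 0" for x
    by (simp add: D_sa)
  then have "D *\<^sub>V x = 0" for x
    by (simp add: cinner_norm_sq)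
  then show ?thesis
    by (intro cblinfun_eqI) (simp add: D_def)
qed

text \<open>Any positive root commutes with its own square \<open>A\<close>, hence with the
  constructed root, so the two agree and the definite description has a value.\<close>

lemma cop_sqrt_pos: "cop_pos A \<Longrightarrow> cop_pos (cop_sqrt A)"
  and cop_sqrt_square: "cop_pos A \<Longrightarrow> cop_sqrt A o\<^sub>C cop_sqrt A = A"
proof -
  assume A: "cop_pos A"
  obtain B where B: "cop_pos B" "B o\<^sub>C B = A" "\<And>C. C o\<^sub>C A = A o\<^sub>C C \<Longrightarrow> C o\<^sub>C B = B o\<^sub>C C"
    using cop_pos_sqrt_exists[OF A] by blast
  have unique: "C = B" if C: "cop_pos C" "C o\<^sub>C C = A" for C
  proof (rule cop_pos_sqrt_unique)
    show "C o\<^sub>C B = B o\<^sub>C C"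
      unfolding C(2)[symmetric] by (rule B(3)) (simp only: C(2)[symmetric] cop_comp_assoc)
    show "C o\<^sub>C C = B o\<^sub>C B"
      using C(2) B(2) by simp
  qed (rule C(1) B(1))+
  have "cop_sqrt A = B"
    unfolding cop_sqrt_def
  proof (rule the_equality)
    show "cop_pos B \<and> B o\<^sub>C B = A"
      using B(1,2) by simp
  qed (simp add: unique)
  then show "cop_pos (cop_sqrt A)" "cop_sqrt A o\<^sub>C cop_sqrt A = A"
    using B(1,2) by simp_all
qed

section \<open>Square-summable families and amplification\<close>

instance chilbert_space \<subseteq> banach ..

lemma l2_eqI: "(\<And>i. l2_nth f i = l2_nth g i) \<Longrightarrow> f = g"
  by (metis ext l2_nth_inject)

lemmas l2_nth_simps [simp] = plus_l2.rep_eq minus_l2.rep_eq zero_l2.rep_eq uminus_l2.rep_eq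
  scaleC_l2.rep_eq scaleR_l2.rep_eq l2_tensor.rep_eq

lemma l2_nth_sum: "l2_nth (\<Sum>k\<in>F. f k) i = (\<Sum>k\<in>F. l2_nth (f k) i)"
  by (induction F rule: infinite_finite_induct) auto

lemma bounded_linear_l2_nth: "bounded_linear (\<lambda>f. l2_nth f i)"
  by (rule bounded_linear_intro[where K = 1]) (auto simp: norm_l2_nth_le)

lemma l2_from_bound:
  fixes f :: "'i \<Rightarrow> 'h :: complex_inner"
  assumes "\<And>F. finite F \<Longrightarrow> (\<Sum>i\<in>F. (norm (f i))\<^sup>2) \<le> c\<^sup>2" "0 \<le> c"
  obtains g where "l2_nth g = f" "norm g \<le> c"
proof -
  have sm: "(\<lambda>i. (norm (f i))\<^sup>2) summable_on UNIV"
    by (rule nonneg_bdd_above_summable_on) (use assms(1) in \<open>auto intro!: bdd_aboveI[of _ "c\<^sup>2"]\<close>)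
  then have g: "l2_nth (Abs_l2 f) = f"
    by (simp add: Abs_l2_inverse)
  have "(norm (Abs_l2 f))\<^sup>2 \<le> c\<^sup>2"
    unfolding norm_l2_sq g by (rule infsum_le_finite_sums[OF sm]) (rule assms(1))
  then have "norm (Abs_l2 f) \<le> c"
    using assms(2) by (rule power2_le_imp_le)
  then show ?thesis
    using that g by blast
qed

text \<open>The elementary tensor of a basis vector with \<open>h\<close>; such vectors play the
  role of a basis when the coordinates lie in a Hilbert space.\<close>

lift_definition l2_single :: "'i \<Rightarrow> 'h :: complex_inner \<Rightarrow> ('i, 'h) l2" is "\<lambda>i h j. if j = i then h else 0"
proof -
  fix i :: 'i and h :: 'h
  show "(\<lambda>j. (norm (if j = i then h else 0))\<^sup>2) summable_on UNIV"
    by (rule finite_nonzero_values_imp_summable_on) (auto intro: finite_subset[of _ "{i}"])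
qed

lemma l2_single_zero [simp]: "l2_single i 0 = 0"
  by (rule l2_eqI) (simp add: l2_single.rep_eq)

lemma fock_basis_single: "fock_basis \<alpha> = l2_single \<alpha> 1"
  by (rule l2_eqI) (simp add: l2_single.rep_eq fock_basis.rep_eq)

lemma l2_single_tensor: "l2_single i c \<otimes>\<^sub>l h = l2_single i (c *\<^sub>C h)"
  by (rule l2_eqI) (simp add: l2_single.rep_eq)

lemma l2_single_one_tensor: "l2_single i 1 \<otimes>\<^sub>l h = l2_single i h"
  by (simp add: l2_single_tensor scaleC_one)

lemma l2_single_one_scaleC: "c *\<^sub>C l2_single i 1 = l2_single i (c :: complex)"
  by (rule l2_eqI) (simp add: l2_single.rep_eq scaleC_complex_def)

lemma cinner_l2_single_left: "cinner (l2_single i h) f = cinner h (l2_nth f i)"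
proof -
  have "cinner (l2_single i h) f = (\<Sum>\<^sub>\<infinity>j. cinner (if j = i then h else 0) (l2_nth f j))"
    by (simp add: cinner_l2.rep_eq l2_single.rep_eq)
  also have "\<dots> = (\<Sum>\<^sub>\<infinity>j\<in>{i}. cinner (if j = i then h else 0) (l2_nth f j))"
    by (rule infsum_cong_neutral) auto
  finally show ?thesis by simp
qed

lemma cinner_l2_single_right: "cinner f (l2_single i h) = cinner (l2_nth f i) h"
  using cinner_l2_single_left[of i h f] by (metis cinner_commute)

lemma norm_l2_single [simp]: "norm (l2_single i h) = norm h"
proof -
  have "complex_of_real ((norm (l2_single i h))\<^sup>2) = complex_of_real ((norm h)\<^sup>2)"
    unfolding cinner_norm_sq[symmetric] cinner_l2_single_left by (simp add: l2_single.rep_eq)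
  then have "(norm (l2_single i h))\<^sup>2 = (norm h)\<^sup>2"
    using of_real_eq_iff by blast
  then show ?thesis by simp
qed

lemma norm_sq_sum_orthogonal:
  fixes v :: "'i \<Rightarrow> 'a :: complex_inner"
  assumes "finite F" "\<And>i j. i \<in> F \<Longrightarrow> j \<in> F \<Longrightarrow> i \<noteq> j \<Longrightarrow> cinner (v i) (v j) = 0"
  shows "(norm (\<Sum>i\<in>F. v i))\<^sup>2 = (\<Sum>i\<in>F. (norm (v i))\<^sup>2)"
  using assms
proof (induction F rule: finite_induct)
  case (insert i F)
  have "cinner (v i) (\<Sum>j\<in>F. v j) = 0"
    unfolding cinner.sum_right by (rule sum.neutral) (use insert in auto)
  then have "inner (v i) (\<Sum>j\<in>F. v j) = 0"
    by (simp add: inner_eq_Re_cinner)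
  then have "(norm (v i + (\<Sum>j\<in>F. v j)))\<^sup>2 = (norm (v i))\<^sup>2 + (norm (\<Sum>j\<in>F. v j))\<^sup>2"
    by (simp add: power2_norm_eq_inner inner_add_left inner_add_right inner_commute)
  then show ?case
    using insert by simp
qed simp

lemma norm_sq_sum_l2_single:
  "finite F \<Longrightarrow> (norm (\<Sum>i\<in>F. l2_single i (g i)))\<^sup>2 = (\<Sum>i\<in>F. (norm (g i))\<^sup>2)"
  by (subst norm_sq_sum_orthogonal) (auto simp: cinner_l2_single_left l2_single.rep_eq)

text \<open>By Pythagoras the squared error of a finite partial sum is (norm f)^2 minus the squared
  coordinates already taken.\<close>

lemma l2_has_sum: "((\<lambda>i. l2_single i (l2_nth f i)) has_sum f) UNIV"
proof -
  have eq: "(norm (f - (\<Sum>i\<in>F. l2_single i (l2_nth f i))))\<^sup>2 = (norm f)\<^sup>2 - (\<Sum>i\<in>F. (norm (l2_nth f i))\<^sup>2)"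
    if "finite F" for F
  proof -
    let ?s = "\<Sum>i\<in>F. l2_single i (l2_nth f i)"
    have "inner f ?s = (\<Sum>i\<in>F. (norm (l2_nth f i))\<^sup>2)"
      by (simp add: inner_eq_Re_cinner cinner.sum_right cinner_l2_single_right Re_cinner_self)
    then show ?thesis
      using norm_sq_sum_l2_single[OF that, of "l2_nth f"]
      by (simp add: power2_norm_eq_inner inner_diff_left inner_diff_right inner_commute)
  qed
  have "((\<lambda>i. (norm (l2_nth f i))\<^sup>2) has_sum (norm f)\<^sup>2) UNIV"
    unfolding norm_l2_sq by (rule has_sum_infsum) (rule l2_nth_summable)
  then have "((\<lambda>F. (norm f)\<^sup>2 - (\<Sum>i\<in>F. (norm (l2_nth f i))\<^sup>2)) \<longlongrightarrow> (norm f)\<^sup>2 - (norm f)\<^sup>2) (finite_subsets_at_top UNIV)"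
    unfolding has_sum_def by (intro tendsto_diff tendsto_const)
  then have "((\<lambda>F. (norm (f - (\<Sum>i\<in>F. l2_single i (l2_nth f i))))\<^sup>2) \<longlongrightarrow> 0) (finite_subsets_at_top UNIV)"
    by (subst tendsto_cong[OF eventually_finite_subsets_at_top_weakI[OF eq]]) auto
  then have "((\<lambda>F. sqrt ((norm (f - (\<Sum>i\<in>F. l2_single i (l2_nth f i))))\<^sup>2)) \<longlongrightarrow> sqrt 0) (finite_subsets_at_top UNIV)"
    by (rule tendsto_real_sqrt)
  then have "((\<lambda>F. norm ((\<Sum>i\<in>F. l2_single i (l2_nth f i)) - f)) \<longlongrightarrow> 0) (finite_subsets_at_top UNIV)"
    by (simp add: norm_minus_commute)
  then have "((\<lambda>F. (\<Sum>i\<in>F. l2_single i (l2_nth f i)) - f) \<longlongrightarrow> 0) (finite_subsets_at_top UNIV)"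
    by (rule tendsto_norm_zero_cancel)
  then show ?thesis
    unfolding has_sum_def by (rule LIM_zero_cancel)
qed

text \<open>Density of finitely supported families in the form of an induction rule: a closed
  additive property need only be checked on single coordinates. Scalars are absorbed in the
  arbitrary \<open>h\<close>.\<close>

lemma l2_total:
  fixes S :: "('i, 'h :: complex_inner) l2 set"
  assumes "closed S" "0 \<in> S" "\<And>x y. x \<in> S \<Longrightarrow> y \<in> S \<Longrightarrow> x + y \<in> S" "\<And>i h. l2_single i h \<in> S"
  shows "f \<in> S"
proof (rule Lim_in_closed_set[OF assms(1)])
  show "((\<lambda>F. \<Sum>i\<in>F. l2_single i (l2_nth f i)) \<longlongrightarrow> f) (finite_subsets_at_top UNIV)"
    using l2_has_sum unfolding has_sum_def .
  have "(\<Sum>i\<in>F. l2_single i (l2_nth f i)) \<in> S" for F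
    by (induction F rule: infinite_finite_induct) (auto simp: assms)
  then show "\<forall>\<^sub>F F in finite_subsets_at_top UNIV. (\<Sum>i\<in>F. l2_single i (l2_nth f i)) \<in> S"
    by simp
qed (rule finite_subsets_at_top_neq_bot)

lemma cop_eqI_l2_single:
  fixes A B :: "(('i, 'h :: complex_inner) l2, 'b :: complex_inner) cblinfun"
  assumes "\<And>i h. A *\<^sub>V l2_single i h = B *\<^sub>V l2_single i h"
  shows "A = B"
proof (rule cblinfun_eqI)
  fix f
  have "f \<in> {f. A *\<^sub>V f = B *\<^sub>V f}"
  proof (rule l2_total)
    show "closed {f. A *\<^sub>V f = B *\<^sub>V f}"
      by (intro closed_Collect_eq bounded_linear.continuous_on[OF cop_bounded_linear] continuous_on_id)
  qed (auto simp: assms cop_add_right)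
  then show "A *\<^sub>V f = B *\<^sub>V f" by simp
qed

lemma cop_eqI_basis:
  fixes A B :: "(('i, complex) l2, 'b :: complex_inner) cblinfun"
  assumes "\<And>i. A *\<^sub>V l2_single i 1 = B *\<^sub>V l2_single i 1"
  shows "A = B"
proof (rule cop_eqI_l2_single)
  fix i h
  show "A *\<^sub>V l2_single i h = B *\<^sub>V l2_single i h"
    unfolding l2_single_one_scaleC[of h i, symmetric] cop_scaleC_right assms ..
qed

section \<open>Elementary tensors\<close>

lemma cinner_tensor: "cinner (f \<otimes>\<^sub>l u) (g \<otimes>\<^sub>l v) = cinner f g * cinner u v"
proof -
  have "cinner (f \<otimes>\<^sub>l u) (g \<otimes>\<^sub>l v) = (\<Sum>\<^sub>\<infinity>i. cinner (l2_nth f i) (l2_nth g i) * cinner u v)"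
    by (simp add: cinner_l2.rep_eq cinner_scaleC_left cinner_scaleC_right cinner_complex_def mult_ac)
  also have "\<dots> = cinner f g * cinner u v"
    by (simp add: infsum_cmult_left' cinner_l2.rep_eq)
  finally show ?thesis .
qed

lemma norm_tensor: "norm (f \<otimes>\<^sub>l h) = norm f * norm h"
proof -
  have "complex_of_real ((norm (f \<otimes>\<^sub>l h))\<^sup>2) = complex_of_real ((norm f * norm h)\<^sup>2)"
    unfolding cinner_norm_sq[symmetric] cinner_tensor by (simp add: cinner_norm_sq power_mult_distrib)
  then have "(norm (f \<otimes>\<^sub>l h))\<^sup>2 = (norm f * norm h)\<^sup>2"
    using of_real_eq_iff by blast
  then show ?thesis by simp
qed

lemma tensor_add_left: "(f + g) \<otimes>\<^sub>l h = f \<otimes>\<^sub>l h + g \<otimes>\<^sub>l h"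
  by (rule l2_eqI) (simp add: scaleC_add_left)

lemma tensor_add_right: "f \<otimes>\<^sub>l (h + k) = f \<otimes>\<^sub>l h + f \<otimes>\<^sub>l k"
  by (rule l2_eqI) (simp add: scaleC_add_right)

lemma tensor_scaleC_left: "(c *\<^sub>C f) \<otimes>\<^sub>l h = c *\<^sub>C (f \<otimes>\<^sub>l h)"
  by (rule l2_eqI) (simp add: scaleC_scaleC scaleC_complex_def)

lemma tensor_scaleC_right: "f \<otimes>\<^sub>l (c *\<^sub>C h) = c *\<^sub>C (f \<otimes>\<^sub>l h)"
  by (rule l2_eqI) (simp add: scaleC_scaleC mult.commute)

lemma bounded_linear_tensor_left: "bounded_linear (\<lambda>f. f \<otimes>\<^sub>l h)"
  by (rule bounded_linear_intro[where K = "norm h"])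
    (auto simp: tensor_add_left norm_tensor tensor_scaleC_left scaleR_scaleC)

lemma tensor_sum_left: "(\<Sum>k\<in>F. f k) \<otimes>\<^sub>l h = (\<Sum>k\<in>F. f k \<otimes>\<^sub>l h)"
  by (rule bounded_linear.linear[OF bounded_linear_tensor_left, THEN linear_sum])

lemma tensor_zero_right [simp]: "f \<otimes>\<^sub>l 0 = 0"
  by (rule l2_eqI) simp

lemma tensor_zero_left [simp]: "0 \<otimes>\<^sub>l h = 0"
  by (rule l2_eqI) simp

lemma tensor_sum_right: "f \<otimes>\<^sub>l (\<Sum>k\<in>F. h k) = (\<Sum>k\<in>F. f \<otimes>\<^sub>l h k)"
  by (induction F rule: infinite_finite_induct) (auto simp: tensor_add_right)

section \<open>Orthonormal expansions, operator matrices and amplification\<close>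

lemma finite_orthonormal_expansion:
  fixes S :: "'a :: complex_inner set"
  assumes "finite S"
  shows "\<exists>U. finite U \<and> (\<forall>u\<in>U. norm u = 1) \<and> (\<forall>u\<in>U. \<forall>v\<in>U. u \<noteq> v \<longrightarrow> cinner u v = 0) \<and>
    (\<forall>s\<in>S. s = (\<Sum>u\<in>U. cinner s u *\<^sub>C u))"
  using assms
proof (induction S rule: finite_induct)
  case empty
  show ?case by (intro exI[of _ "{}"]) simp
next
  case (insert s S)
  obtain U where fin: "finite U" and nU': "\<forall>u\<in>U. norm u = 1"
    and oU': "\<forall>u\<in>U. \<forall>v\<in>U. u \<noteq> v \<longrightarrow> cinner u v = 0"
    and eU': "\<forall>s\<in>S. s = (\<Sum>u\<in>U. cinner s u *\<^sub>C u)"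
    using insert.IH by (elim exE conjE) (rule that)
  note nU = bspec[OF nU'] and oU = bspec[OF bspec[OF oU'], THEN mp] and eU = bspec[OF eU']
  define p where "p = (\<Sum>u\<in>U. cinner s u *\<^sub>C u)"
  define r where "r = s - p"
  have comb: "cinner (\<Sum>u\<in>U. c u *\<^sub>C u) v = c v" if "v \<in> U" for c v
  proof -
    have "cinner (\<Sum>u\<in>U. c u *\<^sub>C u) v = (\<Sum>u\<in>U. c u * cinner u v)"
      by (simp add: cinner.sum_left cinner_scaleC_left)
    also have "\<dots> = (\<Sum>u\<in>{v}. c u * cinner u v)"
      by (rule sum.mono_neutral_right) (use fin that oU in auto)
    finally show ?thesis
      using nU[OF that] by (simp add: cinner_norm_sq)
  qed
  have r_orth: "cinner r u = 0" if "u \<in> U" for u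
    using comb[OF that, of "cinner s"] by (simp add: r_def p_def cinner_diff_left)
  have r_orth': "cinner u r = 0" if "u \<in> U" for u
    using r_orth[OF that] cinner_commute[of u r] by simp
  show ?case
  proof (cases "r = 0")
    case True
    then show ?thesis
      using fin nU' oU' eU' unfolding r_def p_def
      by (intro exI[of _ U] conjI ballI) (simp_all only: insert_iff right_minus_eq, blast+)
  next
    case False
    \<comment> \<open>Gram-Schmidt: the normalized residual of \<open>s\<close> joins the set, and
      the earlier vectors keep their expansions because they are orthogonal to it.\<close>
    define w where "w = complex_of_real (1 / norm r) *\<^sub>C r"
    have nw: "norm w = 1"
      using False by (simp add: w_def norm_scaleC norm_divide)
    have wu: "cinner w u = 0" "cinner u w = 0" if "u \<in> U" for u
      using r_orth[OF that] r_orth'[OF that] by (simp_all add: w_def cinner_scaleC_left cinner_scaleC_right)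
    have "w \<notin> U"
      using wu(1)[of w] nw by (auto simp: cinner_norm_sq)
    have "cinner t w = 0" if "t \<in> S" for t
    proof -
      have "cinner (\<Sum>u\<in>U. cinner t u *\<^sub>C u) w = 0"
        unfolding cinner.sum_left by (rule sum.neutral) (simp add: cinner_scaleC_left wu)
      then show ?thesis
        using eU[OF that] by simp
    qed
    then have eS: "t = (\<Sum>u\<in>insert w U. cinner t u *\<^sub>C u)" if "t \<in> S" for t
      unfolding sum.insert[OF fin \<open>w \<notin> U\<close>] using that eU[OF that] by simp
    have "cinner p w = 0"
      unfolding p_def cinner.sum_left by (rule sum.neutral) (simp add: cinner_scaleC_left wu)
    then have "cinner s w = cinner r w"
      by (simp add: r_def cinner_diff_left)
    also have "\<dots> = norm r"
      using False by (simp add: w_def cinner_scaleC_right cinner_norm_sq power2_eq_square)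
    finally have "cinner s w *\<^sub>C w = r"
      using False by (simp add: w_def scaleC_scaleC scaleC_one)
    then have es: "s = (\<Sum>u\<in>insert w U. cinner s u *\<^sub>C u)"
      unfolding sum.insert[OF fin \<open>w \<notin> U\<close>] p_def[symmetric] by (simp add: r_def)
    have nI: "\<forall>u\<in>insert w U. norm u = 1"
      using nU nw by simp
    have oI: "\<forall>u\<in>insert w U. \<forall>v\<in>insert w U. u \<noteq> v \<longrightarrow> cinner u v = 0"
      using oU wu by simp
    have eI: "\<forall>t\<in>insert s S. t = (\<Sum>u\<in>insert w U. cinner t u *\<^sub>C u)"
    proof
      fix t assume "t \<in> insert s S"
      then consider "t = s" | "t \<in> S" by blast
      then show "t = (\<Sum>u\<in>insert w U. cinner t u *\<^sub>C u)"
        by cases (use es in \<open>simp only:\<close>, rule eS)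
    qed
    show ?thesis
      by (intro exI[of _ "insert w U"] conjI nI oI eI finite.insertI fin)
  qed
qed

text \<open>The bound of an operator matrix as an inequality rather than a supremum, for operators
  between possibly different spaces; in this form it passes directly to limits and
  compressions.\<close>

definition mat_bound :: "nat \<Rightarrow> (nat \<Rightarrow> nat \<Rightarrow> ('a :: complex_inner, 'b :: complex_inner) cblinfun) \<Rightarrow> real \<Rightarrow> bool"
  where "mat_bound m A c \<longleftrightarrow> 0 \<le> c \<and>
    (\<forall>x. (\<Sum>i<m. (norm (\<Sum>j<m. A i j *\<^sub>V x j))\<^sup>2) \<le> c\<^sup>2 * (\<Sum>j<m. (norm (x j))\<^sup>2))"

lemma mat_boundD:
  "mat_bound m A c \<Longrightarrow> (\<Sum>i<m. (norm (\<Sum>j<m. A i j *\<^sub>V x j))\<^sup>2) \<le> c\<^sup>2 * (\<Sum>j<m. (norm (x j))\<^sup>2)"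
  by (simp add: mat_bound_def)

lemma mat_bound_one_iff: "mat_bound 1 (\<lambda>_ _. A) c \<longleftrightarrow> 0 \<le> c \<and> norm A \<le> c"
proof
  assume m: "mat_bound 1 (\<lambda>_ _. A) c"
  then have c: "0 \<le> c" by (simp add: mat_bound_def)
  have "norm (A *\<^sub>V x) \<le> c * norm x" for x
  proof (rule power2_le_imp_le)
    show "(norm (A *\<^sub>V x))\<^sup>2 \<le> (c * norm x)\<^sup>2"
      using mat_boundD[OF m, of "\<lambda>_. x"] by (simp add: power_mult_distrib)
  qed (use c in simp)
  then show "0 \<le> c \<and> norm A \<le> c"
    using c by (auto intro: cop_norm_leI)
next
  assume c: "0 \<le> c \<and> norm A \<le> c"
  have "(norm (A *\<^sub>V x))\<^sup>2 \<le> c\<^sup>2 * (norm x)\<^sup>2" for x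
    unfolding power_mult_distrib[symmetric]
    using c by (intro power_mono order_trans[OF cop_norm_bound] mult_right_mono) auto
  then show "mat_bound 1 (\<lambda>_ _. A) c"
    using c by (simp add: mat_bound_def)
qed

text \<open>Expanding all \<open>h j k\<close> in one orthonormal set turns each tensor sum into a
  sum over u of terms g(j, u) tensor u. These are orthogonal in u, so the scalar bound applies for
  each u separately and Pythagoras adds the results: amplification is a direct sum of
  copies.\<close>

lemma mat_bound_tensor_finite:
  fixes A :: "nat \<Rightarrow> nat \<Rightarrow> ('i, complex) l2 cop" and h :: "nat \<Rightarrow> 'k \<Rightarrow> 'h :: complex_inner"
  assumes m: "mat_bound m A c" and K: "finite K"
  shows "(\<Sum>i<m. (norm (\<Sum>j<m. \<Sum>k\<in>K. (A i j *\<^sub>V f j k) \<otimes>\<^sub>l h j k))\<^sup>2)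
    \<le> c\<^sup>2 * (\<Sum>j<m. (norm (\<Sum>k\<in>K. f j k \<otimes>\<^sub>l h j k))\<^sup>2)"
proof -
  have fin_h: "finite ((\<lambda>(j, k). h j k) ` ({..<m} \<times> K))"
    using K by simp
  obtain U where fin: "finite U" and nU: "\<forall>u\<in>U. norm u = 1"
    and oU: "\<forall>u\<in>U. \<forall>v\<in>U. u \<noteq> v \<longrightarrow> cinner u v = 0"
    and eU: "\<forall>s\<in>(\<lambda>(j, k). h j k) ` ({..<m} \<times> K). s = (\<Sum>u\<in>U. cinner s u *\<^sub>C u)"
    using finite_orthonormal_expansion[OF fin_h] by (elim exE conjE) (rule that)
  have h: "h j k = (\<Sum>u\<in>U. cinner (h j k) u *\<^sub>C u)" if "j < m" "k \<in> K" for j k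
  proof (rule bspec[OF eU])
    show "h j k \<in> (\<lambda>(j, k). h j k) ` ({..<m} \<times> K)"
      by (rule image_eqI[of _ _ "(j, k)"]) (use that in simp_all)
  qed
  define g where "g = (\<lambda>j u. \<Sum>k\<in>K. cinner (h j k) u *\<^sub>C f j k)"
  have expand: "(\<Sum>k\<in>K. (B *\<^sub>V f j k) \<otimes>\<^sub>l h j k) = (\<Sum>u\<in>U. (B *\<^sub>V g j u) \<otimes>\<^sub>l u)" if "j < m" for j and B :: "('i, complex) l2 cop"
  proof -
    have "(\<Sum>k\<in>K. (B *\<^sub>V f j k) \<otimes>\<^sub>l h j k) = (\<Sum>k\<in>K. \<Sum>u\<in>U. cinner (h j k) u *\<^sub>C ((B *\<^sub>V f j k) \<otimes>\<^sub>l u))"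
    proof (rule sum.cong[OF refl])
      fix k assume "k \<in> K"
      have "(B *\<^sub>V f j k) \<otimes>\<^sub>l h j k = (B *\<^sub>V f j k) \<otimes>\<^sub>l (\<Sum>u\<in>U. cinner (h j k) u *\<^sub>C u)"
        using h[OF that \<open>k \<in> K\<close>] by simp
      also have "\<dots> = (\<Sum>u\<in>U. cinner (h j k) u *\<^sub>C ((B *\<^sub>V f j k) \<otimes>\<^sub>l u))"
        by (simp only: tensor_sum_right tensor_scaleC_right)
      finally show "(B *\<^sub>V f j k) \<otimes>\<^sub>l h j k = (\<Sum>u\<in>U. cinner (h j k) u *\<^sub>C ((B *\<^sub>V f j k) \<otimes>\<^sub>l u))" .
    qed
    also have "\<dots> = (\<Sum>u\<in>U. \<Sum>k\<in>K. cinner (h j k) u *\<^sub>C ((B *\<^sub>V f j k) \<otimes>\<^sub>l u))"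
      by (rule sum.swap)
    also have "\<dots> = (\<Sum>u\<in>U. (B *\<^sub>V g j u) \<otimes>\<^sub>l u)"
      by (simp only: g_def cop_sum_right tensor_sum_left cop_scaleC_right tensor_scaleC_left)
    finally show ?thesis .
  qed
  have norm_U: "(norm (\<Sum>u\<in>U. v u \<otimes>\<^sub>l u))\<^sup>2 = (\<Sum>u\<in>U. (norm (v u))\<^sup>2)" for v :: "'h \<Rightarrow> ('i, complex) l2"
  proof -
    have "(norm (\<Sum>u\<in>U. v u \<otimes>\<^sub>l u))\<^sup>2 = (\<Sum>u\<in>U. (norm (v u \<otimes>\<^sub>l u))\<^sup>2)"
      by (rule norm_sq_sum_orthogonal[OF fin]) (simp add: cinner_tensor oU)
    also have "\<dots> = (\<Sum>u\<in>U. (norm (v u))\<^sup>2)"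
      by (rule sum.cong) (simp_all add: norm_tensor nU)
    finally show ?thesis .
  qed
  have "(\<Sum>i<m. (norm (\<Sum>j<m. \<Sum>k\<in>K. (A i j *\<^sub>V f j k) \<otimes>\<^sub>l h j k))\<^sup>2)
      = (\<Sum>i<m. (norm (\<Sum>u\<in>U. (\<Sum>j<m. A i j *\<^sub>V g j u) \<otimes>\<^sub>l u))\<^sup>2)"
  proof (rule sum.cong[OF refl])
    fix i
    have "(\<Sum>j<m. \<Sum>k\<in>K. (A i j *\<^sub>V f j k) \<otimes>\<^sub>l h j k) = (\<Sum>j<m. \<Sum>u\<in>U. (A i j *\<^sub>V g j u) \<otimes>\<^sub>l u)"
      by (rule sum.cong) (simp_all add: expand)
    also have "\<dots> = (\<Sum>u\<in>U. \<Sum>j<m. (A i j *\<^sub>V g j u) \<otimes>\<^sub>l u)"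
      by (rule sum.swap)
    finally show "(norm (\<Sum>j<m. \<Sum>k\<in>K. (A i j *\<^sub>V f j k) \<otimes>\<^sub>l h j k))\<^sup>2
        = (norm (\<Sum>u\<in>U. (\<Sum>j<m. A i j *\<^sub>V g j u) \<otimes>\<^sub>l u))\<^sup>2"
      by (simp only: tensor_sum_left)
  qed
  also have "\<dots> = (\<Sum>i<m. \<Sum>u\<in>U. (norm (\<Sum>j<m. A i j *\<^sub>V g j u))\<^sup>2)"
    by (simp only: norm_U)
  also have "\<dots> = (\<Sum>u\<in>U. \<Sum>i<m. (norm (\<Sum>j<m. A i j *\<^sub>V g j u))\<^sup>2)"
    by (rule sum.swap)
  also have "\<dots> \<le> (\<Sum>u\<in>U. c\<^sup>2 * (\<Sum>j<m. (norm (g j u))\<^sup>2))"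
    by (rule sum_mono) (rule mat_boundD[OF m])
  also have "\<dots> = c\<^sup>2 * (\<Sum>j<m. \<Sum>u\<in>U. (norm (g j u))\<^sup>2)"
    by (simp only: sum_distrib_left[symmetric] sum.swap[of _ U])
  also have "\<dots> = c\<^sup>2 * (\<Sum>j<m. (norm (\<Sum>k\<in>K. f j k \<otimes>\<^sub>l h j k))\<^sup>2)"
  proof -
    have "(\<Sum>u\<in>U. (norm (g j u))\<^sup>2) = (norm (\<Sum>k\<in>K. f j k \<otimes>\<^sub>l h j k))\<^sup>2" if "j < m" for j
      using norm_U[of "g j"] expand[OF that, of id_cop] by simp
    then show ?thesis by simp
  qed
  finally show ?thesis .
qed

text \<open>Cauchy criterion: a finite sum outside a large finite set is controlled by the tail of
  \<open>w\<close>. It serves families whose norms are only square-summable.\<close>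

lemma summable_on_square_bound:
  fixes g :: "'i \<Rightarrow> 'a :: banach" and w :: "'i \<Rightarrow> real"
  assumes g: "\<And>F. finite F \<Longrightarrow> (norm (\<Sum>i\<in>F. g i))\<^sup>2 \<le> c\<^sup>2 * (\<Sum>i\<in>F. w i)"
    and w: "w summable_on UNIV" "\<And>i. 0 \<le> w i"
  shows "g summable_on UNIV"
proof -
  have "cauchy_filter (filtermap (sum g) (finite_subsets_at_top UNIV))"
    unfolding cauchy_filter_metric_filtermap
  proof (intro allI impI)
    fix e :: real
    assume "e > 0"
    \<comment> \<open>Tails of \<open>w\<close> are below 2d, and (c^2 + 1) * 2d = e^2 / 8 < (e /
      2)^2; the summand 1 covers c = 0.\<close>
    define d where "d = e\<^sup>2 / (16 * (c\<^sup>2 + 1))"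
    have c1: "c\<^sup>2 + 1 > 0"
      by (rule add_nonneg_pos) auto
    have "d > 0"
      using \<open>e > 0\<close> c1 by (simp add: d_def)
    have "((sum w) \<longlongrightarrow> infsum w UNIV) (finite_subsets_at_top UNIV)"
      using has_sum_infsum[OF w(1)] unfolding has_sum_def .
    then have "\<forall>\<^sub>F F in finite_subsets_at_top UNIV. dist (sum w F) (infsum w UNIV) < d"
      using \<open>d > 0\<close> by (rule tendstoD)
    then obtain F0 where F0: "finite F0" "\<And>F. finite F \<Longrightarrow> F0 \<subseteq> F \<Longrightarrow> dist (sum w F) (infsum w UNIV) < d"
      unfolding eventually_finite_subsets_at_top by auto
    have small: "norm (sum g G) < e / 2" if "finite G" "G \<inter> F0 = {}" for G
    proof -
      have "sum w (F0 \<union> G) = sum w F0 + sum w G"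
        using that F0(1) by (intro sum.union_disjoint) auto
      moreover have "dist (sum w F0) (infsum w UNIV) < d" "dist (sum w (F0 \<union> G)) (infsum w UNIV) < d"
        using F0 that by auto
      ultimately have "sum w G < 2 * d"
        unfolding dist_real_def by linarith
      have "(norm (sum g G))\<^sup>2 \<le> c\<^sup>2 * sum w G"
        by (rule g[OF that(1)])
      also have "\<dots> \<le> (c\<^sup>2 + 1) * sum w G"
        by (intro mult_right_mono sum_nonneg w(2)) auto
      also have "\<dots> < (c\<^sup>2 + 1) * (2 * d)"
        using c1 \<open>sum w G < 2 * d\<close> by (intro mult_strict_left_mono)
      also have "\<dots> = e\<^sup>2 / 8"
        using c1 by (simp add: d_def field_simps)
      also have "\<dots> < (e / 2)\<^sup>2"
        using \<open>e > 0\<close> by (simp add: power_divide)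
      finally show ?thesis
        by (rule power2_less_imp_less) (use \<open>e > 0\<close> in simp)
    qed
    have "dist (sum g F) (sum g F') < e" if F: "finite F" "F0 \<subseteq> F" and F': "finite F'" "F0 \<subseteq> F'" for F F'
    proof -
      have "sum g F = sum g (F \<inter> F') + sum g (F - F')" "sum g F' = sum g (F \<inter> F') + sum g (F' - F)"
        using sum.Int_Diff[OF F(1), of g F'] sum.Int_Diff[OF F'(1), of g F] by (simp_all add: Int_commute)
      then have "dist (sum g F) (sum g F') \<le> norm (sum g (F - F')) + norm (sum g (F' - F))"
        unfolding dist_norm using norm_triangle_ineq4[of "sum g (F - F')" "sum g (F' - F)"] by simp
      moreover have "norm (sum g (F - F')) < e / 2" "norm (sum g (F' - F)) < e / 2"
        using F F' by (intro small; auto)+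
      ultimately show ?thesis by linarith
    qed
    then show "\<exists>P. eventually P (finite_subsets_at_top UNIV) \<and> (\<forall>x y. P x \<and> P y \<longrightarrow> dist (sum g x) (sum g y) < e)"
      using F0(1)
      by (intro exI[of _ "\<lambda>F. finite F \<and> F0 \<subseteq> F"] conjI)
        (auto simp: eventually_finite_subsets_at_top)
  qed
  moreover have "complete (UNIV :: 'a set)"
    by (meson Cauchy_convergent UNIV_I complete_def convergent_def)
  ultimately obtain L where "(sum g \<longlongrightarrow> L) (finite_subsets_at_top UNIV)"
    using complete_uniform[where S = "UNIV :: 'a set"] by (force simp add: filterlim_def)
  then show ?thesis
    using summable_on_def has_sum_def by blast
qed

text \<open>The image of \<xi> is the sum over i of A e_i tensor the i-th coordinate of \<xi>. The
  norms of the terms need not be summable, but the bound on finite tensor sums for a one by one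
  matrix gives unconditional convergence and the norm estimate.\<close>

lemma cop_amplify_exists:
  fixes A :: "('i, complex) l2 cop"
  shows "\<exists>B :: ('i, 'h :: chilbert_space) l2 cop. \<forall>f h. B *\<^sub>V (f \<otimes>\<^sub>l h) = (A *\<^sub>V f) \<otimes>\<^sub>l h"
proof -
  define g where "g = (\<lambda>(\<xi> :: ('i, 'h) l2) i. (A *\<^sub>V l2_single i 1) \<otimes>\<^sub>l l2_nth \<xi> i)"
  have m: "mat_bound 1 (\<lambda>_ _. A) (norm A)"
    by (simp add: mat_bound_one_iff[unfolded One_nat_def])
  have fin: "(norm (\<Sum>i\<in>F. g \<xi> i))\<^sup>2 \<le> (norm A)\<^sup>2 * (\<Sum>i\<in>F. (norm (l2_nth \<xi> i))\<^sup>2)" if "finite F" for F \<xi>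
    using mat_bound_tensor_finite[OF m that, of "\<lambda>_ i. l2_single i 1" "\<lambda>_. l2_nth \<xi>"]
      norm_sq_sum_l2_single[OF that, of "l2_nth \<xi>"]
    by (simp add: g_def l2_single_one_tensor)
  have summ: "g \<xi> summable_on UNIV" for \<xi>
    by (rule summable_on_square_bound[where c = "norm A" and w = "\<lambda>i. (norm (l2_nth \<xi> i))\<^sup>2"])
      (simp_all add: l2_nth_summable fin)
  define f where "f = (\<lambda>\<xi>. infsum (g \<xi>) UNIV)"
  have hs: "(g \<xi> has_sum f \<xi>) UNIV" for \<xi>
    unfolding f_def using summ by (rule has_sum_infsum)
  obtain B where B: "\<And>\<xi>. B *\<^sub>V \<xi> = f \<xi>"
  proof (rule cop_exists[of f "norm A"])
    show "f (x + y) = f x + f y" for x y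
      using has_sum_unique[OF hs[of "x + y"]] has_sum_add[OF hs[of x] hs[of y]]
      by (simp add: g_def tensor_add_right)
    show "f (c *\<^sub>C x) = c *\<^sub>C f x" for c x
      using has_sum_unique[OF hs[of "c *\<^sub>C x"]] has_sum_bounded_linear[OF bounded_linear_scaleC hs[of x], of c]
      by (simp add: g_def tensor_scaleC_right o_def)
    show "norm (f x) \<le> norm A * norm x" for x
    proof (rule tendsto_upperbound)
      show "((\<lambda>F. norm (\<Sum>i\<in>F. g x i)) \<longlongrightarrow> norm (f x)) (finite_subsets_at_top UNIV)"
        using hs[of x] unfolding has_sum_def by (rule tendsto_norm)
      have "norm (\<Sum>i\<in>F. g x i) \<le> norm A * norm x" if "finite F" for F
      proof (rule power2_le_imp_le)
        have "(norm (\<Sum>i\<in>F. g x i))\<^sup>2 \<le> (norm A)\<^sup>2 * (\<Sum>i\<in>F. (norm (l2_nth x i))\<^sup>2)"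
          by (rule fin[OF that])
        also have "\<dots> \<le> (norm A)\<^sup>2 * (norm x)\<^sup>2"
          by (intro mult_left_mono sum_le_norm_l2_sq that) auto
        finally show "(norm (\<Sum>i\<in>F. g x i))\<^sup>2 \<le> (norm A * norm x)\<^sup>2"
          by (simp add: power_mult_distrib)
      qed simp
      then show "\<forall>\<^sub>F F in finite_subsets_at_top UNIV. norm (\<Sum>i\<in>F. g x i) \<le> norm A * norm x"
        by (rule eventually_finite_subsets_at_top_weakI)
    qed (rule finite_subsets_at_top_neq_bot)
  qed blast
  have B_single: "B *\<^sub>V l2_single i h = (A *\<^sub>V l2_single i 1) \<otimes>\<^sub>l h" for i h
  proof -
    have "f (l2_single i h) = infsum (g (l2_single i h)) {i}"
      unfolding f_def by (rule infsum_cong_neutral) (auto simp: g_def l2_single.rep_eq)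
    then show ?thesis
      by (simp add: B g_def l2_single.rep_eq)
  qed
  have "B *\<^sub>V (v \<otimes>\<^sub>l h) = (A *\<^sub>V v) \<otimes>\<^sub>l h" for v h
  proof -
    have "v \<in> {v. B *\<^sub>V (v \<otimes>\<^sub>l h) = (A *\<^sub>V v) \<otimes>\<^sub>l h}"
    proof (rule l2_total)
      show "closed {v. B *\<^sub>V (v \<otimes>\<^sub>l h) = (A *\<^sub>V v) \<otimes>\<^sub>l h}"
        by (intro closed_Collect_eq bounded_linear.continuous_on[OF cop_bounded_linear]
            bounded_linear.continuous_on[OF bounded_linear_tensor_left] continuous_on_id)
      show "l2_single i c \<in> {v. B *\<^sub>V (v \<otimes>\<^sub>l h) = (A *\<^sub>V v) \<otimes>\<^sub>l h}" for i c
        unfolding l2_single_one_scaleC[of c i, symmetric] mem_Collect_eq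
        by (simp only: tensor_scaleC_left cop_scaleC_right l2_single_one_tensor B_single)
    qed (simp_all add: tensor_add_left cop_add_right)
    then show ?thesis by simp
  qed
  then show ?thesis by (intro exI[of _ B] allI)
qed

lemma cop_amplify_tensor [simp]:
  "(cop_amplify A :: ('i, 'h :: chilbert_space) l2 cop) *\<^sub>V (f \<otimes>\<^sub>l h) = (A *\<^sub>V f) \<otimes>\<^sub>l h"
proof -
  obtain B :: "('i, 'h) l2 cop" where B: "\<forall>f h. B *\<^sub>V (f \<otimes>\<^sub>l h) = (A *\<^sub>V f) \<otimes>\<^sub>l h"
    using cop_amplify_exists[of A, where 'h = 'h] by (elim exE) (rule that)
  have "cop_amplify A = B"
    unfolding cop_amplify_def
  proof (rule the_equality)
    fix B' :: "('i, 'h) l2 cop"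
    assume B': "\<forall>f h. B' *\<^sub>V (f \<otimes>\<^sub>l h) = (A *\<^sub>V f) \<otimes>\<^sub>l h"
    show "B' = B"
    proof (rule cop_eqI_l2_single)
      fix i h
      show "B' *\<^sub>V l2_single i h = B *\<^sub>V l2_single i h"
        using B'[rule_format, of "l2_single i 1" h] B[rule_format, of "l2_single i 1" h] by (simp add: l2_single_one_tensor)
    qed
  qed (rule B)
  then show ?thesis using B by simp
qed

lemma cop_amplify_single: "cop_amplify A *\<^sub>V l2_single i h = (A *\<^sub>V l2_single i 1) \<otimes>\<^sub>l h"
  using cop_amplify_tensor[of A "l2_single i 1" h] by (simp add: l2_single_one_tensor)

lemma cop_amplify_add: "cop_amplify (A + B) = cop_amplify A + cop_amplify B"
  by (rule cop_eqI_l2_single) (simp add: cop_amplify_single tensor_add_left)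

lemma cop_amplify_scaleC: "cop_amplify (c *\<^sub>C A) = c *\<^sub>C cop_amplify A"
  by (rule cop_eqI_l2_single) (simp add: cop_amplify_single tensor_scaleC_left)

lemma cop_amplify_comp: "cop_amplify (A o\<^sub>C B) = cop_amplify A o\<^sub>C cop_amplify B"
  by (rule cop_eqI_l2_single) (simp add: cop_amplify_single)

lemma cop_amplify_zero: "cop_amplify 0 = 0"
  by (rule cop_eqI_l2_single) (simp add: cop_amplify_single)

lemma cop_amplify_sum: "cop_amplify (\<Sum>k\<in>F. A k) = (\<Sum>k\<in>F. cop_amplify (A k))"
  by (induction F rule: infinite_finite_induct) (auto simp: cop_amplify_add cop_amplify_zero)

text \<open>Truncating the vectors to finitely many coordinates gives finite tensor sums, and both
  sides are continuous. Compressions of amplified operators inherit complete contractivity from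
  here.\<close>

lemma mat_bound_amplify:
  fixes A :: "nat \<Rightarrow> nat \<Rightarrow> ('i, complex) l2 cop"
  assumes m: "mat_bound m A c"
  shows "mat_bound m (\<lambda>i j. cop_amplify (A i j) :: ('i, 'h :: chilbert_space) l2 cop) c"
  unfolding mat_bound_def
proof (intro conjI allI)
  show "0 \<le> c" using m by (simp add: mat_bound_def)
  fix x :: "nat \<Rightarrow> ('i, 'h) l2"
  define s where "s = (\<lambda>j F. \<Sum>k\<in>F. l2_single k (l2_nth (x j) k))"
  have s: "(s j \<longlongrightarrow> x j) (finite_subsets_at_top UNIV)" for j
    using l2_has_sum[of "x j"] unfolding has_sum_def s_def .
  show "(\<Sum>i<m. (norm (\<Sum>j<m. cop_amplify (A i j) *\<^sub>V x j))\<^sup>2) \<le> c\<^sup>2 * (\<Sum>j<m. (norm (x j))\<^sup>2)"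
  proof (rule tendsto_le[of "finite_subsets_at_top UNIV"])
    show "((\<lambda>F. \<Sum>i<m. (norm (\<Sum>j<m. cop_amplify (A i j) *\<^sub>V s j F))\<^sup>2) \<longlongrightarrow>
        (\<Sum>i<m. (norm (\<Sum>j<m. cop_amplify (A i j) *\<^sub>V x j))\<^sup>2)) (finite_subsets_at_top UNIV)"
      by (intro tendsto_sum tendsto_power tendsto_norm cop_tendsto s)
    show "((\<lambda>F. c\<^sup>2 * (\<Sum>j<m. (norm (s j F))\<^sup>2)) \<longlongrightarrow> c\<^sup>2 * (\<Sum>j<m. (norm (x j))\<^sup>2)) (finite_subsets_at_top UNIV)"
      by (intro tendsto_mult tendsto_const tendsto_sum tendsto_power tendsto_norm s)
    have "(\<Sum>i<m. (norm (\<Sum>j<m. cop_amplify (A i j) *\<^sub>V s j F))\<^sup>2) \<le> c\<^sup>2 * (\<Sum>j<m. (norm (s j F))\<^sup>2)" if "finite F" for F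
      using mat_bound_tensor_finite[OF m that, of "\<lambda>_ k. l2_single k 1" "\<lambda>j. l2_nth (x j)"]
      by (simp add: s_def cop_sum_right cop_amplify_single l2_single_one_tensor)
    then show "\<forall>\<^sub>F F in finite_subsets_at_top UNIV.
        (\<Sum>i<m. (norm (\<Sum>j<m. cop_amplify (A i j) *\<^sub>V s j F))\<^sup>2) \<le> c\<^sup>2 * (\<Sum>j<m. (norm (s j F))\<^sup>2)"
      by (rule eventually_finite_subsets_at_top_weakI)
  qed (rule finite_subsets_at_top_neq_bot)
qed

lemma cop_amplify_norm_le: "norm (cop_amplify A) \<le> norm A"
  using mat_bound_amplify[of 1 "\<lambda>_ _. A" "norm A"] by (simp add: mat_bound_one_iff[unfolded One_nat_def])

section \<open>Coordinate projections, weighted shifts and pointwise convergence\<close>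

lemma l2_coordinate_projection:
  obtains P :: "('i, 'h :: complex_inner) l2 cop"
  where "\<And>f i. l2_nth (P *\<^sub>V f) i = (if i \<in> S then l2_nth f i else 0)"
proof -
  have "\<exists>g. l2_nth g = (\<lambda>i. if i \<in> S then l2_nth f i else 0) \<and> norm g \<le> norm f" for f :: "('i, 'h) l2"
  proof -
    have "(\<Sum>i\<in>F. (norm (if i \<in> S then l2_nth f i else 0))\<^sup>2) \<le> (norm f)\<^sup>2" if "finite F" for F
      by (rule order_trans[OF sum_mono sum_le_norm_l2_sq[OF that, of f]]) auto
    from l2_from_bound[OF this] show ?thesis by auto
  qed
  then obtain p :: "('i, 'h) l2 \<Rightarrow> ('i, 'h) l2" where p: "\<And>f. l2_nth (p f) = (\<lambda>i. if i \<in> S then l2_nth f i else 0)" "\<And>f. norm (p f) \<le> norm f"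
    by metis
  obtain P where P: "\<And>f. P *\<^sub>V f = p f"
  proof (rule cop_exists[of p 1])
    show "p (x + y) = p x + p y" for x y
      by (rule l2_eqI) (simp add: p)
    show "p (c *\<^sub>C x) = c *\<^sub>C p x" for c x
      by (rule l2_eqI) (simp add: p)
  qed ((use p(2) in simp), blast)
  show ?thesis
    by (rule that[of P]) (simp add: P p(1))
qed

text \<open>Injectivity keeps distinct coordinates apart, so the supremum of the weights bounds the
  norm. Vanishing off the range completes the coordinate description and so determines the
  operator.\<close>

lemma weighted_shift_exists:
  fixes w :: "'i \<Rightarrow> real"
  assumes inj: "inj \<tau>" and w: "\<And>i. \<bar>w i\<bar> \<le> K"
  obtains A :: "('i, complex) l2 cop" where "\<And>f i. l2_nth (A *\<^sub>V f) (\<tau> i) = w i *\<^sub>R l2_nth f i"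
    "\<And>f j. j \<notin> range \<tau> \<Longrightarrow> l2_nth (A *\<^sub>V f) j = 0"
proof -
  have K: "0 \<le> K" using w[of undefined] by linarith
  define a where "a = (\<lambda>(f :: ('i, complex) l2) j. if j \<in> range \<tau> then w (inv \<tau> j) *\<^sub>R l2_nth f (inv \<tau> j) else 0)"
  have bound: "(\<Sum>j\<in>F. (norm (a f j))\<^sup>2) \<le> (K * norm f)\<^sup>2" if "finite F" for F f
  proof -
    have fin: "finite (\<tau> -` F)"
      using inj that by (simp add: finite_vimageI)
    have "(\<Sum>j\<in>F. (norm (a f j))\<^sup>2) = (\<Sum>j\<in>\<tau> ` (\<tau> -` F). (norm (a f j))\<^sup>2)"
      using that by (intro sum.mono_neutral_right) (auto simp: a_def)
    also have "\<dots> = (\<Sum>i\<in>\<tau> -` F. (norm (a f (\<tau> i)))\<^sup>2)"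
      using inj by (subst sum.reindex) (auto intro: inj_on_subset)
    also have "\<dots> \<le> (\<Sum>i\<in>\<tau> -` F. K\<^sup>2 * (norm (l2_nth f i))\<^sup>2)"
    proof (rule sum_mono)
      fix i
      have "(norm (a f (\<tau> i)))\<^sup>2 = \<bar>w i\<bar>\<^sup>2 * (norm (l2_nth f i))\<^sup>2"
        using inj by (simp add: a_def power_mult_distrib)
      also have "\<dots> \<le> K\<^sup>2 * (norm (l2_nth f i))\<^sup>2"
        using w[of i] by (intro mult_right_mono power_mono) auto
      finally show "(norm (a f (\<tau> i)))\<^sup>2 \<le> K\<^sup>2 * (norm (l2_nth f i))\<^sup>2" .
    qed
    also have "\<dots> \<le> K\<^sup>2 * (norm f)\<^sup>2"
      unfolding sum_distrib_left[symmetric] by (intro mult_left_mono sum_le_norm_l2_sq fin) auto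
    finally show ?thesis by (simp add: power_mult_distrib)
  qed
  have "\<exists>g. l2_nth g = a f \<and> norm g \<le> K * norm f" for f
  proof -
    have "0 \<le> K * norm f" using K by simp
    from l2_from_bound[OF bound this] show ?thesis by blast
  qed
  then obtain p where p: "\<And>f. l2_nth (p f) = a f" "\<And>f. norm (p f) \<le> K * norm f"
    by metis
  obtain A where A: "\<And>f. A *\<^sub>V f = p f"
  proof (rule cop_exists[of p K])
    show "p (x + y) = p x + p y" for x y
      by (rule l2_eqI) (simp add: p a_def scaleR_add_right)
    show "p (c *\<^sub>C x) = c *\<^sub>C p x" for c x
      by (rule l2_eqI) (simp add: p a_def scaleC_complex_def)
  qed ((use p(2) in simp), blast)
  show ?thesis
    by (rule that[of A]) (use inj in \<open>simp_all add: A p(1) a_def\<close>)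
qed

text \<open>The uniform bound controls the effect of replacing x by a nearby good vector,
  independently of n. Strong convergence thereby reduces to a total set.\<close>

lemma closed_pointwise_convergence:
  fixes A :: "nat \<Rightarrow> ('a :: complex_inner, 'b :: complex_inner) cblinfun"
  assumes K: "\<And>n. norm (A n) \<le> K"
  shows "closed {x. (\<lambda>n. A n *\<^sub>V x) \<longlonglongrightarrow> L *\<^sub>V x}"
  unfolding closed_sequential_limits
proof (intro allI impI, elim conjE)
  fix f x
  assume f: "\<forall>n. f n \<in> {x. (\<lambda>n. A n *\<^sub>V x) \<longlonglongrightarrow> L *\<^sub>V x}" and lim: "f \<longlonglongrightarrow> x"
  define C where "C = K + norm L + 1"
  have K0: "0 \<le> K"
    using K[of 0] norm_ge_zero order_trans by blast
  have C: "C > 0"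
    unfolding C_def using K0 norm_ge_zero[of L] by linarith
  have "(\<lambda>n. A n *\<^sub>V x) \<longlonglongrightarrow> L *\<^sub>V x"
  proof (rule LIMSEQ_I)
    fix e :: real
    assume "e > 0"
    then have "e / (2 * C) > 0" using C by simp
    then obtain k where k: "norm (f k - x) < e / (2 * C)"
      using LIMSEQ_D[OF lim] by blast
    have "(\<lambda>n. A n *\<^sub>V f k) \<longlonglongrightarrow> L *\<^sub>V f k"
      using f by simp
    then obtain M where M: "\<And>n. n \<ge> M \<Longrightarrow> norm (A n *\<^sub>V f k - L *\<^sub>V f k) < e / 2"
      using LIMSEQ_D[of _ _ "e / 2"] \<open>e > 0\<close> by (metis half_gt_zero)
    have "norm (A n *\<^sub>V x - L *\<^sub>V x) < e" if "n \<ge> M" for n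
    proof -
      have "A n *\<^sub>V x - L *\<^sub>V x = (A n *\<^sub>V f k - L *\<^sub>V f k) + (A n - L) *\<^sub>V (x - f k)"
        by (simp add: cop_diff_right)
      then have "norm (A n *\<^sub>V x - L *\<^sub>V x) \<le> norm (A n *\<^sub>V f k - L *\<^sub>V f k) + norm ((A n - L) *\<^sub>V (x - f k))"
        by (metis norm_triangle_ineq)
      moreover have "norm ((A n - L) *\<^sub>V (x - f k)) \<le> C * norm (f k - x)"
      proof -
        have "norm ((A n - L) *\<^sub>V (x - f k)) \<le> norm (A n - L) * norm (x - f k)"
          by (rule cop_norm_bound)
        also have "\<dots> \<le> C * norm (x - f k)"
          using norm_triangle_ineq4[of "A n" L] K[of n] by (intro mult_right_mono) (auto simp: C_def)
        finally show ?thesis by (simp add: norm_minus_commute)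
      qed
      moreover have "C * norm (f k - x) < e / 2"
        using k C by (simp add: field_simps)
      ultimately show ?thesis
        using M[OF that] by linarith
    qed
    then show "\<exists>no. \<forall>n\<ge>no. norm (A n *\<^sub>V x - L *\<^sub>V x) < e"
      by blast
  qed
  then show "x \<in> {x. (\<lambda>n. A n *\<^sub>V x) \<longlonglongrightarrow> L *\<^sub>V x}"
    by simp
qed

lemma pointwise_convergence_l2:
  fixes A :: "nat \<Rightarrow> (('i, 'h :: complex_inner) l2, 'b :: complex_inner) cblinfun"
  assumes "\<And>n. norm (A n) \<le> K" "\<And>i h. (\<lambda>n. A n *\<^sub>V l2_single i h) \<longlonglongrightarrow> L *\<^sub>V l2_single i h"
  shows "(\<lambda>n. A n *\<^sub>V x) \<longlonglongrightarrow> L *\<^sub>V x"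
proof -
  have "x \<in> {x. (\<lambda>n. A n *\<^sub>V x) \<longlonglongrightarrow> L *\<^sub>V x}"
    by (rule l2_total[OF closed_pointwise_convergence[OF assms(1)]])
      (auto simp: assms(2) cop_add_right intro: tendsto_add)
  then show ?thesis by simp
qed

section \<open>Summability means\<close>

text \<open>Toeplitz regularity: the initial values of \<open>d\<close> are killed by the vanishing
  weights, the rest is small and carries total weight at most 1. The filter is general so as to
  cover Cesaro means and Abel means for r tending to 1 from the left.\<close>

lemma toeplitz_null:
  fixes d :: "nat \<Rightarrow> real" and w :: "'t \<Rightarrow> nat \<Rightarrow> real"
  assumes d: "d \<longlonglongrightarrow> 0" "\<And>j. 0 \<le> d j"
    and s: "\<forall>\<^sub>F t in F. w t sums 1 \<and> (\<forall>j. 0 \<le> w t j)"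
    and l: "\<And>j. ((\<lambda>t. w t j) \<longlongrightarrow> 0) F"
  shows "((\<lambda>t. \<Sum>j. w t j * d j) \<longlongrightarrow> 0) F"
    and "\<forall>\<^sub>F t in F. summable (\<lambda>j. w t j * d j)"
proof -
  obtain D where D: "\<And>j. d j \<le> D"
    using convergent_imp_Bseq[OF convergentI[OF d(1)]] d(2) unfolding Bseq_def by auto
  have summ: "summable (\<lambda>j. w t j * d j)" if "w t sums 1" "\<forall>j. 0 \<le> w t j" for t
  proof (rule summable_comparison_test'[of "\<lambda>j. w t j * D" 0])
    show "summable (\<lambda>j. w t j * D)"
      using that(1) by (intro summable_mult2) (simp add: sums_iff)
    show "norm (w t j * d j) \<le> w t j * D" for j
      using that(2) d(2)[of j] D[of j] by (simp add: mult_left_mono)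
  qed
  show "\<forall>\<^sub>F t in F. summable (\<lambda>j. w t j * d j)"
    using s by (rule eventually_mono) (simp add: summ)
  show "((\<lambda>t. \<Sum>j. w t j * d j) \<longlongrightarrow> 0) F"
  proof (rule tendstoI)
    fix e :: real
    assume "e > 0"
    then have "e / 2 > 0" by simp
    obtain J where "\<And>j. j \<ge> J \<Longrightarrow> norm (d j - 0) < e / 2"
      using LIMSEQ_D[OF d(1) \<open>e / 2 > 0\<close>] by blast
    then have J: "d j \<le> e / 2" if "j \<ge> J" for j
      using that d(2)[of j] by fastforce
    have "((\<lambda>t. \<Sum>j<J. w t j * D) \<longlongrightarrow> (\<Sum>j<J. 0 * D)) F"
      by (intro tendsto_sum tendsto_mult l tendsto_const)
    then have "\<forall>\<^sub>F t in F. (\<Sum>j<J. w t j * D) < e / 2"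
      using order_tendstoD(2) \<open>e / 2 > 0\<close> by fastforce
    with s show "\<forall>\<^sub>F t in F. dist (\<Sum>j. w t j * d j) 0 < e"
    proof eventually_elim
      case (elim t)
      have le: "w t j * d j \<le> (if j < J then w t j * D else 0) + w t j * (e / 2)" for j
      proof (cases "j < J")
        case True
        have "w t j * d j \<le> w t j * D"
          using elim D by (intro mult_left_mono) auto
        moreover have "0 \<le> w t j * (e / 2)"
          using elim \<open>e > 0\<close> by simp
        ultimately show ?thesis using True by simp
      next
        case False
        then have "w t j * d j \<le> w t j * (e / 2)"
          using elim J[of j] by (intro mult_left_mono) auto
        then show ?thesis using False by simp
      qed
      have "(\<lambda>j. if j < J then w t j * D else 0) sums (\<Sum>j | j < J. w t j * D)"
        by (rule sums_If_finite) simp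
      moreover have "(\<lambda>j. w t j * (e / 2)) sums (1 * (e / 2))"
        using elim by (intro sums_mult2) simp
      ultimately have sums: "(\<lambda>j. (if j < J then w t j * D else 0) + w t j * (e / 2)) sums
          ((\<Sum>j | j < J. w t j * D) + 1 * (e / 2))"
        by (rule sums_add)
      have st: "summable (\<lambda>j. w t j * d j)"
        using elim by (intro summ) auto
      have "(\<Sum>j. w t j * d j) \<le> (\<Sum>j. (if j < J then w t j * D else 0) + w t j * (e / 2))"
        by (rule suminf_le[OF le st sums_summable[OF sums]])
      also have "\<dots> = (\<Sum>j<J. w t j * D) + e / 2"
        using sums_unique[OF sums] by (simp add: lessThan_def)
      finally have "(\<Sum>j. w t j * d j) < e"
        using elim by simp
      moreover have "0 \<le> (\<Sum>j. w t j * d j)"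
        using elim d(2) by (intro suminf_nonneg st) auto
      ultimately show ?case
        by (simp add: dist_real_def)
    qed
  qed
qed

text \<open>The term \<open>a s\<close> occurs in the partial sums with index s, ..., N, that is N +
  1 - s times.\<close>

lemma fejer_sum:
  fixes a :: "nat \<Rightarrow> 'a :: real_vector"
  shows "(\<Sum>s\<le>N. (real N + 1 - real s) *\<^sub>R a s) = (\<Sum>j\<le>N. \<Sum>k\<le>j. a k)"
proof (induction N)
  case (Suc N)
  have "(real (Suc N) + 1 - real s) *\<^sub>R a s = (real N + 1 - real s) *\<^sub>R a s + a s" for s
    using scaleR_left_distrib[of "real N + 1 - real s" 1 "a s"] by (simp add: add_diff_eq diff_add_eq)
  then have "(\<Sum>s\<le>Suc N. (real (Suc N) + 1 - real s) *\<^sub>R a s)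
      = (\<Sum>s\<le>N. (real N + 1 - real s) *\<^sub>R a s + a s) + a (Suc N)"
    by simp
  also have "\<dots> = (\<Sum>s\<le>N. (real N + 1 - real s) *\<^sub>R a s) + (\<Sum>s\<le>N. a s) + a (Suc N)"
    by (simp only: sum.distrib)
  also have "\<dots> = (\<Sum>j\<le>Suc N. \<Sum>k\<le>j. a k)"
    unfolding Suc by simp
  finally show ?case .
qed simp

lemma cesaro_sum_eq:
  fixes a :: "nat \<Rightarrow> 'a :: real_vector"
  shows "(\<Sum>s\<le>N. (1 - real s / (real N + 1)) *\<^sub>R a s) = (1 / (real N + 1)) *\<^sub>R (\<Sum>j\<le>N. \<Sum>k\<le>j. a k)"
proof -
  have "1 - real s / (real N + 1) = (1 / (real N + 1)) * (real N + 1 - real s)" for s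
    by (simp add: field_simps)
  then show ?thesis
    by (simp only: scaleR_scaleR[symmetric] scaleR_sum_right[symmetric] fejer_sum)
qed

text \<open>Averaging the first N + 1 partial sums is a Toeplitz method with equal weights 1 / (N +
  1).\<close>

lemma cesaro_mean_tendsto:
  fixes a :: "nat \<Rightarrow> 'a :: real_normed_vector"
  assumes S: "(\<lambda>N. \<Sum>k\<le>N. a k) \<longlonglongrightarrow> L"
  shows "(\<lambda>N. \<Sum>s\<le>N. (1 - real s / (real N + 1)) *\<^sub>R a s) \<longlonglongrightarrow> L"
proof -
  define d where "d = (\<lambda>j. norm ((\<Sum>k\<le>j. a k) - L))"
  define w where "w = (\<lambda>(N :: nat) (j :: nat). if j \<le> N then 1 / (real N + 1) else 0)"
  have w_sums: "w N sums 1" for N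
  proof -
    have "w N sums (\<Sum>j | j \<le> N. 1 / (real N + 1))"
      unfolding w_def by (rule sums_If_finite) simp
    moreover have "(\<Sum>j | j \<le> N. 1 / (real N + 1)) = (1 :: real)"
      using card_atMost[of N] by (simp add: atMost_def[symmetric] field_simps)
    ultimately show ?thesis by (simp only:)
  qed
  have w0: "(\<lambda>N. w N j) \<longlonglongrightarrow> 0" for j
  proof (rule Lim_null_comparison)
    show "\<forall>\<^sub>F N in sequentially. norm (w N j) \<le> inverse (real (Suc N))"
      by (rule always_eventually) (auto simp: w_def field_simps)
    show "(\<lambda>N. inverse (real (Suc N))) \<longlonglongrightarrow> 0"
      by (rule LIMSEQ_inverse_real_of_nat)
  qed
  have "d \<longlonglongrightarrow> 0"
    unfolding d_def using S by (intro tendsto_norm_zero LIM_zero)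
  moreover have "0 \<le> d j" for j
    by (simp add: d_def)
  moreover have "\<forall>\<^sub>F N in sequentially. w N sums 1 \<and> (\<forall>j. 0 \<le> w N j)"
    by (rule always_eventually) (simp add: w_sums, simp add: w_def)
  ultimately have lim: "(\<lambda>N. \<Sum>j. w N j * d j) \<longlonglongrightarrow> 0"
    by (rule toeplitz_null(1)) (rule w0)
  have "norm ((\<Sum>s\<le>N. (1 - real s / (real N + 1)) *\<^sub>R a s) - L) \<le> (\<Sum>j. w N j * d j)" for N
  proof -
    have "(\<Sum>j. w N j * d j) = (\<Sum>j\<le>N. 1 / (real N + 1) * d j)"
      by (subst suminf_finite[of "{..N}"]) (auto simp: w_def)
    have L: "L = (1 / (real N + 1)) *\<^sub>R (\<Sum>j\<le>N. L)"
    proof -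
      have *: "(1 / (real N + 1)) * real (card {..N}) = 1"
        by (simp add: field_simps)
      show ?thesis
        unfolding sum_constant_scaleR scaleR_scaleR * scaleR_one ..
    qed
    have "(\<Sum>s\<le>N. (1 - real s / (real N + 1)) *\<^sub>R a s) - L
        = (1 / (real N + 1)) *\<^sub>R (\<Sum>j\<le>N. (\<Sum>k\<le>j. a k) - L)"
      by (simp only: cesaro_sum_eq sum_subtractf scaleR_right_diff_distrib L[symmetric])
    then have "norm ((\<Sum>s\<le>N. (1 - real s / (real N + 1)) *\<^sub>R a s) - L)
        = (1 / (real N + 1)) * norm (\<Sum>j\<le>N. (\<Sum>k\<le>j. a k) - L)"
      by simp
    also have "\<dots> \<le> (1 / (real N + 1)) * (\<Sum>j\<le>N. d j)"
      unfolding d_def by (intro mult_left_mono norm_sum) auto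
    also have "\<dots> = (\<Sum>j. w N j * d j)"
      unfolding \<open>(\<Sum>j. w N j * d j) = _\<close> by (simp add: sum_distrib_left)
    finally show ?thesis .
  qed
  then have "(\<lambda>N. (\<Sum>s\<le>N. (1 - real s / (real N + 1)) *\<^sub>R a s) - L) \<longlonglongrightarrow> 0"
    by (intro Lim_null_comparison[OF always_eventually lim] allI)
  then show ?thesis
    by (rule LIM_zero_cancel)
qed

section \<open>Matrix bounds\<close>

text \<open>Testing against the row images themselves gives Y^2 <= c X Y. For averages of
  compressions the bilinear form is easier to estimate than the norm.\<close>

lemma mat_boundI_cinner:
  fixes A :: "nat \<Rightarrow> nat \<Rightarrow> ('a :: complex_inner, 'b :: complex_inner) cblinfun"
  assumes c: "0 \<le> c"
    and le: "\<And>x y. Re (\<Sum>i<m. \<Sum>j<m. cinner (A i j *\<^sub>V x j) (y i))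
      \<le> c * L2_set (\<lambda>j. norm (x j)) {..<m} * L2_set (\<lambda>i. norm (y i)) {..<m}"
  shows "mat_bound m A c"
  unfolding mat_bound_def
proof (intro conjI allI c)
  fix x
  define y where "y = (\<lambda>i. \<Sum>j<m. A i j *\<^sub>V x j)"
  define Y where "Y = L2_set (\<lambda>i. norm (y i)) {..<m}"
  define X where "X = L2_set (\<lambda>j. norm (x j)) {..<m}"
  have XY: "0 \<le> X" "0 \<le> Y" "X\<^sup>2 = (\<Sum>j<m. (norm (x j))\<^sup>2)" "Y\<^sup>2 = (\<Sum>i<m. (norm (y i))\<^sup>2)"
    by (simp_all add: X_def Y_def L2_set_def sum_nonneg)
  have "(\<Sum>i<m. \<Sum>j<m. cinner (A i j *\<^sub>V x j) (y i)) = (\<Sum>i<m. cinner (y i) (y i))"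
    by (simp add: y_def cinner.sum_left)
  then have "Re (\<Sum>i<m. \<Sum>j<m. cinner (A i j *\<^sub>V x j) (y i)) = Y\<^sup>2"
    by (simp add: Re_cinner_self XY(4))
  then have "Y * Y \<le> c * X * Y"
    using le[of x y] by (simp add: X_def Y_def power2_eq_square)
  then have "Y \<le> c * X"
    using XY(1,2) c by (cases "Y = 0") auto
  then have "Y\<^sup>2 \<le> (c * X)\<^sup>2"
    using XY(2) by (rule power_mono)
  then show "(\<Sum>i<m. (norm (\<Sum>j<m. A i j *\<^sub>V x j))\<^sup>2) \<le> c\<^sup>2 * (\<Sum>j<m. (norm (x j))\<^sup>2)"
    by (simp add: XY(3,4)[symmetric] power_mult_distrib y_def[symmetric])
      (simp add: XY(4) y_def)
qed

lemma mat_boundD_L2_set: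
  assumes m: "mat_bound m A c"
  shows "L2_set (\<lambda>i. norm (\<Sum>j<m. A i j *\<^sub>V x j)) {..<m} \<le> c * L2_set (\<lambda>j. norm (x j)) {..<m}"
proof -
  have "0 \<le> c" using m by (simp add: mat_bound_def)
  then show ?thesis
    using real_sqrt_le_mono[OF mat_boundD[OF m, of x]] by (simp add: L2_set_def real_sqrt_mult)
qed

lemma mat_boundD_cinner:
  assumes m: "mat_bound m A c"
  shows "Re (\<Sum>i<m. \<Sum>j<m. cinner (A i j *\<^sub>V x j) (y i))
    \<le> c * L2_set (\<lambda>j. norm (x j)) {..<m} * L2_set (\<lambda>i. norm (y i)) {..<m}"
proof -
  define z where "z = (\<lambda>i. \<Sum>j<m. A i j *\<^sub>V x j)"
  have "Re (\<Sum>i<m. \<Sum>j<m. cinner (A i j *\<^sub>V x j) (y i)) = (\<Sum>i<m. Re (cinner (z i) (y i)))"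
    by (simp add: z_def cinner.sum_left)
  also have "\<dots> \<le> (\<Sum>i<m. \<bar>norm (z i)\<bar> * \<bar>norm (y i)\<bar>)"
    by (intro sum_mono) (simp add: order_trans[OF complex_Re_le_cmod norm_cinner_le])
  also have "\<dots> \<le> L2_set (\<lambda>i. norm (z i)) {..<m} * L2_set (\<lambda>i. norm (y i)) {..<m}"
    by (rule L2_set_mult_ineq)
  also have "\<dots> \<le> (c * L2_set (\<lambda>j. norm (x j)) {..<m}) * L2_set (\<lambda>i. norm (y i)) {..<m}"
    unfolding z_def by (intro mult_right_mono mat_boundD_L2_set[OF m] L2_set_nonneg)
  finally show ?thesis .
qed

lemma mat_bound_pointwise_limit:
  assumes m: "\<And>t. mat_bound m (A t) c" and lim: "\<And>i j x. i < m \<Longrightarrow> j < m \<Longrightarrow> ((\<lambda>t. A t i j *\<^sub>V x) \<longlongrightarrow> B i j *\<^sub>V x) F"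
    and F: "F \<noteq> bot"
  shows "mat_bound m B c"
  unfolding mat_bound_def
proof (intro conjI allI)
  show "0 \<le> c" using m by (simp add: mat_bound_def)
  fix x
  show "(\<Sum>i<m. (norm (\<Sum>j<m. B i j *\<^sub>V x j))\<^sup>2) \<le> c\<^sup>2 * (\<Sum>j<m. (norm (x j))\<^sup>2)"
  proof (rule tendsto_upperbound[OF _ _ F])
    show "((\<lambda>t. \<Sum>i<m. (norm (\<Sum>j<m. A t i j *\<^sub>V x j))\<^sup>2) \<longlongrightarrow> (\<Sum>i<m. (norm (\<Sum>j<m. B i j *\<^sub>V x j))\<^sup>2)) F"
      by (intro tendsto_sum tendsto_power tendsto_norm lim) auto
    show "\<forall>\<^sub>F t in F. (\<Sum>i<m. (norm (\<Sum>j<m. A t i j *\<^sub>V x j))\<^sup>2) \<le> c\<^sup>2 * (\<Sum>j<m. (norm (x j))\<^sup>2)"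
      by (rule always_eventually) (intro allI mat_boundD m)
  qed
qed

lemma mat_bound_compress:
  fixes V :: "('h :: complex_inner, 'k :: complex_inner) cblinfun"
  assumes m: "mat_bound m A c" and V: "norm V \<le> 1" and V': "norm V' \<le> 1"
  shows "mat_bound m (\<lambda>i j. V' o\<^sub>C A i j o\<^sub>C V) c"
  unfolding mat_bound_def
proof (intro conjI allI)
  show c: "0 \<le> c" using m by (simp add: mat_bound_def)
  fix x
  have contr: "norm (B *\<^sub>V x) \<le> norm x" if "norm B \<le> 1" for B :: "('u :: complex_inner, 'v :: complex_inner) cblinfun" and x
    using cop_norm_bound[of B x] mult_right_mono[OF that norm_ge_zero[of x]] by simp
  have "(\<Sum>i<m. (norm (\<Sum>j<m. (V' o\<^sub>C A i j o\<^sub>C V) *\<^sub>V x j))\<^sup>2) = (\<Sum>i<m. (norm (V' *\<^sub>V (\<Sum>j<m. A i j *\<^sub>V V *\<^sub>V x j)))\<^sup>2)"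
    by (simp add: cop_sum_right)
  also have "\<dots> \<le> (\<Sum>i<m. (norm (\<Sum>j<m. A i j *\<^sub>V V *\<^sub>V x j))\<^sup>2)"
    by (intro sum_mono power_mono contr V') auto
  also have "\<dots> \<le> c\<^sup>2 * (\<Sum>j<m. (norm (V *\<^sub>V x j))\<^sup>2)"
    by (rule mat_boundD[OF m])
  also have "\<dots> \<le> c\<^sup>2 * (\<Sum>j<m. (norm (x j))\<^sup>2)"
    by (intro mult_left_mono sum_mono power_mono contr V) auto
  finally show "(\<Sum>i<m. (norm (\<Sum>j<m. (V' o\<^sub>C A i j o\<^sub>C V) *\<^sub>V x j))\<^sup>2) \<le> c\<^sup>2 * (\<Sum>j<m. (norm (x j))\<^sup>2)" .
qed

text \<open>The supremum in \<open>opmat_norm\<close> is meaningful only for a bounded set; sums of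
  the entry norms give a crude bound that suffices.\<close>

lemma opmat_norm_bdd:
  fixes A :: "nat \<Rightarrow> nat \<Rightarrow> ('a :: complex_inner, 'b :: complex_inner) cblinfun"
  shows "bdd_above {sqrt (\<Sum>i<m. (norm (\<Sum>j<m. A i j *\<^sub>V x j))\<^sup>2) | x. (\<Sum>j<m. (norm (x j))\<^sup>2) \<le> 1}"
proof (rule bdd_aboveI)
  fix r
  assume "r \<in> {sqrt (\<Sum>i<m. (norm (\<Sum>j<m. A i j *\<^sub>V x j))\<^sup>2) | x. (\<Sum>j<m. (norm (x j))\<^sup>2) \<le> 1}"
  then obtain x where r: "r = sqrt (\<Sum>i<m. (norm (\<Sum>j<m. A i j *\<^sub>V x j))\<^sup>2)" and x: "(\<Sum>j<m. (norm (x j))\<^sup>2) \<le> 1"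
    by blast
  have "norm (x j) \<le> 1" if "j < m" for j
  proof (rule power2_le_imp_le)
    have "(norm (x j))\<^sup>2 \<le> (\<Sum>j<m. (norm (x j))\<^sup>2)"
      by (rule member_le_sum) (use that in auto)
    then show "(norm (x j))\<^sup>2 \<le> 1\<^sup>2" using x by simp
  qed simp
  then have "norm (\<Sum>j<m. A i j *\<^sub>V x j) \<le> (\<Sum>j<m. norm (A i j))" for i
    by (intro sum_norm_le order_trans[OF cop_norm_bound] mult_left_le) auto
  then show "r \<le> sqrt (\<Sum>i<m. (\<Sum>j<m. norm (A i j))\<^sup>2)"
    unfolding r by (intro real_sqrt_le_mono sum_mono power_mono) auto
qed

lemma opmat_norm_le_iff: "0 \<le> c \<Longrightarrow> opmat_norm m A \<le> c \<longleftrightarrow> mat_bound m A c"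
proof
  assume c: "0 \<le> c" and le: "opmat_norm m A \<le> c"
  show "mat_bound m A c"
    unfolding mat_bound_def
  proof (intro conjI allI c)
    fix x :: "nat \<Rightarrow> 'a"
    define n where "n = L2_set (\<lambda>j. norm (x j)) {..<m}"
    have n2: "n\<^sup>2 = (\<Sum>j<m. (norm (x j))\<^sup>2)" and n0: "0 \<le> n"
      by (simp_all add: n_def L2_set_def sum_nonneg)
    show "(\<Sum>i<m. (norm (\<Sum>j<m. A i j *\<^sub>V x j))\<^sup>2) \<le> c\<^sup>2 * (\<Sum>j<m. (norm (x j))\<^sup>2)"
    proof (cases "n = 0")
      case True
      then have "\<forall>j\<in>{..<m}. (norm (x j))\<^sup>2 = 0"
        using n2 sum_nonneg_eq_0_iff[of "{..<m}" "\<lambda>j. (norm (x j))\<^sup>2"] by simp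
      then show ?thesis by simp
    next
      case False
      define u where "u = (\<lambda>j. (1 / n) *\<^sub>R x j)"
      have "(\<Sum>j<m. (norm (u j))\<^sup>2) = (1 / n)\<^sup>2 * (\<Sum>j<m. (norm (x j))\<^sup>2)"
        by (simp add: u_def power_mult_distrib sum_distrib_left sum_divide_distrib power_divide)
      also have "\<dots> = 1"
        using False by (simp add: n2[symmetric] power_divide)
      finally have "sqrt (\<Sum>i<m. (norm (\<Sum>j<m. A i j *\<^sub>V u j))\<^sup>2) \<le> opmat_norm m A"
        unfolding opmat_norm_def by (intro cSup_upper opmat_norm_bdd) (auto intro!: exI[of _ u])
      then have s: "(\<Sum>i<m. (norm (\<Sum>j<m. A i j *\<^sub>V u j))\<^sup>2) \<le> c\<^sup>2"
        using le c by (simp add: real_le_lsqrt sqrt_le_D)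
      have "(\<Sum>j<m. A i j *\<^sub>V u j) = (1 / n) *\<^sub>R (\<Sum>j<m. A i j *\<^sub>V x j)" for i
        by (simp add: u_def cop_scaleR_right scaleR_sum_right)
      then have "(\<Sum>i<m. (norm (\<Sum>j<m. A i j *\<^sub>V u j))\<^sup>2) = (1 / n)\<^sup>2 * (\<Sum>i<m. (norm (\<Sum>j<m. A i j *\<^sub>V x j))\<^sup>2)"
        by (simp add: power_mult_distrib sum_distrib_left sum_divide_distrib power_divide)
      with s show ?thesis
        using False by (simp add: n2[symmetric] field_simps)
    qed
  qed
next
  assume c: "0 \<le> c" and m: "mat_bound m A c"
  show "opmat_norm m A \<le> c"
    unfolding opmat_norm_def
  proof (rule cSup_least)
    have "sqrt (\<Sum>i<m. (norm (\<Sum>j<m. A i j *\<^sub>V (\<lambda>_. 0) j))\<^sup>2) \<in>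
        {sqrt (\<Sum>i<m. (norm (\<Sum>j<m. A i j *\<^sub>V x j))\<^sup>2) | x. (\<Sum>j<m. (norm (x j))\<^sup>2) \<le> 1}"
      by (intro CollectI exI[of _ "\<lambda>_. 0"] conjI) auto
    then show "{sqrt (\<Sum>i<m. (norm (\<Sum>j<m. A i j *\<^sub>V x j))\<^sup>2) | x. (\<Sum>j<m. (norm (x j))\<^sup>2) \<le> 1} \<noteq> {}"
      by blast
  next
    fix r
    assume "r \<in> {sqrt (\<Sum>i<m. (norm (\<Sum>j<m. A i j *\<^sub>V x j))\<^sup>2) | x. (\<Sum>j<m. (norm (x j))\<^sup>2) \<le> 1}"
    then obtain x where r: "r = sqrt (\<Sum>i<m. (norm (\<Sum>j<m. A i j *\<^sub>V x j))\<^sup>2)" and x: "(\<Sum>j<m. (norm (x j))\<^sup>2) \<le> 1"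
      by blast
    have "(\<Sum>i<m. (norm (\<Sum>j<m. A i j *\<^sub>V x j))\<^sup>2) \<le> c\<^sup>2 * (\<Sum>j<m. (norm (x j))\<^sup>2)"
      by (rule mat_boundD[OF m])
    also have "\<dots> \<le> c\<^sup>2 * 1"
      using x by (intro mult_left_mono) auto
    finally show "r \<le> c"
      unfolding r using c by (simp add: real_le_lsqrt)
  qed
qed

lemma opmat_norm_nonneg: "0 \<le> opmat_norm m A"
proof -
  have "0 \<in> {sqrt (\<Sum>i<m. (norm (\<Sum>j<m. A i j *\<^sub>V x j))\<^sup>2) | x. (\<Sum>j<m. (norm (x j))\<^sup>2) \<le> 1}"
    by (intro CollectI exI[of _ "\<lambda>_. 0"] conjI) auto
  then show ?thesis
    unfolding opmat_norm_def by (intro cSup_upper opmat_norm_bdd)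
qed

lemma mat_bound_opmat_norm: "mat_bound m A (opmat_norm m A)"
  using opmat_norm_le_iff[OF opmat_norm_nonneg, of m A m A] by simp

lemma completely_contractive_onI:
  assumes "\<And>m A c. (\<And>i j. i < m \<Longrightarrow> j < m \<Longrightarrow> A i j \<in> S) \<Longrightarrow> mat_bound m A c \<Longrightarrow> mat_bound m (\<lambda>i j. \<Phi> (A i j)) c"
  shows "completely_contractive_on S \<Phi>"
  unfolding completely_contractive_on_def
proof (intro allI impI)
  fix m and A :: "nat \<Rightarrow> nat \<Rightarrow> 'a cop"
  assume A: "\<forall>i<m. \<forall>j<m. A i j \<in> S"
  show "opmat_norm m (\<lambda>i j. \<Phi> (A i j)) \<le> opmat_norm m A"
    using assms[of m A "opmat_norm m A"] A mat_bound_opmat_norm[of m A]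
    by (simp add: opmat_norm_le_iff opmat_norm_nonneg)
qed

lemma completely_contractive_on_norm_le:
  assumes cc: "completely_contractive_on S \<Phi>" and "A \<in> S"
  shows "norm (\<Phi> A) \<le> norm A"
proof -
  have "opmat_norm 1 (\<lambda>_ _. A) \<le> norm A"
    by (rule opmat_norm_le_iff[THEN iffD2, OF norm_ge_zero], rule mat_bound_one_iff[THEN iffD2]) simp
  moreover have "opmat_norm 1 (\<lambda>_ _. \<Phi> A) \<le> opmat_norm 1 (\<lambda>_ _. A)"
    using cc[unfolded completely_contractive_on_def, THEN spec[of _ 1], THEN spec[of _ "\<lambda>_ _. A"]] assms(2)
    by blast
  ultimately have "opmat_norm 1 (\<lambda>_ _. \<Phi> A) \<le> norm A"
    by linarith
  then have "mat_bound 1 (\<lambda>_ _. \<Phi> A) (norm A)"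
    by (rule opmat_norm_le_iff[THEN iffD1, OF norm_ge_zero])
  then show ?thesis
    using mat_bound_one_iff by blast
qed

subsection \<open>Coordinate projections\<close>

definition coord_proj :: "'i set \<Rightarrow> ('i, 'h :: complex_inner) l2 cop"
  where "coord_proj S = (SOME P. \<forall>f i. l2_nth (P *\<^sub>V f) i = (if i \<in> S then l2_nth f i else 0))"

lemma l2_nth_coord_proj [simp]:
  "l2_nth (coord_proj S *\<^sub>V f) i = (if i \<in> S then l2_nth (f :: ('i, 'h :: complex_inner) l2) i else 0)"
proof -
  have "\<exists>P :: ('i, 'h) l2 cop. \<forall>f i. l2_nth (P *\<^sub>V f) i = (if i \<in> S then l2_nth f i else 0)"
    by (rule l2_coordinate_projection[of S]) blast
  from someI_ex[OF this] show ?thesis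
    unfolding coord_proj_def by blast
qed

lemma coord_proj_single: "coord_proj S *\<^sub>V l2_single i h = (if i \<in> S then l2_single i h else 0)"
  by (rule l2_eqI) (auto simp: l2_single.rep_eq)

lemma coord_proj_selfadjoint: "cinner (coord_proj S *\<^sub>V x) y = cinner x (coord_proj S *\<^sub>V y)"
  by (auto simp: cinner_l2.rep_eq intro: infsum_cong)

lemma norm_sq_coord_proj_finite:
  assumes "finite S"
  shows "(norm (coord_proj S *\<^sub>V x))\<^sup>2 = (\<Sum>i\<in>S. (norm (l2_nth x i))\<^sup>2)"
proof -
  have "(norm (coord_proj S *\<^sub>V x))\<^sup>2 = (\<Sum>\<^sub>\<infinity>i\<in>S. (norm (l2_nth x i))\<^sup>2)"
    unfolding norm_l2_sq by (rule infsum_cong_neutral) auto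
  then show ?thesis
    using assms by simp
qed

lemma norm_coord_proj_apply_le: "norm (coord_proj S *\<^sub>V x) \<le> norm x"
proof (rule power2_le_imp_le)
  have "(\<lambda>i. (norm (l2_nth (coord_proj S *\<^sub>V x) i))\<^sup>2) summable_on UNIV"
    by (rule l2_nth_summable)
  then show "(norm (coord_proj S *\<^sub>V x))\<^sup>2 \<le> (norm x)\<^sup>2"
    unfolding norm_l2_sq by (rule infsum_mono[OF _ l2_nth_summable]) auto
qed simp

lemma norm_coord_proj_le: "norm (coord_proj S) \<le> 1"
  by (rule cop_norm_leI) (simp_all add: norm_coord_proj_apply_le)

lemma coord_proj_tendsto:
  fixes x :: "('i, 'h :: complex_inner) l2"
  assumes "\<And>i. \<forall>\<^sub>F n in sequentially. i \<in> S n"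
  shows "(\<lambda>n. coord_proj (S n) *\<^sub>V x) \<longlonglongrightarrow> x"
proof -
  have "(\<lambda>n. coord_proj (S n) *\<^sub>V l2_single i h) \<longlonglongrightarrow> id_cop *\<^sub>V l2_single i h" for i and h :: 'h
    by (rule tendsto_eventually, rule eventually_mono[OF assms[of i]]) (simp add: coord_proj_single)
  from pointwise_convergence_l2[OF norm_coord_proj_le this] show ?thesis
    by simp
qed

section \<open>The algebra of the universal model\<close>

lemma weighted_shift_basis:
  fixes w :: "'i \<Rightarrow> real"
  assumes inj: "inj \<tau>" and w: "\<And>i. \<bar>w i\<bar> \<le> K"
  obtains A :: "('i, complex) l2 cop" where "\<And>i. A *\<^sub>V l2_single i 1 = w i *\<^sub>R l2_single (\<tau> i) 1"
proof -
  obtain A :: "('i, complex) l2 cop" where A: "\<And>f i. l2_nth (A *\<^sub>V f) (\<tau> i) = w i *\<^sub>R l2_nth f i"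
    "\<And>f j. j \<notin> range \<tau> \<Longrightarrow> l2_nth (A *\<^sub>V f) j = 0"
    using weighted_shift_exists[of \<tau> w K] inj w by metis
  have "A *\<^sub>V l2_single i 1 = w i *\<^sub>R l2_single (\<tau> i) 1" for i
  proof (rule l2_eqI)
    fix j
    show "l2_nth (A *\<^sub>V l2_single i 1) j = l2_nth (w i *\<^sub>R l2_single (\<tau> i) 1) j"
    proof (cases "j \<in> range \<tau>")
      case True
      then obtain k where "j = \<tau> k" by blast
      then show ?thesis
        using inj_eq[OF inj, of k i] by (simp add: A(1) l2_single.rep_eq)
    next
      case False
      then have "j \<noteq> \<tau> i" by blast
      then show ?thesis
        using False by (simp add: A(2) l2_single.rep_eq)
    qed
  qed
  then show ?thesis by (rule that)
qed

lemma finite_words: "finite (words k :: 'n :: finite list set)"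
  using finite_lists_length_eq[of "UNIV :: 'n set" k] by (simp add: words_def)

lemma finite_words_le: "finite {\<alpha> :: 'n :: finite list. length \<alpha> \<le> k}"
  using finite_lists_length_le[of "UNIV :: 'n set" k] by simp

lemma word_op_Nil [simp]: "word_op X [] = id_cop"
  and word_op_Cons [simp]: "word_op X (i # \<alpha>) = X $ i o\<^sub>C word_op X \<alpha>"
  by (simp_all add: word_op_def)

text \<open>The weights depend on word length only, so Cesaro means and plain partial sums are both
  instances and statements for arbitrary \<open>u\<close> cover both.\<close>

definition length_sum :: "(nat \<Rightarrow> real) \<Rightarrow> nat \<Rightarrow> ('n :: finite list \<Rightarrow> complex) \<Rightarrow> ('h :: complex_inner cop) ^ 'n \<Rightarrow> 'h cop"
  where "length_sum u N c X = (\<Sum>s\<le>N. u s *\<^sub>R (\<Sum>\<alpha>\<in>words s. c \<alpha> *\<^sub>C word_op X \<alpha>))"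

definition cesaro :: "nat \<Rightarrow> ('n :: finite list \<Rightarrow> complex) \<Rightarrow> ('h :: complex_inner cop) ^ 'n \<Rightarrow> 'h cop"
  where "cesaro N = length_sum (\<lambda>s. 1 - real s / (real N + 1)) N"

lemma scaleC_sum_scaleR: "r *\<^sub>R (c *\<^sub>C x) = (complex_of_real r * c) *\<^sub>C (x :: 'a :: complex_vector)"
  by (simp add: scaleR_scaleC scaleC_scaleC)

lemma words_Union: "(\<Union>s\<in>{..N}. words s) = {\<alpha>. length \<alpha> \<le> N}"
  by (auto simp: words_def)

lemma length_sum_eq_sum:
  "length_sum u N c X = (\<Sum>\<alpha> | length \<alpha> \<le> N. (complex_of_real (u (length \<alpha>)) * c \<alpha>) *\<^sub>C word_op X \<alpha>)"
proof -
  have "length_sum u N c X = (\<Sum>s\<le>N. \<Sum>\<alpha>\<in>words s. (complex_of_real (u (length \<alpha>)) * c \<alpha>) *\<^sub>C word_op X \<alpha>)"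
    unfolding length_sum_def scaleR_sum_right
    by (intro sum.cong refl) (simp add: words_def scaleC_sum_scaleR)
  also have "\<dots> = (\<Sum>\<alpha>\<in>(\<Union>s\<in>{..N}. words s). (complex_of_real (u (length \<alpha>)) * c \<alpha>) *\<^sub>C word_op X \<alpha>)"
    by (rule sum.UNION_disjoint[symmetric]) (auto simp: finite_words, auto simp: words_def)
  finally show ?thesis
    by (simp only: words_Union)
qed

text \<open>\<open>left_bdd\<close> makes the weighted left shifts bounded and
  \<open>right_bdd\<close> the right ones; the latter enter through the description of the algebra
  as their commutant.\<close>

locale fock_weights =
  fixes b :: "'n :: finite list \<Rightarrow> real"
  assumes b_Nil: "b [] = 1" and b_pos: "\<And>\<alpha>. 0 < b \<alpha>"
    and left_bdd: "\<And>i. bdd_above (range (\<lambda>\<alpha>. b \<alpha> / b (i # \<alpha>)))"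
    and right_bdd: "\<And>i. bdd_above (range (\<lambda>\<alpha>. b \<alpha> / b (\<alpha> @ [i])))"
begin

abbreviation W :: "('n fock cop) ^ 'n" where "W \<equiv> universal_model b"
abbreviation e :: "'n list \<Rightarrow> 'n fock" where "e \<gamma> \<equiv> l2_single \<gamma> 1"

lemma W_basis: "W $ i *\<^sub>V e \<alpha> = sqrt (b \<alpha> / b (i # \<alpha>)) *\<^sub>R e (i # \<alpha>)"
proof -
  obtain K where K: "\<And>\<alpha>. b \<alpha> / b (i # \<alpha>) \<le> K"
    using left_bdd[of i] unfolding bdd_above_def by auto
  obtain A :: "'n fock cop" where A: "\<And>\<alpha>. A *\<^sub>V e \<alpha> = sqrt (b \<alpha> / b (i # \<alpha>)) *\<^sub>R e (i # \<alpha>)"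
  proof (rule weighted_shift_basis[of "Cons i" "\<lambda>\<alpha>. sqrt (b \<alpha> / b (i # \<alpha>))" "sqrt K"])
    show "\<bar>sqrt (b \<alpha> / b (i # \<alpha>))\<bar> \<le> sqrt K" for \<alpha>
      using K[of \<alpha>] b_pos[of \<alpha>] b_pos[of "i # \<alpha>"] by (simp add: real_sqrt_le_mono)
  qed (simp, blast)
  have "W $ i = A"
    unfolding universal_model_def vec_lambda_beta fock_basis_single
  proof (rule the_equality)
    fix B assume B: "\<forall>\<alpha>. B *\<^sub>V e \<alpha> = sqrt (b \<alpha> / b (i # \<alpha>)) *\<^sub>R e (i # \<alpha>)"
    show "B = A"
      by (rule cop_eqI_basis) (simp add: A B)
  qed (simp add: A)
  then show ?thesis by (simp add: A)
qed

text \<open>The weights of the letters telescope along the word.\<close>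

lemma word_op_W_basis: "word_op W \<alpha> *\<^sub>V e \<gamma> = sqrt (b \<gamma> / b (\<alpha> @ \<gamma>)) *\<^sub>R e (\<alpha> @ \<gamma>)"
proof (induction \<alpha>)
  case Nil
  then show ?case
    using b_pos[of \<gamma>] by simp
next
  case (Cons i \<alpha>)
  have "sqrt (b \<gamma> / b (\<alpha> @ \<gamma>)) * sqrt (b (\<alpha> @ \<gamma>) / b (i # \<alpha> @ \<gamma>)) = sqrt (b \<gamma> / b (i # \<alpha> @ \<gamma>))"
    using b_pos[of "\<alpha> @ \<gamma>"] by (simp add: real_sqrt_mult[symmetric])
  then show ?case
    by (simp add: Cons cop_scaleR_right W_basis)
qed

section \<open>Weighted right shifts and the matrix entries of their commutant\<close>

definition right_shift :: "'n \<Rightarrow> 'n fock cop"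
  where "right_shift i = (SOME A. \<forall>f. (\<forall>\<alpha>. l2_nth (A *\<^sub>V f) (\<alpha> @ [i]) = sqrt (b \<alpha> / b (\<alpha> @ [i])) *\<^sub>R l2_nth f \<alpha>) \<and>
    (\<forall>\<delta>. \<delta> \<notin> range (\<lambda>\<alpha>. \<alpha> @ [i]) \<longrightarrow> l2_nth (A *\<^sub>V f) \<delta> = 0))"

lemma right_shift_nth: "l2_nth (right_shift i *\<^sub>V f) (\<alpha> @ [i]) = sqrt (b \<alpha> / b (\<alpha> @ [i])) *\<^sub>R l2_nth f \<alpha>"
  and right_shift_nth_0: "\<delta> \<notin> range (\<lambda>\<alpha>. \<alpha> @ [i]) \<Longrightarrow> l2_nth (right_shift i *\<^sub>V f) \<delta> = 0"
proof -
  obtain K where K: "\<And>\<alpha>. b \<alpha> / b (\<alpha> @ [i]) \<le> K"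
    using right_bdd[of i] unfolding bdd_above_def by auto
  have inj: "inj (\<lambda>\<alpha>. \<alpha> @ [i])"
    by (rule injI) simp
  have w: "\<bar>sqrt (b \<alpha> / b (\<alpha> @ [i]))\<bar> \<le> sqrt K" for \<alpha>
    using K[of \<alpha>] b_pos[of \<alpha>] b_pos[of "\<alpha> @ [i]"] by (simp add: real_sqrt_le_mono)
  have "\<exists>A :: 'n fock cop. \<forall>f. (\<forall>\<alpha>. l2_nth (A *\<^sub>V f) (\<alpha> @ [i]) = sqrt (b \<alpha> / b (\<alpha> @ [i])) *\<^sub>R l2_nth f \<alpha>) \<and>
    (\<forall>\<delta>. \<delta> \<notin> range (\<lambda>\<alpha>. \<alpha> @ [i]) \<longrightarrow> l2_nth (A *\<^sub>V f) \<delta> = 0)"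
    by (rule weighted_shift_exists[of "\<lambda>\<alpha>. \<alpha> @ [i]" "\<lambda>\<alpha>. sqrt (b \<alpha> / b (\<alpha> @ [i]))" "sqrt K"],
        rule inj, rule w, blast)
  from someI_ex[OF this, folded right_shift_def]
  show "l2_nth (right_shift i *\<^sub>V f) (\<alpha> @ [i]) = sqrt (b \<alpha> / b (\<alpha> @ [i])) *\<^sub>R l2_nth f \<alpha>"
    "\<delta> \<notin> range (\<lambda>\<alpha>. \<alpha> @ [i]) \<Longrightarrow> l2_nth (right_shift i *\<^sub>V f) \<delta> = 0"
    by blast+
qed

lemma right_shift_basis: "right_shift i *\<^sub>V e \<gamma> = sqrt (b \<gamma> / b (\<gamma> @ [i])) *\<^sub>R e (\<gamma> @ [i])"
proof (rule l2_eqI)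
  fix \<delta>
  show "l2_nth (right_shift i *\<^sub>V e \<gamma>) \<delta> = l2_nth (sqrt (b \<gamma> / b (\<gamma> @ [i])) *\<^sub>R e (\<gamma> @ [i])) \<delta>"
  proof (cases "\<delta> \<in> range (\<lambda>\<alpha>. \<alpha> @ [i])")
    case True
    then obtain \<alpha> where "\<delta> = \<alpha> @ [i]" by blast
    then show ?thesis by (simp add: right_shift_nth l2_single.rep_eq)
  next
    case False
    then have "\<delta> \<noteq> \<gamma> @ [i]" by blast
    then show ?thesis using False by (simp add: right_shift_nth_0 l2_single.rep_eq)
  qed
qed

text \<open>The matrix of the formal series with coefficients \<open>c\<close>: column \<gamma>
  lives on the words ending in \<gamma>. No convergence is demanded, since boundedness is already
  carried by \<phi> as an operator.\<close>

definition entries :: "'n fock cop \<Rightarrow> ('n list \<Rightarrow> complex) \<Rightarrow> bool"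
  where "entries \<phi> c \<longleftrightarrow> (\<forall>\<gamma>. (\<forall>\<beta>. l2_nth (\<phi> *\<^sub>V e \<gamma>) (\<beta> @ \<gamma>) = complex_of_real (sqrt (b \<gamma> / b (\<beta> @ \<gamma>))) * c \<beta>) \<and>
    (\<forall>\<delta>. \<delta> \<notin> range (\<lambda>\<beta>. \<beta> @ \<gamma>) \<longrightarrow> l2_nth (\<phi> *\<^sub>V e \<gamma>) \<delta> = 0))"

text \<open>Coefficients are read from the vacuum column; the factor sqrt(b \<beta>) cancels the
  weight sqrt(1 / b \<beta>) found there.\<close>

definition symbol :: "'n fock cop \<Rightarrow> 'n list \<Rightarrow> complex"
  where "symbol \<phi> \<beta> = complex_of_real (sqrt (b \<beta>)) * l2_nth (\<phi> *\<^sub>V e []) \<beta>"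

lemma entriesD: "entries \<phi> c \<Longrightarrow> l2_nth (\<phi> *\<^sub>V e \<gamma>) (\<beta> @ \<gamma>) = complex_of_real (sqrt (b \<gamma> / b (\<beta> @ \<gamma>))) * c \<beta>"
  and entriesD0: "entries \<phi> c \<Longrightarrow> \<delta> \<notin> range (\<lambda>\<beta>. \<beta> @ \<gamma>) \<Longrightarrow> l2_nth (\<phi> *\<^sub>V e \<gamma>) \<delta> = 0"
  unfolding entries_def by blast+

lemma entries_symbol:
  assumes "entries \<phi> c"
  shows "c = symbol \<phi>"
proof
  fix \<beta>
  have "symbol \<phi> \<beta> = complex_of_real (sqrt (b \<beta>) * sqrt (1 / b \<beta>)) * c \<beta>"
    using entriesD[OF assms, of "[]" \<beta>] by (simp add: symbol_def b_Nil)
  also have "sqrt (b \<beta>) * sqrt (1 / b \<beta>) = 1"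
    using b_pos[of \<beta>] by (simp add: real_sqrt_mult[symmetric])
  finally show "c \<beta> = symbol \<phi> \<beta>" by simp
qed

lemma entries_eqI:
  assumes "entries A c" "entries B c"
  shows "A = B"
proof (rule cop_eqI_basis, rule l2_eqI)
  fix \<gamma> \<delta>
  show "l2_nth (A *\<^sub>V e \<gamma>) \<delta> = l2_nth (B *\<^sub>V e \<gamma>) \<delta>"
  proof (cases "\<delta> \<in> range (\<lambda>\<beta>. \<beta> @ \<gamma>)")
    case True
    then obtain \<beta> where "\<delta> = \<beta> @ \<gamma>" by blast
    then show ?thesis by (simp add: entriesD[OF assms(1)] entriesD[OF assms(2)])
  next
    case False
    then show ?thesis by (simp add: entriesD0[OF assms(1)] entriesD0[OF assms(2)])
  qed
qed

lemma entries_word_op: "entries (word_op W \<alpha>) (\<lambda>\<beta>. if \<beta> = \<alpha> then 1 else 0)"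
  unfolding entries_def word_op_W_basis by (auto simp: l2_single.rep_eq scaleR_conv_of_real)

lemma entries_zero: "entries 0 (\<lambda>_. 0)"
  unfolding entries_def by simp

lemma entries_add: "entries A c \<Longrightarrow> entries B d \<Longrightarrow> entries (A + B) (\<lambda>\<beta>. c \<beta> + d \<beta>)"
  unfolding entries_def by (simp add: distrib_left)

lemma entries_scaleC: "entries A c \<Longrightarrow> entries (k *\<^sub>C A) (\<lambda>\<beta>. k * c \<beta>)"
  unfolding entries_def by (simp add: scaleC_complex_def)

lemma entries_sum: "(\<And>k. k \<in> F \<Longrightarrow> entries (A k) (c k)) \<Longrightarrow> entries (\<Sum>k\<in>F. A k) (\<lambda>\<beta>. \<Sum>k\<in>F. c k \<beta>)"
  by (induction F rule: infinite_finite_induct) (simp_all add: entries_zero entries_add)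

lemma entries_finite_sum:
  assumes "finite F"
  shows "entries (\<Sum>\<alpha>\<in>F. c \<alpha> *\<^sub>C word_op W \<alpha>) (\<lambda>\<beta>. if \<beta> \<in> F then c \<beta> else 0)"
proof -
  have "entries (\<Sum>\<alpha>\<in>F. c \<alpha> *\<^sub>C word_op W \<alpha>) (\<lambda>\<beta>. \<Sum>\<alpha>\<in>F. c \<alpha> * (if \<beta> = \<alpha> then 1 else 0))"
    by (intro entries_sum entries_scaleC entries_word_op)
  also have "(\<lambda>\<beta>. \<Sum>\<alpha>\<in>F. c \<alpha> * (if \<beta> = \<alpha> then 1 else 0)) = (\<lambda>\<beta>. if \<beta> \<in> F then c \<beta> else 0)"
    using assms by (intro ext) (simp add: if_distrib[of "(*) _"] sum.delta' cong: if_cong)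
  finally show ?thesis .
qed

lemma entries_length_sum:
  "entries (length_sum u N c W) (\<lambda>\<beta>. if length \<beta> \<le> N then complex_of_real (u (length \<beta>)) * c \<beta> else 0)"
  using entries_finite_sum[OF finite_words_le[of N], of "\<lambda>\<alpha>. complex_of_real (u (length \<alpha>)) * c \<alpha>"]
  by (simp add: length_sum_eq_sum)

text \<open>Both sides are the square root of x / w.\<close>

lemma sqrt_ratio_aux:
  fixes x y z w :: real
  assumes "0 < x" "0 < y" "0 < z" "0 < w"
  shows "sqrt (z / w) * sqrt (x / z) = sqrt (x / y) * sqrt (y / w)"
proof -
  have "z / w * (x / z) = x / y * (y / w)"
    using assms by simp
  then show ?thesis
    by (simp only: real_sqrt_mult[symmetric])
qed

text \<open>The right shift appends a letter at the end of a word and \<phi> prepends words, so they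
  act at opposite ends; the two products of weights agree by \<open>sqrt_ratio_aux\<close>.\<close>

lemma entries_commute:
  assumes c: "entries \<phi> c"
  shows "\<phi> o\<^sub>C right_shift i = right_shift i o\<^sub>C \<phi>"
proof (rule cop_eqI_basis, rule l2_eqI)
  fix \<gamma> \<delta>
  let ?k = "sqrt (b \<gamma> / b (\<gamma> @ [i]))"
  have lhs: "l2_nth ((\<phi> o\<^sub>C right_shift i) *\<^sub>V e \<gamma>) \<delta> = ?k *\<^sub>R l2_nth (\<phi> *\<^sub>V e (\<gamma> @ [i])) \<delta>"
    by (simp add: right_shift_basis cop_scaleR_right)
  show "l2_nth ((\<phi> o\<^sub>C right_shift i) *\<^sub>V e \<gamma>) \<delta> = l2_nth ((right_shift i o\<^sub>C \<phi>) *\<^sub>V e \<gamma>) \<delta>"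
  proof (cases "\<delta> \<in> range (\<lambda>\<alpha>. \<alpha> @ [i])")
    case False
    then have "\<delta> \<notin> range (\<lambda>\<beta>. \<beta> @ (\<gamma> @ [i]))"
      by auto
    then show ?thesis
      unfolding lhs using False by (simp add: entriesD0[OF c] right_shift_nth_0)
  next
    case True
    then obtain \<alpha> where \<delta>: "\<delta> = \<alpha> @ [i]" by blast
    show ?thesis
    proof (cases "\<alpha> \<in> range (\<lambda>\<beta>. \<beta> @ \<gamma>)")
      case True
      then obtain \<beta> where \<alpha>: "\<alpha> = \<beta> @ \<gamma>" by blast
      have "?k * sqrt (b (\<gamma> @ [i]) / b (\<beta> @ \<gamma> @ [i])) = sqrt (b (\<beta> @ \<gamma>) / b (\<beta> @ \<gamma> @ [i])) * sqrt (b \<gamma> / b (\<beta> @ \<gamma>))"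
        by (rule sqrt_ratio_aux[symmetric]) (rule b_pos)+
      then have "complex_of_real ?k * complex_of_real (sqrt (b (\<gamma> @ [i]) / b (\<beta> @ \<gamma> @ [i])))
          = complex_of_real (sqrt (b (\<beta> @ \<gamma>) / b (\<beta> @ \<gamma> @ [i]))) * complex_of_real (sqrt (b \<gamma> / b (\<beta> @ \<gamma>)))"
        by (simp only: of_real_mult[symmetric])
      moreover have "l2_nth (\<phi> *\<^sub>V e (\<gamma> @ [i])) \<delta> = complex_of_real (sqrt (b (\<gamma> @ [i]) / b (\<beta> @ \<gamma> @ [i]))) * c \<beta>"
        using entriesD[OF c, of "\<gamma> @ [i]" \<beta>] by (simp add: \<delta> \<alpha>)
      moreover have "l2_nth ((right_shift i o\<^sub>C \<phi>) *\<^sub>V e \<gamma>) \<delta>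
          = complex_of_real (sqrt (b (\<beta> @ \<gamma>) / b (\<beta> @ \<gamma> @ [i]))) * (complex_of_real (sqrt (b \<gamma> / b (\<beta> @ \<gamma>))) * c \<beta>)"
        using right_shift_nth[of i "\<phi> *\<^sub>V e \<gamma>" "\<beta> @ \<gamma>"] entriesD[OF c, of \<gamma> \<beta>]
        by (simp add: \<delta> \<alpha> scaleR_conv_of_real)
      ultimately show ?thesis
        unfolding lhs scaleR_conv_of_real by (simp only: mult.assoc[symmetric])
    next
      case False
      then have "\<delta> \<notin> range (\<lambda>\<beta>. \<beta> @ (\<gamma> @ [i]))"
        by (auto simp: \<delta>)
      moreover have "l2_nth (right_shift i *\<^sub>V \<phi> *\<^sub>V e \<gamma>) \<delta> = 0"
        unfolding \<delta> right_shift_nth entriesD0[OF c False] by simp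
      ultimately show ?thesis
        unfolding lhs by (simp add: entriesD0[OF c])
    qed
  qed
qed

text \<open>Commutation with the right shift obtains the column of \<gamma> followed by i from the
  column of \<gamma>, up to a positive factor. Induction from the end of the word thus derives every
  column from the vacuum column.\<close>

lemma entries_of_commute:
  assumes comm: "\<And>i. \<phi> o\<^sub>C right_shift i = right_shift i o\<^sub>C \<phi>"
  shows "entries \<phi> (symbol \<phi>)"
proof -
  have "(\<forall>\<beta>. l2_nth (\<phi> *\<^sub>V e \<gamma>) (\<beta> @ \<gamma>) = complex_of_real (sqrt (b \<gamma> / b (\<beta> @ \<gamma>))) * symbol \<phi> \<beta>) \<and>
    (\<forall>\<delta>. \<delta> \<notin> range (\<lambda>\<beta>. \<beta> @ \<gamma>) \<longrightarrow> l2_nth (\<phi> *\<^sub>V e \<gamma>) \<delta> = 0)" for \<gamma>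
  proof (induction \<gamma> rule: rev_induct)
    case Nil
    have "sqrt (1 / b \<beta>) * sqrt (b \<beta>) = 1" for \<beta>
      using b_pos[of \<beta>] by (simp add: real_sqrt_mult[symmetric])
    then have "complex_of_real (sqrt (1 / b \<beta>)) * complex_of_real (sqrt (b \<beta>)) = 1" for \<beta>
      by (metis of_real_1 of_real_mult)
    then show ?case
      by (simp add: b_Nil symbol_def mult.assoc[symmetric])
  next
    case (snoc i \<gamma>)
    define k where "k = sqrt (b \<gamma> / b (\<gamma> @ [i]))"
    have k: "k > 0"
      using b_pos[of \<gamma>] b_pos[of "\<gamma> @ [i]"] by (simp add: k_def)
    have "\<phi> *\<^sub>V right_shift i *\<^sub>V e \<gamma> = right_shift i *\<^sub>V \<phi> *\<^sub>V e \<gamma>"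
      using arg_cong[OF comm[of i], of "\<lambda>A. A *\<^sub>V e \<gamma>"] by simp
    then have "k *\<^sub>R (\<phi> *\<^sub>V e (\<gamma> @ [i])) = right_shift i *\<^sub>V \<phi> *\<^sub>V e \<gamma>"
      by (simp add: right_shift_basis cop_scaleR_right k_def)
    then have nth: "complex_of_real k * l2_nth (\<phi> *\<^sub>V e (\<gamma> @ [i])) \<delta> = l2_nth (right_shift i *\<^sub>V \<phi> *\<^sub>V e \<gamma>) \<delta>" for \<delta>
      by (metis scaleR_l2.rep_eq scaleR_conv_of_real)
    have one: "l2_nth (\<phi> *\<^sub>V e (\<gamma> @ [i])) (\<beta> @ \<gamma> @ [i]) = complex_of_real (sqrt (b (\<gamma> @ [i]) / b (\<beta> @ \<gamma> @ [i]))) * symbol \<phi> \<beta>" for \<beta>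
    proof -
      have "complex_of_real k * l2_nth (\<phi> *\<^sub>V e (\<gamma> @ [i])) (\<beta> @ \<gamma> @ [i])
          = complex_of_real (sqrt (b (\<beta> @ \<gamma>) / b (\<beta> @ \<gamma> @ [i])) * sqrt (b \<gamma> / b (\<beta> @ \<gamma>))) * symbol \<phi> \<beta>"
        using right_shift_nth[of i "\<phi> *\<^sub>V e \<gamma>" "\<beta> @ \<gamma>"] snoc by (simp add: nth scaleR_conv_of_real)
      also have "sqrt (b (\<beta> @ \<gamma>) / b (\<beta> @ \<gamma> @ [i])) * sqrt (b \<gamma> / b (\<beta> @ \<gamma>)) = k * sqrt (b (\<gamma> @ [i]) / b (\<beta> @ \<gamma> @ [i]))"
        unfolding k_def by (rule sqrt_ratio_aux) (rule b_pos)+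
      finally show ?thesis
        using k by simp
    qed
    have two: "l2_nth (\<phi> *\<^sub>V e (\<gamma> @ [i])) \<delta> = 0" if "\<delta> \<notin> range (\<lambda>\<beta>. \<beta> @ \<gamma> @ [i])" for \<delta>
    proof -
      have "l2_nth (right_shift i *\<^sub>V \<phi> *\<^sub>V e \<gamma>) \<delta> = 0"
      proof (cases "\<delta> \<in> range (\<lambda>\<alpha>. \<alpha> @ [i])")
        case True
        then obtain \<alpha> where \<delta>: "\<delta> = \<alpha> @ [i]" by blast
        have "\<alpha> \<notin> range (\<lambda>\<beta>. \<beta> @ \<gamma>)"
          using that by (auto simp: \<delta>)
        then show ?thesis
          using snoc by (simp add: \<delta> right_shift_nth)
      qed (rule right_shift_nth_0)
      then show ?thesis
        using nth[of \<delta>] k by simp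
    qed
    show ?case
      using one two by simp
  qed
  then show ?thesis
    by (simp add: entries_def)
qed

lemma basis_term: "entries \<phi> c \<Longrightarrow>
    c \<beta> *\<^sub>C (word_op W \<beta> *\<^sub>V e \<gamma>) = l2_single (\<beta> @ \<gamma>) (l2_nth (\<phi> *\<^sub>V e \<gamma>) (\<beta> @ \<gamma>))"
  by (rule l2_eqI) (simp add: entriesD word_op_W_basis l2_single.rep_eq scaleC_complex_def scaleR_conv_of_real)

lemma entries_has_sum_basis:
  assumes c: "entries \<phi> c"
  shows "((\<lambda>\<beta>. c \<beta> *\<^sub>C (word_op W \<beta> *\<^sub>V e \<gamma>)) has_sum \<phi> *\<^sub>V e \<gamma>) UNIV"
proof -
  let ?f = "\<lambda>\<delta>. l2_single \<delta> (l2_nth (\<phi> *\<^sub>V e \<gamma>) \<delta>)"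
  have inj: "inj (\<lambda>\<beta>. \<beta> @ \<gamma>)"
    by (rule injI) simp
  have "(?f has_sum \<phi> *\<^sub>V e \<gamma>) UNIV"
    by (rule l2_has_sum)
  then have "(?f has_sum \<phi> *\<^sub>V e \<gamma>) (range (\<lambda>\<beta>. \<beta> @ \<gamma>))"
    by (rule has_sum_cong_neutral[THEN iffD1, rotated -1]) (auto simp: entriesD0[OF c])
  then have "(?f \<circ> (\<lambda>\<beta>. \<beta> @ \<gamma>) has_sum \<phi> *\<^sub>V e \<gamma>) UNIV"
    by (simp only: has_sum_reindex[OF inj])
  then show ?thesis
    by (simp add: o_def basis_term[OF c])
qed

lemma entries_has_sum_poly:
  assumes c: "entries \<phi> c" and p: "p \<in> fock_polys"
  shows "((\<lambda>\<beta>. c \<beta> *\<^sub>C (word_op W \<beta> *\<^sub>V p)) has_sum \<phi> *\<^sub>V p) UNIV"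
proof -
  obtain F d where p: "p = (\<Sum>\<alpha>\<in>F. d \<alpha> *\<^sub>C e \<alpha>)"
    using p unfolding fock_polys_def fock_basis_single by blast
  have "((\<lambda>\<beta>. c \<beta> *\<^sub>C (word_op W \<beta> *\<^sub>V (\<Sum>\<alpha>\<in>F. d \<alpha> *\<^sub>C e \<alpha>))) has_sum \<phi> *\<^sub>V (\<Sum>\<alpha>\<in>F. d \<alpha> *\<^sub>C e \<alpha>)) UNIV"
  proof (induction F rule: infinite_finite_induct)
    case (insert \<alpha> F)
    have "((\<lambda>\<beta>. d \<alpha> *\<^sub>C c \<beta> *\<^sub>C (word_op W \<beta> *\<^sub>V e \<alpha>)) has_sum d \<alpha> *\<^sub>C (\<phi> *\<^sub>V e \<alpha>)) UNIV"
      using has_sum_bounded_linear[OF bounded_linear_scaleC entries_has_sum_basis[OF c], of "d \<alpha>" \<alpha>]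
      by (simp add: o_def)
    from has_sum_add[OF this insert.IH] show ?case
      using insert.hyps by (simp add: cop_add_right cop_scaleC_right scaleC_add_right scaleC_scaleC mult.commute)
  qed simp_all
  then show ?thesis by (simp add: p)
qed

section \<open>Fourier representations, matrix entries and the commutant\<close>

lemma fourier_rep_of_entries:
  assumes c: "entries \<phi> c"
  shows "fourier_rep b \<phi> c"
  unfolding fourier_rep_def
proof (intro conjI allI ballI)
  fix \<gamma> :: "'n list"
  have inj: "inj (\<lambda>\<beta>. \<beta> @ \<gamma>)"
    by (rule injI) simp
  have "(\<lambda>\<delta>. (norm (l2_nth (\<phi> *\<^sub>V e \<gamma>) \<delta>))\<^sup>2) summable_on range (\<lambda>\<beta>. \<beta> @ \<gamma>)"
    by (rule summable_on_subset_banach[OF l2_nth_summable]) simp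
  then have "((\<lambda>\<delta>. (norm (l2_nth (\<phi> *\<^sub>V e \<gamma>) \<delta>))\<^sup>2) \<circ> (\<lambda>\<beta>. \<beta> @ \<gamma>)) summable_on UNIV"
    by (simp only: summable_on_reindex[OF inj])
  moreover have "(norm (l2_nth (\<phi> *\<^sub>V e \<gamma>) (\<beta> @ \<gamma>)))\<^sup>2 = (cmod (c \<beta>))\<^sup>2 * (b \<gamma> / b (\<beta> @ \<gamma>))" for \<beta>
    using b_pos[of \<gamma>] b_pos[of "\<beta> @ \<gamma>"] by (simp add: entriesD[OF c] norm_mult power_mult_distrib)
  ultimately show "(\<lambda>\<beta>. (cmod (c \<beta>))\<^sup>2 * (b \<gamma> / b (\<beta> @ \<gamma>))) summable_on UNIV"
    by (simp add: o_def)
next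
  have eq: "(\<Sum>\<^sub>\<infinity>\<beta>. c \<beta> *\<^sub>C (word_op W \<beta> *\<^sub>V p)) = \<phi> *\<^sub>V p" if "p \<in> fock_polys" for p
    by (rule infsumI) (rule entries_has_sum_poly[OF c that])
  then show "\<phi> *\<^sub>V p = (\<Sum>\<^sub>\<infinity>\<beta>. c \<beta> *\<^sub>C (word_op W \<beta> *\<^sub>V p))" if "p \<in> fock_polys" for p
    using that by simp
  show "bdd_above {norm (\<Sum>\<^sub>\<infinity>\<beta>. c \<beta> *\<^sub>C (word_op W \<beta> *\<^sub>V p)) | p. p \<in> fock_polys \<and> norm p \<le> 1}"
  proof (rule bdd_aboveI)
    fix r assume "r \<in> {norm (\<Sum>\<^sub>\<infinity>\<beta>. c \<beta> *\<^sub>C (word_op W \<beta> *\<^sub>V p)) | p. p \<in> fock_polys \<and> norm p \<le> 1}"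
    then obtain p where p: "p \<in> fock_polys" "norm p \<le> 1" and r: "r = norm (\<Sum>\<^sub>\<infinity>\<beta>. c \<beta> *\<^sub>C (word_op W \<beta> *\<^sub>V p))"
      by blast
    have "r \<le> norm \<phi> * norm p"
      unfolding r eq[OF p(1)] by (rule cop_norm_bound)
    also have "\<dots> \<le> norm \<phi> * 1"
      using p(2) by (intro mult_left_mono) auto
    finally show "r \<le> norm \<phi>" by simp
  qed
qed

text \<open>\<open>infsum\<close> has the value 0 where the series does not converge, so
  unconditional convergence at each basis vector must be proved before entries can be read off. It
  follows from the square-summability clause, since the summands are orthogonal.\<close>

lemma entries_of_fourier_rep:
  assumes f: "fourier_rep b \<phi> c"
  shows "entries \<phi> c"
  unfolding entries_def
proof (intro allI)
  fix \<gamma>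
  let ?g = "\<lambda>\<beta>. c \<beta> *\<^sub>C (word_op W \<beta> *\<^sub>V e \<gamma>)"
  have g: "?g \<beta> = l2_single (\<beta> @ \<gamma>) (complex_of_real (sqrt (b \<gamma> / b (\<beta> @ \<gamma>))) * c \<beta>)" for \<beta>
    by (rule l2_eqI) (simp add: word_op_W_basis l2_single.rep_eq scaleC_complex_def scaleR_conv_of_real)
  have norm_g: "(norm (?g \<beta>))\<^sup>2 = (cmod (c \<beta>))\<^sup>2 * (b \<gamma> / b (\<beta> @ \<gamma>))" for \<beta>
    unfolding g using b_pos[of \<gamma>] b_pos[of "\<beta> @ \<gamma>"] by (simp add: norm_mult power_mult_distrib)
  have "?g summable_on UNIV"
  proof (rule summable_on_square_bound[where c = 1])
    fix F :: "'n list set" assume "finite F"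
    then have "(norm (\<Sum>\<beta>\<in>F. ?g \<beta>))\<^sup>2 = (\<Sum>\<beta>\<in>F. (norm (?g \<beta>))\<^sup>2)"
      by (rule norm_sq_sum_orthogonal) (simp add: g cinner_l2_single_left l2_single.rep_eq)
    then show "(norm (\<Sum>\<beta>\<in>F. ?g \<beta>))\<^sup>2 \<le> 1\<^sup>2 * (\<Sum>\<beta>\<in>F. (cmod (c \<beta>))\<^sup>2 * (b \<gamma> / b (\<beta> @ \<gamma>)))"
      by (simp add: norm_g)
  next
    show "(\<lambda>\<beta>. (cmod (c \<beta>))\<^sup>2 * (b \<gamma> / b (\<beta> @ \<gamma>))) summable_on UNIV"
      using f unfolding fourier_rep_def by blast
    show "0 \<le> (cmod (c \<beta>))\<^sup>2 * (b \<gamma> / b (\<beta> @ \<gamma>))" for \<beta>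
      using b_pos[of \<gamma>] b_pos[of "\<beta> @ \<gamma>"] by simp
  qed
  then have "(?g has_sum infsum ?g UNIV) UNIV"
    by (rule has_sum_infsum)
  moreover have "e \<gamma> \<in> fock_polys"
    unfolding fock_polys_def fock_basis_single
    by (rule CollectI) (intro exI[of _ "{\<gamma>}"] exI[of _ "\<lambda>_. 1"], simp add: scaleC_one)
  then have "\<phi> *\<^sub>V e \<gamma> = infsum ?g UNIV"
    using f unfolding fourier_rep_def by blast
  ultimately have hs0: "(?g has_sum \<phi> *\<^sub>V e \<gamma>) UNIV"
    by (simp only:)
  have hs: "((\<lambda>\<beta>. l2_nth (?g \<beta>) \<delta>) has_sum l2_nth (\<phi> *\<^sub>V e \<gamma>) \<delta>) UNIV" for \<delta>
    by (rule has_sum_bounded_linear[OF bounded_linear_l2_nth hs0])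
  have "l2_nth (\<phi> *\<^sub>V e \<gamma>) (\<beta> @ \<gamma>) = complex_of_real (sqrt (b \<gamma> / b (\<beta> @ \<gamma>))) * c \<beta>" for \<beta>
  proof -
    have "l2_nth (\<phi> *\<^sub>V e \<gamma>) (\<beta> @ \<gamma>) = (\<Sum>\<^sub>\<infinity>\<beta>'. l2_nth (?g \<beta>') (\<beta> @ \<gamma>))"
      using infsumI[OF hs[of "\<beta> @ \<gamma>"]] by simp
    also have "\<dots> = (\<Sum>\<^sub>\<infinity>\<beta>'\<in>{\<beta>}. l2_nth (?g \<beta>') (\<beta> @ \<gamma>))"
      by (rule infsum_cong_neutral) (auto simp: g l2_single.rep_eq)
    also have "\<dots> = complex_of_real (sqrt (b \<gamma> / b (\<beta> @ \<gamma>))) * c \<beta>"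
      by (simp add: g l2_single.rep_eq)
    finally show ?thesis .
  qed
  moreover have "l2_nth (\<phi> *\<^sub>V e \<gamma>) \<delta> = 0" if "\<delta> \<notin> range (\<lambda>\<beta>. \<beta> @ \<gamma>)" for \<delta>
  proof -
    have "l2_nth (\<phi> *\<^sub>V e \<gamma>) \<delta> = (\<Sum>\<^sub>\<infinity>\<beta>'. l2_nth (?g \<beta>') \<delta>)"
      using infsumI[OF hs[of \<delta>]] by simp
    also have "\<dots> = 0"
      by (rule infsum_0) (use that in \<open>auto simp: g l2_single.rep_eq\<close>)
    finally show ?thesis .
  qed
  ultimately show "(\<forall>\<beta>. l2_nth (\<phi> *\<^sub>V e \<gamma>) (\<beta> @ \<gamma>) = complex_of_real (sqrt (b \<gamma> / b (\<beta> @ \<gamma>))) * c \<beta>) \<and>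
      (\<forall>\<delta>. \<delta> \<notin> range (\<lambda>\<beta>. \<beta> @ \<gamma>) \<longrightarrow> l2_nth (\<phi> *\<^sub>V e \<gamma>) \<delta> = 0)"
    by simp
qed

lemma fourier_rep_iff: "fourier_rep b \<phi> c \<longleftrightarrow> entries \<phi> c"
  using fourier_rep_of_entries entries_of_fourier_rep by blast

lemma F_inf_iff_entries: "\<phi> \<in> F_inf b \<longleftrightarrow> entries \<phi> (symbol \<phi>)"
  using entries_symbol unfolding F_inf_def fourier_rep_iff by blast

text \<open>Sums, products and norm limits are immediate for a commutant, whereas for Fourier
  representations products would mean handling convolutions.\<close>

lemma F_inf_iff_commute: "\<phi> \<in> F_inf b \<longleftrightarrow> (\<forall>i. \<phi> o\<^sub>C right_shift i = right_shift i o\<^sub>C \<phi>)"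
  using entries_commute entries_of_commute F_inf_iff_entries by blast

lemma F_inf_entries: "\<phi> \<in> F_inf b \<Longrightarrow> entries \<phi> (symbol \<phi>)"
  by (simp add: F_inf_iff_entries)

lemma entries_F_inf: "entries \<phi> c \<Longrightarrow> \<phi> \<in> F_inf b"
  using entries_symbol F_inf_iff_entries by blast

lemma F_inf_add: "A \<in> F_inf b \<Longrightarrow> B \<in> F_inf b \<Longrightarrow> A + B \<in> F_inf b"
  by (simp add: F_inf_iff_commute cop_comp.add_left cop_comp.add_right)

lemma F_inf_scaleC: "A \<in> F_inf b \<Longrightarrow> k *\<^sub>C A \<in> F_inf b"
  using entries_scaleC F_inf_entries entries_F_inf by blast

lemma F_inf_comp: "A \<in> F_inf b \<Longrightarrow> B \<in> F_inf b \<Longrightarrow> A o\<^sub>C B \<in> F_inf b"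
  unfolding F_inf_iff_commute by (metis cop_comp_assoc)

lemma closed_F_inf: "closed (F_inf b)"
proof -
  have "F_inf b = (\<Inter>i. {\<phi>. \<phi> o\<^sub>C right_shift i = right_shift i o\<^sub>C \<phi>})"
    using F_inf_iff_commute by blast
  moreover have "closed {\<phi>. \<phi> o\<^sub>C right_shift i = right_shift i o\<^sub>C \<phi>}" for i
    by (intro closed_Collect_eq cop_comp.continuous_on continuous_on_const continuous_on_id)
  ultimately show ?thesis
    by (simp add: closed_INT)
qed

lemma id_cop_F_inf: "id_cop \<in> F_inf b"
  by (simp add: F_inf_iff_commute)

lemma word_op_F_inf: "word_op W \<alpha> \<in> F_inf b"
  by (rule entries_F_inf[OF entries_word_op])

lemma length_sum_F_inf: "length_sum u N c W \<in> F_inf b"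
  by (rule entries_F_inf[OF entries_length_sum])

lemma A_alg_subset_F_inf: "A_alg b \<subseteq> F_inf b"
proof -
  have "universal_model b $ i \<in> F_inf b" for i
    using word_op_F_inf[of "[i]"] by simp
  then show ?thesis
    unfolding A_alg_def
    by (intro Inter_lower CollectI conjI allI ballI closed_F_inf id_cop_F_inf F_inf_add F_inf_comp F_inf_scaleC)
qed

end

section \<open>Cesaro means in the algebra of the universal model\<close>

text \<open>Strong convergence by itself does not allow a moving argument; the uniform norm bound
  does.\<close>

lemma tendsto_cop_apply:
  assumes A: "\<And>x. (\<lambda>n. A n *\<^sub>V x) \<longlonglongrightarrow> L *\<^sub>V x" and K: "\<And>n. norm (A n) \<le> K" and x: "x \<longlonglongrightarrow> y"
  shows "(\<lambda>n. A n *\<^sub>V x n) \<longlonglongrightarrow> L *\<^sub>V y"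
proof -
  have "(\<lambda>n. A n *\<^sub>V (x n - y)) \<longlonglongrightarrow> 0"
  proof (rule Lim_null_comparison)
    have "norm (A n *\<^sub>V (x n - y)) \<le> K * norm (x n - y)" for n
      using cop_norm_bound[of "A n" "x n - y"] mult_right_mono[OF K[of n] norm_ge_zero[of "x n - y"]] by linarith
    then show "\<forall>\<^sub>F n in sequentially. norm (A n *\<^sub>V (x n - y)) \<le> K * norm (x n - y)"
      by simp
    have "(\<lambda>n. K * norm (x n - y)) \<longlonglongrightarrow> K * 0"
      using x by (intro tendsto_mult tendsto_const tendsto_norm_zero LIM_zero)
    then show "(\<lambda>n. K * norm (x n - y)) \<longlonglongrightarrow> 0" by simp
  qed
  from tendsto_add[OF this A[of y]] show ?thesis
    by (simp add: cop_diff_right)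
qed

context fock_weights
begin

lemma compress_nth:
  "l2_nth ((coord_proj S o\<^sub>C A o\<^sub>C coord_proj S) *\<^sub>V e \<gamma>) \<delta> = (if \<gamma> \<in> S \<and> \<delta> \<in> S then l2_nth (A *\<^sub>V e \<gamma>) \<delta> else 0)"
  by (simp add: coord_proj_single)

text \<open>Window m keeps the degrees from m - N to m. An entry from \<gamma> to \<beta> followed
  by \<gamma> survives exactly when |\<beta>| + |\<gamma>| <= m <= |\<gamma>| + N, that is in N + 1
  - |\<beta>| windows: the Fejer weight times N + 1. The cutoff at degree M keeps the range of m
  finite.\<close>

lemma cesaro_window:
  fixes M N :: nat
  assumes c: "entries \<phi> c"
  defines "L \<equiv> {\<alpha> :: 'n list. length \<alpha> \<le> M}"
  defines "Q \<equiv> \<lambda>m. coord_proj (L \<inter> {\<alpha>. length \<alpha> \<le> m \<and> m \<le> length \<alpha> + N}) :: 'n fock cop"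
  shows "coord_proj L o\<^sub>C cesaro N c W o\<^sub>C coord_proj L
    = (1 / (real N + 1)) *\<^sub>R (\<Sum>m\<le>M + N. Q m o\<^sub>C \<phi> o\<^sub>C Q m)"
proof (rule cop_eqI_basis, rule l2_eqI)
  fix \<gamma> \<delta>
  let ?win = "\<lambda>m. {\<alpha> :: 'n list. length \<alpha> \<le> m \<and> m \<le> length \<alpha> + N}"
  let ?I = "{m \<in> {..M + N}. \<gamma> \<in> L \<inter> ?win m \<and> \<delta> \<in> L \<inter> ?win m}"
  have ces: "entries (cesaro N c W) (\<lambda>\<beta>. if length \<beta> \<le> N then complex_of_real (1 - real (length \<beta>) / (real N + 1)) * c \<beta> else 0)"
    unfolding cesaro_def by (rule entries_length_sum)
  have "l2_nth (((1 / (real N + 1)) *\<^sub>R (\<Sum>m\<le>M + N. Q m o\<^sub>C \<phi> o\<^sub>C Q m)) *\<^sub>V e \<gamma>) \<delta>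
      = (1 / (real N + 1)) *\<^sub>R (\<Sum>m\<le>M + N. if \<gamma> \<in> L \<inter> ?win m \<and> \<delta> \<in> L \<inter> ?win m then l2_nth (\<phi> *\<^sub>V e \<gamma>) \<delta> else 0)"
    unfolding cop_apply_simps(5) scaleR_l2.rep_eq cop_sum_apply l2_nth_sum Q_def compress_nth ..
  also have "(\<Sum>m\<le>M + N. if \<gamma> \<in> L \<inter> ?win m \<and> \<delta> \<in> L \<inter> ?win m then l2_nth (\<phi> *\<^sub>V e \<gamma>) \<delta> else 0)
      = (\<Sum>m\<in>?I. l2_nth (\<phi> *\<^sub>V e \<gamma>) \<delta>)"
    by (rule sum.inter_filter[symmetric]) simp
  also have "\<dots> = of_nat (card ?I) * l2_nth (\<phi> *\<^sub>V e \<gamma>) \<delta>"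
    by (rule sum_constant)
  finally have rhs: "l2_nth (((1 / (real N + 1)) *\<^sub>R (\<Sum>m\<le>M + N. Q m o\<^sub>C \<phi> o\<^sub>C Q m)) *\<^sub>V e \<gamma>) \<delta>
      = (1 / (real N + 1)) *\<^sub>R (of_nat (card ?I) * l2_nth (\<phi> *\<^sub>V e \<gamma>) \<delta>)" .
  show "l2_nth ((coord_proj L o\<^sub>C cesaro N c W o\<^sub>C coord_proj L) *\<^sub>V e \<gamma>) \<delta>
      = l2_nth (((1 / (real N + 1)) *\<^sub>R (\<Sum>m\<le>M + N. Q m o\<^sub>C \<phi> o\<^sub>C Q m)) *\<^sub>V e \<gamma>) \<delta>"
  proof (cases "\<gamma> \<in> L \<and> \<delta> \<in> L")
    case False
    then have "?I = {}" by blast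
    then have card0: "card ?I = 0" by (simp only: card.empty)
    show ?thesis
      unfolding rhs card0 compress_nth using False by auto
  next
    case True
    show ?thesis
    proof (cases "\<delta> \<in> range (\<lambda>\<beta>. \<beta> @ \<gamma>)")
      case False
      then show ?thesis
        unfolding rhs compress_nth by (simp add: entriesD0[OF c] entriesD0[OF ces])
    next
      case suff: True
      then obtain \<beta> where \<delta>: "\<delta> = \<beta> @ \<gamma>" by blast
      have "?I = {length \<beta> + length \<gamma>..length \<gamma> + N}"
        using True unfolding \<delta> L_def by auto
      then have card: "card ?I = Suc (length \<gamma> + N) - (length \<beta> + length \<gamma>)"
        by simp
      show ?thesis
      proof (cases "length \<beta> \<le> N")
        case True
        have "real (card ?I) = real N + 1 - real (length \<beta>)"
          unfolding card using True by (simp add: of_nat_diff)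
        then have "(1 / (real N + 1)) * real (card ?I) = 1 - real (length \<beta>) / (real N + 1)"
          by (simp add: field_simps)
        moreover have "complex_of_real (1 / (real N + 1)) * of_nat (card ?I) = complex_of_real ((1 / (real N + 1)) * real (card ?I))"
          by simp
        ultimately have key: "complex_of_real (1 / (real N + 1)) * of_nat (card ?I) = complex_of_real (1 - real (length \<beta>) / (real N + 1))"
          by (simp only:)
        have scale: "(1 / (real N + 1)) *\<^sub>R (of_nat (card ?I) * z) = complex_of_real (1 - real (length \<beta>) / (real N + 1)) * z" for z
          by (simp only: scaleR_conv_of_real mult.assoc[symmetric] key)
        show ?thesis
          unfolding rhs compress_nth scale if_P[OF \<open>\<gamma> \<in> L \<and> \<delta> \<in> L\<close>]
          unfolding \<delta> entriesD[OF c] entriesD[OF ces] if_P[OF True]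
          by (rule mult.left_commute)
      next
        case False
        then have card0: "card ?I = 0" unfolding card by simp
        show ?thesis
          unfolding rhs card0 compress_nth using False
          unfolding \<delta> entriesD[OF ces] by simp
      qed
    qed
  qed
qed

text \<open>Each degree lies in at most N + 1 windows.\<close>

lemma window_norm_sum:
  fixes x :: "'n fock" and M N :: nat
  defines "L \<equiv> {\<alpha> :: 'n list. length \<alpha> \<le> M}"
  defines "Q \<equiv> \<lambda>m. coord_proj (L \<inter> {\<alpha>. length \<alpha> \<le> m \<and> m \<le> length \<alpha> + N}) :: 'n fock cop"
  shows "(\<Sum>m\<le>K. (norm (Q m *\<^sub>V x))\<^sup>2) \<le> (real N + 1) * (norm x)\<^sup>2"
proof -
  let ?win = "\<lambda>m. {\<alpha> :: 'n list. length \<alpha> \<le> m \<and> m \<le> length \<alpha> + N}"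
  have fin: "finite L" unfolding L_def by (rule finite_words_le)
  have "(norm (Q m *\<^sub>V x))\<^sup>2 = (\<Sum>\<alpha>\<in>L. if \<alpha> \<in> ?win m then (norm (l2_nth x \<alpha>))\<^sup>2 else 0)" for m
  proof -
    have "(norm (Q m *\<^sub>V x))\<^sup>2 = (\<Sum>\<alpha>\<in>L \<inter> ?win m. (norm (l2_nth x \<alpha>))\<^sup>2)"
      unfolding Q_def by (rule norm_sq_coord_proj_finite) (use fin in blast)
    then show ?thesis
      by (simp only: sum.inter_restrict[OF fin])
  qed
  then have "(\<Sum>m\<le>K. (norm (Q m *\<^sub>V x))\<^sup>2) = (\<Sum>m\<le>K. \<Sum>\<alpha>\<in>L. if \<alpha> \<in> ?win m then (norm (l2_nth x \<alpha>))\<^sup>2 else 0)"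
    by (simp only:)
  also have "\<dots> = (\<Sum>\<alpha>\<in>L. \<Sum>m\<le>K. if \<alpha> \<in> ?win m then (norm (l2_nth x \<alpha>))\<^sup>2 else 0)"
    by (rule sum.swap)
  also have "\<dots> \<le> (\<Sum>\<alpha>\<in>L. (real N + 1) * (norm (l2_nth x \<alpha>))\<^sup>2)"
  proof (rule sum_mono)
    fix \<alpha>
    have "(\<Sum>m\<le>K. if \<alpha> \<in> ?win m then (norm (l2_nth x \<alpha>))\<^sup>2 else 0) = (\<Sum>m\<in>{m \<in> {..K}. \<alpha> \<in> ?win m}. (norm (l2_nth x \<alpha>))\<^sup>2)"
      by (rule sum.inter_filter[symmetric]) simp
    also have "\<dots> = real (card {m \<in> {..K}. \<alpha> \<in> ?win m}) * (norm (l2_nth x \<alpha>))\<^sup>2"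
      by (rule sum_constant)
    also have "\<dots> \<le> (real N + 1) * (norm (l2_nth x \<alpha>))\<^sup>2"
    proof (rule mult_right_mono)
      have "card {m \<in> {..K}. \<alpha> \<in> ?win m} \<le> card {length \<alpha>..length \<alpha> + N}"
        by (rule card_mono) auto
      then show "real (card {m \<in> {..K}. \<alpha> \<in> ?win m}) \<le> real N + 1"
        by simp
    qed simp
    finally show "(\<Sum>m\<le>K. if \<alpha> \<in> ?win m then (norm (l2_nth x \<alpha>))\<^sup>2 else 0) \<le> (real N + 1) * (norm (l2_nth x \<alpha>))\<^sup>2" .
  qed
  also have "\<dots> \<le> (real N + 1) * (norm x)\<^sup>2"
    unfolding sum_distrib_left[symmetric] by (intro mult_left_mono sum_le_norm_l2_sq fin) simp
  finally show ?thesis .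
qed

(* The Fejer kernel is positive definite: the Schur multiplier (1 - |k - l|/(N + 1))\<^sub>+ is an average
   of compressions to windows of N + 1 consecutive degrees. *)
lemma cesaro_mat_bound:
  assumes A: "\<And>i j. i < m \<Longrightarrow> j < m \<Longrightarrow> A i j \<in> F_inf b" and m: "mat_bound m A c"
  shows "mat_bound m (\<lambda>i j. cesaro N (symbol (A i j)) W) c"
proof -
  define L where "L = (\<lambda>M. {\<alpha> :: 'n list. length \<alpha> \<le> M})"
  define Q where "Q = (\<lambda>M k. coord_proj (L M \<inter> {\<alpha>. length \<alpha> \<le> k \<and> k \<le> length \<alpha> + N}) :: 'n fock cop)"
  have c: "0 \<le> c" using m by (simp add: mat_bound_def)
  have "mat_bound m (\<lambda>i j. coord_proj (L M) o\<^sub>C cesaro N (symbol (A i j)) W o\<^sub>C coord_proj (L M)) c" for M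
  proof (rule mat_boundI_cinner[OF c])
    fix x y :: "nat \<Rightarrow> 'n fock"
    define X where "X = L2_set (\<lambda>j. norm (x j)) {..<m}"
    define Y where "Y = L2_set (\<lambda>j. norm (y j)) {..<m}"
    define \<xi> where "\<xi> = (\<lambda>k. L2_set (\<lambda>j. norm (Q M k *\<^sub>V x j)) {..<m})"
    define \<eta> where "\<eta> = (\<lambda>k. L2_set (\<lambda>j. norm (Q M k *\<^sub>V y j)) {..<m})"
    have win: "coord_proj (L M) o\<^sub>C cesaro N (symbol (A i j)) W o\<^sub>C coord_proj (L M)
        = (1 / (real N + 1)) *\<^sub>R (\<Sum>k\<le>M + N. Q M k o\<^sub>C A i j o\<^sub>C Q M k)" if "i < m" "j < m" for i j
      unfolding L_def Q_def by (rule cesaro_window[OF F_inf_entries[OF A[OF that]]])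
    have "(\<Sum>i<m. \<Sum>j<m. cinner ((coord_proj (L M) o\<^sub>C cesaro N (symbol (A i j)) W o\<^sub>C coord_proj (L M)) *\<^sub>V x j) (y i))
        = (\<Sum>i<m. \<Sum>j<m. complex_of_real (1 / (real N + 1)) * (\<Sum>k\<le>M + N. cinner (A i j *\<^sub>V Q M k *\<^sub>V x j) (Q M k *\<^sub>V y i)))"
    proof (intro sum.cong refl)
      fix i j assume "i \<in> {..<m}" "j \<in> {..<m}"
      then have ij: "i < m" "j < m" by auto
      show "cinner ((coord_proj (L M) o\<^sub>C cesaro N (symbol (A i j)) W o\<^sub>C coord_proj (L M)) *\<^sub>V x j) (y i)
          = complex_of_real (1 / (real N + 1)) * (\<Sum>k\<le>M + N. cinner (A i j *\<^sub>V Q M k *\<^sub>V x j) (Q M k *\<^sub>V y i))"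
        unfolding win[OF ij] cop_apply_simps(5,8) cop_sum_apply cinner_scaleR_left cinner.sum_left
        unfolding Q_def coord_proj_selfadjoint ..
    qed
    also have "\<dots> = complex_of_real (1 / (real N + 1)) * (\<Sum>k\<le>M + N. \<Sum>i<m. \<Sum>j<m. cinner (A i j *\<^sub>V Q M k *\<^sub>V x j) (Q M k *\<^sub>V y i))"
      by (simp only: sum_distrib_left[symmetric] sum.swap[of _ "{..<m}" "{..M + N}"])
    finally have "Re (\<Sum>i<m. \<Sum>j<m. cinner ((coord_proj (L M) o\<^sub>C cesaro N (symbol (A i j)) W o\<^sub>C coord_proj (L M)) *\<^sub>V x j) (y i))
        = (1 / (real N + 1)) * (\<Sum>k\<le>M + N. Re (\<Sum>i<m. \<Sum>j<m. cinner (A i j *\<^sub>V Q M k *\<^sub>V x j) (Q M k *\<^sub>V y i)))"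
      by (simp only: Re_complex_of_real Im_complex_of_real times_complex.sel Re_sum mult_zero_left diff_zero)
    also have "\<dots> \<le> (1 / (real N + 1)) * (\<Sum>k\<le>M + N. c * \<xi> k * \<eta> k)"
      unfolding \<xi>_def \<eta>_def by (intro mult_left_mono sum_mono mat_boundD_cinner[OF m]) simp
    also have "(\<Sum>k\<le>M + N. c * \<xi> k * \<eta> k) = c * (\<Sum>k\<le>M + N. \<bar>\<xi> k\<bar> * \<bar>\<eta> k\<bar>)"
      by (simp add: sum_distrib_left mult.assoc \<xi>_def \<eta>_def)
    also have "(1 / (real N + 1)) * (c * (\<Sum>k\<le>M + N. \<bar>\<xi> k\<bar> * \<bar>\<eta> k\<bar>))
        \<le> (1 / (real N + 1)) * (c * (L2_set \<xi> {..M + N} * L2_set \<eta> {..M + N}))"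
      by (intro mult_left_mono c L2_set_mult_ineq) simp
    \<comment> \<open>Each of the two square sums over windows contributes sqrt(N + 1); together
      they cancel the averaging factor.\<close>
    also have "\<dots> \<le> (1 / (real N + 1)) * (c * ((sqrt (real N + 1) * X) * (sqrt (real N + 1) * Y)))"
    proof -
      have L2: "L2_set (\<lambda>k. L2_set (\<lambda>j. norm (Q M k *\<^sub>V z j)) {..<m}) {..M + N} \<le> sqrt (real N + 1) * L2_set (\<lambda>j. norm (z j)) {..<m}"
        for z :: "nat \<Rightarrow> 'n fock"
      proof -
        have "(\<Sum>k\<le>M + N. (L2_set (\<lambda>j. norm (Q M k *\<^sub>V z j)) {..<m})\<^sup>2) = (\<Sum>k\<le>M + N. \<Sum>j<m. (norm (Q M k *\<^sub>V z j))\<^sup>2)"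
          by (simp add: L2_set_def sum_nonneg)
        also have "\<dots> = (\<Sum>j<m. \<Sum>k\<le>M + N. (norm (Q M k *\<^sub>V z j))\<^sup>2)"
          by (rule sum.swap)
        also have "\<dots> \<le> (\<Sum>j<m. (real N + 1) * (norm (z j))\<^sup>2)"
          unfolding Q_def L_def by (intro sum_mono window_norm_sum)
        finally have "sqrt (\<Sum>k\<le>M + N. (L2_set (\<lambda>j. norm (Q M k *\<^sub>V z j)) {..<m})\<^sup>2) \<le> sqrt ((real N + 1) * (\<Sum>j<m. (norm (z j))\<^sup>2))"
          unfolding sum_distrib_left[symmetric] by (rule real_sqrt_le_mono)
        then show ?thesis
          unfolding L2_set_def[of _ "{..M + N}"] L2_set_def[of "\<lambda>j. norm (z j)"] by (simp only: real_sqrt_mult)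
      qed
      show ?thesis
        unfolding \<xi>_def \<eta>_def X_def Y_def
        by (intro mult_left_mono mult_mono L2 c mult_nonneg_nonneg L2_set_nonneg) auto
    qed
    also have "\<dots> = c * X * Y"
    proof -
      have "(1 / (real N + 1)) * (c * ((sqrt (real N + 1) * X) * (sqrt (real N + 1) * Y)))
          = (1 / (real N + 1)) * (sqrt (real N + 1) * sqrt (real N + 1)) * (c * X * Y)"
        by (simp only: mult_ac)
      also have "(1 / (real N + 1)) * (sqrt (real N + 1) * sqrt (real N + 1)) = 1"
        by simp
      finally show ?thesis by simp
    qed
    finally show "Re (\<Sum>i<m. \<Sum>j<m. cinner ((coord_proj (L M) o\<^sub>C cesaro N (symbol (A i j)) W o\<^sub>C coord_proj (L M)) *\<^sub>V x j) (y i))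
        \<le> c * L2_set (\<lambda>j. norm (x j)) {..<m} * L2_set (\<lambda>i. norm (y i)) {..<m}"
      unfolding X_def Y_def .
  qed
  \<comment> \<open>The cutoff at degree M tends strongly to the identity, and the bound does not
    depend on M.\<close>
  then show ?thesis
  proof (rule mat_bound_pointwise_limit)
    have ev: "\<forall>\<^sub>F n in sequentially. i \<in> L n" for i
      unfolding L_def by (simp add: eventually_ge_at_top)
    have P: "(\<lambda>M. coord_proj (L M) *\<^sub>V x) \<longlonglongrightarrow> id_cop *\<^sub>V x" for x :: "'n fock"
      using coord_proj_tendsto[OF ev, of x] by simp
    fix i j and x :: "'n fock"
    have "(\<lambda>M. coord_proj (L M) *\<^sub>V (cesaro N (symbol (A i j)) W *\<^sub>V coord_proj (L M) *\<^sub>V x)) \<longlonglongrightarrow>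
        id_cop *\<^sub>V (cesaro N (symbol (A i j)) W *\<^sub>V id_cop *\<^sub>V x)"
      by (rule tendsto_cop_apply[OF P norm_coord_proj_le]) (rule cop_tendsto[OF P])
    then show "(\<lambda>M. (coord_proj (L M) o\<^sub>C cesaro N (symbol (A i j)) W o\<^sub>C coord_proj (L M)) *\<^sub>V x) \<longlonglongrightarrow>
        cesaro N (symbol (A i j)) W *\<^sub>V x"
      by simp
  qed simp
qed

lemma cesaro_norm_le:
  assumes "A \<in> F_inf b"
  shows "norm (cesaro N (symbol A) W) \<le> norm A"
proof -
  have "mat_bound 1 (\<lambda>i j. cesaro N (symbol A) W) (norm A)"
    by (rule cesaro_mat_bound[OF assms], rule mat_bound_one_iff[THEN iffD2]) simp
  then show ?thesis
    using mat_bound_one_iff by blast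
qed

lemma cesaro_apply: "cesaro N c X *\<^sub>V x = (\<Sum>s\<le>N. (1 - real s / (real N + 1)) *\<^sub>R ((\<Sum>\<alpha>\<in>words s. c \<alpha> *\<^sub>C word_op X \<alpha>) *\<^sub>V x))"
  by (simp add: cesaro_def length_sum_def cop_sum_apply)

text \<open>On a basis vector the partial sums are truncations of the column of \<open>A\<close> by
  degree, which converge in norm, and averaging keeps the limit. The norm bound on the means extends
  this to all vectors.\<close>

lemma cesaro_tendsto:
  assumes A: "A \<in> F_inf b"
  shows "(\<lambda>N. cesaro N (symbol A) W *\<^sub>V x) \<longlonglongrightarrow> A *\<^sub>V x"
proof (rule pointwise_convergence_l2)
  show "norm (cesaro N (symbol A) W) \<le> norm A" for N
    by (rule cesaro_norm_le[OF A])
  fix \<gamma> and h :: complex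
  have partial: "(\<Sum>s\<le>N. (\<Sum>\<alpha>\<in>words s. symbol A \<alpha> *\<^sub>C word_op W \<alpha>) *\<^sub>V e \<gamma>)
      = coord_proj {\<delta>. length \<delta> \<le> N + length \<gamma>} *\<^sub>V (A *\<^sub>V e \<gamma>)" for N
  proof -
    have "(\<Sum>s\<le>N. (\<Sum>\<alpha>\<in>words s. symbol A \<alpha> *\<^sub>C word_op W \<alpha>) *\<^sub>V e \<gamma>) = length_sum (\<lambda>_. 1) N (symbol A) W *\<^sub>V e \<gamma>"
      by (simp add: length_sum_def cop_sum_apply)
    also have "\<dots> = coord_proj {\<delta>. length \<delta> \<le> N + length \<gamma>} *\<^sub>V (A *\<^sub>V e \<gamma>)"
    proof (rule l2_eqI)
      fix \<delta>
      show "l2_nth (length_sum (\<lambda>_. 1) N (symbol A) W *\<^sub>V e \<gamma>) \<delta>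
          = l2_nth (coord_proj {\<delta>. length \<delta> \<le> N + length \<gamma>} *\<^sub>V (A *\<^sub>V e \<gamma>)) \<delta>"
      proof (cases "\<delta> \<in> range (\<lambda>\<beta>. \<beta> @ \<gamma>)")
        case True
        then obtain \<beta> where "\<delta> = \<beta> @ \<gamma>" by blast
        then show ?thesis
          by (simp add: entriesD[OF entries_length_sum] entriesD[OF F_inf_entries[OF A]])
      next
        case False
        then show ?thesis
          by (simp add: entriesD0[OF entries_length_sum] entriesD0[OF F_inf_entries[OF A]])
      qed
    qed
    finally show ?thesis .
  qed
  have "\<forall>\<^sub>F N in sequentially. \<delta> \<in> {\<delta>. length \<delta> \<le> N + length \<gamma>}" for \<delta> :: "'n list"
    by (rule eventually_mono[OF eventually_ge_at_top[of "length \<delta>"]]) simp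
  from coord_proj_tendsto[OF this, of "A *\<^sub>V e \<gamma>"]
  have "(\<lambda>N. \<Sum>s\<le>N. (\<Sum>\<alpha>\<in>words s. symbol A \<alpha> *\<^sub>C word_op W \<alpha>) *\<^sub>V e \<gamma>) \<longlonglongrightarrow> A *\<^sub>V e \<gamma>"
    unfolding partial .
  from cesaro_mean_tendsto[OF this] have "(\<lambda>N. cesaro N (symbol A) W *\<^sub>V e \<gamma>) \<longlonglongrightarrow> A *\<^sub>V e \<gamma>"
    unfolding cesaro_apply .
  from bounded_linear.tendsto[OF bounded_linear_scaleC this, of h]
  have "(\<lambda>N. cesaro N (symbol A) W *\<^sub>V (h *\<^sub>C e \<gamma>)) \<longlonglongrightarrow> A *\<^sub>V (h *\<^sub>C e \<gamma>)"
    by (simp only: cop_scaleC_right)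
  then show "(\<lambda>N. cesaro N (symbol A) W *\<^sub>V l2_single \<gamma> h) \<longlonglongrightarrow> A *\<^sub>V l2_single \<gamma> h"
    by (simp only: l2_single_one_scaleC)
qed

end

section \<open>Berezin kernels and the von Neumann inequality\<close>

text \<open>Links limits along word length, as in the definition of the domain, with unconditional
  sums over all words.\<close>

lemma filterlim_words_le:
  "filterlim (\<lambda>k. {\<alpha> :: 'n :: finite list. length \<alpha> \<le> k}) (finite_subsets_at_top UNIV) sequentially"
  unfolding filterlim_finite_subsets_at_top
proof (intro allI impI, elim conjE)
  fix X :: "'n list set" assume "finite X"
  then obtain K where K: "\<And>\<alpha>. \<alpha> \<in> X \<Longrightarrow> length \<alpha> \<le> K"
    using finite_nat_set_iff_bounded_le[of "length ` X"] by auto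
  show "\<forall>\<^sub>F k in sequentially. finite {\<alpha> :: 'n list. length \<alpha> \<le> k} \<and> X \<subseteq> {\<alpha>. length \<alpha> \<le> k} \<and> {\<alpha>. length \<alpha> \<le> k} \<subseteq> UNIV"
    by (rule eventually_mono[OF eventually_ge_at_top[of K]]) (use K in \<open>auto simp: finite_words_le intro: order_trans\<close>)
qed

lemma sum_words_le: "(\<Sum>p\<le>k. \<Sum>\<alpha>\<in>words p. f \<alpha>) = (\<Sum>\<alpha> :: 'n :: finite list | length \<alpha> \<le> k. f \<alpha>)"
proof -
  have "(\<Sum>p\<le>k. \<Sum>\<alpha>\<in>words p. f \<alpha>) = (\<Sum>\<alpha>\<in>(\<Union>p\<in>{..k}. words p). f \<alpha>)"
    by (rule sum.UNION_disjoint[symmetric]) (auto simp: finite_words, auto simp: words_def)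
  then show ?thesis
    by (simp only: words_Union)
qed

lemma adj_norm_le: "norm (adj A) \<le> norm A"
proof (rule cop_norm_leI)
  fix y
  have "(norm (adj A *\<^sub>V y))\<^sup>2 = Re (cinner (adj A *\<^sub>V y) (adj A *\<^sub>V y))"
    by (simp only: Re_cinner_self)
  also have "\<dots> = Re (cinner (A *\<^sub>V adj A *\<^sub>V y) y)"
    by (simp only: cinner_adj_right)
  also have "\<dots> \<le> norm (A *\<^sub>V adj A *\<^sub>V y) * norm y"
    using complex_Re_le_cmod norm_cinner_le order_trans by blast
  also have "\<dots> \<le> (norm A * norm (adj A *\<^sub>V y)) * norm y"
    by (intro mult_right_mono cop_norm_bound) simp
  finally have "norm (adj A *\<^sub>V y) * norm (adj A *\<^sub>V y) \<le> (norm A * norm y) * norm (adj A *\<^sub>V y)"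
    by (simp only: power2_eq_square mult_ac)
  then show "norm (adj A *\<^sub>V y) \<le> norm A * norm y"
    by (cases "norm (adj A *\<^sub>V y) = 0") auto
qed simp

lemma pointwise_convergent_dense:
  fixes A :: "nat \<Rightarrow> ('a :: complex_inner, 'b :: chilbert_space) cblinfun"
  assumes K: "\<And>n. norm (A n) \<le> K" and D: "closure D = UNIV" and conv: "\<And>x. x \<in> D \<Longrightarrow> convergent (\<lambda>n. A n *\<^sub>V x)"
  shows "convergent (\<lambda>n. A n *\<^sub>V x)"
proof -
  have K0: "0 \<le> K"
    using K[of 0] norm_ge_zero order_trans by blast
  have "Cauchy (\<lambda>n. A n *\<^sub>V x)"
  proof (rule CauchyI)
    fix r :: real assume "r > 0"
    have "x \<in> closure D" using D by simp
    moreover have "r / (4 * (K + 1)) > 0"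
      using \<open>r > 0\<close> K0 by simp
    ultimately obtain y where y: "y \<in> D" "dist y x < r / (4 * (K + 1))"
      using closure_approachable by blast
    have "Cauchy (\<lambda>n. A n *\<^sub>V y)"
      using conv[OF y(1)] by (rule convergent_Cauchy)
    then obtain M where M: "\<And>m n. m \<ge> M \<Longrightarrow> n \<ge> M \<Longrightarrow> norm (A m *\<^sub>V y - A n *\<^sub>V y) < r / 2"
      using CauchyD[of _ "r / 2"] \<open>r > 0\<close> by (metis half_gt_zero)
    have small: "norm (A n *\<^sub>V (x - y)) \<le> r / 4" for n
    proof -
      have "norm (A n *\<^sub>V (x - y)) \<le> norm (A n) * norm (x - y)"
        by (rule cop_norm_bound)
      also have "\<dots> \<le> (K + 1) * (r / (4 * (K + 1)))"
        using K[of n] y(2) K0 by (intro mult_mono) (auto simp: dist_norm norm_minus_commute)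
      also have "\<dots> = r / 4"
        using K0 by (simp add: field_simps)
      finally show ?thesis .
    qed
    have "norm (A m *\<^sub>V x - A n *\<^sub>V x) < r" if "m \<ge> M" "n \<ge> M" for m n
    proof -
      have "A m *\<^sub>V x - A n *\<^sub>V x = (A m *\<^sub>V y - A n *\<^sub>V y) + (A m *\<^sub>V (x - y) - A n *\<^sub>V (x - y))"
        by (simp add: cop_diff_right)
      then have "norm (A m *\<^sub>V x - A n *\<^sub>V x) \<le> norm (A m *\<^sub>V y - A n *\<^sub>V y) + norm (A m *\<^sub>V (x - y) - A n *\<^sub>V (x - y))"
        by (metis norm_triangle_ineq)
      also have "\<dots> \<le> norm (A m *\<^sub>V y - A n *\<^sub>V y) + (r / 4 + r / 4)"
        by (intro add_left_mono order_trans[OF norm_triangle_ineq4] add_mono small)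
      also have "\<dots> < r"
        using M[OF that] by linarith
      finally show ?thesis .
    qed
    then show "\<exists>M. \<forall>m\<ge>M. \<forall>n\<ge>M. norm (A m *\<^sub>V x - A n *\<^sub>V x) < r"
      by blast
  qed
  then show ?thesis
    by (rule Cauchy_convergent)
qed

context fock_weights
begin

text \<open>Splitting \<open>D\<close> into its square roots turns each term of the series in the
  domain condition into the squared norm of a coordinate of the Berezin kernel.\<close>

lemma berezin_quadratic:
  assumes D: "cop_pos D"
  shows "cinner ((\<Sum>p\<le>k. \<Sum>\<alpha>\<in>words p. b \<alpha> *\<^sub>R (word_op X \<alpha> o\<^sub>C D o\<^sub>C adj (word_op X \<alpha>))) *\<^sub>V h) h
    = complex_of_real (\<Sum>\<alpha> | length \<alpha> \<le> k. (norm (sqrt (b \<alpha>) *\<^sub>R (cop_sqrt D *\<^sub>V adj (word_op X \<alpha>) *\<^sub>V h)))\<^sup>2)"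
proof -
  have "cinner ((b \<alpha> *\<^sub>R (word_op X \<alpha> o\<^sub>C D o\<^sub>C adj (word_op X \<alpha>))) *\<^sub>V h) h
      = complex_of_real ((norm (sqrt (b \<alpha>) *\<^sub>R (cop_sqrt D *\<^sub>V adj (word_op X \<alpha>) *\<^sub>V h)))\<^sup>2)" for \<alpha>
  proof -
    let ?v = "adj (word_op X \<alpha>) *\<^sub>V h"
    have "cinner (word_op X \<alpha> *\<^sub>V D *\<^sub>V ?v) h = cinner (D *\<^sub>V ?v) ?v"
      by (simp only: cinner_adj_right)
    also have "cinner (D *\<^sub>V ?v) ?v = cinner (cop_sqrt D *\<^sub>V cop_sqrt D *\<^sub>V ?v) ?v"
      using arg_cong[OF cop_sqrt_square[OF D], of "\<lambda>A. A *\<^sub>V ?v"] by simp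
    also have "\<dots> = complex_of_real ((norm (cop_sqrt D *\<^sub>V ?v))\<^sup>2)"
      by (simp only: cop_pos_selfadjoint[OF cop_sqrt_pos[OF D]] cinner_norm_sq)
    finally show ?thesis
      using b_pos[of \<alpha>] by (simp add: cinner_scaleR_left power_mult_distrib)
  qed
  then show ?thesis
    unfolding sum_words_le cop_sum_apply cinner.sum_left of_real_sum by (simp only:)
qed

text \<open>The squared coordinates, summed along word length, tend to <S h, h> <= (norm h)^2; being
  nonnegative, any finite family of them obeys the same bound. So a contraction with these
  coordinates exists, which gives the definite description a value.\<close>

lemma berezin_kernel_properties:
  fixes X :: "('h :: chilbert_space cop) ^ 'n"
  assumes X: "X \<in> nc_domain b"
  shows berezin_kernel_nth: "l2_nth (berezin_kernel b X *\<^sub>V h) \<alpha> = sqrt (b \<alpha>) *\<^sub>R (cop_sqrt (Delta b X) *\<^sub>V adj (word_op X \<alpha>) *\<^sub>V h)"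
    and berezin_kernel_norm_le: "norm (berezin_kernel b X) \<le> 1"
proof -
  let ?D = "Delta b X"
  define f where "f = (\<lambda>h \<alpha>. sqrt (b \<alpha>) *\<^sub>R (cop_sqrt ?D *\<^sub>V adj (word_op X \<alpha>) *\<^sub>V h))"
  have D: "cop_pos ?D"
    using X unfolding nc_domain_def by blast
  obtain S where S: "wot_word_sums (\<lambda>\<alpha>. b \<alpha> *\<^sub>R (word_op X \<alpha> o\<^sub>C ?D o\<^sub>C adj (word_op X \<alpha>))) S" "cop_pos (id_cop - S)"
    using X unfolding nc_domain_def by blast
  have lim: "(\<lambda>k. \<Sum>\<alpha> | length \<alpha> \<le> k. (norm (f h \<alpha>))\<^sup>2) \<longlonglongrightarrow> Re (cinner (S *\<^sub>V h) h)" for h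
  proof -
    have "(\<lambda>k. cinner ((\<Sum>p\<le>k. \<Sum>\<alpha>\<in>words p. b \<alpha> *\<^sub>R (word_op X \<alpha> o\<^sub>C ?D o\<^sub>C adj (word_op X \<alpha>))) *\<^sub>V h) h) \<longlonglongrightarrow> cinner (S *\<^sub>V h) h"
      using S(1) unfolding wot_word_sums_def wot_tendsto_def by blast
    from tendsto_Re[OF this] show ?thesis
      unfolding berezin_quadratic[OF D] f_def by (simp only: Re_complex_of_real)
  qed
  have le: "(\<Sum>\<alpha>\<in>F. (norm (f h \<alpha>))\<^sup>2) \<le> (norm h)\<^sup>2" if fin: "finite F" for F h
  proof -
    have "(\<Sum>\<alpha>\<in>F. (norm (f h \<alpha>))\<^sup>2) \<le> Re (cinner (S *\<^sub>V h) h)"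
    proof (rule tendsto_lowerbound[OF lim])
      obtain K where K: "\<And>\<alpha>. \<alpha> \<in> F \<Longrightarrow> length \<alpha> \<le> K"
        using fin finite_nat_set_iff_bounded_le[of "length ` F"] by auto
      have "(\<Sum>\<alpha>\<in>F. (norm (f h \<alpha>))\<^sup>2) \<le> (\<Sum>\<alpha> | length \<alpha> \<le> k. (norm (f h \<alpha>))\<^sup>2)" if "k \<ge> K" for k
        by (rule sum_mono2[OF finite_words_le]) (use K that in \<open>auto intro: order_trans\<close>)
      then show "\<forall>\<^sub>F k in sequentially. (\<Sum>\<alpha>\<in>F. (norm (f h \<alpha>))\<^sup>2) \<le> (\<Sum>\<alpha> | length \<alpha> \<le> k. (norm (f h \<alpha>))\<^sup>2)"
        by (rule eventually_sequentiallyI)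
    qed simp
    moreover have "0 \<le> Re (cinner ((id_cop - S) *\<^sub>V h) h)"
      by (rule cop_pos_Re[OF S(2)])
    ultimately show ?thesis
      by (simp add: cinner_diff_left Re_cinner_self)
  qed
  have "\<exists>g. l2_nth g = f h \<and> norm g \<le> norm h" for h
    by (rule l2_from_bound[of "f h" "norm h"]) (rule le, assumption, simp, blast)
  then obtain p where p: "\<And>h. l2_nth (p h) = f h" "\<And>h. norm (p h) \<le> norm h"
    by metis
  have p_add: "p (x + y) = p x + p y" for x y
    by (rule l2_eqI) (simp add: p f_def cop_add_right scaleR_add_right)
  have p_scale: "p (c *\<^sub>C x) = c *\<^sub>C p x" for c x
    by (rule l2_eqI) (simp add: p f_def cop_scaleC_right scaleC_scaleR_commute)
  obtain K where K: "\<And>h. K *\<^sub>V h = p h"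
    using cop_exists[of p 1, OF p_add p_scale] p(2) by auto
  have summand: "sqrt (b \<alpha>) *\<^sub>R (fock_basis \<alpha> \<otimes>\<^sub>l (cop_sqrt ?D *\<^sub>V adj (word_op X \<alpha>) *\<^sub>V h)) = l2_single \<alpha> (l2_nth (K *\<^sub>V h) \<alpha>)" for \<alpha> h
    unfolding fock_basis_single l2_single_one_tensor
    by (rule l2_eqI) (simp add: K p f_def l2_single.rep_eq)
  have "berezin_kernel b X = K"
    unfolding berezin_kernel_def summand
  proof (rule the_equality)
    show "\<forall>h. ((\<lambda>\<alpha>. l2_single \<alpha> (l2_nth (K *\<^sub>V h) \<alpha>)) has_sum K *\<^sub>V h) UNIV"
      by (intro allI l2_has_sum)
    fix K' assume K': "\<forall>h. ((\<lambda>\<alpha>. l2_single \<alpha> (l2_nth (K *\<^sub>V h) \<alpha>)) has_sum K' *\<^sub>V h) UNIV"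
    show "K' = K"
      by (rule cblinfun_eqI) (rule has_sum_unique[OF K'[rule_format] l2_has_sum])
  qed
  then show "l2_nth (berezin_kernel b X *\<^sub>V h) \<alpha> = sqrt (b \<alpha>) *\<^sub>R (cop_sqrt (Delta b X) *\<^sub>V adj (word_op X \<alpha>) *\<^sub>V h)"
    by (simp add: K p f_def)
  show "norm (berezin_kernel b X) \<le> 1"
    unfolding \<open>berezin_kernel b X = K\<close> by (rule cop_norm_leI) (simp_all add: K p(2))
qed

text \<open>Purity says that the squared coordinates of K h sum to (norm h)^2, so K* K has the
  quadratic form of the identity, and over the complex numbers the form determines the
  operator.\<close>

lemma berezin_kernel_isometry:
  fixes X :: "('h :: chilbert_space cop) ^ 'n"
  assumes X: "X \<in> nc_domain_pure b"
  shows "adj (berezin_kernel b X) o\<^sub>C berezin_kernel b X = id_cop"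
proof -
  let ?K = "berezin_kernel b X"
  have dom: "X \<in> nc_domain b" using X by (simp add: nc_domain_pure_def)
  have D: "cop_pos (Delta b X)"
    using dom unfolding nc_domain_def by blast
  have pure: "wot_word_sums (\<lambda>\<alpha>. b \<alpha> *\<^sub>R (word_op X \<alpha> o\<^sub>C Delta b X o\<^sub>C adj (word_op X \<alpha>))) id_cop"
    using X by (simp add: nc_domain_pure_def)
  have "cinner ((adj ?K o\<^sub>C ?K - id_cop) *\<^sub>V h) h = 0" for h
  proof -
    have "(\<lambda>k. cinner ((\<Sum>p\<le>k. \<Sum>\<alpha>\<in>words p. b \<alpha> *\<^sub>R (word_op X \<alpha> o\<^sub>C Delta b X o\<^sub>C adj (word_op X \<alpha>))) *\<^sub>V h) h) \<longlonglongrightarrow> cinner (id_cop *\<^sub>V h) h"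
      using pure unfolding wot_word_sums_def wot_tendsto_def by blast
    then have "(\<lambda>k. complex_of_real (\<Sum>\<alpha> | length \<alpha> \<le> k. (norm (l2_nth (?K *\<^sub>V h) \<alpha>))\<^sup>2)) \<longlonglongrightarrow> cinner h h"
      unfolding berezin_quadratic[OF D] berezin_kernel_nth[OF dom] cop_apply_simps(7) .
    then have 1: "(\<lambda>k. \<Sum>\<alpha> | length \<alpha> \<le> k. (norm (l2_nth (?K *\<^sub>V h) \<alpha>))\<^sup>2) \<longlonglongrightarrow> (norm h)\<^sup>2"
      unfolding cinner_norm_sq by (simp only: tendsto_of_real_iff)
    have "((\<lambda>\<alpha>. (norm (l2_nth (?K *\<^sub>V h) \<alpha>))\<^sup>2) has_sum (norm (?K *\<^sub>V h))\<^sup>2) UNIV"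
      unfolding norm_l2_sq by (rule has_sum_infsum[OF l2_nth_summable])
    then have 2: "(\<lambda>k. \<Sum>\<alpha> | length \<alpha> \<le> k. (norm (l2_nth (?K *\<^sub>V h) \<alpha>))\<^sup>2) \<longlonglongrightarrow> (norm (?K *\<^sub>V h))\<^sup>2"
      unfolding has_sum_def by (rule filterlim_compose[OF _ filterlim_words_le])
    have "(norm (?K *\<^sub>V h))\<^sup>2 = (norm h)\<^sup>2"
      by (rule LIMSEQ_unique[OF 2 1])
    then show ?thesis
      by (simp add: cinner_diff_left cinner_adj_left cinner_norm_sq)
  qed
  then have "adj ?K o\<^sub>C ?K - id_cop = 0"
    by (rule cop_zeroI_quadratic)
  then show ?thesis by simp
qed

lemma adj_berezin_single:
  fixes X :: "('h :: chilbert_space cop) ^ 'n"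
  assumes X: "X \<in> nc_domain b"
  shows "adj (berezin_kernel b X) *\<^sub>V l2_single \<alpha> h = sqrt (b \<alpha>) *\<^sub>R (word_op X \<alpha> *\<^sub>V cop_sqrt (Delta b X) *\<^sub>V h)"
proof (rule cinner_eqI)
  fix y
  have D: "cop_pos (Delta b X)"
    using X unfolding nc_domain_def by blast
  have "cinner (adj (berezin_kernel b X) *\<^sub>V l2_single \<alpha> h) y = cinner h (sqrt (b \<alpha>) *\<^sub>R (cop_sqrt (Delta b X) *\<^sub>V adj (word_op X \<alpha>) *\<^sub>V y))"
    by (simp add: cinner_adj_left cinner_l2_single_left berezin_kernel_nth[OF X])
  also have "\<dots> = sqrt (b \<alpha>) * cinner (word_op X \<alpha> *\<^sub>V cop_sqrt (Delta b X) *\<^sub>V h) y"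
    by (simp add: cinner_scaleR_right cop_pos_selfadjoint[OF cop_sqrt_pos[OF D], symmetric] cinner_adj_right)
  finally show "cinner (adj (berezin_kernel b X) *\<^sub>V l2_single \<alpha> h) y = cinner (sqrt (b \<alpha>) *\<^sub>R (word_op X \<alpha> *\<^sub>V cop_sqrt (Delta b X) *\<^sub>V h)) y"
    by (simp add: cinner_scaleR_left)
qed

text \<open>On single coordinates the weight of the model shift times the factor sqrt(b) of the
  kernel at the longer word gives sqrt(b \<alpha>), the factor at the original word.\<close>

lemma berezin_intertwine_word:
  fixes X :: "('h :: chilbert_space cop) ^ 'n"
  assumes X: "X \<in> nc_domain b"
  shows "adj (berezin_kernel b X) o\<^sub>C cop_amplify (word_op W \<beta>) = word_op X \<beta> o\<^sub>C adj (berezin_kernel b X)"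
proof (rule cop_eqI_l2_single)
  fix \<alpha> and h :: 'h
  have word_append: "word_op X (\<beta> @ \<alpha>) = word_op X \<beta> o\<^sub>C word_op X \<alpha>" for \<beta>
    by (induction \<beta>) (simp_all add: cop_comp_assoc)
  have amp: "cop_amplify (word_op W \<beta>) *\<^sub>V l2_single \<alpha> h = sqrt (b \<alpha> / b (\<beta> @ \<alpha>)) *\<^sub>R l2_single (\<beta> @ \<alpha>) h"
    unfolding cop_amplify_single word_op_W_basis
    by (rule l2_eqI) (simp add: l2_single.rep_eq scaleR_scaleC scaleC_complex_def)
  have "sqrt (b \<alpha> / b (\<beta> @ \<alpha>)) * sqrt (b (\<beta> @ \<alpha>)) = sqrt (b \<alpha>)"
    using b_pos[of "\<beta> @ \<alpha>"] by (simp add: real_sqrt_mult[symmetric])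
  then show "(adj (berezin_kernel b X) o\<^sub>C cop_amplify (word_op W \<beta>)) *\<^sub>V l2_single \<alpha> h
      = (word_op X \<beta> o\<^sub>C adj (berezin_kernel b X)) *\<^sub>V l2_single \<alpha> h"
    by (simp add: amp cop_scaleR_right adj_berezin_single[OF X] word_append)
qed

lemma berezin_intertwine_length_sum:
  fixes X :: "('h :: chilbert_space cop) ^ 'n"
  assumes X: "X \<in> nc_domain b"
  shows "adj (berezin_kernel b X) o\<^sub>C cop_amplify (length_sum u N c W) = length_sum u N c X o\<^sub>C adj (berezin_kernel b X)"
proof (rule cblinfun_eqI)
  fix \<xi>
  have "adj (berezin_kernel b X) *\<^sub>V cop_amplify (word_op W \<beta>) *\<^sub>V \<xi> = word_op X \<beta> *\<^sub>V adj (berezin_kernel b X) *\<^sub>V \<xi>" for \<beta>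
    using arg_cong[OF berezin_intertwine_word[OF X], of "\<lambda>A. A *\<^sub>V \<xi>"] by simp
  then show "(adj (berezin_kernel b X) o\<^sub>C cop_amplify (length_sum u N c W)) *\<^sub>V \<xi> = (length_sum u N c X o\<^sub>C adj (berezin_kernel b X)) *\<^sub>V \<xi>"
    by (simp add: length_sum_eq_sum cop_amplify_sum cop_amplify_scaleC cop_sum_apply cop_sum_right cop_scaleC_right)
qed

lemma length_sum_pure:
  fixes X :: "('h :: chilbert_space cop) ^ 'n"
  assumes X: "X \<in> nc_domain_pure b"
  shows "length_sum u N c X = adj (berezin_kernel b X) o\<^sub>C cop_amplify (length_sum u N c W) o\<^sub>C berezin_kernel b X"
proof -
  have dom: "X \<in> nc_domain b" using X by (simp add: nc_domain_pure_def)
  show ?thesis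
    unfolding berezin_intertwine_length_sum[OF dom] cop_comp_assoc berezin_kernel_isometry[OF X] by simp
qed

lemma word_op_tendsto:
  assumes "X \<longlonglongrightarrow> T" shows "(\<lambda>n. word_op (X n) \<alpha>) \<longlonglongrightarrow> word_op T \<alpha>"
  by (induction \<alpha>) (auto intro!: cop_comp.tendsto tendsto_vec_nth assms)

lemma length_sum_tendsto:
  assumes "X \<longlonglongrightarrow> T" shows "(\<lambda>n. length_sum u N c (X n) *\<^sub>V x) \<longlonglongrightarrow> length_sum u N c T *\<^sub>V x"
  unfolding length_sum_eq_sum cop_sum_apply cop_apply_simps(6)
  by (intro tendsto_sum bounded_linear.tendsto[OF bounded_linear_scaleC]
      bounded_linear.tendsto[OF bounded_linear_cop_apply] word_op_tendsto assms)

text \<open>For pure tuples the matrix is a compression of the amplified one. At fixed degree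
  polynomials depend norm continuously on the tuple, so the inequality survives the closure; no
  convergence of Berezin kernels is involved.\<close>

lemma von_neumann_inequality:
  fixes T :: "('h :: chilbert_space cop) ^ 'n"
  assumes T: "T \<in> closure (nc_domain_pure b)" and m: "mat_bound m (\<lambda>i j. length_sum u N (c i j) W) k"
  shows "mat_bound m (\<lambda>i j. length_sum u N (c i j) T) k"
proof -
  obtain X where X: "\<And>n. X n \<in> nc_domain_pure b" "X \<longlonglongrightarrow> T"
    using T closure_sequential by metis
  have "mat_bound m (\<lambda>i j. length_sum u N (c i j) (X n)) k" for n
  proof -
    have dom: "X n \<in> nc_domain b" using X(1)[of n] by (simp add: nc_domain_pure_def)
    show ?thesis
      unfolding length_sum_pure[OF X(1)]
      by (rule mat_bound_compress[OF mat_bound_amplify[OF m]])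
        (rule berezin_kernel_norm_le[OF dom], rule order_trans[OF adj_norm_le berezin_kernel_norm_le[OF dom]])
  qed
  then show ?thesis
    by (rule mat_bound_pointwise_limit[of m _ k _ sequentially]) (rule length_sum_tendsto[OF X(2)], simp)
qed

text \<open>The vanishing condition at \<alpha> for T_i* x is the condition at i # \<alpha> for x,
  so the null space is invariant under the adjoints; the condition at the empty word makes the
  defect operator vanish on it.\<close>

lemma berezin_kernel_injective:
  fixes T :: "('h :: chilbert_space cop) ^ 'n"
  assumes T: "T \<in> nc_domain b" and cnc: "completely_non_coisometric b T" and h: "berezin_kernel b T *\<^sub>V h = 0"
  shows "h = 0"
proof -
  let ?D = "Delta b T"
  have D: "cop_pos ?D"
    using T unfolding nc_domain_def by blast
  define M where "M = {h. berezin_kernel b T *\<^sub>V h = 0}"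
  have M_iff: "h \<in> M \<longleftrightarrow> (\<forall>\<alpha>. cop_sqrt ?D *\<^sub>V adj (word_op T \<alpha>) *\<^sub>V h = 0)" for h
  proof -
    have "h \<in> M \<longleftrightarrow> (\<forall>\<alpha>. l2_nth (berezin_kernel b T *\<^sub>V h) \<alpha> = 0)"
      unfolding M_def using l2_eqI[of "berezin_kernel b T *\<^sub>V h" 0] by auto
    also have "\<dots> \<longleftrightarrow> (\<forall>\<alpha>. cop_sqrt ?D *\<^sub>V adj (word_op T \<alpha>) *\<^sub>V h = 0)"
      unfolding berezin_kernel_nth[OF T] using b_pos by (simp add: less_imp_neq[symmetric])
    finally show ?thesis .
  qed
  have "closed_csubspace M"
    unfolding closed_csubspace_def M_def
    by (auto simp: cop_add_right cop_scaleC_right intro!: closed_Collect_eq continuous_on_const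
        bounded_linear.continuous_on[OF cop_bounded_linear] continuous_on_id)
  moreover have "adj (T $ i) *\<^sub>V x \<in> M" if "x \<in> M" for i x
  proof -
    have "cop_sqrt ?D *\<^sub>V adj (word_op T \<alpha>) *\<^sub>V adj (T $ i) *\<^sub>V x = 0" for \<alpha>
    proof -
      have "cop_sqrt ?D *\<^sub>V adj (word_op T (i # \<alpha>)) *\<^sub>V x = 0"
        using that M_iff by blast
      then show ?thesis by (simp add: adj_comp)
    qed
    then show ?thesis using M_iff by blast
  qed
  moreover have "?D *\<^sub>V x = 0" if "x \<in> M" for x
  proof -
    have "cop_sqrt ?D *\<^sub>V adj (word_op T []) *\<^sub>V x = 0"
      using that M_iff by blast
    then have "cop_sqrt ?D *\<^sub>V cop_sqrt ?D *\<^sub>V x = 0"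
      by simp
    then show ?thesis
      using arg_cong[OF cop_sqrt_square[OF D], of "\<lambda>A. A *\<^sub>V x"] by simp
  qed
  ultimately have "M = {0}"
    using cnc unfolding completely_non_coisometric_def by blast
  then show ?thesis
    using h by (auto simp: M_def)
qed

end

section \<open>The functional calculus\<close>

context fock_weights
begin

section \<open>Polynomials in the universal model and their norm closure\<close>

inductive_set polys :: "'n fock cop set" where
  polys_zero: "0 \<in> polys"
| polys_step: "A \<in> polys \<Longrightarrow> c *\<^sub>C word_op W \<alpha> + A \<in> polys"

lemma polys_word: "c *\<^sub>C word_op W \<alpha> \<in> polys"
  using polys_step[OF polys_zero, of c \<alpha>] by simp

lemma polys_add: "A \<in> polys \<Longrightarrow> B \<in> polys \<Longrightarrow> A + B \<in> polys"
  by (induction rule: polys.induct) (auto simp: add.assoc intro: polys_step)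

lemma polys_scaleC: "A \<in> polys \<Longrightarrow> k *\<^sub>C A \<in> polys"
proof (induction rule: polys.induct)
  case polys_zero
  have "k *\<^sub>C 0 = (0 :: 'n fock cop)" by simp
  then show ?case by (simp only: polys.polys_zero)
next
  case (polys_step A c \<alpha>)
  then show ?case
    by (simp only: scaleC_add_right scaleC_scaleC) (rule polys.polys_step)
qed

lemma word_op_append: "word_op X (\<alpha> @ \<beta>) = word_op X \<alpha> o\<^sub>C word_op X \<beta>"
  by (induction \<alpha>) (simp_all add: cop_comp_assoc)

lemma polys_word_comp: "B \<in> polys \<Longrightarrow> c *\<^sub>C word_op W \<alpha> o\<^sub>C B \<in> polys"
proof (induction rule: polys.induct)
  case (polys_step A d \<beta>)
  have "c *\<^sub>C word_op W \<alpha> o\<^sub>C (d *\<^sub>C word_op W \<beta> + A) = (c * d) *\<^sub>C word_op W (\<alpha> @ \<beta>) + (c *\<^sub>C word_op W \<alpha> o\<^sub>C A)"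
    by (rule cblinfun_eqI) (simp add: word_op_append cop_add_right cop_scaleC_right scaleC_add_right scaleC_scaleC mult.commute)
  then show ?case
    using polys.polys_step[OF polys_step.IH] by simp
qed (simp add: cop_comp.zero_right polys.polys_zero)

lemma polys_comp: "A \<in> polys \<Longrightarrow> B \<in> polys \<Longrightarrow> A o\<^sub>C B \<in> polys"
  by (induction rule: polys.induct)
    (simp_all add: cop_comp.zero_left polys.polys_zero cop_comp.add_left polys_add polys_word_comp)

lemma polys_sum: "(\<And>i. i \<in> F \<Longrightarrow> A i \<in> polys) \<Longrightarrow> (\<Sum>i\<in>F. A i) \<in> polys"
  by (induction F rule: infinite_finite_induct) (simp_all add: polys_zero polys_add)

lemma entries_poly_op:
  assumes "finite {\<alpha>. p \<alpha> \<noteq> 0}"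
  shows "entries (poly_op p W) p"
proof -
  have "(\<lambda>\<beta>. if \<beta> \<in> {\<alpha>. p \<alpha> \<noteq> 0} then p \<beta> else 0) = p"
    by auto
  with entries_finite_sum[OF assms, of p] show ?thesis
    by (simp only: poly_op_def)
qed

text \<open>Both descriptions yield the same matrix entries, and entries determine the
  operator.\<close>

lemma polys_iff: "A \<in> polys \<longleftrightarrow> (\<exists>p. finite {\<alpha>. p \<alpha> \<noteq> 0} \<and> A = poly_op p W)"
proof
  assume "A \<in> polys"
  then have "\<exists>p. finite {\<alpha>. p \<alpha> \<noteq> 0} \<and> entries A p"
  proof (induction rule: polys.induct)
    case polys_zero
    show ?case by (rule exI[of _ "\<lambda>_. 0"]) (simp add: entries_zero)
  next
    case (polys_step A c \<alpha>)
    then obtain p where p: "finite {\<alpha>. p \<alpha> \<noteq> 0}" "entries A p" by blast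
    let ?q = "\<lambda>\<beta>. c * (if \<beta> = \<alpha> then 1 else 0) + p \<beta>"
    have "finite {\<beta>. ?q \<beta> \<noteq> 0}"
      by (rule finite_subset[of _ "insert \<alpha> {\<alpha>. p \<alpha> \<noteq> 0}"]) (auto simp: p(1))
    moreover have "entries (c *\<^sub>C word_op W \<alpha> + A) ?q"
      by (intro entries_add entries_scaleC entries_word_op p(2))
    ultimately show ?case by (intro exI[of _ ?q] conjI)
  qed
  then show "\<exists>p. finite {\<alpha>. p \<alpha> \<noteq> 0} \<and> A = poly_op p W"
    using entries_eqI entries_poly_op by blast
next
  assume "\<exists>p. finite {\<alpha>. p \<alpha> \<noteq> 0} \<and> A = poly_op p W"
  then show "A \<in> polys"
    by (auto simp: poly_op_def intro: polys_sum polys_word)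
qed

lemma length_sum_polys: "length_sum u N c W \<in> polys"
  unfolding length_sum_eq_sum by (intro polys_sum polys_word)

lemma A_alg_id: "id_cop \<in> A_alg b" and A_alg_W: "W $ i \<in> A_alg b"
  unfolding A_alg_def by blast+

lemma A_alg_add: "A \<in> A_alg b \<Longrightarrow> B \<in> A_alg b \<Longrightarrow> A + B \<in> A_alg b"
  and A_alg_comp: "A \<in> A_alg b \<Longrightarrow> B \<in> A_alg b \<Longrightarrow> A o\<^sub>C B \<in> A_alg b"
  and A_alg_scaleC: "A \<in> A_alg b \<Longrightarrow> c *\<^sub>C A \<in> A_alg b"
  unfolding A_alg_def by blast+

lemma polys_subset_A_alg: "polys \<subseteq> A_alg b"
proof
  fix A assume "A \<in> polys"
  then show "A \<in> A_alg b"
  proof (induction rule: polys.induct)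
    case polys_zero
    have "0 *\<^sub>C id_cop = (0 :: 'n fock cop)" by simp
    then show ?case using A_alg_scaleC[OF A_alg_id, of 0] by simp
  next
    case (polys_step A c \<alpha>)
    have "word_op W \<alpha> \<in> A_alg b"
      by (induction \<alpha>) (simp_all add: A_alg_id A_alg_comp A_alg_W)
    then show ?case
      by (intro A_alg_add A_alg_scaleC polys_step.IH)
  qed
qed

lemma tendsto_scaleC_cop: "X \<longlonglongrightarrow> A \<Longrightarrow> (\<lambda>n. c *\<^sub>C X n) \<longlonglongrightarrow> c *\<^sub>C (A :: ('a :: complex_inner, 'b :: complex_inner) cblinfun)"
  by (rule bounded_linear.tendsto[OF bounded_linear_intro[where K = "cmod c"]])
    (auto simp: scaleC_add_right scaleC_scaleR_commute cop_norm_scaleC mult.commute)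

text \<open>The closure of the polynomials is itself one of the closed algebras in the intersection
  that defines \<open>A_alg\<close>.\<close>

lemma A_alg_subset_closure_polys: "A_alg b \<subseteq> closure polys"
proof -
  have seq: "\<exists>X. (\<forall>n. X n \<in> polys) \<and> X \<longlonglongrightarrow> A" if "A \<in> closure polys" for A
    using that unfolding closure_sequential .
  have lim: "A \<in> closure polys" if "\<And>n. X n \<in> polys" "X \<longlonglongrightarrow> A" for X :: "nat \<Rightarrow> 'n fock cop" and A
    unfolding closure_sequential using that by (intro exI[of _ X]) simp
  have base: "A \<in> closure polys" if "A \<in> polys" for A
    using that closure_subset by blast
  have id: "id_cop \<in> polys"
    using polys_word[of 1 "[]"] by (simp add: scaleC_one)
  have W: "W $ i \<in> polys" for i
    using polys_word[of 1 "[i]"] by (simp add: scaleC_one)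
  have add: "A + B \<in> closure polys" "A o\<^sub>C B \<in> closure polys" if A: "A \<in> closure polys" and B: "B \<in> closure polys" for A B
  proof -
    obtain X where X: "\<And>n. X n \<in> polys" "X \<longlonglongrightarrow> A" using seq[OF A] by blast
    obtain Y where Y: "\<And>n. Y n \<in> polys" "Y \<longlonglongrightarrow> B" using seq[OF B] by blast
    show "A + B \<in> closure polys"
      by (rule lim[OF polys_add[OF X(1) Y(1)] tendsto_add[OF X(2) Y(2)]])
    show "A o\<^sub>C B \<in> closure polys"
      by (rule lim[OF polys_comp[OF X(1) Y(1)] cop_comp.tendsto[OF X(2) Y(2)]])
  qed
  have scale: "c *\<^sub>C A \<in> closure polys" if A: "A \<in> closure polys" for c A
  proof -
    obtain X where X: "\<And>n. X n \<in> polys" "X \<longlonglongrightarrow> A" using seq[OF A] by blast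
    show ?thesis
      by (rule lim[OF polys_scaleC[OF X(1)] tendsto_scaleC_cop[OF X(2)]])
  qed
  show ?thesis
    unfolding A_alg_def
    by (intro Inter_lower CollectI conjI allI ballI closed_closure base[OF id] base[OF W] add scale)
qed

text \<open>Linear contractions are norm continuous, so agreement on polynomials spreads to their
  closure; \<open>extensional\<close> settles the values elsewhere.\<close>

lemma poly_calculus_unique:
  fixes T :: "('h :: chilbert_space cop) ^ 'n"
  assumes \<Phi>: "is_poly_calculus b T \<Phi>" and \<Phi>': "is_poly_calculus b T \<Phi>'"
  shows "\<Phi> = \<Phi>'"
proof (rule extensionalityI)
  show "\<Phi> \<in> extensional (A_alg b)" "\<Phi>' \<in> extensional (A_alg b)"
    using \<Phi> \<Phi>' by (auto simp: is_poly_calculus_def)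
  fix A assume A: "A \<in> A_alg b"
  then have "A \<in> closure polys"
    using A_alg_subset_closure_polys by blast
  then obtain X where X: "\<And>n. X n \<in> polys" "X \<longlonglongrightarrow> A"
    using closure_sequential[of A polys] by blast
  have lim: "(\<lambda>n. \<Psi> (X n)) \<longlonglongrightarrow> \<Psi> A" if \<Psi>: "is_poly_calculus b T \<Psi>" for \<Psi>
  proof -
    have lin: "clinear_on (A_alg b) \<Psi>" and cc: "completely_contractive_on (A_alg b) \<Psi>"
      using \<Psi> by (auto simp: is_poly_calculus_def)
    have "norm (\<Psi> (X n) - \<Psi> A) \<le> norm (X n - A)" for n
    proof -
      have Xn: "X n \<in> A_alg b"
        using X(1) polys_subset_A_alg by blast
      have "\<Psi> (X n + (-1) *\<^sub>C A) = \<Psi> (X n) + (-1) *\<^sub>C \<Psi> A"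
        using lin Xn A A_alg_scaleC[OF A] unfolding clinear_on_def by simp
      then have "\<Psi> (X n - A) = \<Psi> (X n) - \<Psi> A"
        by (simp add: scaleC_minus_left scaleC_one)
      moreover have "X n - A \<in> A_alg b"
        using A_alg_add[OF Xn A_alg_scaleC[OF A, of "-1"]] by (simp add: scaleC_minus_left scaleC_one)
      ultimately show ?thesis
        using completely_contractive_on_norm_le[OF cc, of "X n - A"] by simp
    qed
    then have "(\<lambda>n. \<Psi> (X n) - \<Psi> A) \<longlonglongrightarrow> 0"
      using X(2) by (intro Lim_null_comparison[OF always_eventually tendsto_norm_zero[OF LIM_zero]] allI)
    then show ?thesis by (rule LIM_zero_cancel)
  qed
  have "\<Phi> (X n) = \<Phi>' (X n)" for n
  proof -
    obtain p where "finite {\<alpha>. p \<alpha> \<noteq> 0}" "X n = poly_op p W"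
      using X(1)[of n] polys_iff by blast
    then show ?thesis
      using \<Phi> \<Phi>' by (simp add: is_poly_calculus_def)
  qed
  then show "\<Phi> A = \<Phi>' A"
    using LIMSEQ_unique[OF lim[OF \<Phi>]] lim[OF \<Phi>'] by simp
qed

lemma amplify_cesaro_tendsto:
  fixes \<xi> :: "('n list, 'h :: chilbert_space) l2"
  assumes A: "A \<in> F_inf b"
  shows "(\<lambda>N. cop_amplify (cesaro N (symbol A) W) *\<^sub>V \<xi>) \<longlonglongrightarrow> cop_amplify A *\<^sub>V \<xi>"
proof (rule pointwise_convergence_l2)
  show "norm (cop_amplify (cesaro N (symbol A) W) :: ('n list, 'h) l2 cop) \<le> norm A" for N
    by (rule order_trans[OF cop_amplify_norm_le cesaro_norm_le[OF A]])
  show "(\<lambda>N. cop_amplify (cesaro N (symbol A) W) *\<^sub>V l2_single \<gamma> h) \<longlonglongrightarrow> cop_amplify A *\<^sub>V l2_single \<gamma> h" for \<gamma> and h :: 'h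
    unfolding cop_amplify_single
    by (rule bounded_linear.tendsto[OF bounded_linear_tensor_left]) (rule cesaro_tendsto[OF A])
qed

end

section \<open>The calculus at T as a strong limit of Cesaro means\<close>

locale cnc_tuple = fock_weights b for b :: "'n :: finite list \<Rightarrow> real" +
  fixes T :: "('h :: chilbert_space cop) ^ 'n"
  assumes T_dom: "T \<in> nc_domain b" and T_cnc: "completely_non_coisometric b T"
    and T_closure: "T \<in> closure (nc_domain_pure b)"
begin

abbreviation K :: "('h, ('n list, 'h) l2) cblinfun" where "K \<equiv> berezin_kernel b T"

lemma dense_range: "closure (range (cblinfun_apply (adj K))) = UNIV"
  using berezin_kernel_injective[OF T_dom T_cnc] by (intro adj_dense_range) blast

lemma cesaro_T_mat_bound:
  assumes "\<And>i j. i < m \<Longrightarrow> j < m \<Longrightarrow> A i j \<in> F_inf b" "mat_bound m A c"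
  shows "mat_bound m (\<lambda>i j. cesaro N (symbol (A i j)) T) c"
  using cesaro_mat_bound[OF assms] unfolding cesaro_def by (rule von_neumann_inequality[OF T_closure])

lemma cesaro_T_norm_le:
  assumes "A \<in> F_inf b"
  shows "norm (cesaro N (symbol A) T) \<le> norm A"
proof -
  have "mat_bound 1 (\<lambda>i j. cesaro N (symbol A) T) (norm A)"
    by (rule cesaro_T_mat_bound[OF assms], rule mat_bound_one_iff[THEN iffD2]) simp
  then show ?thesis
    using mat_bound_one_iff by blast
qed

lemma cesaro_T_range_tendsto:
  assumes A: "A \<in> F_inf b"
  shows "(\<lambda>N. cesaro N (symbol A) T *\<^sub>V adj K *\<^sub>V \<xi>) \<longlonglongrightarrow> adj K *\<^sub>V cop_amplify A *\<^sub>V \<xi>"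
proof -
  have "cesaro N (symbol A) T *\<^sub>V adj K *\<^sub>V \<xi> = adj K *\<^sub>V cop_amplify (cesaro N (symbol A) W) *\<^sub>V \<xi>" for N
    using arg_cong[OF berezin_intertwine_length_sum[OF T_dom, of "\<lambda>s. 1 - real s / (real N + 1)" N "symbol A"], of "\<lambda>A. A *\<^sub>V \<xi>"]
    by (simp add: cesaro_def)
  then show ?thesis
    by (simp only:) (rule cop_tendsto[OF amplify_cesaro_tendsto[OF A]])
qed

text \<open>The choice has a guaranteed meaning on \<open>F_inf b\<close> only, which is why the
  final map is a restriction of it.\<close>

definition Psi :: "'n fock cop \<Rightarrow> 'h cop"
  where "Psi A = (SOME L. \<forall>x. (\<lambda>N. cesaro N (symbol A) T *\<^sub>V x) \<longlonglongrightarrow> L *\<^sub>V x)"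

lemma Psi_tendsto:
  assumes A: "A \<in> F_inf b"
  shows "(\<lambda>N. cesaro N (symbol A) T *\<^sub>V x) \<longlonglongrightarrow> Psi A *\<^sub>V x"
proof -
  have "convergent (\<lambda>N. cesaro N (symbol A) T *\<^sub>V x)" for x
  proof (rule pointwise_convergent_dense[OF cesaro_T_norm_le[OF A] dense_range])
    fix x assume "x \<in> range (cblinfun_apply (adj K))"
    then obtain \<xi> where "x = adj K *\<^sub>V \<xi>" by blast
    then show "convergent (\<lambda>N. cesaro N (symbol A) T *\<^sub>V x)"
      using convergentI[OF cesaro_T_range_tendsto[OF A, of \<xi>]] by simp
  qed
  then obtain f where f: "\<And>x. (\<lambda>N. cesaro N (symbol A) T *\<^sub>V x) \<longlonglongrightarrow> f x"
    unfolding convergent_def by metis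
  obtain L where "\<And>x. L *\<^sub>V x = f x"
    by (rule cop_pointwise_limit[OF f cesaro_T_norm_le[OF A]]) blast
  then have "\<exists>L. \<forall>x. (\<lambda>N. cesaro N (symbol A) T *\<^sub>V x) \<longlonglongrightarrow> L *\<^sub>V x"
    using f by (intro exI[of _ L]) simp
  from someI_ex[OF this] show ?thesis
    unfolding Psi_def by blast
qed

lemma Psi_intertwine: "A \<in> F_inf b \<Longrightarrow> Psi A *\<^sub>V adj K *\<^sub>V \<xi> = adj K *\<^sub>V cop_amplify A *\<^sub>V \<xi>"
  by (rule LIMSEQ_unique[OF Psi_tendsto cesaro_T_range_tendsto])

text \<open>The intertwining relation on the dense range of K* characterizes the value, so each
  algebraic law reduces to the same law for amplification.\<close>

lemma Psi_eqI:
  assumes A: "A \<in> F_inf b" and B: "\<And>\<xi>. B *\<^sub>V adj K *\<^sub>V \<xi> = adj K *\<^sub>V cop_amplify A *\<^sub>V \<xi>"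
  shows "Psi A = B"
proof (rule cblinfun_eqI)
  fix x
  have "closed {x. Psi A *\<^sub>V x = B *\<^sub>V x}"
    by (intro closed_Collect_eq bounded_linear.continuous_on[OF cop_bounded_linear] continuous_on_id)
  moreover have "range (cblinfun_apply (adj K)) \<subseteq> {x. Psi A *\<^sub>V x = B *\<^sub>V x}"
    by (auto simp: Psi_intertwine[OF A] B)
  ultimately have "closure (range (cblinfun_apply (adj K))) \<subseteq> {x. Psi A *\<^sub>V x = B *\<^sub>V x}"
    by (intro closure_minimal)
  then show "Psi A *\<^sub>V x = B *\<^sub>V x"
    unfolding dense_range by blast
qed

lemma Psi_add: "A \<in> F_inf b \<Longrightarrow> B \<in> F_inf b \<Longrightarrow> Psi (A + B) = Psi A + Psi B"
  by (rule Psi_eqI) (simp_all add: F_inf_add cop_amplify_add Psi_intertwine cop_add_right)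

lemma Psi_scaleC: "A \<in> F_inf b \<Longrightarrow> Psi (c *\<^sub>C A) = c *\<^sub>C Psi A"
  by (rule Psi_eqI) (simp_all add: F_inf_scaleC cop_amplify_scaleC Psi_intertwine cop_scaleC_right)

lemma Psi_comp: "A \<in> F_inf b \<Longrightarrow> B \<in> F_inf b \<Longrightarrow> Psi (A o\<^sub>C B) = Psi A o\<^sub>C Psi B"
  by (rule Psi_eqI) (simp_all add: F_inf_comp cop_amplify_comp Psi_intertwine)

lemma Psi_poly:
  assumes p: "finite {\<alpha>. p \<alpha> \<noteq> 0}"
  shows "Psi (poly_op p W) = poly_op p T"
proof (rule Psi_eqI)
  show "poly_op p W \<in> F_inf b"
    by (rule entries_F_inf[OF entries_poly_op[OF p]])
  fix \<xi>
  have "adj K *\<^sub>V cop_amplify (word_op W \<beta>) *\<^sub>V \<xi> = word_op T \<beta> *\<^sub>V adj K *\<^sub>V \<xi>" for \<beta>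
    using arg_cong[OF berezin_intertwine_word[OF T_dom], of "\<lambda>A. A *\<^sub>V \<xi>"] by simp
  then show "poly_op p T *\<^sub>V adj K *\<^sub>V \<xi> = adj K *\<^sub>V cop_amplify (poly_op p W) *\<^sub>V \<xi>"
    by (simp add: poly_op_def cop_amplify_sum cop_amplify_scaleC cop_sum_apply cop_sum_right cop_scaleC_right)
qed

lemma Psi_mat_bound:
  assumes "\<And>i j. i < m \<Longrightarrow> j < m \<Longrightarrow> A i j \<in> F_inf b" "mat_bound m A c"
  shows "mat_bound m (\<lambda>i j. Psi (A i j)) c"
  by (rule mat_bound_pointwise_limit[OF cesaro_T_mat_bound[OF assms] Psi_tendsto[OF assms(1)]]) simp_all

lemma mat_bound_cong:
  assumes "\<And>i j. i < m \<Longrightarrow> j < m \<Longrightarrow> A i j = B i j"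
  shows "mat_bound m A c \<longleftrightarrow> mat_bound m B c"
proof -
  have "(\<Sum>i<m. (norm (\<Sum>j<m. A i j *\<^sub>V x j))\<^sup>2) = (\<Sum>i<m. (norm (\<Sum>j<m. B i j *\<^sub>V x j))\<^sup>2)" for x
    using assms by simp
  then show ?thesis
    by (simp only: mat_bound_def)
qed

lemma restrict_Psi_completely_contractive:
  assumes "S \<subseteq> F_inf b"
  shows "completely_contractive_on S (restrict Psi S)"
proof (rule completely_contractive_onI)
  fix m A c
  assume A: "\<And>i j. i < m \<Longrightarrow> j < m \<Longrightarrow> A i j \<in> S" and m: "mat_bound m A c"
  have "mat_bound m (\<lambda>i j. Psi (A i j)) c"
    by (rule Psi_mat_bound[OF _ m]) (use A assms in blast)
  then show "mat_bound m (\<lambda>i j. restrict Psi S (A i j)) c"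
    by (rule mat_bound_cong[THEN iffD2, rotated]) (simp add: A)
qed

lemma Psi_norm_le: "A \<in> F_inf b \<Longrightarrow> norm (Psi A) \<le> norm A"
  using completely_contractive_on_norm_le[OF restrict_Psi_completely_contractive[OF order_refl], of A] by simp

lemma is_poly_calculus_Psi: "is_poly_calculus b T (restrict Psi (A_alg b))"
proof -
  have F: "A \<in> F_inf b" if "A \<in> A_alg b" for A
    using that A_alg_subset_F_inf by blast
  have "poly_op p W \<in> A_alg b" if "finite {\<alpha>. p \<alpha> \<noteq> 0}" for p
    using that polys_iff polys_subset_A_alg by blast
  then show ?thesis
    unfolding is_poly_calculus_def clinear_on_def
    by (auto simp: A_alg_add A_alg_scaleC Psi_add Psi_scaleC F Psi_poly
        intro: restrict_Psi_completely_contractive[OF A_alg_subset_F_inf])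
qed

lemma ex1_poly_calculus: "\<exists>!\<Phi>. is_poly_calculus b T \<Phi>"
  using is_poly_calculus_Psi poly_calculus_unique by blast

lemma poly_calculus_eq: "poly_calculus b T = restrict Psi (A_alg b)"
  unfolding poly_calculus_def
  by (rule the_equality, rule is_poly_calculus_Psi, rule poly_calculus_unique[OF _ is_poly_calculus_Psi])

end

section \<open>Weak-star continuity\<close>

lemma limitin_topology_generated_byI:
  assumes "L \<in> \<Union>\<S>" and ev: "\<And>U. U \<in> \<S> \<Longrightarrow> L \<in> U \<Longrightarrow> eventually (\<lambda>n. X n \<in> U) F"
  shows "limitin (topology_generated_by \<S>) X L F"
  unfolding limitin_def
proof (intro conjI allI impI)
  show "L \<in> topspace (topology_generated_by \<S>)"
    using assms(1) by (simp add: topology_generated_by_topspace)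
  fix U assume "openin (topology_generated_by \<S>) U \<and> L \<in> U"
  then have "generate_topology_on \<S> U" "L \<in> U"
    by (auto simp: openin_topology_generated_by_iff)
  then show "eventually (\<lambda>n. X n \<in> U) F"
  proof (induction rule: generate_topology_on.induct)
    case (Int a b)
    then have "eventually (\<lambda>n. X n \<in> a) F" "eventually (\<lambda>n. X n \<in> b) F" by auto
    then show ?case by eventually_elim simp
  next
    case (UN K)
    then obtain k where "k \<in> K" "eventually (\<lambda>n. X n \<in> k) F" by blast
    then show ?case by (auto elim: eventually_mono)
  qed (auto intro: ev)
qed

lemma square_summable_mult:
  fixes x y :: "nat \<Rightarrow> real"
  assumes "summable (\<lambda>k. (x k)\<^sup>2)" "summable (\<lambda>k. (y k)\<^sup>2)"
  shows "summable (\<lambda>k. \<bar>x k\<bar> * \<bar>y k\<bar>)"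
proof (rule summable_comparison_test'[of "\<lambda>k. (x k)\<^sup>2 + (y k)\<^sup>2" 0])
  show "summable (\<lambda>k. (x k)\<^sup>2 + (y k)\<^sup>2)"
    using assms by (rule summable_add)
  show "norm (\<bar>x k\<bar> * \<bar>y k\<bar>) \<le> (x k)\<^sup>2 + (y k)\<^sup>2" for k
  proof -
    have "0 \<le> (\<bar>x k\<bar> - \<bar>y k\<bar>)\<^sup>2" "0 \<le> \<bar>x k\<bar> * \<bar>y k\<bar>" by simp_all
    then show ?thesis
      unfolding power2_diff power2_abs real_norm_def abs_mult abs_abs by linarith
  qed
qed

lemma norm_cinner_cop_le: "norm (cinner (A *\<^sub>V x) y) \<le> norm A * (norm x * norm y)"
proof -
  have "norm (cinner (A *\<^sub>V x) y) \<le> norm (A *\<^sub>V x) * norm y"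
    by (rule norm_cinner_le)
  also have "\<dots> \<le> (norm A * norm x) * norm y"
    by (intro mult_right_mono cop_norm_bound) simp
  finally show ?thesis by (simp only: mult.assoc)
qed

lemma summable_trace_pairing:
  fixes A :: "('a :: complex_inner, 'b :: complex_inner) cblinfun"
  assumes "summable (\<lambda>k. (norm (x k))\<^sup>2)" "summable (\<lambda>k. (norm (y k))\<^sup>2)"
  shows "summable (\<lambda>k. cinner (A *\<^sub>V x k) (y k))"
proof (rule summable_comparison_test'[of "\<lambda>k. norm A * (norm (x k) * norm (y k))" 0])
  show "summable (\<lambda>k. norm A * (norm (x k) * norm (y k)))"
    using square_summable_mult[OF assms] by (intro summable_mult) simp
qed (rule norm_cinner_cop_le)

text \<open>The norm bound dominates the series of each subbasic functional, so termwise convergence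
  passes to the sum by Tannery's theorem.\<close>

lemma limitin_wstarI:
  fixes X :: "nat \<Rightarrow> 'a :: chilbert_space cop"
  assumes wot: "wot_tendsto X L sequentially" and C: "\<And>n. norm (X n) \<le> C"
  shows "limitin wstar_topology X L sequentially"
  unfolding wstar_topology_def
proof (rule limitin_topology_generated_byI)
  let ?S = "{{A. (\<Sum>k. cinner (A *\<^sub>V x k) (y k)) \<in> U} | x y U.
       summable (\<lambda>k. (norm (x k :: 'a))\<^sup>2) \<and> summable (\<lambda>k. (norm (y k))\<^sup>2) \<and> open U}"
  have "{A :: 'a cop. (\<Sum>k. cinner (A *\<^sub>V 0) 0) \<in> UNIV} \<in> ?S"
    by (rule CollectI) (intro exI[of _ "\<lambda>_. 0"] exI[of _ UNIV], simp)
  then show "L \<in> \<Union>?S"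
    by blast
  fix U assume "U \<in> ?S" "L \<in> U"
  then obtain x y V where U: "U = {A. (\<Sum>k. cinner (A *\<^sub>V x k) (y k)) \<in> V}"
    and x: "summable (\<lambda>k. (norm (x k))\<^sup>2)" and y: "summable (\<lambda>k. (norm (y k))\<^sup>2)" and V: "open V"
    by blast
  have "((\<lambda>n. \<Sum>k. cinner (X n *\<^sub>V x k) (y k)) \<longlongrightarrow> (\<Sum>k. cinner (L *\<^sub>V x k) (y k))) sequentially"
  proof (rule tannerys_theorem[of "\<lambda>k n. cinner (X n *\<^sub>V x k) (y k)" "\<lambda>k. cinner (L *\<^sub>V x k) (y k)" sequentially
        "\<lambda>k. C * (norm (x k) * norm (y k))", THEN conjunct2, THEN conjunct2])
    show "(\<lambda>n. cinner (X n *\<^sub>V x k) (y k)) \<longlonglongrightarrow> cinner (L *\<^sub>V x k) (y k)" for k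
      using wot unfolding wot_tendsto_def by blast
    have "norm (cinner (X n *\<^sub>V x k) (y k)) \<le> C * (norm (x k) * norm (y k))" for k n
      by (rule order_trans[OF norm_cinner_cop_le mult_right_mono[OF C]]) simp
    then show "\<forall>\<^sub>F (k, n) in sequentially \<times>\<^sub>F sequentially. norm (cinner (X n *\<^sub>V x k) (y k)) \<le> C * (norm (x k) * norm (y k))"
      by (intro always_eventually) (simp add: case_prod_beta)
    show "summable (\<lambda>k. C * (norm (x k) * norm (y k)))"
      using square_summable_mult[OF x y] by (intro summable_mult) simp
  qed simp
  then show "\<forall>\<^sub>F n in sequentially. X n \<in> U"
    using V \<open>L \<in> U\<close> unfolding U by (auto dest: topological_tendstoD)
qed

text \<open>A vector functional is the pairing with sequences supported at index 0.\<close>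

lemma limitin_wstarD:
  fixes X :: "'i \<Rightarrow> 'a :: chilbert_space cop"
  assumes "limitin wstar_topology X L F"
  shows "((\<lambda>n. cinner (X n *\<^sub>V x) y) \<longlongrightarrow> cinner (L *\<^sub>V x) y) F"
proof (rule topological_tendstoI)
  fix U :: "complex set" assume U: "open U" "cinner (L *\<^sub>V x) y \<in> U"
  define x' where "x' = (\<lambda>k :: nat. if k = 0 then x else 0)"
  define y' where "y' = (\<lambda>k :: nat. if k = 0 then y else 0)"
  have sum: "(\<Sum>k. cinner (A *\<^sub>V x' k) (y' k)) = cinner (A *\<^sub>V x) y" for A
    using suminf_finite[of "{0}" "\<lambda>k. cinner (A *\<^sub>V x' k) (y' k)"] by (simp add: x'_def y'_def)
  have "summable (\<lambda>k. (norm (x' k))\<^sup>2)" "summable (\<lambda>k. (norm (y' k))\<^sup>2)"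
    by (rule summable_finite[of "{0}"]; simp add: x'_def y'_def)+
  then have "openin wstar_topology {A. (\<Sum>k. cinner (A *\<^sub>V x' k) (y' k)) \<in> U}"
    unfolding wstar_topology_def using U(1) by (intro topology_generated_by_Basis) blast
  then have "openin wstar_topology {A. cinner (A *\<^sub>V x) y \<in> U}"
    by (simp only: sum)
  then show "\<forall>\<^sub>F n in F. cinner (X n *\<^sub>V x) y \<in> U"
    using assms[unfolded limitin_def, THEN conjunct2, rule_format, of "{A. cinner (A *\<^sub>V x) y \<in> U}"] U(2) by simp
qed

subsection \<open>Functionals that are norm limits of their Cesaro means\<close>

text \<open>A trace class functional of finite rank, kept as a list of vector pairs so that
  functionals are added by appending lists.\<close>

definition trace_pairing :: "('a :: complex_inner \<times> 'a) list \<Rightarrow> 'a cop \<Rightarrow> complex"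
  where "trace_pairing xs A = (\<Sum>(x, y)\<leftarrow>xs. cinner (A *\<^sub>V x) y)"

lemma trace_pairing_simps [simp]:
  "trace_pairing [] A = 0" "trace_pairing (p # xs) A = cinner (A *\<^sub>V fst p) (snd p) + trace_pairing xs A"
  "trace_pairing (xs @ ys) A = trace_pairing xs A + trace_pairing ys A"
  by (simp_all add: trace_pairing_def case_prod_beta)

text \<open>The square sums of left and right vectors together bound the trace norm by
  Cauchy-Schwarz, and each is a quantity that the subbasis of \<open>wstar_topology\<close> requires
  to be finite.\<close>

definition size_fst :: "('a :: complex_inner \<times> 'a) list \<Rightarrow> real"
  where "size_fst xs = (\<Sum>p\<leftarrow>xs. (norm (fst p))\<^sup>2)"

definition size_snd :: "('a :: complex_inner \<times> 'a) list \<Rightarrow> real"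
  where "size_snd xs = (\<Sum>p\<leftarrow>xs. (norm (snd p))\<^sup>2)"

text \<open>Scaling both entries keeps the two sizes balanced: pairing and sizes are all multiplied
  by r^2, so a weight enters through its square root.\<close>

definition scale_pairs :: "real \<Rightarrow> ('a :: complex_inner \<times> 'a) list \<Rightarrow> ('a \<times> 'a) list"
  where "scale_pairs r xs = map (\<lambda>p. (r *\<^sub>R fst p, r *\<^sub>R snd p)) xs"

lemma scale_pairs_simps:
  "trace_pairing (scale_pairs r xs) A = complex_of_real (r\<^sup>2) * trace_pairing xs A"
  "size_fst (scale_pairs r xs) = r\<^sup>2 * size_fst xs"
  "size_snd (scale_pairs r xs) = r\<^sup>2 * size_snd xs"
  by (induction xs) (simp_all add: scale_pairs_def size_fst_def size_snd_def cop_scaleR_right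
      cinner_scaleR_left cinner_scaleR_right power2_eq_square algebra_simps)

lemma size_append [simp]:
  "size_fst (xs @ ys) = size_fst xs + size_fst ys" "size_snd (xs @ ys) = size_snd xs + size_snd ys"
  by (simp_all add: size_fst_def size_snd_def)

lemma cop_amplify_complex: "(cop_amplify A :: ('i, complex) l2 cop) = A"
proof (rule cop_eqI_basis)
  fix i
  have "f \<otimes>\<^sub>l (1 :: complex) = f" for f :: "('i, complex) l2"
    by (rule l2_eqI) (simp add: scaleC_complex_def)
  then show "cop_amplify A *\<^sub>V l2_single i 1 = A *\<^sub>V l2_single i (1 :: complex)"
    by (simp add: cop_amplify_single)
qed

context fock_weights
begin

abbreviation ces :: "nat \<Rightarrow> 'n fock cop \<Rightarrow> 'n fock cop" where "ces N A \<equiv> cesaro N (symbol A) W"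

lemma ces_F_inf: "ces N A \<in> F_inf b"
  unfolding cesaro_def by (rule length_sum_F_inf)

lemma ces_eq: "ces N A = (\<Sum>\<alpha> | length \<alpha> \<le> N. (complex_of_real (1 - real (length \<alpha>) / (real N + 1)) * symbol A \<alpha>) *\<^sub>C word_op W \<alpha>)"
  unfolding cesaro_def length_sum_eq_sum ..

definition linear_functional :: "('n fock cop \<Rightarrow> complex) \<Rightarrow> bool"
  where "linear_functional f \<longleftrightarrow> (\<forall>A\<in>F_inf b. \<forall>B\<in>F_inf b. f (A + B) = f A + f B) \<and> (\<forall>c. \<forall>A\<in>F_inf b. f (c *\<^sub>C A) = c * f A)"

text \<open>Norm convergence of the functionals A -> f(ces N A) to f on the unit ball of the
  algebra. Together with linearity and boundedness this is what yields a trace class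
  representation.\<close>

definition cesaro_regular :: "('n fock cop \<Rightarrow> complex) \<Rightarrow> bool"
  where "cesaro_regular f \<longleftrightarrow> (\<forall>r>0. \<forall>\<^sub>F N in sequentially. \<forall>A\<in>F_inf b. norm (f A - f (ces N A)) \<le> r * norm A)"

lemma linear_functional_zero:
  assumes "linear_functional f" shows "f 0 = 0"
proof -
  have "(0 :: 'n fock cop) \<in> F_inf b" by (rule entries_F_inf[OF entries_zero])
  moreover have "0 *\<^sub>C 0 = (0 :: 'n fock cop)" by simp
  ultimately show ?thesis
    using assms unfolding linear_functional_def by (metis mult_zero_left)
qed

lemma linear_functional_sum:
  assumes f: "linear_functional f" and A: "\<And>\<alpha>. \<alpha> \<in> S \<Longrightarrow> A \<alpha> \<in> F_inf b"
  shows "f (\<Sum>\<alpha>\<in>S. c \<alpha> *\<^sub>C A \<alpha>) = (\<Sum>\<alpha>\<in>S. c \<alpha> * f (A \<alpha>))"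
proof -
  have "(\<Sum>\<alpha>\<in>S. c \<alpha> *\<^sub>C A \<alpha>) \<in> F_inf b \<and> f (\<Sum>\<alpha>\<in>S. c \<alpha> *\<^sub>C A \<alpha>) = (\<Sum>\<alpha>\<in>S. c \<alpha> * f (A \<alpha>))"
    using A
  proof (induction S rule: infinite_finite_induct)
    case (insert \<alpha> S)
    have 1: "c \<alpha> *\<^sub>C A \<alpha> \<in> F_inf b"
      by (rule F_inf_scaleC) (simp add: insert.prems)
    have 2: "(\<Sum>\<alpha>\<in>S. c \<alpha> *\<^sub>C A \<alpha>) \<in> F_inf b" "f (\<Sum>\<alpha>\<in>S. c \<alpha> *\<^sub>C A \<alpha>) = (\<Sum>\<alpha>\<in>S. c \<alpha> * f (A \<alpha>))"
      using insert.IH insert.prems by auto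
    have "f (c \<alpha> *\<^sub>C A \<alpha> + (\<Sum>\<alpha>\<in>S. c \<alpha> *\<^sub>C A \<alpha>)) = f (c \<alpha> *\<^sub>C A \<alpha>) + f (\<Sum>\<alpha>\<in>S. c \<alpha> *\<^sub>C A \<alpha>)"
      using f 1 2(1) unfolding linear_functional_def by blast
    moreover have "f (c \<alpha> *\<^sub>C A \<alpha>) = c \<alpha> * f (A \<alpha>)"
      using f insert.prems unfolding linear_functional_def by blast
    ultimately show ?case
      using insert.hyps 2 F_inf_add[OF 1 2(1)] by simp
  qed (simp_all add: linear_functional_zero[OF f] entries_F_inf[OF entries_zero])
  then show ?thesis ..
qed

lemma linear_functional_cinner: "linear_functional (\<lambda>A. cinner (A *\<^sub>V x) y)"
  by (simp add: linear_functional_def cinner_add_left cinner_scaleC_left)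

lemma linear_functional_diff:
  "linear_functional f \<Longrightarrow> linear_functional g \<Longrightarrow> linear_functional (\<lambda>A. f A - g A)"
  by (simp add: linear_functional_def algebra_simps)

lemma linear_functional_trace_pairing: "linear_functional (trace_pairing xs)"
  by (induction xs) (simp_all add: linear_functional_def cinner_add_left cinner_scaleC_left algebra_simps)

text \<open>An epsilon/3 argument; comparing the two functionals at \<open>ces N A\<close> relies on
  the Cesaro means being contractive.\<close>

lemma cesaro_regular_approx:
  assumes "\<And>r. r > 0 \<Longrightarrow> \<exists>g. cesaro_regular g \<and> (\<forall>A\<in>F_inf b. norm (f A - g A) \<le> r * norm A)"
  shows "cesaro_regular f"
  unfolding cesaro_regular_def
proof (intro allI impI)
  fix r :: real assume "r > 0"
  then have r3: "r / 3 > 0" by simp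
  obtain g where g: "cesaro_regular g" "\<And>A. A \<in> F_inf b \<Longrightarrow> norm (f A - g A) \<le> r / 3 * norm A"
    using assms[OF r3] by blast
  have diff: "norm (f A - f (ces N A)) \<le> r * norm A"
    if A: "A \<in> F_inf b" and N: "norm (g A - g (ces N A)) \<le> r / 3 * norm A" for A N
  proof -
    have "norm (f (ces N A) - g (ces N A)) \<le> r / 3 * norm (ces N A)"
      by (rule g(2)[OF ces_F_inf])
    also have "\<dots> \<le> r / 3 * norm A"
      using r3 by (intro mult_left_mono cesaro_norm_le A) auto
    finally have 3: "norm (f (ces N A) - g (ces N A)) \<le> r / 3 * norm A" .
    have eq: "f A - f (ces N A) = (f A - g A) + (g A - g (ces N A)) - (f (ces N A) - g (ces N A))"
      by simp
    have "norm (f A - f (ces N A)) \<le> norm (f A - g A) + norm (g A - g (ces N A)) + norm (f (ces N A) - g (ces N A))"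
      unfolding eq using norm_triangle_ineq4[of "(f A - g A) + (g A - g (ces N A))" "f (ces N A) - g (ces N A)"]
        norm_triangle_ineq[of "f A - g A" "g A - g (ces N A)"] by linarith
    then show ?thesis
      using g(2)[OF A] N 3 by linarith
  qed
  have "\<forall>\<^sub>F N in sequentially. \<forall>A\<in>F_inf b. norm (g A - g (ces N A)) \<le> r / 3 * norm A"
    using g(1) r3 unfolding cesaro_regular_def by blast
  then show "\<forall>\<^sub>F N in sequentially. \<forall>A\<in>F_inf b. norm (f A - f (ces N A)) \<le> r * norm A"
    by (rule eventually_mono) (simp add: diff)
qed

lemma cesaro_regular_add:
  assumes f: "cesaro_regular f" and g: "cesaro_regular g"
  shows "cesaro_regular (\<lambda>A. f A + g A)"
  unfolding cesaro_regular_def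
proof (intro allI impI)
  fix r :: real assume "r > 0"
  then have r2: "r / 2 > 0" by simp
  have "\<forall>\<^sub>F N in sequentially. \<forall>A\<in>F_inf b. norm (f A - f (ces N A)) \<le> r / 2 * norm A"
    "\<forall>\<^sub>F N in sequentially. \<forall>A\<in>F_inf b. norm (g A - g (ces N A)) \<le> r / 2 * norm A"
    using f g r2 unfolding cesaro_regular_def by blast+
  then show "\<forall>\<^sub>F N in sequentially. \<forall>A\<in>F_inf b. norm (f A + g A - (f (ces N A) + g (ces N A))) \<le> r * norm A"
  proof eventually_elim
    case (elim N)
    show ?case
    proof
      fix A assume A: "A \<in> F_inf b"
      have eq: "f A + g A - (f (ces N A) + g (ces N A)) = (f A - f (ces N A)) + (g A - g (ces N A))"
        by simp
      have "norm (f A - f (ces N A)) \<le> r / 2 * norm A" "norm (g A - g (ces N A)) \<le> r / 2 * norm A"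
        using elim A by blast+
      then show "norm (f A + g A - (f (ces N A) + g (ces N A))) \<le> r * norm A"
        unfolding eq using norm_triangle_ineq[of "f A - f (ces N A)" "g A - g (ces N A)"] by linarith
    qed
  qed
qed

lemma cesaro_regular_zero: "cesaro_regular (\<lambda>_. 0)"
  unfolding cesaro_regular_def by simp

lemma ces_diff_entries:
  assumes "length \<beta> \<le> N" "A \<in> F_inf b"
  shows "l2_nth (A *\<^sub>V e \<gamma>) (\<beta> @ \<gamma>) - l2_nth (ces N A *\<^sub>V e \<gamma>) (\<beta> @ \<gamma>)
    = complex_of_real (real (length \<beta>) / (real N + 1)) * l2_nth (A *\<^sub>V e \<gamma>) (\<beta> @ \<gamma>)"
  unfolding cesaro_def entriesD[OF entries_length_sum] entriesD[OF F_inf_entries[OF assms(2)]]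
  using assms(1) by (simp add: algebra_simps)

text \<open>For N at least |\<beta>| the Cesaro mean changes the entry belonging to \<beta> by the
  relative amount |\<beta>| / (N + 1), uniformly in \<open>A\<close>.\<close>

lemma cesaro_regular_entry: "cesaro_regular (\<lambda>A. l2_nth (A *\<^sub>V e \<gamma>) \<delta> * z)"
proof (cases "\<delta> \<in> range (\<lambda>\<beta>. \<beta> @ \<gamma>)")
  case False
  have "l2_nth (A *\<^sub>V e \<gamma>) \<delta> = 0" if "A \<in> F_inf b" for A
    by (rule entriesD0[OF F_inf_entries[OF that] False])
  then show ?thesis
    by (simp add: cesaro_regular_def ces_F_inf)
next
  case True
  then obtain \<beta> where \<delta>: "\<delta> = \<beta> @ \<gamma>" by blast
  show ?thesis
    unfolding cesaro_regular_def
  proof (intro allI impI)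
    fix r :: real assume "r > 0"
    define k where "k = real (length \<beta>) * norm z"
    have diff: "norm (l2_nth (A *\<^sub>V e \<gamma>) \<delta> * z - l2_nth (ces N A *\<^sub>V e \<gamma>) \<delta> * z) \<le> r * norm A"
      if N: "N \<ge> max (length \<beta>) (nat \<lceil>k / r\<rceil>)" and A: "A \<in> F_inf b" for N A
    proof -
      have "k / r \<le> real N"
        using N by linarith
      then have "k \<le> r * (real N + 1)"
        using \<open>r > 0\<close> by (simp add: field_simps)
      then have kN: "k / (real N + 1) \<le> r"
        by (simp add: pos_divide_le_eq)
      have "norm (l2_nth (A *\<^sub>V e \<gamma>) \<delta>) \<le> norm A"
        using order_trans[OF norm_l2_nth_le cop_norm_bound[of A "e \<gamma>"]] by simp
      then have "k / (real N + 1) * norm (l2_nth (A *\<^sub>V e \<gamma>) \<delta>) \<le> r * norm A"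
        using kN \<open>r > 0\<close> by (intro mult_mono) auto
      moreover have "l2_nth (A *\<^sub>V e \<gamma>) \<delta> * z - l2_nth (ces N A *\<^sub>V e \<gamma>) \<delta> * z
          = complex_of_real (real (length \<beta>) / (real N + 1)) * l2_nth (A *\<^sub>V e \<gamma>) \<delta> * z"
        using ces_diff_entries[of \<beta> N A \<gamma>] N A by (simp add: \<delta> left_diff_distrib[symmetric])
      moreover have "norm (complex_of_real (real (length \<beta>) / (real N + 1)) * l2_nth (A *\<^sub>V e \<gamma>) \<delta> * z)
          = k / (real N + 1) * norm (l2_nth (A *\<^sub>V e \<gamma>) \<delta>)"
        unfolding norm_mult norm_of_real k_def by simp
      ultimately show ?thesis by (simp only:)
    qed
    show "\<forall>\<^sub>F N in sequentially. \<forall>A\<in>F_inf b. norm (l2_nth (A *\<^sub>V e \<gamma>) \<delta> * z - l2_nth (ces N A *\<^sub>V e \<gamma>) \<delta> * z) \<le> r * norm A"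
      by (rule eventually_mono[OF eventually_ge_at_top[of "max (length \<beta>) (nat \<lceil>k / r\<rceil>)"]]) (blast intro: diff)
  qed
qed

text \<open>Lipschitz dependence on the parameter, uniform on the unit ball, lets regularity be
  checked on a dense or total set of vectors.\<close>

lemma closed_cesaro_regular:
  fixes F :: "'x :: real_normed_vector \<Rightarrow> 'n fock cop \<Rightarrow> complex"
  assumes lip: "\<And>x y A. A \<in> F_inf b \<Longrightarrow> norm (F x A - F y A) \<le> C * norm (x - y) * norm A" and C: "0 \<le> C"
  shows "closed {x. cesaro_regular (F x)}"
  unfolding closed_sequential_limits
proof (intro allI impI, elim conjE)
  fix s x
  assume s: "\<forall>n. s n \<in> {x. cesaro_regular (F x)}" and lim: "s \<longlonglongrightarrow> x"
  have "cesaro_regular (F x)"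
  proof (rule cesaro_regular_approx)
    fix r :: real assume "r > 0"
    then have "r / (C + 1) > 0" using C by simp
    then obtain n where n: "norm (s n - x) < r / (C + 1)"
      using LIMSEQ_D[OF lim] by blast
    have "(C + 1) * norm (s n - x) \<le> (C + 1) * (r / (C + 1))"
      using n C by (intro mult_left_mono) auto
    also have "(C + 1) * (r / (C + 1)) = r"
      using C by simp
    finally have "(C + 1) * norm (s n - x) \<le> r" .
    moreover have "C * norm (s n - x) \<le> (C + 1) * norm (s n - x)"
      by (intro mult_right_mono) auto
    ultimately have "C * norm (s n - x) \<le> r"
      by linarith
    then have "C * norm (x - s n) \<le> r"
      by (simp only: norm_minus_commute)
    then have "\<forall>A\<in>F_inf b. norm (F x A - F (s n) A) \<le> r * norm A"
      using order_trans[OF lip mult_right_mono[OF _ norm_ge_zero]] by blast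
    then show "\<exists>g. cesaro_regular g \<and> (\<forall>A\<in>F_inf b. norm (F x A - g A) \<le> r * norm A)"
      using s by blast
  qed
  then show "x \<in> {x. cesaro_regular (F x)}" by simp
qed

text \<open>Totality of single coordinates in each argument reduces the claim to one matrix entry
  times a constant.\<close>

lemma cesaro_regular_amplify:
  fixes \<xi> \<eta> :: "('n list, 'h :: chilbert_space) l2"
  shows "cesaro_regular (\<lambda>A. cinner (cop_amplify A *\<^sub>V \<xi>) \<eta>)"
proof -
  have bound: "norm (cinner ((cop_amplify A :: ('n list, 'h) l2 cop) *\<^sub>V x) y) \<le> norm x * norm y * norm A" for A x y
  proof -
    have "norm (cinner ((cop_amplify A :: ('n list, 'h) l2 cop) *\<^sub>V x) y) \<le> norm (cop_amplify A :: ('n list, 'h) l2 cop) * (norm x * norm y)"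
      by (rule norm_cinner_cop_le)
    also have "\<dots> \<le> norm A * (norm x * norm y)"
      by (intro mult_right_mono cop_amplify_norm_le) simp
    finally show ?thesis by (simp only: mult_ac)
  qed
  have single: "cesaro_regular (\<lambda>A. cinner (cop_amplify A *\<^sub>V l2_single \<gamma> h) \<eta>)" for \<gamma> and h :: 'h and \<eta>
  proof -
    have "\<eta> \<in> {\<eta>. cesaro_regular (\<lambda>A. cinner (cop_amplify A *\<^sub>V l2_single \<gamma> h) \<eta>)}"
    proof (rule l2_total)
      show "closed {\<eta>. cesaro_regular (\<lambda>A. cinner (cop_amplify A *\<^sub>V l2_single \<gamma> h) \<eta>)}"
      proof (rule closed_cesaro_regular)
        show "norm (cinner (cop_amplify A *\<^sub>V l2_single \<gamma> h) x - cinner (cop_amplify A *\<^sub>V l2_single \<gamma> h) y) \<le> norm h * norm (x - y) * norm A" for x y A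
          using bound[of A "l2_single \<gamma> h" "x - y"] by (simp only: cinner_diff_right norm_l2_single)
      qed simp
      fix \<delta> k
      have "cinner (cop_amplify A *\<^sub>V l2_single \<gamma> h) (l2_single \<delta> k) = l2_nth (A *\<^sub>V e \<gamma>) \<delta> * cinner h k" for A
        by (simp add: cop_amplify_single cinner_l2_single_right cinner_scaleC_left)
      then show "l2_single \<delta> k \<in> {\<eta>. cesaro_regular (\<lambda>A. cinner (cop_amplify A *\<^sub>V l2_single \<gamma> h) \<eta>)}"
        by (simp only: mem_Collect_eq cesaro_regular_entry)
    qed (simp_all add: cesaro_regular_zero cinner_add_right cesaro_regular_add)
    then show ?thesis by simp
  qed
  have "\<xi> \<in> {\<xi>. cesaro_regular (\<lambda>A. cinner (cop_amplify A *\<^sub>V \<xi>) \<eta>)}"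
  proof (rule l2_total)
    show "closed {\<xi>. cesaro_regular (\<lambda>A. cinner (cop_amplify A *\<^sub>V \<xi>) \<eta>)}"
    proof (rule closed_cesaro_regular)
      show "norm (cinner (cop_amplify A *\<^sub>V x) \<eta> - cinner (cop_amplify A *\<^sub>V y) \<eta>) \<le> norm \<eta> * norm (x - y) * norm A" for x y A
        using bound[of A "x - y" \<eta>] by (simp only: cop_diff_right cinner_diff_left mult_ac)
    qed simp
  qed (simp_all add: cesaro_regular_zero cop_add_right cinner_add_left cesaro_regular_add single)
  then show ?thesis by simp
qed

lemma cesaro_regular_cinner: "cesaro_regular (\<lambda>A. cinner (A *\<^sub>V x) y)"
  using cesaro_regular_amplify[of x y] by (simp only: cop_amplify_complex)

lemma cesaro_regular_trace_pairing: "cesaro_regular (trace_pairing xs)"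
proof (induction xs)
  case Nil
  have "trace_pairing [] = (\<lambda>_ :: 'n fock cop. 0)" by (rule ext) simp
  then show ?case by (simp only: cesaro_regular_zero)
next
  case (Cons p xs)
  have "trace_pairing (p # xs) = (\<lambda>A :: 'n fock cop. cinner (A *\<^sub>V fst p) (snd p) + trace_pairing xs A)" by (rule ext) simp
  then show ?case by (simp only: cesaro_regular_add[OF cesaro_regular_cinner Cons])
qed

lemma cesaro_regular_diff_trace_pairing:
  assumes "cesaro_regular f" shows "cesaro_regular (\<lambda>A. f A - trace_pairing xs A)"
proof -
  have "trace_pairing (map (\<lambda>p. (- fst p, snd p)) xs) A = - trace_pairing xs A" for A :: "'n fock cop"
    by (induction xs) (simp_all add: cinner_minus_left bounded_linear.linear[OF cop_bounded_linear, THEN linear_neg])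
  then have "(\<lambda>A. f A - trace_pairing xs A) = (\<lambda>A. f A + trace_pairing (map (\<lambda>p. (- fst p, snd p)) xs) A)"
    by (intro ext) simp
  then show ?thesis
    by (simp only: cesaro_regular_add[OF assms cesaro_regular_trace_pairing])
qed

end

subsection \<open>Trace class representation\<close>

context fock_weights
begin

text \<open>The value f(ces N A) depends on the coefficients of length at most N, which are
  coordinates of the vacuum column of \<open>A\<close>. The vector \<open>v\<close> collects the
  Fejer weights, the normalization sqrt(b \<alpha>) and the values of \<open>f\<close> on the
  monomials, conjugated for the second slot of the inner product.\<close>

lemma coefficient_vector:
  assumes f: "linear_functional f"
  obtains v where "coord_proj {\<alpha>. length \<alpha> \<le> N} *\<^sub>V v = v"
    "\<And>A. cinner (A *\<^sub>V e []) v = f (ces N A)"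
proof
  let ?L = "{\<alpha> :: 'n list. length \<alpha> \<le> N}"
  let ?u = "\<lambda>\<alpha> :: 'n list. complex_of_real (1 - real (length \<alpha>) / (real N + 1))"
  define v where "v = (\<Sum>\<alpha>\<in>?L. l2_single \<alpha> (cnj (?u \<alpha> * complex_of_real (sqrt (b \<alpha>)) * f (word_op W \<alpha>))))"
  show "coord_proj ?L *\<^sub>V v = v"
    unfolding v_def cop_sum_right by (rule sum.cong) (simp_all add: coord_proj_single)
  show "cinner (A *\<^sub>V e []) v = f (ces N A)" for A
  proof -
    have "cinner (A *\<^sub>V e []) v = (\<Sum>\<alpha>\<in>?L. l2_nth (A *\<^sub>V e []) \<alpha> * (?u \<alpha> * complex_of_real (sqrt (b \<alpha>)) * f (word_op W \<alpha>)))"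
      unfolding v_def cinner.sum_right cinner_l2_single_right by (simp add: cinner_complex_def)
    also have "\<dots> = (\<Sum>\<alpha>\<in>?L. (?u \<alpha> * symbol A \<alpha>) * f (word_op W \<alpha>))"
      by (rule sum.cong) (simp_all add: symbol_def mult_ac)
    also have "\<dots> = f (ces N A)"
      unfolding ces_eq by (rule linear_functional_sum[OF f word_op_F_inf, symmetric])
    finally show ?thesis .
  qed
qed

text \<open>The image in the Fock space of a ball of finite-rank trace class functionals, each
  restricted to the algebra and written as a vacuum functional.\<close>

definition representable :: "real \<Rightarrow> 'n fock set"
  where "representable c = {v. \<exists>xs. size_fst xs \<le> c \<and> size_snd xs \<le> c \<and>
    (\<forall>A\<in>F_inf b. cinner (A *\<^sub>V e []) v = trace_pairing xs A)}"

lemma representable_zero: "0 \<le> c \<Longrightarrow> 0 \<in> representable c"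
  unfolding representable_def by (rule CollectI) (intro exI[of _ "[]"], simp add: size_fst_def size_snd_def)

text \<open>Scale the two lists by the square roots of the weights and append them.\<close>

lemma convex_representable: "convex (representable c)"
  unfolding convex_def
proof (intro ballI allI impI)
  fix v w and s t :: real
  assume v: "v \<in> representable c" and w: "w \<in> representable c" and st: "0 \<le> s" "0 \<le> t" "s + t = 1"
  obtain xs where xs: "size_fst xs \<le> c" "size_snd xs \<le> c" "\<And>A. A \<in> F_inf b \<Longrightarrow> cinner (A *\<^sub>V e []) v = trace_pairing xs A"
    using v unfolding representable_def by blast
  obtain ys where ys: "size_fst ys \<le> c" "size_snd ys \<le> c" "\<And>A. A \<in> F_inf b \<Longrightarrow> cinner (A *\<^sub>V e []) w = trace_pairing ys A"
    using w unfolding representable_def by blast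
  let ?zs = "scale_pairs (sqrt s) xs @ scale_pairs (sqrt t) ys"
  have comb: "s * p + t * q \<le> c" if "p \<le> c" "q \<le> c" for p q
    using convex_bound_le[OF that st] .
  have "size_fst ?zs \<le> c" "size_snd ?zs \<le> c"
    using st comb xs(1,2) ys(1,2) by (simp_all add: scale_pairs_simps)
  moreover have "cinner (A *\<^sub>V e []) (s *\<^sub>R v + t *\<^sub>R w) = trace_pairing ?zs A" if "A \<in> F_inf b" for A
    using st xs(3)[OF that] ys(3)[OF that] by (simp add: scale_pairs_simps cinner_add_right cinner_scaleR_right)
  ultimately show "s *\<^sub>R v + t *\<^sub>R w \<in> representable c"
    unfolding representable_def by blast
qed

text \<open>The window identity read as a formula for a functional: the M + N + 1 compressed pairs
  form the list, and the overlap count N + 1 cancels the averaging factor in both sizes.\<close>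

lemma window_pairing:
  assumes c: "(norm x)\<^sup>2 \<le> c" "(norm y)\<^sup>2 \<le> c"
  obtains xs where "size_fst xs \<le> c" "size_snd xs \<le> c"
    "\<And>A. A \<in> F_inf b \<Longrightarrow> cinner (ces N A *\<^sub>V coord_proj {\<alpha>. length \<alpha> \<le> M} *\<^sub>V x) (coord_proj {\<alpha>. length \<alpha> \<le> M} *\<^sub>V y) = trace_pairing xs A"
proof
  define L where "L = {\<alpha> :: 'n list. length \<alpha> \<le> M}"
  define Q where "Q = (\<lambda>m. coord_proj (L \<inter> {\<alpha>. length \<alpha> \<le> m \<and> m \<le> length \<alpha> + N}) :: 'n fock cop)"
  define ys where "ys = map (\<lambda>m. (Q m *\<^sub>V x, Q m *\<^sub>V y)) [0..<Suc (M + N)]"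
  define xs where "xs = scale_pairs (sqrt (1 / (real N + 1))) ys"
  have interv: "{0..<Suc (M + N)} = {..M + N}" by auto
  have size: "size_fst ys = (\<Sum>m\<le>M + N. (norm (Q m *\<^sub>V x))\<^sup>2)" "size_snd ys = (\<Sum>m\<le>M + N. (norm (Q m *\<^sub>V y))\<^sup>2)"
    "trace_pairing ys A = (\<Sum>m\<le>M + N. cinner (A *\<^sub>V Q m *\<^sub>V x) (Q m *\<^sub>V y))" for A
    unfolding size_fst_def size_snd_def trace_pairing_def ys_def map_map o_def
    by (simp_all only: interv_sum_list_conv_sum_set_nat set_upt interv fst_conv snd_conv case_prod_conv)
  have bound: "(1 / (real N + 1)) * (\<Sum>m\<le>M + N. (norm (Q m *\<^sub>V z))\<^sup>2) \<le> c" if "(norm z)\<^sup>2 \<le> c" for z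
  proof -
    have "(1 / (real N + 1)) * (\<Sum>m\<le>M + N. (norm (Q m *\<^sub>V z))\<^sup>2) \<le> (1 / (real N + 1)) * ((real N + 1) * (norm z)\<^sup>2)"
      unfolding Q_def L_def by (intro mult_left_mono window_norm_sum) simp
    also have "\<dots> = (norm z)\<^sup>2" by simp
    finally show ?thesis using that by linarith
  qed
  have sq: "(sqrt (1 / (real N + 1)))\<^sup>2 = 1 / (real N + 1)" by simp
  show "size_fst xs \<le> c" "size_snd xs \<le> c"
    unfolding xs_def scale_pairs_simps size sq by (rule bound[OF c(1)], rule bound[OF c(2)])
  fix A assume A: "A \<in> F_inf b"
  have "cinner (ces N A *\<^sub>V coord_proj L *\<^sub>V x) (coord_proj L *\<^sub>V y)
      = cinner ((coord_proj L o\<^sub>C ces N A o\<^sub>C coord_proj L) *\<^sub>V x) y"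
    by (simp only: cop_apply_simps coord_proj_selfadjoint)
  also have "\<dots> = cinner (((1 / (real N + 1)) *\<^sub>R (\<Sum>m\<le>M + N. Q m o\<^sub>C A o\<^sub>C Q m)) *\<^sub>V x) y"
    unfolding Q_def L_def cesaro_window[OF F_inf_entries[OF A]] ..
  also have "\<dots> = trace_pairing xs A"
    unfolding xs_def scale_pairs_simps size sq cop_apply_simps(5,8) cop_sum_apply cinner_scaleR_left cinner.sum_left
    unfolding Q_def coord_proj_selfadjoint ..
  finally show "cinner (ces N A *\<^sub>V coord_proj {\<alpha>. length \<alpha> \<le> M} *\<^sub>V x) (coord_proj {\<alpha>. length \<alpha> \<le> M} *\<^sub>V y) = trace_pairing xs A"
    unfolding L_def .
qed

text \<open>Test with y parallel to C x, both vectors scaled to norm sqrt(c).\<close>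

lemma norm_le_of_quadratic:
  assumes c: "0 < c" and le: "\<And>x y. (norm x)\<^sup>2 \<le> c \<Longrightarrow> (norm y)\<^sup>2 \<le> c \<Longrightarrow> Re (cinner (C *\<^sub>V x) y) \<le> k"
  shows "c * norm C \<le> k"
proof -
  have k: "0 \<le> k"
    using le[of 0 0] c by simp
  have "norm C \<le> k / c"
  proof (rule cop_norm_leI)
    fix z
    show "norm (C *\<^sub>V z) \<le> k / c * norm z"
    proof (cases "C *\<^sub>V z = 0")
      case True
      then show ?thesis using k c by simp
    next
      case False
      then have nz: "norm z > 0" "norm (C *\<^sub>V z) > 0" by auto
      define x where "x = (sqrt c / norm z) *\<^sub>R z"
      define y where "y = (sqrt c / norm (C *\<^sub>V z)) *\<^sub>R (C *\<^sub>V z)"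
      have "norm x = sqrt c" "norm y = sqrt c"
        using nz c by (simp_all add: x_def y_def)
      then have "Re (cinner (C *\<^sub>V x) y) \<le> k"
        using c by (intro le) simp_all
      also have "Re (cinner (C *\<^sub>V x) y) = (sqrt c * sqrt c) / norm z * norm (C *\<^sub>V z)"
        using nz by (simp add: x_def y_def cop_scaleR_right cinner_scaleR_left cinner_scaleR_right
            Re_cinner_self power2_eq_square)
      also have "sqrt c * sqrt c = c"
        using c by simp
      finally show ?thesis
        using nz c by (simp add: field_simps)
    qed
  qed (use k c in simp)
  then show ?thesis
    using c by (simp add: field_simps)
qed

(* Hahn-Banach for the finite-dimensional quotient, carried out by projecting onto a closed convex
   subset of the Fock space. *)
lemma coefficient_vector_in_closure:
  assumes f: "linear_functional f" and bound: "\<And>A. A \<in> F_inf b \<Longrightarrow> norm (f A) \<le> c * norm A" and c: "0 < c"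
    and v: "coord_proj {\<alpha>. length \<alpha> \<le> N} *\<^sub>V v = v" "\<And>A. cinner (A *\<^sub>V e []) v = f (ces N A)"
  shows "v \<in> closure (representable c)"
proof (rule ccontr)
  assume notin: "v \<notin> closure (representable c)"
  let ?L = "{\<alpha> :: 'n list. length \<alpha> \<le> N}"
  have "representable c \<noteq> {}"
    using representable_zero[of c] c by auto
  then have "closure (representable c) \<noteq> {}"
    by simp
  then obtain p where p: "p \<in> closure (representable c)" "\<And>s. s \<in> closure (representable c) \<Longrightarrow> inner (v - p) (s - p) \<le> 0"
    using closest_point_exists_hilbert[OF closed_closure convex_closure[OF convex_representable], of c v] by blast
  define u where "u = v - p"
  have "u \<noteq> 0"
    using p(1) notin by (auto simp: u_def)
  \<comment> \<open>The polynomial whose vacuum column is \<open>u\<close> cut to degree N. It turns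
    inner products of \<open>u\<close> with vectors supported in these degrees into values of
    functionals at \<open>B\<close>, the separating element of a Hahn-Banach argument.\<close>
  define B where "B = length_sum (\<lambda>_. 1) N (\<lambda>\<alpha>. complex_of_real (sqrt (b \<alpha>)) * l2_nth u \<alpha>) W"
  have B: "B \<in> F_inf b"
    unfolding B_def by (rule length_sum_F_inf)
  have "B *\<^sub>V e [] = coord_proj ?L *\<^sub>V u"
  proof (rule l2_eqI)
    fix \<beta>
    have "sqrt (1 / b \<beta>) * sqrt (b \<beta>) = 1"
      using b_pos[of \<beta>] by (simp add: real_sqrt_mult[symmetric])
    then have "complex_of_real (sqrt (1 / b \<beta>)) * (complex_of_real (sqrt (b \<beta>)) * l2_nth u \<beta>) = l2_nth u \<beta>"
      by (simp only: mult.assoc[symmetric] of_real_mult[symmetric]) simp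
    moreover have "l2_nth (B *\<^sub>V e []) \<beta>
        = complex_of_real (sqrt (1 / b \<beta>)) * (if length \<beta> \<le> N then complex_of_real 1 * (complex_of_real (sqrt (b \<beta>)) * l2_nth u \<beta>) else 0)"
      using entriesD[OF entries_length_sum, of "\<lambda>_. 1" N "\<lambda>\<alpha>. complex_of_real (sqrt (b \<alpha>)) * l2_nth u \<alpha>" "[]" \<beta>]
      unfolding B_def append_Nil2 b_Nil .
    ultimately show "l2_nth (B *\<^sub>V e []) \<beta> = l2_nth (coord_proj ?L *\<^sub>V u) \<beta>"
      by simp
  qed
  then have inner_u: "inner u w = Re (cinner (B *\<^sub>V e []) w)" if "coord_proj ?L *\<^sub>V w = w" for w
    using that by (simp add: inner_eq_Re_cinner coord_proj_selfadjoint)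
  have "Re (f (ces N B)) \<le> c * norm (ces N B)"
    using order_trans[OF complex_Re_le_cmod bound[OF ces_F_inf]] .
  then have uv: "inner u v \<le> c * norm (ces N B)"
    unfolding inner_u[OF v(1)] v(2) .
  \<comment> \<open>Vector functionals of \<open>ces N A\<close> at truncated vectors have
    coefficient vectors in \<open>representable c\<close>, hence obey the separating inequality; the
    truncation to degree M makes the pairing finite and is removed in the limit.\<close>
  have key: "Re (cinner (ces N B *\<^sub>V x) y) \<le> c * norm (ces N B) - (norm u)\<^sup>2" if x: "(norm x)\<^sup>2 \<le> c" and y: "(norm y)\<^sup>2 \<le> c" for x y
  proof (rule tendsto_upperbound)
    let ?P = "\<lambda>M. coord_proj {\<alpha> :: 'n list. length \<alpha> \<le> M} :: 'n fock cop"
    have P: "(\<lambda>M. ?P M *\<^sub>V z) \<longlonglongrightarrow> z" for z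
      by (rule coord_proj_tendsto) (simp add: eventually_ge_at_top)
    show "(\<lambda>M. Re (cinner (ces N B *\<^sub>V ?P M *\<^sub>V x) (?P M *\<^sub>V y))) \<longlonglongrightarrow> Re (cinner (ces N B *\<^sub>V x) y)"
      by (intro tendsto_Re cinner.tendsto cop_tendsto P)
    have "Re (cinner (ces N B *\<^sub>V ?P M *\<^sub>V x) (?P M *\<^sub>V y)) \<le> c * norm (ces N B) - (norm u)\<^sup>2" for M
    proof -
      obtain xs where xs: "size_fst xs \<le> c" "size_snd xs \<le> c"
        "\<And>A. A \<in> F_inf b \<Longrightarrow> cinner (ces N A *\<^sub>V ?P M *\<^sub>V x) (?P M *\<^sub>V y) = trace_pairing xs A"
        using window_pairing[OF x y, of N M] by blast
      obtain w where w: "coord_proj ?L *\<^sub>V w = w" "\<And>A. cinner (A *\<^sub>V e []) w = cinner (ces N A *\<^sub>V ?P M *\<^sub>V x) (?P M *\<^sub>V y)"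
        using coefficient_vector[OF linear_functional_cinner, of N "?P M *\<^sub>V x" "?P M *\<^sub>V y"] by blast
      have "w \<in> representable c"
        unfolding representable_def using xs w(2) by auto
      then have "inner u (w - p) \<le> 0"
        unfolding u_def using p(2) closure_subset by blast
      moreover have "inner u v - inner u p = (norm u)\<^sup>2"
        by (simp add: u_def power2_norm_eq_inner inner_diff_left inner_diff_right)
      ultimately have "inner u w \<le> inner u v - (norm u)\<^sup>2"
        by (simp add: inner_diff_right)
      then show ?thesis
        unfolding inner_u[OF w(1)] w(2) using uv by linarith
    qed
    then show "\<forall>\<^sub>F M in sequentially. Re (cinner (ces N B *\<^sub>V ?P M *\<^sub>V x) (?P M *\<^sub>V y)) \<le> c * norm (ces N B) - (norm u)\<^sup>2"
      by simp
  qed simp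
  \<comment> \<open>The form ranges up to c * norm (ces N B) on these x and y, which leaves no room
    for the gap (norm u)^2.\<close>
  have "c * norm (ces N B) \<le> c * norm (ces N B) - (norm u)\<^sup>2"
    by (rule norm_le_of_quadratic[OF c key])
  then show False
    using \<open>u \<noteq> 0\<close> by simp
qed

text \<open>Two errors of c / 4: one from passing to a Cesaro truncation of \<open>f\<close>, one
  from replacing \<open>v\<close> by a nearby representable vector, whose vacuum functional differs
  by at most the distance.\<close>

lemma trace_pairing_step:
  assumes f: "linear_functional f" and reg: "cesaro_regular f"
    and bound: "\<And>A. A \<in> F_inf b \<Longrightarrow> norm (f A) \<le> c * norm A" and c: "0 < c"
  obtains xs where "size_fst xs \<le> c" "size_snd xs \<le> c"
    "\<And>A. A \<in> F_inf b \<Longrightarrow> norm (f A - trace_pairing xs A) \<le> c / 2 * norm A"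
proof -
  have c4: "c / 4 > 0" using c by simp
  have "\<forall>\<^sub>F N in sequentially. \<forall>A\<in>F_inf b. norm (f A - f (ces N A)) \<le> c / 4 * norm A"
    using reg c4 unfolding cesaro_regular_def by blast
  then obtain N where N: "\<And>A. A \<in> F_inf b \<Longrightarrow> norm (f A - f (ces N A)) \<le> c / 4 * norm A"
    unfolding eventually_sequentially by blast
  obtain v where v: "coord_proj {\<alpha>. length \<alpha> \<le> N} *\<^sub>V v = v" "\<And>A. cinner (A *\<^sub>V e []) v = f (ces N A)"
    using coefficient_vector[OF f, of N] by blast
  obtain w where w: "w \<in> representable c" "dist w v < c / 4"
    using coefficient_vector_in_closure[OF f bound c v] c4 closure_approachable by blast
  obtain xs where xs: "size_fst xs \<le> c" "size_snd xs \<le> c"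
    "\<And>A. A \<in> F_inf b \<Longrightarrow> cinner (A *\<^sub>V e []) w = trace_pairing xs A"
    using w(1) unfolding representable_def by blast
  have "norm (f A - trace_pairing xs A) \<le> c / 2 * norm A" if A: "A \<in> F_inf b" for A
  proof -
    have "f (ces N A) - trace_pairing xs A = cinner (A *\<^sub>V e []) (v - w)"
      by (simp add: cinner_diff_right v(2) xs(3)[OF A])
    then have "norm (f (ces N A) - trace_pairing xs A) \<le> norm A * (1 * norm (v - w))"
      using norm_cinner_cop_le[of A "e []" "v - w"] by simp
    also have "\<dots> \<le> norm A * (c / 4)"
      using w(2) by (intro mult_left_mono) (auto simp: dist_norm norm_minus_commute)
    finally have "norm (f (ces N A) - trace_pairing xs A) \<le> c / 4 * norm A"
      by (simp add: mult.commute)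
    moreover have "f A - trace_pairing xs A = (f A - f (ces N A)) + (f (ces N A) - trace_pairing xs A)"
      by simp
    ultimately show ?thesis
      using N[OF A] norm_triangle_ineq[of "f A - f (ces N A)" "f (ces N A) - trace_pairing xs A"] by simp
  qed
  then show ?thesis
    using that xs(1,2) by blast
qed

text \<open>The remainder after a step is again linear and regular, with half the bound, so the step
  repeats with c / 2^j and the sizes form a geometric series.\<close>

lemma trace_pairing_series:
  assumes f: "linear_functional f" and reg: "cesaro_regular f"
    and bound: "\<And>A. A \<in> F_inf b \<Longrightarrow> norm (f A) \<le> c * norm A" and c: "0 < c"
  obtains xs where "\<And>j. size_fst (xs j) \<le> c / 2 ^ j" "\<And>j. size_snd (xs j) \<le> c / 2 ^ j"
    "\<And>A. A \<in> F_inf b \<Longrightarrow> (\<lambda>j. trace_pairing (xs j) A) sums f A"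
proof -
  \<comment> \<open>The clause at j = 0 pins the starting functional, since dependent choice yields
    only some sequence that satisfies the invariant.\<close>
  define good where "good = (\<lambda>j g. linear_functional g \<and> cesaro_regular g \<and> (\<forall>A\<in>F_inf b. norm (g A) \<le> c / 2 ^ j * norm A) \<and> (j = 0 \<longrightarrow> g = f))"
  define next_step where "next_step = (\<lambda>(j :: nat) g (h :: 'n fock cop \<Rightarrow> complex). \<exists>xs. size_fst xs \<le> c / 2 ^ j \<and> size_snd xs \<le> c / 2 ^ j \<and> h = (\<lambda>A. g A - trace_pairing xs A))"
  have "\<exists>g. \<forall>j. good j (g j) \<and> next_step j (g j) (g (Suc j))"
  proof (rule dependent_nat_choice)
    show "\<exists>g. good 0 g"
      by (rule exI[of _ f]) (simp add: good_def f reg bound)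
    fix g and j :: nat assume "good j g"
    then have g: "linear_functional g" "cesaro_regular g" "\<And>A. A \<in> F_inf b \<Longrightarrow> norm (g A) \<le> c / 2 ^ j * norm A"
      unfolding good_def by auto
    have "c / 2 ^ j > 0" using c by simp
    then obtain xs where xs: "size_fst xs \<le> c / 2 ^ j" "size_snd xs \<le> c / 2 ^ j"
      "\<And>A. A \<in> F_inf b \<Longrightarrow> norm (g A - trace_pairing xs A) \<le> c / 2 ^ j / 2 * norm A"
      using trace_pairing_step[OF g] by blast
    have "good (Suc j) (\<lambda>A. g A - trace_pairing xs A)"
      unfolding good_def using xs(3)
      by (auto intro: linear_functional_diff g linear_functional_trace_pairing cesaro_regular_diff_trace_pairing simp: mult.commute)
    moreover have "next_step j g (\<lambda>A. g A - trace_pairing xs A)"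
      unfolding next_step_def using xs(1,2) by blast
    ultimately show "\<exists>h. good (Suc j) h \<and> next_step j g h"
      by blast
  qed
  then obtain g where g: "\<And>j. good j (g j)" "\<And>j. next_step j (g j) (g (Suc j))"
    by blast
  have "\<forall>j. \<exists>xs. size_fst xs \<le> c / 2 ^ j \<and> size_snd xs \<le> c / 2 ^ j \<and> g (Suc j) = (\<lambda>A. g j A - trace_pairing xs A)"
    using g(2) unfolding next_step_def by blast
  then obtain xs where xs: "\<And>j. size_fst (xs j) \<le> c / 2 ^ j" "\<And>j. size_snd (xs j) \<le> c / 2 ^ j"
    "\<And>j. g (Suc j) = (\<lambda>A. g j A - trace_pairing (xs j) A)"
    by metis
  have g0: "g 0 = f"
    using g(1)[of 0] by (simp add: good_def)
  have partial: "(\<Sum>j<J. trace_pairing (xs j) A) = f A - g J A" for J A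
    by (induction J) (simp_all add: g0 xs(3))
  have "(\<lambda>j. trace_pairing (xs j) A) sums f A" if A: "A \<in> F_inf b" for A
  proof -
    have "(\<lambda>J. g J A) \<longlonglongrightarrow> 0"
    proof (rule Lim_null_comparison)
      show "\<forall>\<^sub>F J in sequentially. norm (g J A) \<le> (c * norm A) * (1 / 2) ^ J"
        using g(1) A by (intro always_eventually) (auto simp: good_def power_divide)
      have "(\<lambda>J. (c * norm A) * (1 / 2) ^ J) \<longlonglongrightarrow> (c * norm A) * 0"
        by (intro tendsto_mult tendsto_const LIMSEQ_power_zero) simp
      then show "(\<lambda>J. (c * norm A) * (1 / 2) ^ J) \<longlonglongrightarrow> 0" by simp
    qed
    then have "(\<lambda>J. f A - g J A) \<longlonglongrightarrow> f A - 0"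
      by (intro tendsto_diff tendsto_const)
    then show ?thesis
      unfolding sums_def partial by simp
  qed
  then show ?thesis
    using that xs(1,2) by blast
qed

text \<open>The countably many finite lists are padded with zeros to a double family and enumerated
  by \<open>prod_decode\<close>. Each total size is at most 2d by the geometric series, and
  unconditional summability permits the regrouping into rows.\<close>

lemma functional_representation:
  assumes f: "linear_functional f" and reg: "cesaro_regular f"
    and bound: "\<And>A. A \<in> F_inf b \<Longrightarrow> norm (f A) \<le> c * norm A"
  obtains x y :: "nat \<Rightarrow> 'n fock" where "summable (\<lambda>k. (norm (x k))\<^sup>2)" "summable (\<lambda>k. (norm (y k))\<^sup>2)"
    "\<And>A. A \<in> F_inf b \<Longrightarrow> f A = (\<Sum>k. cinner (A *\<^sub>V x k) (y k))"
proof -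
  \<comment> \<open>The iteration demands a positive bound, whatever the sign of c.\<close>
  define d where "d = max c 1"
  have d: "d > 0" "\<And>A. A \<in> F_inf b \<Longrightarrow> norm (f A) \<le> d * norm A"
    using order_trans[OF bound mult_right_mono] by (auto simp: d_def)
  obtain xs where xs: "\<And>j. size_fst (xs j) \<le> d / 2 ^ j" "\<And>j. size_snd (xs j) \<le> d / 2 ^ j"
    "\<And>A. A \<in> F_inf b \<Longrightarrow> (\<lambda>j. trace_pairing (xs j) A) sums f A"
    using trace_pairing_series[OF f reg d(2) d(1)] by blast
  define X where "X = (\<lambda>(j, k). if k < length (xs j) then fst (xs j ! k) else 0)"
  define Y where "Y = (\<lambda>(j, k). if k < length (xs j) then snd (xs j ! k) else 0)"
  have summable: "(\<lambda>p. (norm (Z p))\<^sup>2) summable_on UNIV"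
    if Z: "\<And>j k. k \<ge> length (xs j) \<Longrightarrow> Z (j, k) = 0" "\<And>j. (\<Sum>k<length (xs j). (norm (Z (j, k)))\<^sup>2) \<le> d / 2 ^ j"
    for Z :: "nat \<times> nat \<Rightarrow> 'n fock"
  proof (rule nonneg_bdd_above_summable_on)
    have Z0: "k < length (xs j)" if "Z (j, k) \<noteq> 0" for j k
      using Z(1)[of j k] that by (cases "k < length (xs j)") auto
    show "bdd_above (sum (\<lambda>p. (norm (Z p))\<^sup>2) ` {F. F \<subseteq> UNIV \<and> finite F})"
    proof (rule bdd_aboveI2)
      fix F assume "F \<in> {F :: (nat \<times> nat) set. F \<subseteq> UNIV \<and> finite F}"
      then have "finite F" by simp
      then obtain J where J: "fst ` F \<subseteq> {..<J}"
        using finite_nat_bounded[of "fst ` F"] by auto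
      have "sum (\<lambda>p. (norm (Z p))\<^sup>2) F = sum (\<lambda>p. (norm (Z p))\<^sup>2) (F \<inter> (SIGMA j:{..<J}. {..<length (xs j)}))"
        using \<open>finite F\<close> J by (intro sum.mono_neutral_right) (auto intro: Z0)
      also have "\<dots> \<le> sum (\<lambda>p. (norm (Z p))\<^sup>2) (SIGMA j:{..<J}. {..<length (xs j)})"
        by (intro sum_mono2) auto
      also have "\<dots> = (\<Sum>j<J. \<Sum>k<length (xs j). (norm (Z (j, k)))\<^sup>2)"
        by (subst sum.Sigma) (simp_all add: case_prod_beta)
      also have "\<dots> \<le> (\<Sum>j<J. d / 2 ^ j)"
        by (intro sum_mono Z(2))
      also have "\<dots> = d * (\<Sum>j<J. (1 / 2) ^ j)"
        by (simp add: sum_distrib_left power_divide)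
      also have "\<dots> \<le> d * 2"
        using d(1) by (intro mult_left_mono) (simp_all add: sum_gp_strict)
      finally show "sum (\<lambda>p. (norm (Z p))\<^sup>2) F \<le> d * 2" .
    qed
  qed simp
  have size_sum: "size_fst zs = (\<Sum>k<length zs. (norm (fst (zs ! k)))\<^sup>2)" "size_snd zs = (\<Sum>k<length zs. (norm (snd (zs ! k)))\<^sup>2)"
    "trace_pairing zs A = (\<Sum>k<length zs. cinner (A *\<^sub>V fst (zs ! k)) (snd (zs ! k)))" for zs :: "('n fock \<times> 'n fock) list" and A
    unfolding size_fst_def size_snd_def trace_pairing_def sum_list_sum_nth by (simp_all add: atLeast0LessThan case_prod_beta)
  have X: "(\<lambda>p. (norm (X p))\<^sup>2) summable_on UNIV"
    by (rule summable) (use xs(1) in \<open>simp_all add: X_def size_sum\<close>)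
  have Y: "(\<lambda>p. (norm (Y p))\<^sup>2) summable_on UNIV"
    by (rule summable) (use xs(2) in \<open>simp_all add: Y_def size_sum\<close>)
  have bij: "bij_betw prod_decode (UNIV :: nat set) UNIV"
    by (rule bij_prod_decode)
  show ?thesis
  proof (rule that[of "\<lambda>n. X (prod_decode n)" "\<lambda>n. Y (prod_decode n)"])
    show "summable (\<lambda>k. (norm (X (prod_decode k)))\<^sup>2)"
      by (rule summable_on_imp_summable) (use X summable_on_reindex_bij_betw[OF bij, of "\<lambda>p. (norm (X p))\<^sup>2"] in blast)
    show "summable (\<lambda>k. (norm (Y (prod_decode k)))\<^sup>2)"
      by (rule summable_on_imp_summable) (use Y summable_on_reindex_bij_betw[OF bij, of "\<lambda>p. (norm (Y p))\<^sup>2"] in blast)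
    fix A assume A: "A \<in> F_inf b"
    define g where "g = (\<lambda>p. cinner (A *\<^sub>V X p) (Y p))"
    have g_sum: "g summable_on UNIV"
    proof (rule Infinite_Sum.abs_summable_summable, rule Infinite_Sum.abs_summable_on_comparison_test')
      show "(\<lambda>p. norm A * ((norm (X p))\<^sup>2 + (norm (Y p))\<^sup>2)) summable_on UNIV"
        by (intro summable_on_cmult_right summable_on_add X Y)
      show "norm (g p) \<le> norm A * ((norm (X p))\<^sup>2 + (norm (Y p))\<^sup>2)" for p
      proof -
        have "0 \<le> (norm (X p) - norm (Y p))\<^sup>2" "0 \<le> norm (X p) * norm (Y p)" by simp_all
        then have "norm (X p) * norm (Y p) \<le> (norm (X p))\<^sup>2 + (norm (Y p))\<^sup>2"
          unfolding power2_diff by linarith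
        then have "norm A * (norm (X p) * norm (Y p)) \<le> norm A * ((norm (X p))\<^sup>2 + (norm (Y p))\<^sup>2)"
          by (rule mult_left_mono) simp
        then show ?thesis
          unfolding g_def using norm_cinner_cop_le[of A "X p" "Y p"] by linarith
      qed
    qed
    have row: "infsum (\<lambda>k. g (j, k)) UNIV = trace_pairing (xs j) A" for j
    proof -
      have "infsum (\<lambda>k. g (j, k)) UNIV = infsum (\<lambda>k. g (j, k)) {..<length (xs j)}"
        by (rule infsum_cong_neutral) (auto simp: g_def X_def Y_def)
      then show ?thesis
        by (simp add: size_sum g_def X_def Y_def)
    qed
    have gU: "g summable_on (UNIV \<times> UNIV)"
      using g_sum by simp
    have "(\<lambda>j. infsum (\<lambda>k. g (j, k)) UNIV) summable_on UNIV"
      using summable_on_Sigma_banach[of "\<lambda>j k. g (j, k)" UNIV "\<lambda>_. UNIV"] gU by (simp add: case_prod_beta)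
    from has_sum_imp_sums[OF has_sum_infsum[OF this]]
    have "f A = infsum (\<lambda>j. infsum (\<lambda>k. g (j, k)) UNIV) UNIV"
      unfolding row using sums_unique2[OF xs(3)[OF A]] by blast
    also have "\<dots> = infsum g UNIV"
      using infsum_Sigma_banach[OF gU] by simp
    also have "\<dots> = infsum (\<lambda>n. g (prod_decode n)) UNIV"
      by (rule infsum_reindex_bij_betw[OF bij, symmetric])
    also have "\<dots> = (\<Sum>n. g (prod_decode n))"
    proof -
      have "(\<lambda>n. g (prod_decode n)) summable_on UNIV"
        using g_sum summable_on_reindex_bij_betw[OF bij, of g] by blast
      from has_sum_imp_sums[OF has_sum_infsum[OF this]] show ?thesis
        by (rule sums_unique)
    qed
    finally show "f A = (\<Sum>n. cinner (A *\<^sub>V X (prod_decode n)) (Y (prod_decode n)))"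
      by (simp only: g_def)
  qed
qed

end

section \<open>The extension to the noncommutative Hardy algebra\<close>

context fock_weights
begin

text \<open>Every element of the algebra is a weak-star limit of a sequence of polynomials;
  uniqueness of the extension rests on this.\<close>

lemma ces_wstar_tendsto:
  assumes A: "A \<in> F_inf b"
  shows "limitin (subtopology wstar_topology (F_inf b)) (\<lambda>N. ces N A) A sequentially"
  unfolding limitin_subtopology
proof (intro conjI A)
  have "wot_tendsto (\<lambda>N. ces N A) A sequentially"
    unfolding wot_tendsto_def by (intro allI cinner.tendsto tendsto_const cesaro_tendsto[OF A])
  then show "limitin wstar_topology (\<lambda>N. ces N A) A sequentially"
    by (rule limitin_wstarI) (rule cesaro_norm_le[OF A])
qed (simp add: ces_F_inf)

end

context cnc_tuple
begin

lemma norm_cinner_Psi_le: "A \<in> F_inf b \<Longrightarrow> norm (cinner (Psi A *\<^sub>V x) y) \<le> norm A * (norm x * norm y)"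
  by (rule order_trans[OF norm_cinner_cop_le mult_right_mono[OF Psi_norm_le]]) auto

text \<open>For x = K* \<xi> the functional is a vector functional of the amplified operator at
  \<xi> and K y, already known to be regular; contractivity of \<open>Psi\<close> makes the set of
  good x closed.\<close>

lemma cesaro_regular_Psi: "cesaro_regular (\<lambda>A. cinner (Psi A *\<^sub>V x) y)"
proof -
  have "closed {x. cesaro_regular (\<lambda>A. cinner (Psi A *\<^sub>V x) y)}"
  proof (rule closed_cesaro_regular)
    show "norm (cinner (Psi A *\<^sub>V x) y - cinner (Psi A *\<^sub>V x') y) \<le> norm y * norm (x - x') * norm A" if "A \<in> F_inf b" for x x' A
      using norm_cinner_Psi_le[OF that, of "x - x'" y] by (simp only: cop_diff_right cinner_diff_left mult_ac)
  qed simp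
  moreover have "adj K *\<^sub>V \<xi> \<in> {x. cesaro_regular (\<lambda>A. cinner (Psi A *\<^sub>V x) y)}" for \<xi>
  proof -
    have "cesaro_regular (\<lambda>A. cinner (cop_amplify A *\<^sub>V \<xi>) (K *\<^sub>V y))"
      by (rule cesaro_regular_amplify)
    then show ?thesis
      by (simp add: cesaro_regular_def Psi_intertwine ces_F_inf cinner_adj_left)
  qed
  ultimately have "closure (range (cblinfun_apply (adj K))) \<subseteq> {x. cesaro_regular (\<lambda>A. cinner (Psi A *\<^sub>V x) y)}"
    by (intro closure_minimal) auto
  then show ?thesis
    unfolding dense_range by blast
qed

text \<open>Finite partial sums are regular, and the tail of the series with terms norm (x k) * norm
  (y k) bounds the error uniformly on the unit ball. So the whole pairing is regular and is
  represented on the Fock space.\<close>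

lemma Psi_trace_pairing_representation:
  fixes x y :: "nat \<Rightarrow> 'h"
  assumes x: "summable (\<lambda>k. (norm (x k))\<^sup>2)" and y: "summable (\<lambda>k. (norm (y k))\<^sup>2)"
  obtains x' y' :: "nat \<Rightarrow> 'n fock" where "summable (\<lambda>k. (norm (x' k))\<^sup>2)" "summable (\<lambda>k. (norm (y' k))\<^sup>2)"
    "\<And>A. A \<in> F_inf b \<Longrightarrow> (\<Sum>k. cinner (Psi A *\<^sub>V x k) (y k)) = (\<Sum>k. cinner (A *\<^sub>V x' k) (y' k))"
proof -
  define f where "f = (\<lambda>A. \<Sum>k. cinner (Psi A *\<^sub>V x k) (y k))"
  define m where "m = (\<lambda>k. norm (x k) * norm (y k))"
  have m: "summable m"
    using square_summable_mult[OF x y] by (simp add: m_def)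
  have summ: "summable (\<lambda>k. cinner (Psi A *\<^sub>V x k) (y k))" for A
    by (rule summable_trace_pairing[OF x y])
  have "linear_functional f"
    unfolding linear_functional_def f_def
    by (simp add: Psi_add Psi_scaleC cinner_add_left cinner_scaleC_left suminf_add[OF summ summ, symmetric] suminf_mult[OF summ])
  moreover have "cesaro_regular f"
  proof (rule cesaro_regular_approx)
    fix r :: real assume "r > 0"
    obtain n where n: "norm (\<Sum>k. m (k + n)) < r"
      using suminf_exist_split[OF \<open>r > 0\<close> m] by blast
    define g where "g = (\<lambda>A. \<Sum>k<n. cinner (Psi A *\<^sub>V x k) (y k))"
    have "cesaro_regular g"
      unfolding g_def by (induction n) (simp_all add: cesaro_regular_zero cesaro_regular_add cesaro_regular_Psi)
    moreover have "norm (f A - g A) \<le> r * norm A" if A: "A \<in> F_inf b" for A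
    proof -
      have tail: "summable (\<lambda>k. norm A * m (k + n))"
        using m by (intro summable_mult summable_ignore_initial_segment)
      have "f A - g A = (\<Sum>k. cinner (Psi A *\<^sub>V x (k + n)) (y (k + n)))"
        unfolding f_def g_def using suminf_split_initial_segment[OF summ, of A n] by simp
      also have "norm \<dots> \<le> (\<Sum>k. norm A * m (k + n))"
        by (rule norm_suminf_le[OF _ tail]) (simp add: m_def norm_cinner_Psi_le[OF A])
      also have "\<dots> = norm A * (\<Sum>k. m (k + n))"
        using m by (intro suminf_mult summable_ignore_initial_segment)
      also have "\<dots> \<le> norm A * r"
        using n by (intro mult_left_mono) auto
      finally show ?thesis by (simp only: mult.commute)
    qed
    ultimately show "\<exists>g. cesaro_regular g \<and> (\<forall>A\<in>F_inf b. norm (f A - g A) \<le> r * norm A)"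
      by blast
  qed
  moreover have "norm (f A) \<le> suminf m * norm A" if A: "A \<in> F_inf b" for A
  proof -
    have "norm (f A) \<le> (\<Sum>k. norm A * m k)"
      unfolding f_def by (rule norm_suminf_le[OF _ summable_mult[OF m]]) (simp add: m_def norm_cinner_Psi_le[OF A])
    also have "\<dots> = suminf m * norm A"
      using suminf_mult[OF m] by (simp add: mult.commute)
    finally show ?thesis .
  qed
  ultimately obtain x' y' :: "nat \<Rightarrow> 'n fock" where "summable (\<lambda>k. (norm (x' k))\<^sup>2)" "summable (\<lambda>k. (norm (y' k))\<^sup>2)"
    "\<And>A. A \<in> F_inf b \<Longrightarrow> f A = (\<Sum>k. cinner (A *\<^sub>V x' k) (y' k))"
    using functional_representation by blast
  then show ?thesis
    using that unfolding f_def by blast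
qed

abbreviation Ext :: "'n fock cop \<Rightarrow> 'h cop" where "Ext \<equiv> restrict Psi (F_inf b)"

text \<open>The preimage of a subbasic set is the trace of a subbasic set on the algebra, because
  pulled back pairings are again pairings.\<close>

lemma Ext_wstar_continuous: "continuous_map (subtopology wstar_topology (F_inf b)) wstar_topology Ext"
  unfolding wstar_topology_def[where 'a = 'h] continuous_on_generated_topo_iff
proof (intro conjI allI impI)
  let ?S = "{{A :: 'h cop. (\<Sum>k. cinner (A *\<^sub>V x k) (y k)) \<in> U} | x y U.
       summable (\<lambda>k. (norm (x k))\<^sup>2) \<and> summable (\<lambda>k. (norm (y k))\<^sup>2) \<and> open U}"
  have "{A :: 'h cop. (\<Sum>k. cinner (A *\<^sub>V 0) 0) \<in> UNIV} \<in> ?S"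
    by (rule CollectI) (intro exI[of _ "\<lambda>_. 0"] exI[of _ UNIV], simp)
  then show "Ext ` topspace (subtopology wstar_topology (F_inf b)) \<subseteq> \<Union>?S"
    by blast
  have "{A :: 'n fock cop. (\<Sum>k. cinner (A *\<^sub>V 0) 0) \<in> UNIV} \<in>
      {{A. (\<Sum>k. cinner (A *\<^sub>V x k) (y k)) \<in> U} | x y U.
       summable (\<lambda>k. (norm (x k :: 'n fock))\<^sup>2) \<and> summable (\<lambda>k. (norm (y k))\<^sup>2) \<and> open U}"
    by (rule CollectI) (intro exI[of _ "\<lambda>_. 0"] exI[of _ UNIV], simp)
  then have top: "topspace (wstar_topology :: 'n fock cop topology) = UNIV"
    unfolding wstar_topology_def topology_generated_by_topspace by blast
  fix U assume "U \<in> ?S"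
  then obtain x y V where U: "U = {A. (\<Sum>k. cinner (A *\<^sub>V x k) (y k)) \<in> V}"
    and xy: "summable (\<lambda>k. (norm (x k))\<^sup>2)" "summable (\<lambda>k. (norm (y k))\<^sup>2)" and V: "open V"
    by blast
  obtain x' y' :: "nat \<Rightarrow> 'n fock" where x': "summable (\<lambda>k. (norm (x' k))\<^sup>2)" "summable (\<lambda>k. (norm (y' k))\<^sup>2)"
    and eq: "\<And>A. A \<in> F_inf b \<Longrightarrow> (\<Sum>k. cinner (Psi A *\<^sub>V x k) (y k)) = (\<Sum>k. cinner (A *\<^sub>V x' k) (y' k))"
    using Psi_trace_pairing_representation[OF xy] by blast
  have "openin wstar_topology {A. (\<Sum>k. cinner (A *\<^sub>V x' k) (y' k)) \<in> V}"
    unfolding wstar_topology_def using x' V by (intro topology_generated_by_Basis) blast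
  moreover have "Ext -` U \<inter> topspace (subtopology wstar_topology (F_inf b)) = {A. (\<Sum>k. cinner (A *\<^sub>V x' k) (y' k)) \<in> V} \<inter> F_inf b"
    unfolding U topspace_subtopology top by (auto simp: eq)
  ultimately show "openin (subtopology wstar_topology (F_inf b)) (Ext -` U \<inter> topspace (subtopology wstar_topology (F_inf b)))"
    unfolding openin_subtopology by blast
qed

lemma is_wstar_extension_Ext: "is_wstar_extension b T Ext"
  unfolding is_wstar_extension_def
proof (intro conjI ballI Ext_wstar_continuous)
  show "Ext \<in> extensional (F_inf b)" by simp
  show "Ext A = poly_calculus b T A" if "A \<in> A_alg b" for A
    using that A_alg_subset_F_inf by (auto simp: poly_calculus_eq)
  show "algebra_hom_on (F_inf b) Ext"
    by (simp add: algebra_hom_on_def clinear_on_def F_inf_add F_inf_scaleC F_inf_comp Psi_add Psi_scaleC Psi_comp)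
qed

text \<open>Both maps agree on Cesaro means, which lie in \<open>A_alg b\<close>. Vector functionals
  of the values converge to those of both limits, and they separate operators.\<close>

lemma wstar_extension_unique:
  assumes \<Psi>: "is_wstar_extension b T \<Psi>"
  shows "\<Psi> = Ext"
proof (rule extensionalityI)
  show "\<Psi> \<in> extensional (F_inf b)" "Ext \<in> extensional (F_inf b)"
    using \<Psi> by (simp_all add: is_wstar_extension_def)
  fix A assume A: "A \<in> F_inf b"
  have ces_A: "ces N A \<in> A_alg b" for N
    using length_sum_polys polys_subset_A_alg unfolding cesaro_def by blast
  have "limitin wstar_topology (\<Psi> \<circ> (\<lambda>N. ces N A)) (\<Psi> A) sequentially"
    using \<Psi> by (intro continuous_map_limit[OF _ ces_wstar_tendsto[OF A]]) (simp add: is_wstar_extension_def)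
  from limitin_wstarD[OF this]
  have lim: "(\<lambda>N. cinner (Psi (ces N A) *\<^sub>V x) y) \<longlonglongrightarrow> cinner (\<Psi> A *\<^sub>V x) y" for x y
    using \<Psi> ces_A by (simp add: is_wstar_extension_def poly_calculus_eq)
  have "limitin wstar_topology (Ext \<circ> (\<lambda>N. ces N A)) (Ext A) sequentially"
    by (rule continuous_map_limit[OF Ext_wstar_continuous ces_wstar_tendsto[OF A]])
  from limitin_wstarD[OF this]
  have lim': "(\<lambda>N. cinner (Psi (ces N A) *\<^sub>V x) y) \<longlonglongrightarrow> cinner (Ext A *\<^sub>V x) y" for x y
    by (simp add: ces_F_inf)
  show "\<Psi> A = Ext A"
    by (rule cblinfun_eqI, rule cinner_eqI, rule LIMSEQ_unique[OF lim lim'])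
qed

lemma ex1_wstar_extension: "\<exists>!\<Psi>. is_wstar_extension b T \<Psi>"
  using is_wstar_extension_Ext wstar_extension_unique by blast

lemma Hinf_calculus_eq: "Hinf_calculus b T = Ext"
  unfolding Hinf_calculus_def by (rule the_equality, rule is_wstar_extension_Ext, rule wstar_extension_unique)

text \<open>A sequence converging in the weak operator topology is bounded and therefore converges
  weak-star; the passage to sequences is what provides the bound.\<close>

lemma seq_wot_continuous_Ext: "seq_wot_continuous_on (F_inf b) Ext"
  unfolding seq_wot_continuous_on_def
proof (intro allI impI, elim conjE)
  fix A L
  assume A: "range A \<subseteq> F_inf b" and L: "L \<in> F_inf b" and wot: "wot_tendsto A L sequentially"
  obtain C where C: "\<And>n. norm (A n) \<le> C"
    using wot_convergent_bounded[OF wot] by blast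
  have "limitin (subtopology wstar_topology (F_inf b)) A L sequentially"
    unfolding limitin_subtopology using A L limitin_wstarI[OF wot C] by (auto intro: always_eventually)
  from continuous_map_limit[OF Ext_wstar_continuous this]
  have "limitin wstar_topology (Ext \<circ> A) (Ext L) sequentially" .
  from limitin_wstarD[OF this] show "wot_tendsto (\<lambda>k. Ext (A k)) (Ext L) sequentially"
    unfolding wot_tendsto_def o_def by blast
qed

text \<open>The amplified sequence still converges strongly, being bounded and convergent on single
  coordinates; intertwining carries this to the dense range of K*.\<close>

lemma seq_sot_continuous_Ext: "seq_sot_continuous_on (F_inf b) Ext"
  unfolding seq_sot_continuous_on_def
proof (intro allI impI, elim conjE)
  fix A L
  assume A: "range A \<subseteq> F_inf b" and L: "L \<in> F_inf b" and sot: "sot_tendsto A L sequentially"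
  have An: "A n \<in> F_inf b" for n using A by blast
  have lim: "(\<lambda>n. A n *\<^sub>V x) \<longlonglongrightarrow> L *\<^sub>V x" for x
    using sot unfolding sot_tendsto_def by blast
  have "wot_tendsto A L sequentially"
    unfolding wot_tendsto_def by (intro allI cinner.tendsto tendsto_const lim)
  then obtain C where C: "\<And>n. norm (A n) \<le> C"
    using wot_convergent_bounded by blast
  have amp: "(\<lambda>n. cop_amplify (A n) *\<^sub>V \<xi>) \<longlonglongrightarrow> cop_amplify L *\<^sub>V \<xi>" for \<xi> :: "('n list, 'h) l2"
  proof (rule pointwise_convergence_l2)
    show "norm (cop_amplify (A n) :: ('n list, 'h) l2 cop) \<le> C" for n
      by (rule order_trans[OF cop_amplify_norm_le C])
    show "(\<lambda>n. cop_amplify (A n) *\<^sub>V l2_single \<gamma> h) \<longlonglongrightarrow> cop_amplify L *\<^sub>V l2_single \<gamma> h" for \<gamma> and h :: 'h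
      unfolding cop_amplify_single by (rule bounded_linear.tendsto[OF bounded_linear_tensor_left lim])
  qed
  have "norm (Psi (A n)) \<le> C" for n
    by (rule order_trans[OF Psi_norm_le[OF An] C])
  then have "closed {x. (\<lambda>n. Psi (A n) *\<^sub>V x) \<longlonglongrightarrow> Psi L *\<^sub>V x}"
    by (rule closed_pointwise_convergence)
  moreover have "adj K *\<^sub>V \<xi> \<in> {x. (\<lambda>n. Psi (A n) *\<^sub>V x) \<longlonglongrightarrow> Psi L *\<^sub>V x}" for \<xi>
    using cop_tendsto[OF amp, of "adj K"] by (simp add: Psi_intertwine An L)
  ultimately have "closure (range (cblinfun_apply (adj K))) \<subseteq> {x. (\<lambda>n. Psi (A n) *\<^sub>V x) \<longlonglongrightarrow> Psi L *\<^sub>V x}"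
    by (intro closure_minimal) auto
  then have "(\<lambda>n. Psi (A n) *\<^sub>V x) \<longlonglongrightarrow> Psi L *\<^sub>V x" for x
    unfolding dense_range by blast
  then show "sot_tendsto (\<lambda>k. Ext (A k)) (Ext L) sequentially"
    by (simp add: sot_tendsto_def An L)
qed

lemma cesaro_sot_Ext:
  assumes c: "fourier_rep b \<phi> c"
  shows "sot_tendsto (\<lambda>N. \<Sum>s\<le>N. (1 - real s / (real N + 1)) *\<^sub>R (\<Sum>\<alpha>\<in>words s. c \<alpha> *\<^sub>C word_op T \<alpha>)) (Ext \<phi>) sequentially"
proof -
  have \<phi>: "\<phi> \<in> F_inf b" "c = symbol \<phi>"
    using c entries_symbol entries_F_inf by (auto simp: fourier_rep_iff)
  have Ext: "Ext \<phi> = Psi \<phi>"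
    using \<phi>(1) by simp
  show ?thesis
    unfolding sot_tendsto_def Ext \<phi>(2)
    using Psi_tendsto[OF \<phi>(1), unfolded cesaro_def length_sum_def] by blast
qed

end

section \<open>Abel means\<close>

text \<open>Summation by parts: 1 - r times the generating function of the partial sums is the
  generating function of the terms.\<close>

lemma abel_step:
  fixes S :: "nat \<Rightarrow> 'a :: real_normed_vector"
  assumes S: "(\<lambda>k. r ^ k *\<^sub>R S k) sums s" and a: "a 0 = S 0" "\<And>k. a (Suc k) = S (Suc k) - S k"
  shows "(\<lambda>k. r ^ k *\<^sub>R a k) sums ((1 - r) *\<^sub>R s)"
proof -
  define g where "g = (\<lambda>k. r ^ k *\<^sub>R (if k = 0 then 0 else S (k - 1)))"
  have "(\<lambda>k. r *\<^sub>R (r ^ k *\<^sub>R S k)) sums (r *\<^sub>R s)"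
    by (rule sums_scaleR_right[OF S])
  then have "(\<lambda>k. g (Suc k)) sums (r *\<^sub>R s)"
    by (simp add: g_def)
  then have "g sums (r *\<^sub>R s + g 0)"
    by (rule sums_Suc)
  then have "g sums (r *\<^sub>R s)"
    by (simp add: g_def)
  from sums_diff[OF S this] have "(\<lambda>k. r ^ k *\<^sub>R S k - g k) sums ((1 - r) *\<^sub>R s)"
    by (simp add: scaleR_left_diff_distrib)
  moreover have "r ^ k *\<^sub>R S k - g k = r ^ k *\<^sub>R a k" for k
    by (cases k) (simp_all add: g_def a scaleR_right_diff_distrib)
  ultimately show ?thesis by simp
qed

lemma abel_weights_sums:
  fixes r :: real
  assumes "0 \<le> r" "r < 1"
  shows "(\<lambda>N. (1 - r)\<^sup>2 * ((real N + 1) * r ^ N)) sums 1"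
proof -
  have "(\<lambda>N. (1 - r)\<^sup>2 * (of_nat (Suc N) * r ^ N)) sums ((1 - r)\<^sup>2 * (1 / (1 - r)\<^sup>2))"
    using assms by (intro sums_mult geometric_deriv_sums) simp
  then show ?thesis
    using assms by (simp add: add.commute)
qed

text \<open>Two summations by parts write the Abel mean as an average of Cesaro means with weights
  (1 - r)^2 (N + 1) r^N of total 1. Boundedness of the Cesaro means thus already makes the Abel
  series converge.\<close>

lemma abel_sums_cesaro:
  fixes a :: "nat \<Rightarrow> 'a :: banach"
  defines "\<sigma> \<equiv> \<lambda>N. \<Sum>s\<le>N. (1 - real s / (real N + 1)) *\<^sub>R a s"
  assumes C: "\<And>N. norm (\<sigma> N) \<le> C" and r: "0 \<le> r" "r < 1"
  shows "(\<lambda>k. r ^ k *\<^sub>R a k) sums (\<Sum>N. ((1 - r)\<^sup>2 * ((real N + 1) * r ^ N)) *\<^sub>R \<sigma> N)"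
    and "summable (\<lambda>N. ((1 - r)\<^sup>2 * ((real N + 1) * r ^ N)) *\<^sub>R \<sigma> N)"
proof -
  define w where "w = (\<lambda>N. (1 - r)\<^sup>2 * ((real N + 1) * r ^ N))"
  have w: "w sums 1" "\<And>N. 0 \<le> w N"
    unfolding w_def using abel_weights_sums[OF r] r by simp_all
  have summ: "summable (\<lambda>N. w N *\<^sub>R \<sigma> N)"
  proof (rule summable_comparison_test'[of "\<lambda>N. w N * C" 0])
    show "summable (\<lambda>N. w N * C)"
      using w(1) by (intro summable_mult2) (simp add: sums_iff)
    have "\<bar>w N\<bar> * norm (\<sigma> N) \<le> w N * C" for N
      using w(2)[of N] C[of N] by (simp add: mult_left_mono)
    then show "norm (w N *\<^sub>R \<sigma> N) \<le> w N * C" for N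
      by simp
  qed
  then show "summable (\<lambda>N. ((1 - r)\<^sup>2 * ((real N + 1) * r ^ N)) *\<^sub>R \<sigma> N)"
    by (simp only: w_def)
  define S where "S = (\<lambda>N. \<Sum>k\<le>N. a k)"
  define M where "M = (\<lambda>N. \<Sum>j\<le>N. S j)"
  have \<sigma>: "\<sigma> N = (1 / (real N + 1)) *\<^sub>R M N" for N
    unfolding \<sigma>_def M_def S_def by (rule cesaro_sum_eq)
  have M: "w N *\<^sub>R \<sigma> N = (1 - r)\<^sup>2 *\<^sub>R (r ^ N *\<^sub>R M N)" for N
    unfolding \<sigma> w_def by (simp add: field_simps)
  have ne: "(1 - r)\<^sup>2 \<noteq> 0" using r by simp
  have unscale: "inverse ((1 - r)\<^sup>2) *\<^sub>R (w N *\<^sub>R \<sigma> N) = r ^ N *\<^sub>R M N" for N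
    unfolding M by (simp only: scaleR_scaleR mult.assoc[symmetric] left_inverse[OF ne] mult_1_left)
  have "summable (\<lambda>N. inverse ((1 - r)\<^sup>2) *\<^sub>R (w N *\<^sub>R \<sigma> N))"
    using summ by (rule summable_scaleR_right)
  then have summ_M: "summable (\<lambda>N. r ^ N *\<^sub>R M N)"
    unfolding unscale .
  have total: "(\<Sum>N. w N *\<^sub>R \<sigma> N) = (1 - r)\<^sup>2 *\<^sub>R (\<Sum>N. r ^ N *\<^sub>R M N)"
    unfolding M by (rule suminf_scaleR_right[OF summ_M, symmetric])
  have "(\<lambda>k. r ^ k *\<^sub>R S k) sums ((1 - r) *\<^sub>R (\<Sum>N. r ^ N *\<^sub>R M N))"
    by (rule abel_step[OF summable_sums[OF summ_M]]) (simp_all add: M_def)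
  then have "(\<lambda>k. r ^ k *\<^sub>R a k) sums ((1 - r) *\<^sub>R (1 - r) *\<^sub>R (\<Sum>N. r ^ N *\<^sub>R M N))"
    by (rule abel_step) (simp_all add: S_def)
  then show "(\<lambda>k. r ^ k *\<^sub>R a k) sums (\<Sum>N. ((1 - r)\<^sup>2 * ((real N + 1) * r ^ N)) *\<^sub>R \<sigma> N)"
    using total unfolding w_def by (simp add: power2_eq_square)
qed

text \<open>For fixed N the weight vanishes as r tends to 1, so averaging the Cesaro means is a
  Toeplitz method and keeps their limit.\<close>

lemma abel_limit_of_cesaro:
  fixes a :: "nat \<Rightarrow> 'a :: banach"
  assumes lim: "(\<lambda>N. \<Sum>s\<le>N. (1 - real s / (real N + 1)) *\<^sub>R a s) \<longlonglongrightarrow> L"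
  shows "((\<lambda>r. \<Sum>k. r ^ k *\<^sub>R a k) \<longlongrightarrow> L) (at_left 1)"
proof -
  define \<sigma> where "\<sigma> = (\<lambda>N. \<Sum>s\<le>N. (1 - real s / (real N + 1)) *\<^sub>R a s)"
  define w where "w = (\<lambda>(r :: real) N. (1 - r)\<^sup>2 * ((real N + 1) * r ^ N))"
  define d where "d = (\<lambda>N. norm (\<sigma> N - L))"
  obtain C where C: "\<And>N. norm (\<sigma> N) \<le> C"
    using convergent_imp_Bseq[OF convergentI[OF lim]] unfolding Bseq_def \<sigma>_def by blast
  have ev: "\<forall>\<^sub>F r in at_left (1 :: real). 0 \<le> r \<and> r < 1"
    by (rule eventually_mono[OF eventually_at_left_real[of 0 1]]) auto
  have "d \<longlonglongrightarrow> 0"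
    unfolding d_def \<sigma>_def by (intro tendsto_norm_zero LIM_zero lim)
  moreover have "0 \<le> d N" for N by (simp add: d_def)
  moreover have "\<forall>\<^sub>F r in at_left 1. w r sums 1 \<and> (\<forall>N. 0 \<le> w r N)"
    using ev by (rule eventually_mono) (simp add: w_def abel_weights_sums)
  moreover have "((\<lambda>r. w r N) \<longlongrightarrow> 0) (at_left 1)" for N
  proof -
    have "((\<lambda>r. w r N) \<longlongrightarrow> (1 - 1)\<^sup>2 * ((real N + 1) * 1 ^ N)) (at_left 1)"
      unfolding w_def by (intro tendsto_intros)
    then show ?thesis by simp
  qed
  ultimately have T: "((\<lambda>r. \<Sum>N. w r N * d N) \<longlongrightarrow> 0) (at_left 1)" "\<forall>\<^sub>F r in at_left 1. summable (\<lambda>N. w r N * d N)"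
    by (rule toeplitz_null)+
  have "\<forall>\<^sub>F r in at_left 1. norm ((\<Sum>k. r ^ k *\<^sub>R a k) - L) \<le> (\<Sum>N. w r N * d N)"
    using ev T(2)
  proof eventually_elim
    case (elim r)
    then have r: "0 \<le> r" "r < 1" by auto
    have w0: "0 \<le> w r N" for N
      using r by (simp add: w_def)
    have "(\<Sum>k. r ^ k *\<^sub>R a k) = (\<Sum>N. w r N *\<^sub>R \<sigma> N)" and summ: "summable (\<lambda>N. w r N *\<^sub>R \<sigma> N)"
      using abel_sums_cesaro[OF C[unfolded \<sigma>_def] r] unfolding w_def \<sigma>_def by (simp_all add: sums_iff)
    moreover have L: "(\<lambda>N. w r N *\<^sub>R L) sums (1 *\<^sub>R L)"
      unfolding w_def by (rule sums_scaleR_left[OF abel_weights_sums[OF r]])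
    ultimately have "(\<Sum>k. r ^ k *\<^sub>R a k) - L = (\<Sum>N. w r N *\<^sub>R (\<sigma> N - L))"
      using suminf_diff[OF summ sums_summable[OF L]] sums_unique[OF L] by (simp add: scaleR_right_diff_distrib)
    also have "norm \<dots> \<le> (\<Sum>N. w r N * d N)"
      by (rule norm_suminf_le) (use elim w0 in \<open>simp_all add: d_def\<close>)
    finally show ?case .
  qed
  then have "((\<lambda>r. (\<Sum>k. r ^ k *\<^sub>R a k) - L) \<longlongrightarrow> 0) (at_left 1)"
    by (rule Lim_null_comparison) (rule T(1))
  then show ?thesis
    by (rule LIM_zero_cancel)
qed

lemma word_op_scaleR: "word_op (r *\<^sub>R X) \<alpha> = r ^ length \<alpha> *\<^sub>R word_op X \<alpha>"
  by (induction \<alpha>) (simp_all add: cop_comp.scaleR_left cop_comp.scaleR_right)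

lemma words_sum_scaleR:
  "(\<Sum>\<alpha>\<in>words k. r ^ length \<alpha> *\<^sub>R (c \<alpha> *\<^sub>C word_op X \<alpha>)) = r ^ k *\<^sub>R (\<Sum>\<alpha>\<in>words k. c \<alpha> *\<^sub>C word_op X \<alpha>)"
  unfolding scaleR_sum_right by (rule sum.cong) (simp_all add: words_def)

text \<open>The dilates rT are pure for r close to 1 and tend to T in norm.\<close>

lemma radially_pure_closure:
  assumes "radially_pure b T"
  shows "T \<in> closure (nc_domain_pure b)"
proof -
  obtain \<delta> where \<delta>: "0 < \<delta>" "\<delta> < 1" "\<And>r. \<delta> < r \<Longrightarrow> r < 1 \<Longrightarrow> r *\<^sub>R T \<in> nc_domain_pure b"
    using assms unfolding radially_pure_def by blast
  have "((\<lambda>r. r *\<^sub>R T) \<longlongrightarrow> 1 *\<^sub>R T) (at_left 1)"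
    by (intro tendsto_intros)
  then have "((\<lambda>r. r *\<^sub>R T) \<longlongrightarrow> T) (at_left 1)"
    by simp
  moreover have "\<forall>\<^sub>F r in at_left 1. r *\<^sub>R T \<in> closure (nc_domain_pure b)"
    by (rule eventually_mono[OF eventually_at_left_real[OF \<delta>(2)]]) (use \<delta>(3) closure_subset in auto)
  ultimately show ?thesis
    by (intro Lim_in_closed_set[OF closed_closure, of "\<lambda>r. r *\<^sub>R T" _ "at_left 1"]) auto
qed

section \<open>Abel means and Berezin transforms of the dilates\<close>

context cnc_tuple
begin

text \<open>Operator norm convergence comes from the uniform bound on the Cesaro means at
  \<open>T\<close>, which makes their weighted average an absolutely convergent series.\<close>

lemma abel_summable:
  assumes \<phi>: "\<phi> \<in> F_inf b" and r: "0 \<le> r" "r < 1"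
  shows "summable (\<lambda>k. r ^ k *\<^sub>R (\<Sum>\<alpha>\<in>words k. symbol \<phi> \<alpha> *\<^sub>C word_op T \<alpha>))"
proof (rule sums_summable, rule abel_sums_cesaro(1)[OF _ r])
  show "norm (\<Sum>s\<le>N. (1 - real s / (real N + 1)) *\<^sub>R (\<Sum>\<alpha>\<in>words s. symbol \<phi> \<alpha> *\<^sub>C word_op T \<alpha>)) \<le> norm \<phi>" for N
    using cesaro_T_norm_le[OF \<phi>, of N] unfolding cesaro_def length_sum_def .
qed

lemma abel_apply:
  assumes \<phi>: "\<phi> \<in> F_inf b" and r: "0 \<le> r" "r < 1"
  shows "(\<Sum>k. r ^ k *\<^sub>R (\<Sum>\<alpha>\<in>words k. symbol \<phi> \<alpha> *\<^sub>C word_op T \<alpha>)) *\<^sub>V x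
    = (\<Sum>k. r ^ k *\<^sub>R ((\<Sum>\<alpha>\<in>words k. symbol \<phi> \<alpha> *\<^sub>C word_op T \<alpha>) *\<^sub>V x))"
  using bounded_linear.suminf[OF bounded_linear_cop_apply abel_summable[OF assms], of x] by simp

lemma abel_sot:
  assumes \<phi>: "\<phi> \<in> F_inf b"
  shows "sot_tendsto (\<lambda>r. \<Sum>k. r ^ k *\<^sub>R (\<Sum>\<alpha>\<in>words k. symbol \<phi> \<alpha> *\<^sub>C word_op T \<alpha>)) (Psi \<phi>) (at_left 1)"
  unfolding sot_tendsto_def
proof
  fix x
  have "((\<lambda>r. \<Sum>k. r ^ k *\<^sub>R ((\<Sum>\<alpha>\<in>words k. symbol \<phi> \<alpha> *\<^sub>C word_op T \<alpha>) *\<^sub>V x)) \<longlongrightarrow> Psi \<phi> *\<^sub>V x) (at_left 1)"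
    by (rule abel_limit_of_cesaro) (rule Psi_tendsto[OF \<phi>, unfolded cesaro_apply])
  moreover have "\<forall>\<^sub>F r in at_left (1 :: real). (\<Sum>k. r ^ k *\<^sub>R ((\<Sum>\<alpha>\<in>words k. symbol \<phi> \<alpha> *\<^sub>C word_op T \<alpha>) *\<^sub>V x))
      = (\<Sum>k. r ^ k *\<^sub>R (\<Sum>\<alpha>\<in>words k. symbol \<phi> \<alpha> *\<^sub>C word_op T \<alpha>)) *\<^sub>V x"
    by (rule eventually_mono[OF eventually_at_left_real[of 0 1]]) (auto simp: abel_apply[OF \<phi>])
  ultimately show "((\<lambda>r. (\<Sum>k. r ^ k *\<^sub>R (\<Sum>\<alpha>\<in>words k. symbol \<phi> \<alpha> *\<^sub>C word_op T \<alpha>)) *\<^sub>V x) \<longlongrightarrow> Psi \<phi> *\<^sub>V x) (at_left 1)"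
    by (rule Lim_transform_eventually)
qed

text \<open>At a pure rT the Cesaro means are compressions of those of the model and converge
  strongly to the compression of \<phi>; they are also the Cesaro means of a norm convergent series
  and so converge to its sum.\<close>

lemma berezin_transform_eq_abel:
  assumes \<phi>: "\<phi> \<in> F_inf b" and r: "0 \<le> r" "r < 1" and pure: "r *\<^sub>R T \<in> nc_domain_pure b"
  shows "adj (berezin_kernel b (r *\<^sub>R T)) o\<^sub>C cop_amplify \<phi> o\<^sub>C berezin_kernel b (r *\<^sub>R T)
    = (\<Sum>k. r ^ k *\<^sub>R (\<Sum>\<alpha>\<in>words k. symbol \<phi> \<alpha> *\<^sub>C word_op T \<alpha>))"
proof (rule cblinfun_eqI)
  fix x
  let ?B = "berezin_kernel b (r *\<^sub>R T)"
  define a where "a = (\<lambda>k. \<Sum>\<alpha>\<in>words k. symbol \<phi> \<alpha> *\<^sub>C word_op T \<alpha>)"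
  have "symbol \<phi> \<alpha> *\<^sub>C word_op (r *\<^sub>R T) \<alpha> = r ^ length \<alpha> *\<^sub>R (symbol \<phi> \<alpha> *\<^sub>C word_op T \<alpha>)" for \<alpha>
    unfolding word_op_scaleR by (rule scaleC_scaleR_commute)
  then have ces: "cesaro N (symbol \<phi>) (r *\<^sub>R T) = (\<Sum>s\<le>N. (1 - real s / (real N + 1)) *\<^sub>R (r ^ s *\<^sub>R a s))" for N
    unfolding cesaro_def length_sum_def a_def by (simp only: words_sum_scaleR)
  have "(\<lambda>N. \<Sum>s\<le>N. r ^ s *\<^sub>R a s) \<longlonglongrightarrow> (\<Sum>k. r ^ k *\<^sub>R a k)"
    unfolding a_def by (rule summable_LIMSEQ'[OF abel_summable[OF \<phi> r]])
  from cesaro_mean_tendsto[OF this] have "(\<lambda>N. cesaro N (symbol \<phi>) (r *\<^sub>R T)) \<longlonglongrightarrow> (\<Sum>k. r ^ k *\<^sub>R a k)"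
    unfolding ces .
  then have "(\<lambda>N. cesaro N (symbol \<phi>) (r *\<^sub>R T) *\<^sub>V x) \<longlonglongrightarrow> (\<Sum>k. r ^ k *\<^sub>R a k) *\<^sub>V x"
    by (rule bounded_linear.tendsto[OF bounded_linear_cop_apply])
  moreover have "cesaro N (symbol \<phi>) (r *\<^sub>R T) *\<^sub>V x = adj ?B *\<^sub>V cop_amplify (ces N \<phi>) *\<^sub>V ?B *\<^sub>V x" for N
    unfolding cesaro_def length_sum_pure[OF pure] by simp
  then have "(\<lambda>N. cesaro N (symbol \<phi>) (r *\<^sub>R T) *\<^sub>V x) \<longlonglongrightarrow> adj ?B *\<^sub>V cop_amplify \<phi> *\<^sub>V ?B *\<^sub>V x"
    by (simp only:) (rule cop_tendsto[OF amplify_cesaro_tendsto[OF \<phi>]])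
  ultimately show "(adj ?B o\<^sub>C cop_amplify \<phi> o\<^sub>C ?B) *\<^sub>V x = (\<Sum>k. r ^ k *\<^sub>R (\<Sum>\<alpha>\<in>words k. symbol \<phi> \<alpha> *\<^sub>C word_op T \<alpha>)) *\<^sub>V x"
    unfolding a_def using LIMSEQ_unique by fastforce
qed

lemma berezin_sot:
  assumes \<phi>: "\<phi> \<in> F_inf b" and pure: "radially_pure b T"
  shows "sot_tendsto (\<lambda>r. adj (berezin_kernel b (r *\<^sub>R T)) o\<^sub>C cop_amplify \<phi> o\<^sub>C berezin_kernel b (r *\<^sub>R T)) (Psi \<phi>) (at_left 1)"
  unfolding sot_tendsto_def
proof
  fix x
  obtain \<delta> where \<delta>: "0 < \<delta>" "\<delta> < 1" "\<And>r. \<delta> < r \<Longrightarrow> r < 1 \<Longrightarrow> r *\<^sub>R T \<in> nc_domain_pure b"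
    using pure unfolding radially_pure_def by blast
  have "((\<lambda>r. (\<Sum>k. r ^ k *\<^sub>R (\<Sum>\<alpha>\<in>words k. symbol \<phi> \<alpha> *\<^sub>C word_op T \<alpha>)) *\<^sub>V x) \<longlongrightarrow> Psi \<phi> *\<^sub>V x) (at_left 1)"
    using abel_sot[OF \<phi>] unfolding sot_tendsto_def by blast
  moreover have "\<forall>\<^sub>F r in at_left 1. (\<Sum>k. r ^ k *\<^sub>R (\<Sum>\<alpha>\<in>words k. symbol \<phi> \<alpha> *\<^sub>C word_op T \<alpha>)) *\<^sub>V x
      = (adj (berezin_kernel b (r *\<^sub>R T)) o\<^sub>C cop_amplify \<phi> o\<^sub>C berezin_kernel b (r *\<^sub>R T)) *\<^sub>V x"
  proof (rule eventually_mono[OF eventually_at_left_real[OF \<delta>(2)]])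
    fix r assume "r \<in> {\<delta><..<1}"
    then have r: "0 \<le> r" "r < 1" "r *\<^sub>R T \<in> nc_domain_pure b"
      using \<delta> by auto
    show "(\<Sum>k. r ^ k *\<^sub>R (\<Sum>\<alpha>\<in>words k. symbol \<phi> \<alpha> *\<^sub>C word_op T \<alpha>)) *\<^sub>V x
      = (adj (berezin_kernel b (r *\<^sub>R T)) o\<^sub>C cop_amplify \<phi> o\<^sub>C berezin_kernel b (r *\<^sub>R T)) *\<^sub>V x"
      unfolding berezin_transform_eq_abel[OF \<phi> r] ..
  qed
  ultimately show "((\<lambda>r. (adj (berezin_kernel b (r *\<^sub>R T)) o\<^sub>C cop_amplify \<phi> o\<^sub>C berezin_kernel b (r *\<^sub>R T)) *\<^sub>V x) \<longlongrightarrow> Psi \<phi> *\<^sub>V x) (at_left 1)"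
    by (rule Lim_transform_eventually)
qed

end

theorem theorem2p12:
  fixes b :: "'n :: finite list \<Rightarrow> real"
    and T :: "('h :: chilbert_space cop) ^ 'n"
  assumes "admissible b"
    and "\<And>i. bdd_above (range (\<lambda>\<alpha>. b \<alpha> / b (\<alpha> @ [i])))"
    and "T \<in> nc_domain b"
    and "completely_non_coisometric b T"
  shows
    "(T \<in> closure (nc_domain_pure b) \<longrightarrow>
        (\<exists>!\<Phi>. is_poly_calculus b T \<Phi>) \<and>
        (\<exists>!\<Psi>. is_wstar_extension b T \<Psi>) \<and>
        completely_contractive_on (F_inf b) (Hinf_calculus b T) \<and>
        seq_wot_continuous_on (F_inf b) (Hinf_calculus b T) \<and>
        seq_sot_continuous_on (F_inf b) (Hinf_calculus b T) \<and>
        (\<forall>\<phi> c. fourier_rep b \<phi> c \<longrightarrow>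
           sot_tendsto
             (\<lambda>N. \<Sum>s\<le>N. (1 - real s / (real N + 1)) *\<^sub>R (\<Sum>\<alpha>\<in>words s. c \<alpha> *\<^sub>C word_op T \<alpha>))
             (Hinf_calculus b T \<phi>) sequentially)) \<and>
     (radially_pure b T \<and> radially_pure b (universal_model b) \<longrightarrow>
        (\<forall>\<phi> c. fourier_rep b \<phi> c \<longrightarrow>
           (\<forall>r. 0 \<le> r \<and> r < 1 \<longrightarrow>
              summable (\<lambda>k. \<Sum>\<alpha>\<in>words k. r ^ length \<alpha> *\<^sub>R (c \<alpha> *\<^sub>C word_op T \<alpha>))) \<and>
           sot_tendsto
             (\<lambda>r. \<Sum>k. \<Sum>\<alpha>\<in>words k. r ^ length \<alpha> *\<^sub>R (c \<alpha> *\<^sub>C word_op T \<alpha>))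
             (Hinf_calculus b T \<phi>) (at_left 1) \<and>
           sot_tendsto
             (\<lambda>r. adj (berezin_kernel b (r *\<^sub>R T)) o\<^sub>C cop_amplify \<phi> o\<^sub>C berezin_kernel b (r *\<^sub>R T))
             (Hinf_calculus b T \<phi>) (at_left 1)))"
proof (intro conjI impI allI)
  interpret fock_weights b
    using assms(1,2) by unfold_locales (auto simp: admissible_def)
  have cnc: "cnc_tuple b T" if "T \<in> closure (nc_domain_pure b)"
    using assms(3,4) that by unfold_locales
  {
    assume "T \<in> closure (nc_domain_pure b)"
    then interpret cnc_tuple b T by (rule cnc)
    show "\<exists>!\<Phi>. is_poly_calculus b T \<Phi>" by (rule ex1_poly_calculus)
    show "\<exists>!\<Psi>. is_wstar_extension b T \<Psi>" by (rule ex1_wstar_extension)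
    show "completely_contractive_on (F_inf b) (Hinf_calculus b T)"
      unfolding Hinf_calculus_eq by (rule restrict_Psi_completely_contractive[OF order_refl])
    show "seq_wot_continuous_on (F_inf b) (Hinf_calculus b T)"
      unfolding Hinf_calculus_eq by (rule seq_wot_continuous_Ext)
    show "seq_sot_continuous_on (F_inf b) (Hinf_calculus b T)"
      unfolding Hinf_calculus_eq by (rule seq_sot_continuous_Ext)
    show "sot_tendsto (\<lambda>N. \<Sum>s\<le>N. (1 - real s / (real N + 1)) *\<^sub>R (\<Sum>\<alpha>\<in>words s. c \<alpha> *\<^sub>C word_op T \<alpha>))
        (Hinf_calculus b T \<phi>) sequentially" if "fourier_rep b \<phi> c" for \<phi> c
      unfolding Hinf_calculus_eq by (rule cesaro_sot_Ext[OF that])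
  }
  {
    fix \<phi> c
    assume "radially_pure b T \<and> radially_pure b (universal_model b)"
    then have pure: "radially_pure b T" ..
    \<comment> \<open>Radial purity places T in the closure of the pure tuples, so the calculus of
      the first part is available here.\<close>
    interpret cnc_tuple b T by (rule cnc[OF radially_pure_closure[OF pure]])
    assume c: "fourier_rep b \<phi> c"
    then have \<phi>: "\<phi> \<in> F_inf b" and c_eq: "c = symbol \<phi>"
      using entries_symbol entries_F_inf by (auto simp: fourier_rep_iff)
    have Ext: "Hinf_calculus b T \<phi> = Psi \<phi>"
      unfolding Hinf_calculus_eq using \<phi> by simp
    show "summable (\<lambda>k. \<Sum>\<alpha>\<in>words k. r ^ length \<alpha> *\<^sub>R (c \<alpha> *\<^sub>C word_op T \<alpha>))" if "0 \<le> r \<and> r < 1" for r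
      unfolding words_sum_scaleR c_eq using that by (intro abel_summable[OF \<phi>]) auto
    show "sot_tendsto (\<lambda>r. \<Sum>k. \<Sum>\<alpha>\<in>words k. r ^ length \<alpha> *\<^sub>R (c \<alpha> *\<^sub>C word_op T \<alpha>)) (Hinf_calculus b T \<phi>) (at_left 1)"
      unfolding words_sum_scaleR c_eq Ext by (rule abel_sot[OF \<phi>])
    show "sot_tendsto (\<lambda>r. adj (berezin_kernel b (r *\<^sub>R T)) o\<^sub>C cop_amplify \<phi> o\<^sub>C berezin_kernel b (r *\<^sub>R T))
        (Hinf_calculus b T \<phi>) (at_left 1)"
      unfolding Ext by (rule berezin_sot[OF \<phi> pure])
  }
qed

end
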